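(* Let $G$ be a finitely generated sofic group and let $X$ be an algebraic group over an uncountable algebraically closed field $K$. Suppose that $\tau \in CA_{algr}(G,X,K)$ is post-surjective. Then $\tau$ is $(\bullet)$-pre-injective.
   Context: Algebraic varieties and groups. An algebraic variety over an algebraically closed field $K$ is a reduced $K$-scheme of finite type, identified with its set of $K$-points. An algebraic group over $K$ is a group that is an algebraic variety whose group operations are algebraic morphisms; it is not assumed connected. Write $A = X(K)$ and let $e$ be the neutral element of $X$. Cellular automata. For a group $G$ and a set $A$, elements of $A^G$ are maps $c\colon G\to A$, with shift action $(gc)(h)=c(g^{-1}h)$. A cellular automaton is a map $\tau\colon A^G\to A^G$ for which there are a finite subset $M\subset G$ (a memory set) and a map $\mu\colon A^M\to A$ (a local defining map) with $(\tau(c))(g)=\mu((g^{-1}c)|_M)$ for all $c\in A^G$, $g\in G$. The set $CA_{algr}(G,X,K)$ consists of the cellular automata $\tau\colon A^G\to A^G$ admitting a finite memory set $M$ whose local defining map $\mu\colon A^M\to A$ is induced by a homomorphism of algebraic groups $X^M\to X$, where $X^M$ is the fibered product of copies of $X$ indexed by $M$. Post-surjectivity. Two configurations $c,d\in A^G$ are asymptotic if $c|_{G\setminus E}=d|_{G\setminus E}$ for some finite $E\subset G$. A cellular automaton $\tau$ is post-surjective if for all $x,y\in A^G$ with $y$ asymptotic to $\tau(x)$, there is $z\in A^G$ asymptotic to $x$ with $\tau(z)=y$. Weak pre-injectivity. For a finite $\Omega\subset G$ and $D\subset A^\Omega$, put $D_e = D\times\{e\}^{G\setminus\Omega}\subset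 A^G$. A cellular automaton $\tau\in CA_{algr}(G,X,K)$ is $(\bullet)$-pre-injective if there do not exist a finite subset $\Omega\subset G$ and a Zariski closed subset $H\subsetneq A^\Omega$ such that $\tau((A^\Omega)_e)=\tau(H_e)$. Sofic groups. Let $G$ be finitely generated with finite symmetric generating set $S$. An $S$-labeled graph is a pair $(V,E)$ with vertex set $V$ and edge set $E\subset V\times S\times V$; isomorphisms are bijections of vertices preserving labeled edges in both directions. $B_{\mathcal G}(v,r)$ is the ball of radius $r$ around $v$ in the path metric of $\mathcal G$, viewed as an $S$-labeled subgraph, and $B_S(r)$ is the ball of radius $r$ around $1_G$ in the Cayley graph with vertex set $G$ and edges $(g,s,gs)$. $G$ is sofic if and only if for all $r,\varepsilon>0$ there is a finite $S$-labeled graph $\mathcal G=(V,E)$ such that $|V(r)|\ge(1-\varepsilon)|V|$, where $V(r)$ is the set of $v\in V$ for which there is an $S$-labeled graph isomorphism $B_S(r)\to B_{\mathcal G}(v,r)$ sending $1_G$ to $v$. *)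

theory Defs
  imports
    "HOL-Algebra.Generated_Groups"
    "HOL-Algebra.Product_Groups"
    "HOL-Analysis.Abstract_Topology"
    "HOL-Computational_Algebra.Polynomial"
begin

section \<open>Algebraic varieties as spaces with functions\<close>

text \<open>
  A reduced scheme of finite type over an algebraically closed field \<open>K\<close>, identified with its set
  of \<open>K\<close>-points, is the same thing as a topological space with a sheaf of \<open>K\<close>-valued functions that
  has a finite open cover by affine pieces, i.e. pieces isomorphic to Zariski closed subsets of
  some \<open>K\<^sup>n\<close> (Serre). Neither irreducibility nor separatedness is required.

  The functions in \<open>regular X U\<close> are total functions on the type of points; only their values on
  the open set \<open>U\<close> matter (first clause of \<open>space_with_functions\<close>).
\<close>

record ('a, 'k) fspace =
  zariski :: "'a topology"
  regular :: "'a set \<Rightarrow> ('a \<Rightarrow> 'k) set"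

definition space_with_functions :: "('a, 'k::field) fspace \<Rightarrow> bool" where
  "space_with_functions X \<longleftrightarrow>
     (\<forall>U f g. openin (zariski X) U \<longrightarrow> f \<in> regular X U \<longrightarrow> (\<forall>x\<in>U. g x = f x) \<longrightarrow> g \<in> regular X U) \<and>
     (\<forall>U V f. openin (zariski X) U \<longrightarrow> openin (zariski X) V \<longrightarrow> V \<subseteq> U \<longrightarrow>
        f \<in> regular X U \<longrightarrow> f \<in> regular X V) \<and>
     (\<forall>\<U> f. (\<forall>U\<in>\<U>. openin (zariski X) U \<and> f \<in> regular X U) \<longrightarrow> f \<in> regular X (\<Union>\<U>)) \<and>
     (\<forall>U c. openin (zariski X) U \<longrightarrow> (\<lambda>x. c) \<in> regular X U) \<and>
     (\<forall>U f g. openin (zariski X) U \<longrightarrow> f \<in> regular X U \<longrightarrow> g \<in> regular X U \<longrightarrow>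
        (\<lambda>x. f x + g x) \<in> regular X U \<and> (\<lambda>x. f x * g x) \<in> regular X U) \<and>
     (\<forall>U f. openin (zariski X) U \<longrightarrow> f \<in> regular X U \<longrightarrow>
        openin (zariski X) {x \<in> U. f x \<noteq> 0} \<and>
        (\<lambda>x. inverse (f x)) \<in> regular X {x \<in> U. f x \<noteq> 0})"

definition morphism ::
    "('a, 'k) fspace \<Rightarrow> ('b, 'k) fspace \<Rightarrow> ('a \<Rightarrow> 'b) \<Rightarrow> bool" where
  "morphism X Y \<phi> \<longleftrightarrow>
     continuous_map (zariski X) (zariski Y) \<phi> \<and>
     (\<forall>V f. openin (zariski Y) V \<longrightarrow> f \<in> regular Y V \<longrightarrow>
        (\<lambda>x. f (\<phi> x)) \<in> regular X {x \<in> topspace (zariski X). \<phi> x \<in> V})"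

definition isomorphic_fspaces ::
    "('a, 'k) fspace \<Rightarrow> ('b, 'k) fspace \<Rightarrow> bool" where
  "isomorphic_fspaces X Y \<longleftrightarrow>
     (\<exists>\<phi> \<psi>. morphism X Y \<phi> \<and> morphism Y X \<psi> \<and>
        (\<forall>x \<in> topspace (zariski X). \<psi> (\<phi> x) = x) \<and>
        (\<forall>y \<in> topspace (zariski Y). \<phi> (\<psi> y) = y))"

definition open_subspace :: "('a, 'k) fspace \<Rightarrow> 'a set \<Rightarrow> ('a, 'k) fspace" where
  "open_subspace X U = \<lparr>zariski = subtopology (zariski X) U, regular = regular X\<rparr>"

text \<open>
  Points of \<open>K\<^sup>n\<close> are the functions in \<open>{..<n} \<rightarrow>\<^sub>E UNIV\<close>. Polynomials in \<open>n\<close> variables are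
  represented by the functions they induce.
\<close>

inductive_set poly_funs :: "nat \<Rightarrow> ((nat \<Rightarrow> 'k::field) \<Rightarrow> 'k) set" for n :: nat where
  const: "(\<lambda>x. c) \<in> poly_funs n"
| coord: "i < n \<Longrightarrow> (\<lambda>x. x i) \<in> poly_funs n"
| add: "p \<in> poly_funs n \<Longrightarrow> q \<in> poly_funs n \<Longrightarrow> (\<lambda>x. p x + q x) \<in> poly_funs n"
| mult: "p \<in> poly_funs n \<Longrightarrow> q \<in> poly_funs n \<Longrightarrow> (\<lambda>x. p x * q x) \<in> poly_funs n"

definition zero_locus :: "nat \<Rightarrow> ((nat \<Rightarrow> 'k::field) \<Rightarrow> 'k) set \<Rightarrow> (nat \<Rightarrow> 'k) set" where
  "zero_locus n P = {x \<in> {..<n} \<rightarrow>\<^sub>E UNIV. \<forall>p\<in>P. p x = 0}"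

definition zariski_topology :: "nat \<Rightarrow> (nat \<Rightarrow> 'k::field) topology" where
  "zariski_topology n =
     topology (\<lambda>U. \<exists>P \<subseteq> poly_funs n. U = ({..<n} \<rightarrow>\<^sub>E UNIV) - zero_locus n P)"

lemma openin_zariski_topology:
  "openin (zariski_topology n) U \<longleftrightarrow>
     (\<exists>P \<subseteq> poly_funs n. U = ({..<n} \<rightarrow>\<^sub>E UNIV) - zero_locus n P)"
proof -
  let ?O = "\<lambda>U::(nat \<Rightarrow> 'a) set. \<exists>P \<subseteq> poly_funs n. U = ({..<n} \<rightarrow>\<^sub>E UNIV) - zero_locus n P"
  have "istopology ?O"
    unfolding istopology_def
  proof (intro conjI allI impI)
    fix S T :: "(nat \<Rightarrow> 'a) set" assume "?O S" "?O T"
    then obtain P Q where P: "P \<subseteq> poly_funs n" "S = ({..<n} \<rightarrow>\<^sub>E UNIV) - zero_locus n P"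
      and Q: "Q \<subseteq> poly_funs n" "T = ({..<n} \<rightarrow>\<^sub>E UNIV) - zero_locus n Q" by blast
    let ?R = "{\<lambda>x. p x * q x | p q. p \<in> P \<and> q \<in> Q}"
    have "?R \<subseteq> poly_funs n" using P(1) Q(1) by (blast intro: poly_funs.mult)
    moreover have "S \<inter> T = ({..<n} \<rightarrow>\<^sub>E UNIV) - zero_locus n ?R"
      unfolding P(2) Q(2) zero_locus_def by (auto; fastforce)
    ultimately show "?O (S \<inter> T)" by blast
  next
    fix \<K> :: "(nat \<Rightarrow> 'a) set set" assume "\<forall>K\<in>\<K>. ?O K"
    then obtain P where P: "\<And>K. K \<in> \<K> \<Longrightarrow> P K \<subseteq> poly_funs n \<and> K = ({..<n} \<rightarrow>\<^sub>E UNIV) - zero_locus n (P K)"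
      by metis
    have "(\<Union>K\<in>\<K>. P K) \<subseteq> poly_funs n" using P by blast
    moreover have "\<Union>\<K> = (\<Union>K\<in>\<K>. ({..<n} \<rightarrow>\<^sub>E UNIV) - zero_locus n (P K))" using P by auto
    then have "\<Union>\<K> = ({..<n} \<rightarrow>\<^sub>E UNIV) - zero_locus n (\<Union>K\<in>\<K>. P K)"
      unfolding zero_locus_def by auto
    ultimately show "?O (\<Union>\<K>)" by blast
  qed
  then show ?thesis
    unfolding zariski_topology_def by (simp add: topology_inverse')
qed

definition affine_subspace :: "nat \<Rightarrow> (nat \<Rightarrow> 'k::field) set \<Rightarrow> (nat \<Rightarrow> 'k, 'k) fspace" where
  "affine_subspace n Z =
     \<lparr>zariski = subtopology (zariski_topology n) Z,
      regular = (\<lambda>U. {f. \<forall>x\<in>U. \<exists>W. openin (subtopology (zariski_topology n) Z) W \<and> x \<in> W \<and> W \<subseteq> U \<and>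
                        (\<exists>p\<in>poly_funs n. \<exists>q\<in>poly_funs n. \<forall>y\<in>W. q y \<noteq> 0 \<and> f y = p y / q y)})\<rparr>"

definition affine_variety :: "('a, 'k::field) fspace \<Rightarrow> bool" where
  "affine_variety X \<longleftrightarrow>
     (\<exists>n Z. closedin (zariski_topology n) Z \<and> isomorphic_fspaces X (affine_subspace n Z))"

definition algebraic_variety :: "('a, 'k::alg_closed_field) fspace \<Rightarrow> bool" where
  "algebraic_variety X \<longleftrightarrow>
     space_with_functions X \<and>
     (\<exists>\<U>. finite \<U> \<and> \<Union>\<U> = topspace (zariski X) \<and>
        (\<forall>U\<in>\<U>. openin (zariski X) U \<and> affine_variety (open_subspace X U)))"


section \<open>Fibered powers\<close>

text \<open>
  The product over \<open>K\<close> of the copies of \<open>X\<close> indexed by a finite set \<open>M\<close>. On a box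
  \<open>\<Prod>\<^sub>m U\<^sub>m\<close> of open sets one has the finite sums of products of regular functions on the factors
  (the image of \<open>\<Otimes>\<^sub>m O(U\<^sub>m)\<close>); their non-vanishing loci form a basis of the Zariski topology of
  the product, which is in general finer than the product topology, and the regular functions are
  locally quotients of them.
\<close>

definition tensor_funs ::
    "'i set \<Rightarrow> ('a, 'k::field) fspace \<Rightarrow> ('i \<Rightarrow> 'a set) \<Rightarrow> (('i \<Rightarrow> 'a) \<Rightarrow> 'k) set" where
  "tensor_funs M X U =
     {\<lambda>x. \<Sum>j<N. \<Prod>m\<in>M. f j m (x m) | (N::nat) f. \<forall>j<N. \<forall>m\<in>M. f j m \<in> regular X (U m)}"

definition power_topology :: "'i set \<Rightarrow> ('a, 'k::field) fspace \<Rightarrow> ('i \<Rightarrow> 'a) topology" where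
  "power_topology M X =
     topology_generated_by
       {{x \<in> (\<Pi>\<^sub>E m\<in>M. U m). h x \<noteq> 0} | U h.
          (\<forall>m\<in>M. openin (zariski X) (U m)) \<and> h \<in> tensor_funs M X U}"

definition power_fspace :: "'i set \<Rightarrow> ('a, 'k::field) fspace \<Rightarrow> ('i \<Rightarrow> 'a, 'k) fspace" where
  "power_fspace M X =
     \<lparr>zariski = power_topology M X,
      regular = (\<lambda>V. {f. \<forall>x\<in>V. \<exists>W U. openin (power_topology M X) W \<and> x \<in> W \<and> W \<subseteq> V \<and>
                        (\<forall>m\<in>M. openin (zariski X) (U m)) \<and> W \<subseteq> (\<Pi>\<^sub>E m\<in>M. U m) \<and>
                        (\<exists>p\<in>tensor_funs M X U. \<exists>q\<in>tensor_funs M X U.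
                           \<forall>y\<in>W. q y \<noteq> 0 \<and> f y = p y / q y)})\<rparr>"


section \<open>Algebraic groups\<close>

record ('a, 'k) alg_group = "'a monoid" +
  variety :: "('a, 'k) fspace"

text \<open>The product \<open>X \<times> X\<close> is the power of \<open>X\<close> indexed by the two elements of \<^typ>\<open>bool\<close>.\<close>

definition algebraic_group :: "('a, 'k::alg_closed_field) alg_group \<Rightarrow> bool" where
  "algebraic_group X \<longleftrightarrow>
     group X \<and>
     algebraic_variety (variety X) \<and>
     topspace (zariski (variety X)) = carrier X \<and>
     morphism (power_fspace (UNIV :: bool set) (variety X)) (variety X)
       (\<lambda>p. p False \<otimes>\<^bsub>X\<^esub> p True) \<and>
     morphism (variety X) (variety X) (\<lambda>x. inv\<^bsub>X\<^esub> x)"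

definition alg_group_power ::
    "'i set \<Rightarrow> ('a, 'k::field) alg_group \<Rightarrow> ('i \<Rightarrow> 'a, 'k) alg_group" where
  "alg_group_power M X =
     \<lparr>carrier = carrier (product_group M (\<lambda>_. X)),
      monoid.mult = monoid.mult (product_group M (\<lambda>_. X)),
      one = one (product_group M (\<lambda>_. X)),
      variety = power_fspace M (variety X)\<rparr>"

definition alg_group_hom ::
    "('a, 'k) alg_group \<Rightarrow> ('b, 'k) alg_group \<Rightarrow> ('a \<Rightarrow> 'b) \<Rightarrow> bool" where
  "alg_group_hom X Y \<phi> \<longleftrightarrow> \<phi> \<in> hom X Y \<and> morphism (variety X) (variety Y) \<phi>"


section \<open>Cellular automata\<close>

definition configs :: "('g, 'm) monoid_scheme \<Rightarrow> 'a set \<Rightarrow> ('g \<Rightarrow> 'a) set" where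
  "configs G A = (carrier G \<rightarrow>\<^sub>E A)"

definition shift :: "('g, 'm) monoid_scheme \<Rightarrow> 'g \<Rightarrow> ('g \<Rightarrow> 'a) \<Rightarrow> 'g \<Rightarrow> 'a" where
  "shift G g c = (\<lambda>h\<in>carrier G. c (inv\<^bsub>G\<^esub> g \<otimes>\<^bsub>G\<^esub> h))"

definition local_rule ::
    "('g, 'm) monoid_scheme \<Rightarrow> 'a set \<Rightarrow> (('g \<Rightarrow> 'a) \<Rightarrow> ('g \<Rightarrow> 'a)) \<Rightarrow>
     'g set \<Rightarrow> (('g \<Rightarrow> 'a) \<Rightarrow> 'a) \<Rightarrow> bool" where
  "local_rule G A \<tau> M \<mu> \<longleftrightarrow>
     finite M \<and> M \<subseteq> carrier G \<and> \<mu> \<in> (M \<rightarrow>\<^sub>E A) \<rightarrow> A \<and>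
     (\<forall>c\<in>configs G A. \<forall>g\<in>carrier G. \<tau> c g = \<mu> (restrict (shift G (inv\<^bsub>G\<^esub> g) c) M))"

definition cellular_automaton ::
    "('g, 'm) monoid_scheme \<Rightarrow> 'a set \<Rightarrow> (('g \<Rightarrow> 'a) \<Rightarrow> ('g \<Rightarrow> 'a)) \<Rightarrow> bool" where
  "cellular_automaton G A \<tau> \<longleftrightarrow>
     \<tau> \<in> configs G A \<rightarrow> configs G A \<and> (\<exists>M \<mu>. local_rule G A \<tau> M \<mu>)"

text \<open>The field \<open>K\<close> is the type of scalars \<^typ>\<open>'k\<close> of \<open>X\<close>.\<close>

definition CA_algr ::
    "('g, 'm) monoid_scheme \<Rightarrow> ('a, 'k::alg_closed_field) alg_group \<Rightarrow>
     (('g \<Rightarrow> 'a) \<Rightarrow> ('g \<Rightarrow> 'a)) set" where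
  "CA_algr G X =
     {\<tau>. cellular_automaton G (carrier X) \<tau> \<and>
         (\<exists>M \<mu>. local_rule G (carrier X) \<tau> M \<mu> \<and> alg_group_hom (alg_group_power M X) X \<mu>)}"

definition asymptotic :: "('g, 'm) monoid_scheme \<Rightarrow> ('g \<Rightarrow> 'a) \<Rightarrow> ('g \<Rightarrow> 'a) \<Rightarrow> bool" where
  "asymptotic G c d \<longleftrightarrow>
     (\<exists>E. finite E \<and> E \<subseteq> carrier G \<and> restrict c (carrier G - E) = restrict d (carrier G - E))"

definition post_surjective ::
    "('g, 'm) monoid_scheme \<Rightarrow> 'a set \<Rightarrow> (('g \<Rightarrow> 'a) \<Rightarrow> ('g \<Rightarrow> 'a)) \<Rightarrow> bool" where
  "post_surjective G A \<tau> \<longleftrightarrow>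
     (\<forall>x\<in>configs G A. \<forall>y\<in>configs G A. asymptotic G y (\<tau> x) \<longrightarrow>
        (\<exists>z\<in>configs G A. asymptotic G z x \<and> \<tau> z = y))"

definition extend_by ::
    "('g, 'm) monoid_scheme \<Rightarrow> 'a \<Rightarrow> 'g set \<Rightarrow> ('g \<Rightarrow> 'a) set \<Rightarrow> ('g \<Rightarrow> 'a) set" where
  "extend_by G e \<Omega> D =
     {c \<in> extensional (carrier G). restrict c \<Omega> \<in> D \<and> (\<forall>g\<in>carrier G - \<Omega>. c g = e)}"

definition bullet_pre_injective ::
    "('g, 'm) monoid_scheme \<Rightarrow> ('a, 'k::field) alg_group \<Rightarrow>
     (('g \<Rightarrow> 'a) \<Rightarrow> ('g \<Rightarrow> 'a)) \<Rightarrow> bool" where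
  "bullet_pre_injective G X \<tau> \<longleftrightarrow>
     \<not> (\<exists>\<Omega> H. finite \<Omega> \<and> \<Omega> \<subseteq> carrier G \<and>
          closedin (zariski (variety (alg_group_power \<Omega> X))) H \<and>
          H \<subset> (\<Omega> \<rightarrow>\<^sub>E carrier X) \<and>
          \<tau> ` extend_by G \<one>\<^bsub>X\<^esub> \<Omega> (\<Omega> \<rightarrow>\<^sub>E carrier X) = \<tau> ` extend_by G \<one>\<^bsub>X\<^esub> \<Omega> H)"


section \<open>Sofic groups\<close>

type_synonym ('v, 's) labeled_graph = "'v set \<times> ('v \<times> 's \<times> 'v) set"

definition is_labeled_graph :: "'s set \<Rightarrow> ('v, 's) labeled_graph \<Rightarrow> bool" where
  "is_labeled_graph S \<Gamma> \<longleftrightarrow> snd \<Gamma> \<subseteq> fst \<Gamma> \<times> S \<times> fst \<Gamma>"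

definition labeled_graph_iso ::
    "('v, 's) labeled_graph \<Rightarrow> ('w, 's) labeled_graph \<Rightarrow> ('v \<Rightarrow> 'w) \<Rightarrow> bool" where
  "labeled_graph_iso \<Gamma> \<Delta> \<phi> \<longleftrightarrow>
     bij_betw \<phi> (fst \<Gamma>) (fst \<Delta>) \<and>
     (\<forall>u\<in>fst \<Gamma>. \<forall>v\<in>fst \<Gamma>. \<forall>s. (u, s, v) \<in> snd \<Gamma> \<longleftrightarrow> (\<phi> u, s, \<phi> v) \<in> snd \<Delta>)"

text \<open>The path metric ignores the orientation of edges, so that it is symmetric.\<close>

definition adjacency :: "('v, 's) labeled_graph \<Rightarrow> ('v \<times> 'v) set" where
  "adjacency \<Gamma> = {(u, v). \<exists>s. (u, s, v) \<in> snd \<Gamma> \<or> (v, s, u) \<in> snd \<Gamma>}"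

definition ball_vertices :: "('v, 's) labeled_graph \<Rightarrow> 'v \<Rightarrow> nat \<Rightarrow> 'v set" where
  "ball_vertices \<Gamma> v r = {w \<in> fst \<Gamma>. \<exists>n\<le>r. (v, w) \<in> adjacency \<Gamma> ^^ n}"

definition graph_ball :: "('v, 's) labeled_graph \<Rightarrow> 'v \<Rightarrow> nat \<Rightarrow> ('v, 's) labeled_graph" where
  "graph_ball \<Gamma> v r =
     (ball_vertices \<Gamma> v r, snd \<Gamma> \<inter> ball_vertices \<Gamma> v r \<times> UNIV \<times> ball_vertices \<Gamma> v r)"

definition cayley_graph :: "('g, 'm) monoid_scheme \<Rightarrow> 'g set \<Rightarrow> ('g, 'g) labeled_graph" where
  "cayley_graph G S = (carrier G, {(g, s, g \<otimes>\<^bsub>G\<^esub> s) | g s. g \<in> carrier G \<and> s \<in> S})"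

definition good_vertices ::
    "('g, 'm) monoid_scheme \<Rightarrow> 'g set \<Rightarrow> ('v, 'g) labeled_graph \<Rightarrow> nat \<Rightarrow> 'v set" where
  "good_vertices G S \<Gamma> r =
     {v \<in> fst \<Gamma>. \<exists>\<phi>. labeled_graph_iso (graph_ball (cayley_graph G S) \<one>\<^bsub>G\<^esub> r) (graph_ball \<Gamma> v r) \<phi> \<and>
                    \<phi> \<one>\<^bsub>G\<^esub> = v}"

definition finite_symmetric_generating_set :: "('g, 'm) monoid_scheme \<Rightarrow> 'g set \<Rightarrow> bool" where
  "finite_symmetric_generating_set G S \<longleftrightarrow>
     finite S \<and> S \<subseteq> carrier G \<and> (\<forall>s\<in>S. inv\<^bsub>G\<^esub> s \<in> S) \<and> generate G S = carrier G"

definition finitely_generated :: "('g, 'm) monoid_scheme \<Rightarrow> bool" where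
  "finitely_generated G \<longleftrightarrow> (\<exists>S. finite S \<and> S \<subseteq> carrier G \<and> generate G S = carrier G)"

text \<open>
  Soficity of a finitely generated group. The condition does not depend on \<open>S\<close>. Finite graphs may
  be taken to have natural numbers as vertices; the empty graph has to be excluded, as it satisfies
  the inequality for trivial reasons.
\<close>

definition sofic :: "('g, 'm) monoid_scheme \<Rightarrow> bool" where
  "sofic G \<longleftrightarrow>
     (\<exists>S. finite_symmetric_generating_set G S \<and>
        (\<forall>r::nat. \<forall>\<epsilon>::real. r > 0 \<longrightarrow> \<epsilon> > 0 \<longrightarrow>
           (\<exists>\<Gamma> :: (nat, 'g) labeled_graph.
              is_labeled_graph S \<Gamma> \<and> finite (fst \<Gamma>) \<and> fst \<Gamma> \<noteq> {} \<and>
              real (card (good_vertices G S \<Gamma> r)) \<ge> (1 - \<epsilon>) * real (card (fst \<Gamma>)))))"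

end

(*
  Let N be the kernel of tau on the configurations supported in Omega. If H has the same image as
  A^Omega, then A^Omega is the union of the sets H n with n in N. Let A0 be the identity component
  of the group X of points; (A0)^Omega is irreducible. If N is finite and contained in (A0)^Omega,
  then every coset of (A0)^Omega lies in one H n, which gives H = A^Omega.

  The two other cases are excluded by counting on a finite sofic approximation with vertex set V,
  whose set J of good vertices satisfies |J| >= (1 - eps) |V|. The local rule defines a homomorphism
  Phi : A^V -> A^J, and a positive proportion of the good vertices carries disjoint copies of Omega,
  so that the kernel of Phi contains the product of proportionally many copies of N. On the other
  hand, post-surjectivity makes Phi surjective on cosets of A0, respectively dominant on (A0)^V.
  If N is not contained in (A0)^Omega, one counts cosets of A0. If N is infinite and contained in
  (A0)^Omega, one counts algebraically independent regular functions: those of A^J pull back along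
  Phi, and every copy of N adds one that is not constant on the fibres of Phi.

  Dominance is where the uncountability of the field enters: A0 is the countable union, over all
  finite sets E, of the sets of values a for which the configuration with the single entry a is the
  image of a configuration supported in E, hence one of these sets is dense.
*)

theory Submission
  imports Defs
begin

section \<open>Algebras of functions and algebraic independence\<close>

text \<open>Soficity sees only a finite part of \<open>G\<close>, whereas post-surjectivity gives
  each value its own support. A common support is therefore needed. For cosets, finitely many
  representatives suffice. Inside A0 only a dense set of values is served, and the preimages found
  may leave A0; so they are also sorted by their pattern of cosets, and a quotient of two preimages
  with equal pattern has its values in A0. As \<open>J\<close> is smaller than \<open>V\<close>,
  surjectivity alone gives no contradiction: the deficit |V| - |J| has to be beaten by the number of
  disjoint copies of Omega. That number is at least |V| / (2 |Omega|^2), since a good vertex whose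
  copy meets a given copy is determined by two elements of Omega. The tolerance eps is chosen
  against this ratio. Dimension is replaced by the number of independent functions on some open part
  of a power of A0. Superadditivity and a linear upper bound are what is known of this number, so
  powers are compared through its growth rate. A rate close to the supremum is attained on a block
  of some length l, which is why the approximation is taken l times over.\<close>

lemma homogeneous_system_nontrivial_solution:
  fixes M :: "'i \<Rightarrow> 'j \<Rightarrow> 'k::field"
  assumes "finite B" "finite A" "card B < card A"
  shows "\<exists>c. (\<exists>a\<in>A. c a \<noteq> 0) \<and> (\<forall>b\<in>B. (\<Sum>a\<in>A. c a * M a b) = 0)"
  using assms
proof (induction B arbitrary: A M rule: finite_induct)
  case empty
  then obtain a where "a \<in> A" by fastforce
  then show ?case by (intro exI[of _ "\<lambda>_. 1"]) auto
next
  case (insert b B)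
  show ?case
  proof (cases "\<forall>a\<in>A. M a b = 0")
    case True
    obtain c where c: "\<exists>a\<in>A. c a \<noteq> 0" "\<forall>b\<in>B. (\<Sum>a\<in>A. c a * M a b) = 0"
      using insert.IH[of A M] insert.prems insert.hyps by auto
    then show ?thesis using True by (intro exI[of _ c]) auto
  next
    case False
    then obtain a0 where a0: "a0 \<in> A" "M a0 b \<noteq> 0" by blast
    \<comment> \<open>Gaussian elimination: equation \<open>b\<close> is solved for the unknown
      \<open>a0\<close>, and \<open>M'\<close> is the matrix of the other equations after
      substitution. One unknown and one equation disappear.\<close>
    define A' where "A' = A - {a0}"
    define M' where "M' = (\<lambda>a b'. M a b' - M a b / M a0 b * M a0 b')"
    have "card B < card A'" using insert.prems insert.hyps a0 by (simp add: A'_def)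
    moreover have "finite A'" using insert.prems by (simp add: A'_def)
    ultimately obtain c' where c': "\<exists>a\<in>A'. c' a \<noteq> 0" "\<forall>b\<in>B. (\<Sum>a\<in>A'. c' a * M' a b) = 0"
      using insert.IH[of A' M'] by auto
    define c where "c = c'(a0 := - (\<Sum>a\<in>A'. c' a * M a b / M a0 b))"
    have eq: "(\<Sum>a\<in>A. c a * M a b') = (\<Sum>a\<in>A'. c' a * M' a b')" for b'
    proof -
      have "(\<Sum>a\<in>A. c a * M a b') = c a0 * M a0 b' + (\<Sum>a\<in>A'. c a * M a b')"
        using a0 insert.prems by (simp add: A'_def sum.remove)
      also have "(\<Sum>a\<in>A'. c a * M a b') = (\<Sum>a\<in>A'. c' a * M a b')"
        by (rule sum.cong) (auto simp: c_def A'_def)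
      also have "c a0 * M a0 b' = - (\<Sum>a\<in>A'. c' a * (M a b / M a0 b * M a0 b'))"
        by (simp add: c_def sum_distrib_right mult.assoc)
      finally show ?thesis by (simp add: M'_def algebra_simps sum_subtractf)
    qed
    have "M' a b = 0" for a using a0 by (simp add: M'_def)
    then have "\<forall>b'\<in>insert b B. (\<Sum>a\<in>A. c a * M a b') = 0"
      using c' by (simp add: eq)
    moreover have "\<exists>a\<in>A. c a \<noteq> 0" using c' by (auto simp: c_def A'_def)
    ultimately show ?thesis by blast
  qed
qed

text \<open>Polynomials occur as the functions they induce. An element then has no preferred
  expression in the generators, so degrees are only ever bounded from above, by
  \<open>deg_le\<close>.\<close>

inductive_set fun_alg :: "('x \<Rightarrow> 'k::field) set \<Rightarrow> ('x \<Rightarrow> 'k) set" for F where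
  const: "(\<lambda>x. c) \<in> fun_alg F"
| gen: "f \<in> F \<Longrightarrow> f \<in> fun_alg F"
| add: "p \<in> fun_alg F \<Longrightarrow> q \<in> fun_alg F \<Longrightarrow> (\<lambda>x. p x + q x) \<in> fun_alg F"
| mult: "p \<in> fun_alg F \<Longrightarrow> q \<in> fun_alg F \<Longrightarrow> (\<lambda>x. p x * q x) \<in> fun_alg F"

lemma fun_alg_prod:
  "(\<And>i. i \<in> I \<Longrightarrow> p i \<in> fun_alg F) \<Longrightarrow> (\<lambda>x. \<Prod>i\<in>I. p i x) \<in> fun_alg F"
  by (induction I rule: infinite_finite_induct) (auto intro: fun_alg.intros)

lemma fun_alg_comp:
  assumes "p \<in> fun_alg F" "\<And>f. f \<in> F \<Longrightarrow> (\<lambda>x. f (h x)) \<in> fun_alg F'"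
  shows "(\<lambda>x. p (h x)) \<in> fun_alg F'"
  using assms by (induction rule: fun_alg.induct) (auto intro: fun_alg.intros)

lemma poly_funs_eq_fun_alg: "poly_funs n = fun_alg ((\<lambda>i x. x i) ` {..<n})"
proof (intro equalityI subsetI)
  show "p \<in> fun_alg ((\<lambda>i x. x i) ` {..<n})" if "p \<in> poly_funs n" for p :: "(nat \<Rightarrow> 'a) \<Rightarrow> 'a"
    using that by induction (auto intro: fun_alg.intros)
  show "p \<in> poly_funs n" if "p \<in> fun_alg ((\<lambda>i x. x i) ` {..<n})" for p :: "(nat \<Rightarrow> 'a) \<Rightarrow> 'a"
    using that by induction (auto intro: poly_funs.intros)
qed

text \<open>The exponent of each generator is bounded separately, not the total degree: the
  monomials are then indexed by a product set of cardinality
  \<open>(k + 1) ^ card F\<close>.\<close>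

definition deg_le :: "('x \<Rightarrow> 'k::field) set \<Rightarrow> nat \<Rightarrow> ('x \<Rightarrow> 'k) set" where
  "deg_le F k = {\<lambda>x. \<Sum>\<alpha>\<in>F \<rightarrow>\<^sub>E {..k}. c \<alpha> * (\<Prod>f\<in>F. f x ^ \<alpha> f) | c. True}"

lemma deg_le_monomial:
  assumes "finite F" "\<And>f. f \<in> F \<Longrightarrow> a f \<le> k"
  shows "(\<lambda>x. c * (\<Prod>f\<in>F. f x ^ a f)) \<in> deg_le F k"
proof -
  have *: "restrict a F \<in> F \<rightarrow>\<^sub>E {..k}" using assms by auto
  have fin: "finite (F \<rightarrow>\<^sub>E {..k})" using assms by (simp add: finite_PiE)
  have "(\<Sum>\<alpha>\<in>F \<rightarrow>\<^sub>E {..k}. (if \<alpha> = restrict a F then c else 0) * (\<Prod>f\<in>F. f x ^ \<alpha> f))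
      = c * (\<Prod>f\<in>F. f x ^ a f)" for x
  proof -
    have "(\<Sum>\<alpha>\<in>F \<rightarrow>\<^sub>E {..k}. (if \<alpha> = restrict a F then c else 0) * (\<Prod>f\<in>F. f x ^ \<alpha> f))
      = (\<Sum>\<alpha>\<in>F \<rightarrow>\<^sub>E {..k}. if \<alpha> = restrict a F then c * (\<Prod>f\<in>F. f x ^ restrict a F f) else 0)"
      by (rule sum.cong) auto
    also have "\<dots> = c * (\<Prod>f\<in>F. f x ^ restrict a F f)" using * fin by simp
    finally show ?thesis by simp
  qed
  then show ?thesis unfolding deg_le_def by (intro CollectI exI[of _ "\<lambda>\<alpha>. if \<alpha> = restrict a F then c else 0"]) simp
qed

lemma deg_le_add:
  assumes "p \<in> deg_le F k" "q \<in> deg_le F k" shows "(\<lambda>x. p x + q x) \<in> deg_le F k"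
proof -
  obtain c d where p: "p = (\<lambda>x. \<Sum>\<alpha>\<in>F \<rightarrow>\<^sub>E {..k}. c \<alpha> * (\<Prod>f\<in>F. f x ^ \<alpha> f))"
    and q: "q = (\<lambda>x. \<Sum>\<alpha>\<in>F \<rightarrow>\<^sub>E {..k}. d \<alpha> * (\<Prod>f\<in>F. f x ^ \<alpha> f))"
    using assms unfolding deg_le_def by blast
  show ?thesis unfolding deg_le_def
    by (intro CollectI exI[of _ "\<lambda>\<alpha>. c \<alpha> + d \<alpha>"]) (simp add: p q sum.distrib algebra_simps)
qed

lemma deg_le_const:
  assumes "finite F" shows "(\<lambda>x. c) \<in> deg_le F k"
  using deg_le_monomial[of F "\<lambda>_. 0" k c] assms by simp

lemma deg_le_sum:
  assumes "finite F" "\<And>i. i \<in> I \<Longrightarrow> p i \<in> deg_le F k"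
  shows "(\<lambda>x. \<Sum>i\<in>I. p i x) \<in> deg_le F k"
  using assms(2)
  by (induction I rule: infinite_finite_induct) (auto intro: deg_le_add deg_le_const assms(1))

lemma deg_le_mult:
  assumes "finite F" "p \<in> deg_le F j" "q \<in> deg_le F k"
  shows "(\<lambda>x. p x * q x) \<in> deg_le F (j + k)"
proof -
  obtain c d where p: "p = (\<lambda>x. \<Sum>\<alpha>\<in>F \<rightarrow>\<^sub>E {..j}. c \<alpha> * (\<Prod>f\<in>F. f x ^ \<alpha> f))"
    and q: "q = (\<lambda>x. \<Sum>\<beta>\<in>F \<rightarrow>\<^sub>E {..k}. d \<beta> * (\<Prod>f\<in>F. f x ^ \<beta> f))"
    using assms unfolding deg_le_def by blast
  have "(\<lambda>x. (c \<alpha> * d \<beta>) * (\<Prod>f\<in>F. f x ^ (\<alpha> f + \<beta> f))) \<in> deg_le F (j + k)"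
    if "\<alpha> \<in> F \<rightarrow>\<^sub>E {..j}" "\<beta> \<in> F \<rightarrow>\<^sub>E {..k}" for \<alpha> \<beta>
    using that PiE_mem by (intro deg_le_monomial assms(1)) (fastforce intro: add_mono)
  then have "(\<lambda>x. \<Sum>\<alpha>\<in>F \<rightarrow>\<^sub>E {..j}. \<Sum>\<beta>\<in>F \<rightarrow>\<^sub>E {..k}. (c \<alpha> * d \<beta>) * (\<Prod>f\<in>F. f x ^ (\<alpha> f + \<beta> f)))
      \<in> deg_le F (j + k)"
    by (intro deg_le_sum assms(1)) auto
  also have "(\<lambda>x. \<Sum>\<alpha>\<in>F \<rightarrow>\<^sub>E {..j}. \<Sum>\<beta>\<in>F \<rightarrow>\<^sub>E {..k}. (c \<alpha> * d \<beta>) * (\<Prod>f\<in>F. f x ^ (\<alpha> f + \<beta> f)))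
      = (\<lambda>x. p x * q x)"
    by (simp add: p q sum_product power_add prod.distrib algebra_simps)
  finally show ?thesis .
qed

lemma deg_le_mono:
  assumes "finite F" "j \<le> k" shows "deg_le F j \<subseteq> deg_le F k"
proof
  fix p assume "p \<in> deg_le F j"
  then have "(\<lambda>x. p x * 1) \<in> deg_le F (j + (k - j))"
    by (intro deg_le_mult deg_le_const assms(1))
  then show "p \<in> deg_le F k" using assms by simp
qed

lemma deg_le_power:
  assumes "finite F" "p \<in> deg_le F k"
  shows "(\<lambda>x. p x ^ n) \<in> deg_le F (k * n)"
proof (induction n)
  case 0 show ?case using deg_le_const[OF assms(1), of 1 0] by simp
next
  case (Suc n)
  show ?case using deg_le_mult[OF assms(1) assms(2) Suc] by (simp add: add.commute)
qed

lemma deg_le_prod: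
  assumes "finite F" "finite I" "\<And>i. i \<in> I \<Longrightarrow> p i \<in> deg_le F k"
  shows "(\<lambda>x. \<Prod>i\<in>I. p i x) \<in> deg_le F (k * card I)"
  using assms(2,3)
proof (induction I rule: finite_induct)
  case empty show ?case using deg_le_const[OF assms(1), of 1 0] by simp
next
  case (insert i I)
  then have "(\<lambda>x. p i x * (\<Prod>i\<in>I. p i x)) \<in> deg_le F (k + k * card I)"
    by (intro deg_le_mult assms(1)) auto
  then show ?case using insert by simp
qed

lemma fun_alg_deg_le:
  assumes "finite F" "p \<in> fun_alg F" shows "\<exists>k. p \<in> deg_le F k"
  using assms(2)
proof induction
  case (const c) show ?case using deg_le_const[OF assms(1)] by blast
next
  case (gen f)
  have "(\<lambda>x. 1 * (\<Prod>g\<in>F. g x ^ (if g = f then 1 else 0))) \<in> deg_le F 1"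
    by (intro deg_le_monomial assms(1)) auto
  moreover have "(\<Prod>g\<in>F. g x ^ (if g = f then 1 else 0)) = f x" for x
  proof -
    have "(\<Prod>g\<in>F. g x ^ (if g = f then 1 else 0)) = (\<Prod>g\<in>F. if g = f then f x else 1)"
      by (rule prod.cong) auto
    then show ?thesis using assms(1) gen by simp
  qed
  ultimately show ?case by auto
next
  case (add p q)
  then obtain j k where "p \<in> deg_le F j" "q \<in> deg_le F k" by blast
  then have "p \<in> deg_le F (max j k)" "q \<in> deg_le F (max j k)"
    using deg_le_mono[OF assms(1)] by (meson max.cobounded1 max.cobounded2 subsetD)+
  then show ?case using deg_le_add by blast
next
  case (mult p q)
  then show ?case using deg_le_mult[OF assms(1)] by blast
qed

text \<open>Expanding each \<open>r a\<close> in monomials leaves \<open>card A\<close> unknown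
  coefficients against \<open>(k + 1) ^ card F\<close> linear equations, one per monomial.\<close>

lemma deg_le_dependent:
  assumes F: "finite F" and A: "finite A" "(k + 1) ^ card F < card A"
    and r: "\<And>a. a \<in> A \<Longrightarrow> r a \<in> deg_le F k"
  shows "\<exists>c. (\<exists>a\<in>A. c a \<noteq> 0) \<and> (\<forall>x. (\<Sum>a\<in>A. c a * r a x) = 0)"
proof -
  let ?B = "F \<rightarrow>\<^sub>E {..k}"
  have "\<forall>a\<in>A. \<exists>M. \<forall>x. r a x = (\<Sum>\<alpha>\<in>?B. M \<alpha> * (\<Prod>f\<in>F. f x ^ \<alpha> f))"
  proof
    fix a assume "a \<in> A"
    from r[OF this] obtain c where "r a = (\<lambda>x. \<Sum>\<alpha>\<in>?B. c \<alpha> * (\<Prod>f\<in>F. f x ^ \<alpha> f))"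
      unfolding deg_le_def by blast
    then show "\<exists>M. \<forall>x. r a x = (\<Sum>\<alpha>\<in>?B. M \<alpha> * (\<Prod>f\<in>F. f x ^ \<alpha> f))" by (intro exI[of _ c]) simp
  qed
  from bchoice[OF this] obtain M where
    M: "\<And>a x. a \<in> A \<Longrightarrow> r a x = (\<Sum>\<alpha>\<in>?B. M a \<alpha> * (\<Prod>f\<in>F. f x ^ \<alpha> f))"
    by blast
  have "finite ?B" "card ?B = (k + 1) ^ card F"
    using F by (simp_all add: finite_PiE card_PiE)
  then obtain c where c: "\<exists>a\<in>A. c a \<noteq> 0" "\<forall>b\<in>?B. (\<Sum>a\<in>A. c a * M a b) = 0"
    using homogeneous_system_nontrivial_solution[of ?B A M] A by auto
  have "(\<Sum>a\<in>A. c a * r a x) = 0" for x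
  proof -
    have "(\<Sum>a\<in>A. c a * r a x) = (\<Sum>a\<in>A. \<Sum>\<alpha>\<in>?B. c a * M a \<alpha> * (\<Prod>f\<in>F. f x ^ \<alpha> f))"
      by (rule sum.cong) (simp_all add: M sum_distrib_left mult.assoc)
    also have "\<dots> = (\<Sum>\<alpha>\<in>?B. (\<Sum>a\<in>A. c a * M a \<alpha>) * (\<Prod>f\<in>F. f x ^ \<alpha> f))"
      by (subst sum.swap) (simp add: sum_distrib_right)
    also have "\<dots> = 0" using c(2) by (intro sum.neutral) auto
    finally show ?thesis .
  qed
  then show ?thesis using c(1) by blast
qed

text \<open>The polynomial of a relation is its family of coefficients on a box of exponents, so
  nonzero formal polynomials are excluded, not merely nonzero functions. For empty \<open>Y\<close>
  every relation holds and independence fails; hence the hypothesis of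
  \<open>alg_indep_0\<close>.\<close>

definition alg_indep :: "'x set \<Rightarrow> (nat \<Rightarrow> 'x \<Rightarrow> 'k::field) \<Rightarrow> nat \<Rightarrow> bool" where
  "alg_indep Y f d \<longleftrightarrow>
     (\<forall>s c. (\<forall>y\<in>Y. (\<Sum>\<alpha>\<in>{..<d} \<rightarrow>\<^sub>E {..s}. c \<alpha> * (\<Prod>i<d. f i y ^ \<alpha> i)) = 0) \<longrightarrow>
        (\<forall>\<alpha>\<in>{..<d} \<rightarrow>\<^sub>E {..s::nat}. c \<alpha> = 0))"

lemma alg_indepD:
  assumes "alg_indep Y f d"
    and "\<And>y. y \<in> Y \<Longrightarrow> (\<Sum>\<alpha>\<in>{..<d} \<rightarrow>\<^sub>E {..s}. c \<alpha> * (\<Prod>i<d. f i y ^ \<alpha> i)) = 0"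
    and "\<alpha> \<in> {..<d} \<rightarrow>\<^sub>E {..s}"
  shows "c \<alpha> = 0"
  using assms(1)[unfolded alg_indep_def, THEN spec, THEN spec, THEN mp, THEN bspec, OF _ assms(3)] assms(2)
  by blast

text \<open>The monomials of degree at most \<open>s\<close> in each of \<open>d\<close> independent functions, multiplied by a
  power of the common denominator, are \<open>(s + 1)\<^sup>d\<close> independent elements of a space of dimension
  \<open>O(s ^ card F)\<close>.\<close>

lemma alg_indep_le_card:
  assumes F: "finite F" and ind: "alg_indep Y f d"
    and p: "\<And>i. i < d \<Longrightarrow> p i \<in> fun_alg F" and q: "q \<in> fun_alg F"
    and quot: "\<And>i y. i < d \<Longrightarrow> y \<in> Y \<Longrightarrow> q y \<noteq> 0 \<and> f i y = p i y / q y"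
  shows "d \<le> card F"
proof (rule ccontr)
  assume "\<not> d \<le> card F"
  then have dF: "card F < d" by simp
  have "\<exists>k. \<forall>i<d. p i \<in> deg_le F k"
  proof -
    have "\<forall>i<d. \<exists>k. p i \<in> deg_le F k" using p fun_alg_deg_le[OF F] by blast
    then obtain K where K: "\<And>i. i < d \<Longrightarrow> p i \<in> deg_le F (K i)" by metis
    have "p i \<in> deg_le F (Max (K ` {..<d}))" if "i < d" for i
    proof -
      have "K i \<le> Max (K ` {..<d})" using that by (intro Max_ge) auto
      then show ?thesis using K[OF that] deg_le_mono[OF F] by blast
    qed
    then show ?thesis by blast
  qed
  then obtain k0 where k0: "\<And>i. i < d \<Longrightarrow> p i \<in> deg_le F k0" by blast
  obtain k1 where k1: "q \<in> deg_le F k1" using fun_alg_deg_le[OF F q] by blast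
  define a where "a = max k0 k1"
  have pa: "\<And>i. i < d \<Longrightarrow> p i \<in> deg_le F a" and qa: "q \<in> deg_le F a"
    using k0 k1 deg_le_mono[OF F] unfolding a_def by (meson max.cobounded1 max.cobounded2 subsetD)+
  define N where "N = card F"
  have bound: "(s + 1) ^ d \<le> (a * s * d + 1) ^ N" for s
  proof (rule ccontr)
    assume less: "\<not> (s + 1) ^ d \<le> (a * s * d + 1) ^ N"
    let ?A = "{..<d} \<rightarrow>\<^sub>E {..s}"
    \<comment> \<open>Each factor \<open>f i y ^ \<alpha> i\<close> is brought to the denominator
      \<open>q y ^ s\<close>, whatever the exponent, so all monomials share the denominator
      \<open>(q y ^ s) ^ d\<close> and \<open>r \<alpha>\<close> is the numerator.\<close>
    define r where "r = (\<lambda>\<alpha> y. \<Prod>i<d. p i y ^ \<alpha> i * q y ^ (s - \<alpha> i))"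
    have r: "r \<alpha> \<in> deg_le F (a * s * d)" if \<alpha>: "\<alpha> \<in> ?A" for \<alpha>
    proof -
      have "(\<lambda>y. p i y ^ \<alpha> i * q y ^ (s - \<alpha> i)) \<in> deg_le F (a * s)" if "i < d" for i
      proof -
        have "\<alpha> i \<le> s" using \<alpha> that by auto
        moreover have "(\<lambda>y. p i y ^ \<alpha> i * q y ^ (s - \<alpha> i)) \<in> deg_le F (a * \<alpha> i + a * (s - \<alpha> i))"
          by (intro deg_le_mult deg_le_power F pa qa that)
        ultimately show ?thesis by (simp flip: distrib_left)
      qed
      then show ?thesis using deg_le_prod[of F "{..<d}" _ "a * s"] F by (simp add: r_def)
    qed
    have "finite ?A" "card ?A = (s + 1) ^ d" by (simp_all add: finite_PiE card_PiE)
    then obtain c where c: "\<exists>\<alpha>\<in>?A. c \<alpha> \<noteq> 0" "\<forall>y. (\<Sum>\<alpha>\<in>?A. c \<alpha> * r \<alpha> y) = 0"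
      using deg_le_dependent[where A = ?A and r = r, OF F _ _ r] less unfolding N_def by fastforce
    have "(\<Sum>\<alpha>\<in>?A. c \<alpha> * (\<Prod>i<d. f i y ^ \<alpha> i)) = 0" if y: "y \<in> Y" for y
    proof -
      have "(\<Prod>i<d. f i y ^ \<alpha> i) * (q y ^ s) ^ d = r \<alpha> y" if \<alpha>: "\<alpha> \<in> ?A" for \<alpha>
      proof -
        have "f i y ^ \<alpha> i * q y ^ s = p i y ^ \<alpha> i * q y ^ (s - \<alpha> i)" if "i < d" for i
        proof -
          have "\<alpha> i \<le> s" using \<alpha> that by auto
          then have "q y ^ s = q y ^ \<alpha> i * q y ^ (s - \<alpha> i)" by (simp flip: power_add)
          then show ?thesis using quot[OF that y] by (simp add: power_divide)
        qed
        then have "(\<Prod>i<d. f i y ^ \<alpha> i * q y ^ s) = r \<alpha> y" unfolding r_def by (intro prod.cong) auto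
        then show ?thesis by (simp add: prod.distrib)
      qed
      then have "(\<Sum>\<alpha>\<in>?A. c \<alpha> * (\<Prod>i<d. f i y ^ \<alpha> i)) * (q y ^ s) ^ d = (\<Sum>\<alpha>\<in>?A. c \<alpha> * r \<alpha> y)"
        by (simp add: sum_distrib_right mult.assoc)
      then have "(\<Sum>\<alpha>\<in>?A. c \<alpha> * (\<Prod>i<d. f i y ^ \<alpha> i)) * (q y ^ s) ^ d = 0" using c by metis
      \<comment> \<open>That \<open>q\<close> does not vanish is part of the hypothesis on quotients
        and is available through any index below \<open>d\<close>; \<open>0\<close> is one because
        \<open>card F < d\<close>.\<close>
      moreover have "(q y ^ s) ^ d \<noteq> 0" using quot[OF _ y, of 0] dF by simp
      ultimately show ?thesis unfolding mult_eq_0_iff by blast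
    qed
    then have "\<forall>\<alpha>\<in>?A. c \<alpha> = 0" using ind unfolding alg_indep_def by blast
    then show False using c by blast
  qed
  \<comment> \<open>With \<open>s = b\<close> the growth comparison is violated: the left side is at
    least \<open>(b + 1) * (b + 1) ^ N\<close>, the right side at most
    \<open>((a * d + 1) * (b + 1)) ^ N\<close>, which is \<open>b * (b + 1) ^ N\<close> by the
    choice of \<open>b\<close>.\<close>
  define b where "b = (a * d + 1) ^ N"
  have "(b + 1) ^ Suc N \<le> (b + 1) ^ d" using dF by (intro power_increasing) (auto simp: N_def)
  also have "\<dots> \<le> (a * b * d + 1) ^ N" by (rule bound)
  also have "\<dots> \<le> ((a * d + 1) * (b + 1)) ^ N" by (intro power_mono) (auto simp: algebra_simps)
  also have "\<dots> = b * (b + 1) ^ N" unfolding b_def power_mult_distrib ..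
  finally have "(b + 1) * (b + 1) ^ N \<le> b * (b + 1) ^ N" by simp
  then show False by simp
qed

section \<open>Criteria for algebraic independence\<close>

lemma sum_PiE_lessThan_Suc:
  "(\<Sum>\<alpha>\<in>{..<Suc d} \<rightarrow>\<^sub>E B. h \<alpha>) = (\<Sum>j\<in>B. \<Sum>\<alpha>\<in>{..<d} \<rightarrow>\<^sub>E B. h (\<alpha>(d := j)))"
proof -
  let ?u = "\<lambda>(j, \<alpha>). \<alpha>(d := j)"
  have inj: "inj_on ?u (B \<times> ({..<d} \<rightarrow>\<^sub>E B))"
    by (rule inj_combinator) simp
  have img: "{..<Suc d} \<rightarrow>\<^sub>E B = ?u ` (B \<times> ({..<d} \<rightarrow>\<^sub>E B))"
    unfolding lessThan_Suc by (rule PiE_insert_eq)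
  have "(\<Sum>\<alpha>\<in>{..<Suc d} \<rightarrow>\<^sub>E B. h \<alpha>) = (\<Sum>p\<in>B \<times> ({..<d} \<rightarrow>\<^sub>E B). h (?u p))"
    unfolding img sum.reindex[OF inj] comp_def ..
  also have "\<dots> = (\<Sum>j\<in>B. \<Sum>\<alpha>\<in>{..<d} \<rightarrow>\<^sub>E B. h (\<alpha>(d := j)))"
    unfolding sum.cartesian_product by (rule sum.cong) auto
  finally show ?thesis .
qed

lemma power_sum_zero_imp_coeffs_zero:
  fixes a :: "nat \<Rightarrow> 'k::field"
  assumes "finite B" "card B > s" "\<And>t. t \<in> B \<Longrightarrow> (\<Sum>j\<le>s. a j * t ^ j) = 0" "j \<le> s"
  shows "a j = 0"
proof -
  define p where "p = (\<Sum>j\<le>s. monom (a j) j)"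
  have "p = 0"
  proof (rule ccontr)
    assume "p \<noteq> 0"
    have "B \<subseteq> {t. poly p t = 0}"
      using assms(3) by (auto simp: p_def poly_sum poly_monom)
    then have "card B \<le> card {t. poly p t = 0}" using \<open>p \<noteq> 0\<close> by (intro card_mono poly_roots_finite)
    also have "\<dots> \<le> degree p" using \<open>p \<noteq> 0\<close> by (rule card_poly_roots_bound)
    also have "\<dots> \<le> s" unfolding p_def by (intro degree_sum_le) (auto intro: le_trans[OF degree_monom_le])
    finally show False using assms by simp
  qed
  then have "coeff p j = 0" by simp
  then show ?thesis using assms(4) by (simp add: p_def coeff_sum sum.delta')
qed

lemma alg_indep_0: "Y \<noteq> {} \<Longrightarrow> alg_indep Y f 0"
  unfolding alg_indep_def by auto

lemma alg_indep_cong: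
  "(\<And>i y. i < d \<Longrightarrow> y \<in> Y \<Longrightarrow> f i y = g i y) \<Longrightarrow> alg_indep Y f d \<longleftrightarrow> alg_indep Y g d"
proof -
  assume *: "\<And>i y. i < d \<Longrightarrow> y \<in> Y \<Longrightarrow> f i y = g i y"
  have "(\<Prod>i<d. f i y ^ \<alpha> i) = (\<Prod>i<d. g i y ^ \<alpha> i)" if "y \<in> Y" for y and \<alpha> :: "nat \<Rightarrow> nat"
    using * that by (intro prod.cong) auto
  then show ?thesis unfolding alg_indep_def by simp
qed

text \<open>Order a relation by powers of the last function. Where one coefficient is nonzero, move
  inside the fibre of the first \<open>d\<close> functions: the coefficients stay fixed while the
  last function takes more than \<open>s\<close> values, too many for a nonzero polynomial of degree
  at most \<open>s\<close>. The point \<open>y\<close> may depend on the relation.\<close>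

lemma alg_indep_Suc:
  assumes wit: "\<And>s c \<alpha>0. \<alpha>0 \<in> {..<d} \<rightarrow>\<^sub>E {..s} \<Longrightarrow> c \<alpha>0 \<noteq> 0 \<Longrightarrow>
      \<exists>y\<in>Y. (\<Sum>\<alpha>\<in>{..<d} \<rightarrow>\<^sub>E {..s::nat}. c \<alpha> * (\<Prod>i<d. f i y ^ \<alpha> i)) \<noteq> 0 \<and>
        (\<exists>B. finite B \<and> card B > s \<and> (\<forall>t\<in>B. \<exists>y'\<in>Y. f d y' = t \<and> (\<forall>i<d. f i y' = f i y)))"
  shows "alg_indep Y f (Suc d)"
  unfolding alg_indep_def
proof (intro allI impI)
  fix s :: nat and c
  let ?A = "{..<d} \<rightarrow>\<^sub>E {..s}"
  assume zero: "\<forall>y\<in>Y. (\<Sum>\<alpha>\<in>{..<Suc d} \<rightarrow>\<^sub>E {..s}. c \<alpha> * (\<Prod>i<Suc d. f i y ^ \<alpha> i)) = 0"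
  have expand: "(\<Sum>\<alpha>\<in>{..<Suc d} \<rightarrow>\<^sub>E {..s}. c \<alpha> * (\<Prod>i<Suc d. f i y ^ \<alpha> i)) =
     (\<Sum>j\<le>s. (\<Sum>\<alpha>\<in>?A. c (\<alpha>(d := j)) * (\<Prod>i<d. f i y ^ \<alpha> i)) * f d y ^ j)" for y
    unfolding sum_PiE_lessThan_Suc
    by (intro sum.cong refl) (auto simp: sum_distrib_right mult.assoc intro!: sum.cong)
  show "\<forall>\<alpha>\<in>{..<Suc d} \<rightarrow>\<^sub>E {..s}. c \<alpha> = 0"
  proof (rule ballI, rule ccontr)
    fix \<gamma> assume \<gamma>: "\<gamma> \<in> {..<Suc d} \<rightarrow>\<^sub>E {..s}" "c \<gamma> \<noteq> 0"
    then have "\<gamma> d \<le> s" by auto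
    have upd: "(restrict \<gamma> {..<d})(d := \<gamma> d) = \<gamma>"
      using \<gamma> by (auto simp: fun_eq_iff PiE_def extensional_def)
    have "restrict \<gamma> {..<d} \<in> ?A" using \<gamma>(1) by fastforce
    moreover have "c ((restrict \<gamma> {..<d})(d := \<gamma> d)) \<noteq> 0" unfolding upd by (rule \<gamma>(2))
    ultimately have wit_pre: "restrict \<gamma> {..<d} \<in> ?A" "c ((restrict \<gamma> {..<d})(d := \<gamma> d)) \<noteq> 0" .
    define P where "P y \<longleftrightarrow> (\<Sum>\<alpha>\<in>?A. c (\<alpha>(d := \<gamma> d)) * (\<Prod>i<d. f i y ^ \<alpha> i)) \<noteq> 0" for y
    define R where "R y B \<longleftrightarrow> finite B \<and> card B > s \<and> (\<forall>t\<in>B. \<exists>y'\<in>Y. f d y' = t \<and> (\<forall>i<d. f i y' = f i y))"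
      for y B
    have "\<exists>y\<in>Y. P y \<and> (\<exists>B. R y B)"
      unfolding P_def R_def by (rule wit[of "restrict \<gamma> {..<d}" s "\<lambda>\<alpha>. c (\<alpha>(d := \<gamma> d))", OF wit_pre])
    then obtain y B where yB: "y \<in> Y" "P y" "R y B" by blast
    note yB' = yB(1) yB(2)[unfolded P_def] yB(3)[unfolded R_def]
    have y: "y \<in> Y" "(\<Sum>\<alpha>\<in>?A. c (\<alpha>(d := \<gamma> d)) * (\<Prod>i<d. f i y ^ \<alpha> i)) \<noteq> 0"
      and B: "finite B" "card B > s" "\<forall>t\<in>B. \<exists>y'\<in>Y. f d y' = t \<and> (\<forall>i<d. f i y' = f i y)"
      using yB' by fast+
    have "(\<Sum>j\<le>s. (\<Sum>\<alpha>\<in>?A. c (\<alpha>(d := j)) * (\<Prod>i<d. f i y ^ \<alpha> i)) * t ^ j) = 0" if t: "t \<in> B" for t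
    proof -
      obtain y' where y': "y' \<in> Y" "f d y' = t" "\<forall>i<d. f i y' = f i y" using bspec[OF B(3) t] by blast
      have "(\<Prod>i<d. f i y' ^ \<alpha> i) = (\<Prod>i<d. f i y ^ \<alpha> i)" for \<alpha>
        using y'(3) by (intro prod.cong) auto
      then show ?thesis using bspec[OF zero y'(1), unfolded expand] unfolding y'(2) by (simp only:)
    qed
    from power_sum_zero_imp_coeffs_zero[OF B(1,2) this \<open>\<gamma> d \<le> s\<close>] y(2) show False by (rule notE[rotated])
  qed
qed

text \<open>At a point of \<open>W\<close> over \<open>(y, z)\<close> a relation is a polynomial in
  the \<open>f i y\<close> whose coefficients are polynomials in the \<open>g i z\<close>. For fixed
  \<open>z\<close> independence of \<open>f\<close> kills these coefficients, and independence of
  \<open>g\<close> then kills theirs. \<open>W\<close> need not be a product; a point over each pair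
  is enough.\<close>

lemma alg_indep_Times:
  assumes f: "alg_indep Y f d" and g: "alg_indep Z g e"
    and h: "\<And>y z. y \<in> Y \<Longrightarrow> z \<in> Z \<Longrightarrow> \<exists>w\<in>W. (\<forall>i<d. h i w = f i y) \<and> (\<forall>i<e. h (d + i) w = g i z)"
  shows "alg_indep W h (d + e)"
  unfolding alg_indep_def
proof (intro allI impI)
  fix s :: nat and c
  let ?A = "{..<d} \<rightarrow>\<^sub>E {..s}" and ?B = "{..<e} \<rightarrow>\<^sub>E {..s}" and ?C = "{..<d + e} \<rightarrow>\<^sub>E {..s}"
  \<comment> \<open>Exponents in \<open>d + e\<close> variables are pairs of exponents:
    \<open>j\<close> concatenates, \<open>k\<close> splits.\<close>
  define j where "j = (\<lambda>(\<alpha>, \<beta>). \<lambda>i\<in>{..<d + e}. if i < d then \<alpha> i else \<beta> (i - d) :: nat)"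
  define k where "k = (\<lambda>\<gamma>. (restrict \<gamma> {..<d}, \<lambda>i\<in>{..<e}. \<gamma> (d + i) :: nat))"
  have k: "k \<gamma> \<in> ?A \<times> ?B" "j (k \<gamma>) = \<gamma>" if "\<gamma> \<in> ?C" for \<gamma>
    using that by (auto simp: k_def j_def fun_eq_iff PiE_def extensional_def)
  have j: "j p \<in> ?C" "k (j p) = p" if "p \<in> ?A \<times> ?B" for p
    using that by (auto simp: k_def j_def fun_eq_iff PiE_def extensional_def Pi_def)
  assume zero: "\<forall>w\<in>W. (\<Sum>\<gamma>\<in>?C. c \<gamma> * (\<Prod>i<d + e. h i w ^ \<gamma> i)) = 0"
  have sum0: "(\<Sum>\<alpha>\<in>?A. (\<Sum>\<beta>\<in>?B. c (j (\<alpha>, \<beta>)) * (\<Prod>i<e. g i z ^ \<beta> i)) * (\<Prod>i<d. f i y ^ \<alpha> i)) = 0"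
    if yz: "y \<in> Y" "z \<in> Z" for y z
  proof -
    obtain w where w: "w \<in> W" "\<forall>i<d. h i w = f i y" "\<forall>i<e. h (d + i) w = g i z" using h yz by blast
    have "(\<Sum>\<gamma>\<in>?C. c \<gamma> * (\<Prod>i<d + e. h i w ^ \<gamma> i)) =
        (\<Sum>p\<in>?A \<times> ?B. c (j p) * (\<Prod>i<d + e. h i w ^ j p i))"
      by (rule sum.reindex_bij_witness[where i = j and j = k]) (use j k in auto)
    also have "\<dots> = (\<Sum>(\<alpha>, \<beta>)\<in>?A \<times> ?B. c (j (\<alpha>, \<beta>)) * ((\<Prod>i<d. f i y ^ \<alpha> i) * (\<Prod>i<e. g i z ^ \<beta> i)))"
    proof (rule sum.cong, simp, clarify)
      fix \<alpha> \<beta>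
      have "(\<Prod>i<d + e. h i w ^ j (\<alpha>, \<beta>) i) = (\<Prod>i<d. h i w ^ j (\<alpha>, \<beta>) i) * (\<Prod>i<e. h (d + i) w ^ j (\<alpha>, \<beta>) (d + i))"
        by (induction e) (auto simp: mult.assoc)
      also have "(\<Prod>i<d. h i w ^ j (\<alpha>, \<beta>) i) = (\<Prod>i<d. f i y ^ \<alpha> i)"
        using w by (intro prod.cong) (auto simp: j_def)
      also have "(\<Prod>i<e. h (d + i) w ^ j (\<alpha>, \<beta>) (d + i)) = (\<Prod>i<e. g i z ^ \<beta> i)"
        using w by (intro prod.cong) (auto simp: j_def)
      finally show "c (j (\<alpha>, \<beta>)) * (\<Prod>i<d + e. h i w ^ j (\<alpha>, \<beta>) i) =
         c (j (\<alpha>, \<beta>)) * ((\<Prod>i<d. f i y ^ \<alpha> i) * (\<Prod>i<e. g i z ^ \<beta> i))" by simp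
    qed
    also have "\<dots> = (\<Sum>\<alpha>\<in>?A. (\<Sum>\<beta>\<in>?B. c (j (\<alpha>, \<beta>)) * (\<Prod>i<e. g i z ^ \<beta> i)) * (\<Prod>i<d. f i y ^ \<alpha> i))"
      by (simp add: sum.cartesian_product[symmetric] sum_distrib_right sum_distrib_left algebra_simps)
    finally show ?thesis using zero w by simp
  qed
  have inner: "(\<Sum>\<beta>\<in>?B. c (j (\<alpha>, \<beta>)) * (\<Prod>i<e. g i z ^ \<beta> i)) = 0" if "\<alpha> \<in> ?A" "z \<in> Z" for \<alpha> z
    by (rule alg_indepD[OF f, where c = "\<lambda>\<alpha>. \<Sum>\<beta>\<in>?B. c (j (\<alpha>, \<beta>)) * (\<Prod>i<e. g i z ^ \<beta> i)", OF sum0])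
      (use that in auto)
  have c0: "c (j (\<alpha>, \<beta>)) = 0" if "\<alpha> \<in> ?A" "\<beta> \<in> ?B" for \<alpha> \<beta>
    by (rule alg_indepD[OF g, where c = "\<lambda>\<beta>. c (j (\<alpha>, \<beta>))", OF inner]) (use that in auto)
  show "\<forall>\<gamma>\<in>?C. c \<gamma> = 0"
  proof
    fix \<gamma> assume "\<gamma> \<in> ?C"
    from c0[of "fst (k \<gamma>)" "snd (k \<gamma>)"] k[OF this] show "c \<gamma> = 0" by (auto simp: mem_Times_iff)
  qed
qed

section \<open>Noetherian rings of functions and generic points\<close>

definition fun_ring :: "('x \<Rightarrow> 'k::field) set \<Rightarrow> bool" where
  "fun_ring R \<longleftrightarrow> (\<forall>c. (\<lambda>x. c) \<in> R) \<and>
     (\<forall>f\<in>R. \<forall>g\<in>R. (\<lambda>x. f x + g x) \<in> R \<and> (\<lambda>x. f x * g x) \<in> R)"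

definition fun_ideal :: "('x \<Rightarrow> 'k::field) set \<Rightarrow> ('x \<Rightarrow> 'k) set \<Rightarrow> bool" where
  "fun_ideal R I \<longleftrightarrow> I \<subseteq> R \<and> (\<lambda>x. 0) \<in> I \<and> (\<forall>f\<in>I. \<forall>g\<in>I. (\<lambda>x. f x + g x) \<in> I) \<and>
     (\<forall>r\<in>R. \<forall>f\<in>I. (\<lambda>x. r x * f x) \<in> I)"

lemma fun_ideal_add: "fun_ideal R I \<Longrightarrow> f \<in> I \<Longrightarrow> g \<in> I \<Longrightarrow> (\<lambda>x. f x + g x) \<in> I"
  and fun_ideal_mult: "fun_ideal R I \<Longrightarrow> r \<in> R \<Longrightarrow> f \<in> I \<Longrightarrow> (\<lambda>x. r x * f x) \<in> I"
  by (auto simp: fun_ideal_def)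

definition noetherian_fun_ring :: "('x \<Rightarrow> 'k::field) set \<Rightarrow> bool" where
  "noetherian_fun_ring R \<longleftrightarrow> (\<forall>I::nat \<Rightarrow> _. (\<forall>k. fun_ideal R (I k)) \<longrightarrow> (\<forall>j k. j \<le> k \<longrightarrow> I j \<subseteq> I k) \<longrightarrow>
     (\<exists>k0. \<forall>k\<ge>k0. I k = I k0))"

text \<open>The strict bound counts terms, so \<open>d = 0\<close> leaves only the zero function,
  the base of the inductions below. \<open>t\<close> is an arbitrary function, possibly algebraic
  over \<open>R\<close>; the coefficients are not determined.\<close>

definition adjoin_below :: "('x \<Rightarrow> 'k::field) set \<Rightarrow> ('x \<Rightarrow> 'k) \<Rightarrow> nat \<Rightarrow> ('x \<Rightarrow> 'k) set" where
  "adjoin_below R t d = {\<lambda>x. \<Sum>j<d. c j x * t x ^ j | c. \<forall>j<d. c j \<in> R}"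

definition adjoin :: "('x \<Rightarrow> 'k::field) set \<Rightarrow> ('x \<Rightarrow> 'k) \<Rightarrow> ('x \<Rightarrow> 'k) set" where
  "adjoin R t = (\<Union>d. adjoin_below R t d)"

lemma fun_ring_poly_funs: "fun_ring (poly_funs n)"
  unfolding fun_ring_def by (auto intro: poly_funs.intros)

lemma adjoin_below_add:
  assumes "fun_ring R" "f \<in> adjoin_below R t d" "g \<in> adjoin_below R t d"
  shows "(\<lambda>x. f x + g x) \<in> adjoin_below R t d"
proof -
  obtain a b where a: "f = (\<lambda>x. \<Sum>j<d. a j x * t x ^ j)" "\<forall>j<d. a j \<in> R"
    and b: "g = (\<lambda>x. \<Sum>j<d. b j x * t x ^ j)" "\<forall>j<d. b j \<in> R"
    using assms(2,3) unfolding adjoin_below_def by blast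
  have "\<forall>j<d. (\<lambda>x. a j x + b j x) \<in> R" using a b assms(1) by (simp add: fun_ring_def)
  moreover have "(\<lambda>x. f x + g x) = (\<lambda>x. \<Sum>j<d. (a j x + b j x) * t x ^ j)"
    by (simp add: a b sum.distrib algebra_simps)
  ultimately show ?thesis unfolding adjoin_below_def
    by (intro CollectI exI[of _ "\<lambda>j x. a j x + b j x"]) simp
qed

lemma adjoin_below_mult:
  assumes "fun_ring R" "r \<in> R" "f \<in> adjoin_below R t d"
  shows "(\<lambda>x. r x * f x) \<in> adjoin_below R t d"
proof -
  obtain a where a: "f = (\<lambda>x. \<Sum>j<d. a j x * t x ^ j)" "\<forall>j<d. a j \<in> R"
    using assms unfolding adjoin_below_def by blast
  have "\<forall>j<d. (\<lambda>x. r x * a j x) \<in> R" using a assms by (simp add: fun_ring_def)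
  moreover have "(\<lambda>x. r x * f x) = (\<lambda>x. \<Sum>j<d. (r x * a j x) * t x ^ j)"
    by (simp add: a sum_distrib_left mult.assoc)
  ultimately show ?thesis unfolding adjoin_below_def
    by (intro CollectI exI[of _ "\<lambda>j x. r x * a j x"]) simp
qed

lemma adjoin_below_monomial:
  assumes "fun_ring R" "c \<in> R" "j < d"
  shows "(\<lambda>x. c x * t x ^ j) \<in> adjoin_below R t d"
proof -
  have "(\<Sum>i<d. (if i = j then c x else 0) * t x ^ i) = c x * t x ^ j" for x
  proof -
    have "(\<Sum>i<d. (if i = j then c x else 0) * t x ^ i) = (\<Sum>i<d. if i = j then c x * t x ^ j else 0)"
      by (rule sum.cong) auto
    then show ?thesis using assms(3) by simp
  qed
  moreover have "(\<lambda>x. if i = j then c x else 0) \<in> R" for i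
    using assms by (cases "i = j") (auto simp: fun_ring_def)
  ultimately show ?thesis unfolding adjoin_below_def
    by (intro CollectI exI[of _ "\<lambda>i x. if i = j then c x else 0"]) simp
qed

lemma adjoin_below_zero: "fun_ring R \<Longrightarrow> (\<lambda>x. 0) \<in> adjoin_below R t d"
  unfolding adjoin_below_def
  by (intro CollectI exI[of _ "\<lambda>j x. 0"]) (simp add: fun_ring_def)

lemma adjoin_below_shift:
  assumes "fun_ring R" "f \<in> adjoin_below R t d"
  shows "(\<lambda>x. t x * f x) \<in> adjoin_below R t (Suc d)"
proof -
  obtain a where a: "f = (\<lambda>x. \<Sum>j<d. a j x * t x ^ j)" "\<forall>j<d. a j \<in> R"
    using assms unfolding adjoin_below_def by blast
  define b where "b j = (case j of 0 \<Rightarrow> (\<lambda>x. 0) | Suc i \<Rightarrow> a i)" for j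
  have "\<forall>j<Suc d. b j \<in> R" using a assms by (auto simp: fun_ring_def b_def split: nat.split)
  moreover have "(\<lambda>x. t x * f x) = (\<lambda>x. \<Sum>j<Suc d. b j x * t x ^ j)"
    unfolding sum.lessThan_Suc_shift by (simp add: a b_def sum_distrib_left algebra_simps)
  ultimately show ?thesis unfolding adjoin_below_def by blast
qed

lemma adjoin_below_mono:
  assumes "fun_ring R" "d \<le> e"
  shows "adjoin_below R t d \<subseteq> adjoin_below R t e"
proof
  fix f assume "f \<in> adjoin_below R t d"
  then obtain a where a: "f = (\<lambda>x. \<Sum>j<d. a j x * t x ^ j)" "\<forall>j<d. a j \<in> R"
    unfolding adjoin_below_def by blast
  define b where "b j = (if j < d then a j else (\<lambda>x. 0))" for j
  have "(\<Sum>j<d. a j x * t x ^ j) = (\<Sum>j<e. b j x * t x ^ j)" for x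
    by (rule sum.mono_neutral_cong_left) (use assms in \<open>auto simp: b_def\<close>)
  moreover have "\<forall>j<e. b j \<in> R" using a assms by (auto simp: fun_ring_def b_def)
  ultimately show "f \<in> adjoin_below R t e" unfolding adjoin_below_def a(1) by auto
qed

lemma adjoin_mult_below:
  assumes "fun_ring R" "f \<in> adjoin_below R t d" "g \<in> adjoin R t"
  shows "(\<lambda>x. f x * g x) \<in> adjoin R t"
  using assms(2)
proof (induction d arbitrary: f)
  case 0
  then have "f = (\<lambda>x. 0)" by (auto simp: adjoin_below_def)
  then show ?case using adjoin_below_zero[OF assms(1)] by (auto simp: adjoin_def)
next
  case (Suc d)
  then obtain a where a: "f = (\<lambda>x. \<Sum>j<Suc d. a j x * t x ^ j)" "\<forall>j<Suc d. a j \<in> R"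
    unfolding adjoin_below_def by blast
  have "(\<lambda>x. \<Sum>j<d. a j x * t x ^ j) \<in> adjoin_below R t d" using a by (auto simp: adjoin_below_def)
  then have 1: "(\<lambda>x. (\<Sum>j<d. a j x * t x ^ j) * g x) \<in> adjoin R t" by (rule Suc.IH)
  have 2: "(\<lambda>x. t x ^ d * g x) \<in> adjoin R t"
  proof (induction d)
    case 0 show ?case using assms(3) by simp
  next
    case (Suc d)
    then show ?case using adjoin_below_shift[OF assms(1)] unfolding adjoin_def by (fastforce simp: mult.assoc)
  qed
  then obtain e where "(\<lambda>x. t x ^ d * g x) \<in> adjoin_below R t e" by (auto simp: adjoin_def)
  with adjoin_below_mult[OF assms(1), of "a d"] a
  have "(\<lambda>x. a d x * (t x ^ d * g x)) \<in> adjoin R t" by (auto simp: adjoin_def)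
  then obtain e1 e2 where e: "(\<lambda>x. (\<Sum>j<d. a j x * t x ^ j) * g x) \<in> adjoin_below R t e1"
    "(\<lambda>x. a d x * (t x ^ d * g x)) \<in> adjoin_below R t e2" using 1 by (auto simp: adjoin_def)
  have "(\<lambda>x. (\<Sum>j<d. a j x * t x ^ j) * g x + a d x * (t x ^ d * g x)) \<in> adjoin_below R t (max e1 e2)"
    using e adjoin_below_mono[OF assms(1), of e1 "max e1 e2" t] adjoin_below_mono[OF assms(1), of e2 "max e1 e2" t]
    by (intro adjoin_below_add[OF assms(1)]) auto
  then show ?case unfolding adjoin_def a(1) by (auto simp: algebra_simps)
qed

lemma fun_ring_adjoin: assumes "fun_ring R" shows "fun_ring (adjoin R t)"
proof -
  have c: "(\<lambda>x. c) \<in> adjoin R t" for c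
    using adjoin_below_monomial[OF assms, of "\<lambda>x. c" 0 1 t] assms by (auto simp: adjoin_def fun_ring_def)
  have m: "(\<lambda>x. f x * g x) \<in> adjoin R t" if "f \<in> adjoin R t" "g \<in> adjoin R t" for f g
    using adjoin_mult_below[OF assms _ that(2)] that(1) unfolding adjoin_def[of R t] by blast
  have a: "(\<lambda>x. f x + g x) \<in> adjoin R t" if fg: "f \<in> adjoin R t" "g \<in> adjoin R t" for f g
  proof -
    obtain d e where "f \<in> adjoin_below R t d" "g \<in> adjoin_below R t e" using fg by (auto simp: adjoin_def)
    then have "(\<lambda>x. f x + g x) \<in> adjoin_below R t (max d e)"
      using adjoin_below_mono[OF assms, of d "max d e" t] adjoin_below_mono[OF assms, of e "max d e" t]
      by (intro adjoin_below_add[OF assms]) auto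
    then show ?thesis by (auto simp: adjoin_def)
  qed
  show ?thesis unfolding fun_ring_def using c m a by blast
qed

text \<open>Hilbert's basis theorem. \<open>J k d\<close> is the ideal of leading coefficients of
  those members of \<open>I k\<close> that have at most the \<open>d\<close>-th power of
  \<open>t\<close>. It grows in both arguments; once it is stationary in \<open>k\<close> for all
  \<open>d\<close> simultaneously, cancelling leading terms shows that \<open>I k\<close> is
  stationary too.\<close>

lemma noetherian_adjoin:
  assumes R: "fun_ring R" and N: "noetherian_fun_ring R"
  shows "noetherian_fun_ring (adjoin R t)"
  unfolding noetherian_fun_ring_def
proof (intro allI impI)
  fix I :: "nat \<Rightarrow> ('a \<Rightarrow> 'b) set"
  assume I: "\<forall>k. fun_ideal (adjoin R t) (I k)" and mono: "\<forall>j k. j \<le> k \<longrightarrow> I j \<subseteq> I k"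
  define J where "J k d = {c \<in> R. \<exists>g\<in>adjoin_below R t d. (\<lambda>x. c x * t x ^ d + g x) \<in> I k}" for k d
  have JI: "c \<in> J k d" if "c \<in> R" "g \<in> adjoin_below R t d" "(\<lambda>x. c x * t x ^ d + g x) \<in> I k" for c g k d
    using that by (auto simp: J_def)
  have RA: "r \<in> R \<Longrightarrow> r \<in> adjoin R t" for r
    using adjoin_below_monomial[OF R, of r 0 1 t] by (auto simp: adjoin_def)
  have ideal: "fun_ideal R (J k d)" for k d
    unfolding fun_ideal_def
  proof (intro conjI ballI)
    show "J k d \<subseteq> R" by (auto simp: J_def)
    show "(\<lambda>x. 0) \<in> J k d"
      using adjoin_below_zero[OF R, of t d] I R by (auto simp: J_def fun_ideal_def fun_ring_def intro!: bexI[of _ "\<lambda>x. 0"])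
  next
    fix c c' assume "c \<in> J k d" "c' \<in> J k d"
    then obtain g g' where g: "c \<in> R" "g \<in> adjoin_below R t d" "(\<lambda>x. c x * t x ^ d + g x) \<in> I k"
      and g': "c' \<in> R" "g' \<in> adjoin_below R t d" "(\<lambda>x. c' x * t x ^ d + g' x) \<in> I k"
      by (auto simp: J_def)
    have "(\<lambda>x. (c x * t x ^ d + g x) + (c' x * t x ^ d + g' x)) \<in> I k"
      by (rule fun_ideal_add[OF I[rule_format] g(3) g'(3)])
    then have 1: "(\<lambda>x. (c x + c' x) * t x ^ d + (g x + g' x)) \<in> I k" by (simp add: algebra_simps)
    have "(\<lambda>x. c x + c' x) \<in> R" using R g g' by (simp add: fun_ring_def)
    then show "(\<lambda>x. c x + c' x) \<in> J k d" by (rule JI[OF _ adjoin_below_add[OF R g(2) g'(2)] 1])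
  next
    fix r c assume r: "r \<in> R" and "c \<in> J k d"
    then obtain g where g: "c \<in> R" "g \<in> adjoin_below R t d" "(\<lambda>x. c x * t x ^ d + g x) \<in> I k"
      by (auto simp: J_def)
    have "(\<lambda>x. r x * (c x * t x ^ d + g x)) \<in> I k"
      by (rule fun_ideal_mult[OF I[rule_format] RA[OF r] g(3)])
    then have 1: "(\<lambda>x. (r x * c x) * t x ^ d + r x * g x) \<in> I k" by (simp add: algebra_simps)
    have "(\<lambda>x. r x * c x) \<in> R" using R g r by (simp add: fun_ring_def)
    then show "(\<lambda>x. r x * c x) \<in> J k d" by (rule JI[OF _ adjoin_below_mult[OF R r g(2)] 1])
  qed
  have tA: "t \<in> adjoin R t"
    using adjoin_below_monomial[OF R, of "\<lambda>x. 1" 1 2 t] R by (auto simp: adjoin_def fun_ring_def)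
  have step: "J k d \<subseteq> J k (Suc d)" for k d
  proof
    fix c assume "c \<in> J k d"
    then obtain g where g: "c \<in> R" "g \<in> adjoin_below R t d" "(\<lambda>x. c x * t x ^ d + g x) \<in> I k"
      by (auto simp: J_def)
    have "(\<lambda>x. t x * (c x * t x ^ d + g x)) \<in> I k"
      by (rule fun_ideal_mult[OF I[rule_format] tA g(3)])
    then have "(\<lambda>x. c x * t x ^ Suc d + t x * g x) \<in> I k" by (simp add: algebra_simps)
    then show "c \<in> J k (Suc d)" by (rule JI[OF g(1) adjoin_below_shift[OF R g(2)]])
  qed
  have Jmono: "J j d \<subseteq> J k e" if "j \<le> k" "d \<le> e" for j k d e
  proof -
    have "I j \<subseteq> I k" using mono \<open>j \<le> k\<close> by simp
    then have "J j d \<subseteq> J k d" by (auto simp: J_def)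
    also have "J k d \<subseteq> J k e" by (rule lift_Suc_mono_le[of "J k", OF step \<open>d \<le> e\<close>])
    finally show ?thesis .
  qed
  \<comment> \<open>Used for the diagonal \<open>e k = k\<close> and for each constant
    \<open>e\<close>.\<close>
  have stab: "\<exists>k0. \<forall>k\<ge>k0. J k (e k) = J k0 (e k0)" if "\<And>j k. j \<le> k \<Longrightarrow> e j \<le> e k" for e
  proof (rule N[unfolded noetherian_fun_ring_def, rule_format, of "\<lambda>k. J k (e k)"])
    show "J j (e j) \<subseteq> J k (e k)" if "j \<le> k" for j k by (rule Jmono) (use that \<open>\<And>j k. j \<le> k \<Longrightarrow> e j \<le> e k\<close> in auto)
  qed (rule ideal)
  obtain k1 where k1: "\<And>k. k \<ge> k1 \<Longrightarrow> J k k = J k1 k1" using stab[of "\<lambda>k. k"] by auto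
  have "\<forall>d. \<exists>k0. \<forall>k\<ge>k0. J k d = J k0 d" using stab[of "\<lambda>_. _"] by blast
  then obtain K where K: "\<And>d k. k \<ge> K d \<Longrightarrow> J k d = J (K d) d" by metis
  \<comment> \<open>Beyond \<open>k1\<close> the diagonal is constant, which squeezes
    \<open>J k d\<close> for every \<open>d > k1\<close>. The finitely many
    \<open>d \<le> k1\<close> are stationary from \<open>K d\<close> on, and \<open>k0\<close>
    dominates all these thresholds.\<close>
  define k0 where "k0 = Max (insert k1 (K ` {..k1}))"
  have k0: "k1 \<le> k0" "d \<le> k1 \<Longrightarrow> K d \<le> k0" for d
    unfolding k0_def by (rule Max_ge, simp, simp, rule Max_ge) auto
  have Jk0: "J k d = J k0 d" if k: "k \<ge> k0" for k d
  proof (cases "d \<le> k1")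
    case True
    then have "K d \<le> k0" by (rule k0)
    then show ?thesis using K[of d k] K[of d k0] k by simp
  next
    case False
    have "J k d \<subseteq> J (max k d) (max k d)" "J k1 k1 \<subseteq> J k0 d" "J k0 d \<subseteq> J k d"
      using Jmono[of k "max k d" d "max k d"] Jmono[of k1 k0 k1 d] Jmono[of k0 k d d] False k0(1) k by simp_all
    then show ?thesis using k1[of "max k d"] k k0 by auto
  qed
  have "f \<in> I k0" if "k \<ge> k0" "f \<in> I k" "f \<in> adjoin_below R t d" for k f d
    using that
  proof (induction d arbitrary: f)
    case 0
    then have "f = (\<lambda>x. 0)" by (auto simp: adjoin_below_def)
    then show ?case using I by (simp add: fun_ideal_def)
  next
    case (Suc d)
    then obtain a where a: "f = (\<lambda>x. \<Sum>j<Suc d. a j x * t x ^ j)" "\<forall>j<Suc d. a j \<in> R"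
      unfolding adjoin_below_def by blast
    define g where "g = (\<lambda>x. \<Sum>j<d. a j x * t x ^ j)"
    have g: "g \<in> adjoin_below R t d" using a by (auto simp: adjoin_below_def g_def)
    have f: "f = (\<lambda>x. a d x * t x ^ d + g x)" by (auto simp: a g_def)
    \<comment> \<open>The leading coefficient of \<open>f\<close> is also that of some member of
      \<open>I k0\<close>. The difference of the two lies in \<open>I k\<close> and has fewer terms,
      so the induction hypothesis puts it into \<open>I k0\<close>.\<close>
    have "a d \<in> J k d" using a(2) Suc.prems(2) f by (intro JI[OF _ g]) simp_all
    then have "a d \<in> J k0 d" using Jk0 Suc.prems by blast
    then obtain h where h: "h \<in> adjoin_below R t d" "(\<lambda>x. a d x * t x ^ d + h x) \<in> I k0"
      by (auto simp: J_def)
    have m1: "(\<lambda>x. - 1) \<in> R" using R by (simp add: fun_ring_def)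
    have "(\<lambda>x. a d x * t x ^ d + h x) \<in> I k" using h(2) mono Suc.prems(1) by blast
    then have "(\<lambda>x. (- 1) * (a d x * t x ^ d + h x)) \<in> I k"
      by (rule fun_ideal_mult[OF I[rule_format] RA[OF m1]])
    then have "(\<lambda>x. f x + (- 1) * (a d x * t x ^ d + h x)) \<in> I k"
      by (rule fun_ideal_add[OF I[rule_format] Suc.prems(2)])
    then have 1: "(\<lambda>x. g x + (- 1) * h x) \<in> I k" by (simp add: f algebra_simps)
    have "(\<lambda>x. g x + (- 1) * h x) \<in> adjoin_below R t d"
      using adjoin_below_add[OF R g adjoin_below_mult[OF R m1 h(1)]] .
    then have "(\<lambda>x. g x + (- 1) * h x) \<in> I k0" using Suc.IH Suc.prems(1) 1 by blast
    then have "(\<lambda>x. (g x + (- 1) * h x) + (a d x * t x ^ d + h x)) \<in> I k0"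
      using h(2) by (rule fun_ideal_add[OF I[rule_format]])
    then show ?case by (simp add: f algebra_simps)
  qed
  moreover have "I k \<subseteq> adjoin R t" for k using I by (simp add: fun_ideal_def)
  ultimately have "I k \<subseteq> I k0" if "k \<ge> k0" for k using that unfolding adjoin_def by blast
  then have "\<forall>k\<ge>k0. I k = I k0" using mono by blast
  then show "\<exists>k0. \<forall>k\<ge>k0. I k = I k0" by blast
qed

section \<open>Polynomial functions and their zero loci\<close>

lemma poly_funs_mono: "n \<le> m \<Longrightarrow> poly_funs n \<subseteq> poly_funs m"
proof
  fix p :: "(nat \<Rightarrow> 'a) \<Rightarrow> 'a" assume "n \<le> m" "p \<in> poly_funs n"
  from this(2,1) show "p \<in> poly_funs m" by induction (auto intro: poly_funs.intros)
qed

lemma poly_funs_Suc: "poly_funs (Suc n) = adjoin (poly_funs n) (\<lambda>x. x n)"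
proof
  note R = fun_ring_poly_funs[of n]
  note A = fun_ring_adjoin[OF R, of "\<lambda>x. x n"]
  have "p \<in> adjoin (poly_funs n) (\<lambda>x. x n)" if "p \<in> poly_funs (Suc n)" for p :: "(nat \<Rightarrow> 'a) \<Rightarrow> 'a"
    using that
  proof induction
    case (const c) then show ?case using A unfolding fun_ring_def by blast
  next
    case (coord i)
    show ?case
    proof (cases "i = n")
      case True
      then show ?thesis
        using adjoin_below_monomial[OF R, of "\<lambda>x::nat \<Rightarrow> 'a. 1" 1 2 "\<lambda>x. x n"]
        by (auto simp: adjoin_def intro: poly_funs.const)
    next
      case False
      then have "(\<lambda>x. x i) \<in> poly_funs n" using coord by (auto intro: poly_funs.coord)
      then show ?thesis
        using adjoin_below_monomial[OF R, of "\<lambda>x::nat \<Rightarrow> 'a. x i" 0 1 "\<lambda>x. x n"] by (auto simp: adjoin_def)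
    qed
  qed (use A in \<open>auto simp: fun_ring_def\<close>)
  then show "poly_funs (Suc n) \<subseteq> adjoin (poly_funs n) (\<lambda>x::nat \<Rightarrow> 'a. x n)" by blast
  have pw: "(\<lambda>x. x n ^ j) \<in> poly_funs (Suc n)" for j
    by (induction j) (auto intro: poly_funs.intros)
  have "(\<lambda>x. \<Sum>j<d. c j x * x n ^ j) \<in> poly_funs (Suc n)"
    if "\<forall>j<d. c j \<in> poly_funs n" for d :: nat and c :: "nat \<Rightarrow> (nat \<Rightarrow> 'a) \<Rightarrow> 'a"
    using that
  proof (induction d)
    case 0 show ?case by (auto intro: poly_funs.intros)
  next
    case (Suc d)
    then show ?case using poly_funs_mono[of n "Suc n"] pw by (auto intro!: poly_funs.add poly_funs.mult)
  qed
  then show "adjoin (poly_funs n) (\<lambda>x::nat \<Rightarrow> 'a. x n) \<subseteq> poly_funs (Suc n)"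
    unfolding adjoin_def adjoin_below_def by blast
qed

text \<open>Induction by Hilbert's basis theorem from polynomials in no variables: these are the
  constants, whose ideals are zero or everything.\<close>

lemma noetherian_poly_funs: "noetherian_fun_ring (poly_funs n)"
proof (induction n)
  case 0
  have const: "\<exists>c. f = (\<lambda>x. c)" if "f \<in> poly_funs 0" for f :: "(nat \<Rightarrow> 'a) \<Rightarrow> 'a"
    using that by induction auto
  show ?case unfolding noetherian_fun_ring_def
  proof (intro allI impI)
    fix I :: "nat \<Rightarrow> ((nat \<Rightarrow> 'a) \<Rightarrow> 'a) set"
    assume I: "\<forall>k. fun_ideal (poly_funs 0) (I k)" and mono: "\<forall>j k. j \<le> k \<longrightarrow> I j \<subseteq> I k"
    show "\<exists>k0. \<forall>k\<ge>k0. I k = I k0"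
    proof (cases "\<exists>k. \<exists>c\<noteq>0. (\<lambda>x. c) \<in> I k")
      case True
      then obtain k0 c where c: "c \<noteq> 0" "(\<lambda>x. c) \<in> I k0" by blast
      have "(\<lambda>x. b) \<in> I k0" for b
      proof -
        have "(\<lambda>x::nat \<Rightarrow> 'a. (b / c) * c) \<in> I k0"
          using I c(2) by (intro fun_ideal_mult[of "poly_funs 0"] poly_funs.const) auto
        then show ?thesis using c by simp
      qed
      then have "poly_funs 0 \<subseteq> I k0" using const by blast
      moreover have "I k \<subseteq> poly_funs 0" for k using I by (simp add: fun_ideal_def)
      ultimately have "\<forall>k\<ge>k0. I k = I k0" using mono by (metis order.antisym order.trans)
      then show ?thesis ..
    next
      case False
      have "I k = {\<lambda>x. 0}" for k
      proof -
        have "I k \<subseteq> poly_funs 0" "(\<lambda>x. 0) \<in> I k" using I by (simp_all add: fun_ideal_def)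
        then show ?thesis using False const by blast
      qed
      then show ?thesis by simp
    qed
  qed
next
  case (Suc n)
  then show ?case unfolding poly_funs_Suc by (intro noetherian_adjoin fun_ring_poly_funs)
qed

text \<open>The ideals \<open>I k\<close> of functions vanishing on the loci form an increasing
  chain, and each locus is recovered as the zero locus of its own ideal. This direction needs no
  Nullstellensatz.\<close>

lemma zero_loci_stabilize:
  fixes P :: "nat \<Rightarrow> ((nat \<Rightarrow> 'k::field) \<Rightarrow> 'k) set"
  assumes P: "\<And>k. P k \<subseteq> poly_funs n"
    and dec: "\<And>j k. j \<le> k \<Longrightarrow> zero_locus n (P k) \<subseteq> zero_locus n (P j)"
  shows "\<exists>k0. \<forall>k\<ge>k0. zero_locus n (P k) = zero_locus n (P k0)"
proof -
  define I where "I k = {f \<in> poly_funs n. \<forall>x\<in>zero_locus n (P k). f x = 0}" for k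
  have "fun_ideal (poly_funs n) (I k)" for k
    unfolding fun_ideal_def I_def by (auto intro: poly_funs.intros)
  moreover have "I j \<subseteq> I k" if "j \<le> k" for j k using dec[OF that] unfolding I_def by blast
  ultimately obtain k0 where k0: "\<forall>k\<ge>k0. I k = I k0"
    using noetherian_poly_funs[of n, unfolded noetherian_fun_ring_def, rule_format, of I] by blast
  have "zero_locus n (P k) = zero_locus n (I k)" for k
    using P unfolding I_def zero_locus_def by blast
  then show ?thesis using k0 by metis
qed

lemma fun_ideal_add_gen:
  assumes R: "fun_ring R" and p: "fun_ideal R p" and a: "a \<in> R"
  shows "fun_ideal R {\<lambda>x. f x + r x * a x | f r. f \<in> p \<and> r \<in> R}"
    and "p \<subseteq> {\<lambda>x. f x + r x * a x | f r. f \<in> p \<and> r \<in> R}"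
    and "a \<in> {\<lambda>x. f x + r x * a x | f r. f \<in> p \<and> r \<in> R}"
proof -
  let ?q = "{\<lambda>x. f x + r x * a x | f r. f \<in> p \<and> r \<in> R}"
  have R0: "(\<lambda>x. c) \<in> R" for c using R by (simp add: fun_ring_def)
  show 1: "p \<subseteq> ?q"
  proof
    fix f assume "f \<in> p"
    then show "f \<in> ?q" using R0[of 0] by (intro CollectI exI[of _ f] exI[of _ "\<lambda>x. 0"]) simp
  qed
  have p0: "(\<lambda>x. 0) \<in> p" using p by (simp add: fun_ideal_def)
  show "a \<in> ?q" using R0[of 1] p0 by (intro CollectI exI[of _ "\<lambda>x. 0"] exI[of _ "\<lambda>x. 1"]) simp
  show "fun_ideal R ?q" unfolding fun_ideal_def
  proof (intro conjI ballI)
    show "?q \<subseteq> R" using R p a by (auto simp: fun_ring_def fun_ideal_def)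
    show "(\<lambda>x. 0) \<in> ?q" using 1 p0 by blast
  next
    fix f g assume "f \<in> ?q" "g \<in> ?q"
    then obtain f1 r1 f2 r2 where *: "f = (\<lambda>x. f1 x + r1 x * a x)" "f1 \<in> p" "r1 \<in> R"
      "g = (\<lambda>x. f2 x + r2 x * a x)" "f2 \<in> p" "r2 \<in> R" by blast
    have "(\<lambda>x. f x + g x) = (\<lambda>x. (f1 x + f2 x) + (r1 x + r2 x) * a x)" by (simp add: * algebra_simps)
    moreover have "(\<lambda>x. f1 x + f2 x) \<in> p" "(\<lambda>x. r1 x + r2 x) \<in> R"
      using * p R by (auto simp: fun_ideal_def fun_ring_def)
    ultimately show "(\<lambda>x. f x + g x) \<in> ?q"
      by (intro CollectI exI[of _ "\<lambda>x. f1 x + f2 x"] exI[of _ "\<lambda>x. r1 x + r2 x"]) simp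
  next
    fix s f assume s: "s \<in> R" and "f \<in> ?q"
    then obtain f1 r1 where *: "f = (\<lambda>x. f1 x + r1 x * a x)" "f1 \<in> p" "r1 \<in> R" by blast
    have "(\<lambda>x. s x * f x) = (\<lambda>x. s x * f1 x + (s x * r1 x) * a x)" by (simp add: * algebra_simps)
    moreover have "(\<lambda>x. s x * f1 x) \<in> p" "(\<lambda>x. s x * r1 x) \<in> R"
      using * p R s by (auto simp: fun_ideal_def fun_ring_def)
    ultimately show "(\<lambda>x. s x * f x) \<in> ?q"
      by (intro CollectI exI[of _ "\<lambda>x. s x * f1 x"] exI[of _ "\<lambda>x. s x * r1 x"]) simp
  qed
qed

lemma fun_ideal_sum:
  assumes "fun_ideal R p" "\<And>i. i \<in> A \<Longrightarrow> f i \<in> p"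
  shows "(\<lambda>x. \<Sum>i\<in>A. f i x) \<in> p"
  using assms(2)
  by (induction A rule: infinite_finite_induct) (use assms(1) in \<open>auto simp: fun_ideal_def\<close>)

text \<open>An ideal maximal among those disjoint from \<open>S\<close> is the ideal of a point. Otherwise every
  \<open>x\<^sub>i - c\<close> divides an element of \<open>S\<close> modulo this ideal; since there are uncountably many \<open>c\<close>,
  many of the quotients lie in one finite-dimensional space, and a linear relation among them
  produces a polynomial in \<open>x\<^sub>i\<close> that lies in the ideal.\<close>

lemma generic_point:
  fixes P :: "((nat \<Rightarrow> 'k::alg_closed_field) \<Rightarrow> 'k) set"
  assumes unc: "uncountable (UNIV :: 'k set)" and P: "P \<subseteq> poly_funs n"
    and S: "countable S" "S \<subseteq> poly_funs n" "(\<lambda>x. 1) \<in> S"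
    and mult: "\<And>s t. s \<in> S \<Longrightarrow> t \<in> S \<Longrightarrow> (\<lambda>x. s x * t x) \<in> S"
    and nv: "\<And>s. s \<in> S \<Longrightarrow> \<exists>z\<in>zero_locus n P. s z \<noteq> 0"
  shows "\<exists>z\<in>zero_locus n P. \<forall>s\<in>S. s z \<noteq> 0"
proof -
  define R where "R = (poly_funs n :: ((nat \<Rightarrow> 'k) \<Rightarrow> 'k) set)"
  have R: "fun_ring R" unfolding R_def by (rule fun_ring_poly_funs)
  have Rc: "(\<lambda>x. c) \<in> R" for c using R by (simp add: fun_ring_def)
  \<comment> \<open>\<open>nv\<close> says that this vanishing ideal is disjoint from
    \<open>S\<close>, so it starts the application of Zorn's lemma.\<close>
  define I0 where "I0 = {f \<in> R. \<forall>z\<in>zero_locus n P. f z = 0}"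
  define A where "A = {p. fun_ideal R p \<and> p \<inter> S = {} \<and> I0 \<subseteq> p}"
  have "I0 \<in> A" using nv by (auto simp: A_def fun_ideal_def I0_def R_def intro: poly_funs.intros)
  then have "A \<noteq> {}" by blast
  moreover have "\<Union>C \<in> A" if C: "C \<noteq> {}" "subset.chain A C" for C
  proof -
    have CA: "C \<subseteq> A" and ch: "\<And>x y. x \<in> C \<Longrightarrow> y \<in> C \<Longrightarrow> x \<subseteq> y \<or> y \<subseteq> x"
      using C(2) by (auto simp: subset.chain_def)
    have "fun_ideal R (\<Union>C)" unfolding fun_ideal_def
    proof (intro conjI ballI)
      show "\<Union>C \<subseteq> R" using CA by (auto simp: A_def fun_ideal_def)
      show "(\<lambda>x. 0) \<in> \<Union>C" using CA C(1) by (auto simp: A_def fun_ideal_def)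
    next
      fix f g assume "f \<in> \<Union>C" "g \<in> \<Union>C"
      then obtain x where "x \<in> C" "f \<in> x" "g \<in> x" using ch by blast
      moreover from this have "fun_ideal R x" using CA by (auto simp: A_def)
      ultimately show "(\<lambda>x. f x + g x) \<in> \<Union>C" using fun_ideal_add[of R x f g] by blast
    next
      fix r f assume "r \<in> R" "f \<in> \<Union>C"
      then obtain x where "x \<in> C" "f \<in> x" by blast
      moreover from this have "fun_ideal R x" using CA by (auto simp: A_def)
      ultimately show "(\<lambda>x. r x * f x) \<in> \<Union>C" using fun_ideal_mult[of R x r f] \<open>r \<in> R\<close> by blast
    qed
    then show ?thesis using CA C(1) by (auto simp: A_def)
  qed
  ultimately obtain p where pA: "p \<in> A" and max: "\<And>q. q \<in> A \<Longrightarrow> p \<subseteq> q \<Longrightarrow> q = p"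
    using subset_Zorn_nonempty[of A] by blast
  have p: "fun_ideal R p" and pS: "p \<inter> S = {}" and I0p: "I0 \<subseteq> p" using pA by (auto simp: A_def)
  \<comment> \<open>Maximality: adjoining any \<open>a\<close> outside \<open>p\<close> produces an
    ideal that meets \<open>S\<close>.\<close>
  have meets: "\<exists>f\<in>p. \<exists>r\<in>R. (\<lambda>x. f x + r x * a x) \<in> S" if a: "a \<in> R" "a \<notin> p" for a
  proof -
    let ?q = "{\<lambda>x. f x + r x * a x | f r. f \<in> p \<and> r \<in> R}"
    have "?q \<notin> A" using max[of ?q] fun_ideal_add_gen[OF R p a(1)] a(2) by blast
    then have "?q \<inter> S \<noteq> {}" using fun_ideal_add_gen(1,2)[OF R p a(1)] I0p unfolding A_def by blast
    then show ?thesis by blast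
  qed
  \<comment> \<open>If neither factor is in \<open>p\<close>, each yields an element of
    \<open>S\<close> modulo \<open>p\<close>. The product of these two is in \<open>S\<close>, and
    also in \<open>p\<close> because \<open>a * b\<close> is.\<close>
  have prime: "a \<in> p \<or> b \<in> p" if ab: "a \<in> R" "b \<in> R" "(\<lambda>x. a x * b x) \<in> p" for a b
  proof (rule ccontr)
    assume "\<not> ?thesis"
    then have "a \<notin> p" "b \<notin> p" by auto
    from meets[OF ab(1) this(1)] meets[OF ab(2) this(2)]
    obtain f r g t where *: "f \<in> p" "r \<in> R" "(\<lambda>x. f x + r x * a x) \<in> S"
      "g \<in> p" "t \<in> R" "(\<lambda>x. g x + t x * b x) \<in> S" by (elim bexE)
    have 1: "(\<lambda>x. (f x + r x * a x) * (g x + t x * b x)) \<in> S" using mult *(3,6) by blast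
    have "(\<lambda>x. g x + t x * b x) \<in> R" using *(6) S(2) by (auto simp: R_def)
    then have i1: "(\<lambda>x. (g x + t x * b x) * f x) \<in> p" by (rule fun_ideal_mult[OF p _ *(1)])
    have "(\<lambda>x. r x * a x) \<in> R" "(\<lambda>x. r x * t x) \<in> R" using R * ab by (auto simp: fun_ring_def)
    note i2 = fun_ideal_mult[OF p this(1) *(4)] and i3 = fun_ideal_mult[OF p this(2) ab(3)]
    from fun_ideal_add[OF p i1 fun_ideal_add[OF p i2 i3]]
    have "(\<lambda>x. (f x + r x * a x) * (g x + t x * b x)) \<in> p" by (simp add: algebra_simps)
    then show False using 1 pS by blast
  qed
  have one: "(\<lambda>x. c) \<notin> p" if "c \<noteq> 0" for c
  proof
    assume "(\<lambda>x. c) \<in> p"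
    then have "(\<lambda>x::nat \<Rightarrow> 'k. (1 / c) * c) \<in> p" by (rule fun_ideal_mult[OF p Rc[of "1 / c"]])
    then show False using that pS S(3) by auto
  qed
  have polyR: "(\<lambda>x. poly q (x i)) \<in> R" if "i < n" for q i
    using that unfolding R_def
    by (induction q) (simp_all add: poly_funs.const poly_funs.add poly_funs.mult poly_funs.coord)
  \<comment> \<open>Over an algebraically closed field a nonzero polynomial in one coordinate splits
    off linear factors, one of which lies in the prime \<open>p\<close>. Constants are excluded, as
    no nonzero constant is in \<open>p\<close>.\<close>
  have root: "\<exists>c. (\<lambda>x. x i - c) \<in> p" if i: "i < n" and "q \<noteq> 0" "(\<lambda>x. poly q (x i)) \<in> p" for i q
    using that(2,3)
  proof (induction "degree q" arbitrary: q)
    case 0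
    then obtain a where "q = [:a:]" by (metis degree_eq_zeroE)
    then show ?case using 0 one[of a] by auto
  next
    case (Suc d)
    then obtain c where "poly q c = 0" using alg_closed_imp_poly_has_root[of q] by auto
    then obtain q' where q': "q = [:- c, 1:] * q'" by (metis dvdE poly_eq_0_iff_dvd)
    have "q' \<noteq> 0" using q' Suc.prems by auto
    then have "degree q = Suc (degree q')" unfolding q' by (subst degree_mult_eq) auto
    then have d: "d = degree q'" using Suc.hyps(2) by simp
    have "(\<lambda>x. poly [:- c, 1:] (x i) * poly q' (x i)) \<in> p" using Suc.prems(2) unfolding q' poly_mult .
    then have "(\<lambda>x. poly [:- c, 1:] (x i)) \<in> p \<or> (\<lambda>x. poly q' (x i)) \<in> p"
      using prime polyR[OF i] by blast
    then show ?case using Suc.hyps(1)[OF d \<open>q' \<noteq> 0\<close>] by auto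
  qed
  have coord: "\<exists>c. (\<lambda>x. x i - c) \<in> p" if i: "i < n" for i
  proof (rule ccontr)
    assume no: "\<not> ?thesis"
    let ?F = "(\<lambda>i x. x i) ` {..<n} :: ((nat \<Rightarrow> 'k) \<Rightarrow> 'k) set"
    have xR: "(\<lambda>x. x i - c) \<in> R" for c using polyR[OF i, of "[:- c, 1:]"] by simp
    have "\<forall>c. \<exists>fr. fst fr \<in> p \<and> snd fr \<in> R \<and> (\<lambda>x. fst fr x + snd fr x * (x i - c)) \<in> S"
    proof
      fix c
      have "(\<lambda>x. x i - c) \<notin> p" using no by blast
      from meets[OF xR this] obtain f r where "f \<in> p" "r \<in> R" "(\<lambda>x. f x + r x * (x i - c)) \<in> S"
        by (elim bexE)
      then show "\<exists>fr. fst fr \<in> p \<and> snd fr \<in> R \<and> (\<lambda>x. fst fr x + snd fr x * (x i - c)) \<in> S"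
        by (intro exI[of _ "(f, r)"]) simp
    qed
    from choice[OF this] obtain fr where fr': "\<forall>c. fst (fr c) \<in> p \<and> snd (fr c) \<in> R \<and>
      (\<lambda>x. fst (fr c) x + snd (fr c) x * (x i - c)) \<in> S" ..
    define f r where "f c = fst (fr c)" and "r c = snd (fr c)" for c
    have fr: "f c \<in> p" "r c \<in> R" "(\<lambda>x. f c x + r c x * (x i - c)) \<in> S" for c
      using fr' by (simp_all add: f_def r_def)
    have "\<exists>k. r c \<in> deg_le ?F k" for c
      using fr(2)[of c] fun_alg_deg_le[of ?F "r c"] by (simp add: R_def poly_funs_eq_fun_alg)
    then obtain k where k: "\<And>c. r c \<in> deg_le ?F (k c)" by metis
    \<comment> \<open>Each scalar \<open>c\<close> is labelled by the element of \<open>S\<close> it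
      produces together with a degree bound for its quotient \<open>r c\<close>. There are countably
      many labels, hence infinitely many scalars with the same label.\<close>
    define \<phi> where "\<phi> c = ((\<lambda>x. f c x + r c x * (x i - c)), k c)" for c
    have "countable (\<phi> ` UNIV)"
    proof (rule countable_subset)
      show "\<phi> ` UNIV \<subseteq> S \<times> UNIV" using fr by (auto simp: \<phi>_def)
      show "countable (S \<times> (UNIV :: nat set))" using S by simp
    qed
    moreover have "(UNIV :: 'k set) = (\<Union>v\<in>\<phi> ` UNIV. {c. \<phi> c = v})" by auto
    ultimately obtain v where v: "infinite {c. \<phi> c = v}"
      using unc countable_UN[of "\<phi> ` UNIV" "\<lambda>v. {c. \<phi> c = v}"] countable_finite by metis
    obtain s m where sm: "v = (s, m)" by fastforce
    \<comment> \<open>One scalar more than the number of monomials of degree at most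
      \<open>m\<close>, which forces a linear relation among the \<open>r c\<close>.\<close>
    obtain A where A: "finite A" "card A = Suc ((m + 1) ^ card ?F)" "A \<subseteq> {c. \<phi> c = v}"
      using infinite_arbitrarily_large[OF v] by blast
    have Am: "r c \<in> deg_le ?F m" and As: "s = (\<lambda>x. f c x + r c x * (x i - c))" if "c \<in> A" for c
      using A(3) that k[of c] by (auto simp: \<phi>_def sm)
    obtain l where l: "\<exists>c\<in>A. l c \<noteq> 0" "\<forall>x. (\<Sum>c\<in>A. l c * r c x) = 0"
      using deg_le_dependent[of ?F A m r] A Am by auto
    \<comment> \<open>Modulo \<open>p\<close>, \<open>r c\<close> is \<open>s\<close> divided by
      \<open>x i - c\<close>. Clearing denominators in the relation between the \<open>r c\<close>
      leaves \<open>s\<close> times \<open>q\<close> at \<open>x i\<close>. Evaluation at a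
      \<open>c0\<close> with \<open>l c0 \<noteq> 0\<close> leaves a single term, so
      \<open>q\<close> is not zero.\<close>
    define q where "q = (\<Sum>c\<in>A. smult (l c) (\<Prod>c'\<in>A - {c}. [:- c', 1:]))"
    have polyq: "poly q t = (\<Sum>c\<in>A. l c * (\<Prod>c'\<in>A - {c}. t - c'))" for t
      by (simp add: q_def poly_sum poly_prod)
    have "q \<noteq> 0"
    proof -
      obtain c0 where c0: "c0 \<in> A" "l c0 \<noteq> 0" using l by blast
      have "(\<Prod>c'\<in>A - {c}. c0 - c') = 0" if "c \<in> A - {c0}" for c
        using A(1) c0 that by (intro prod_zero) auto
      then have "(\<Sum>c\<in>A - {c0}. l c * (\<Prod>c'\<in>A - {c}. c0 - c')) = 0" by (intro sum.neutral) simp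
      then have "poly q c0 = l c0 * (\<Prod>c'\<in>A - {c0}. c0 - c')"
        using c0 A(1) by (simp add: polyq sum.remove)
      then show ?thesis using c0 A(1) by auto
    qed
    have key: "s x * poly q (x i) = (\<Sum>c\<in>A. (l c * (\<Prod>c'\<in>A - {c}. x i - c')) * f c x)" for x
    proof -
      have "s x * poly q (x i) = (\<Sum>c\<in>A. (f c x + r c x * (x i - c)) * (l c * (\<Prod>c'\<in>A - {c}. x i - c')))"
        unfolding polyq sum_distrib_left by (rule sum.cong) (use As in \<open>auto dest: fun_cong\<close>)
      also have "\<dots> = (\<Sum>c\<in>A. (l c * (\<Prod>c'\<in>A - {c}. x i - c')) * f c x + (l c * r c x) * (\<Prod>c'\<in>A. x i - c'))"
        using A(1) by (intro sum.cong refl) (simp add: prod.remove algebra_simps)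
      also have "\<dots> = (\<Sum>c\<in>A. (l c * (\<Prod>c'\<in>A - {c}. x i - c')) * f c x) +
          (\<Sum>c\<in>A. l c * r c x) * (\<Prod>c'\<in>A. x i - c')"
        by (simp add: sum.distrib sum_distrib_right)
      finally show ?thesis using l(2) by simp
    qed
    have prodR: "(\<lambda>x. l c * (\<Prod>c'\<in>B. x i - c')) \<in> R" for c B
      using polyR[OF i, of "smult (l c) (\<Prod>c'\<in>B. [:- c', 1:])"] by (simp add: poly_prod)
    have "(\<lambda>x. \<Sum>c\<in>A. (l c * (\<Prod>c'\<in>A - {c}. x i - c')) * f c x) \<in> p"
      using prodR fr(1) p by (intro fun_ideal_sum[OF p]) (simp add: fun_ideal_def)
    then have "(\<lambda>x. s x * poly q (x i)) \<in> p" unfolding key .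
    moreover obtain c where "c \<in> A" using l by blast
    then have "s \<in> S" using fr(3) As by simp
    ultimately have "(\<lambda>x. poly q (x i)) \<in> p"
      using prime[of s] polyR[OF i] S(2) pS unfolding R_def by blast
    then show False using root[OF i \<open>q \<noteq> 0\<close>] no by blast
  qed
  then obtain c where c: "\<And>i. i < n \<Longrightarrow> (\<lambda>x. x i - c i) \<in> p" by metis
  \<comment> \<open>Modulo \<open>p\<close> each coordinate is the constant \<open>c i\<close>, so
    each polynomial is congruent to its value at \<open>z\<close>. Hence \<open>p\<close> vanishes
    at \<open>z\<close> and \<open>S\<close>, being disjoint from \<open>p\<close>, does
    not.\<close>
  define z where "z = restrict c {..<n}"
  have eval: "(\<lambda>x. f x - f z) \<in> p" if "f \<in> poly_funs n" for f
    using that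
  proof induction
    case (const a) then show ?case using p by (simp add: fun_ideal_def)
  next
    case (coord i) then show ?case using c by (simp add: z_def)
  next
    case (add f g)
    then have "(\<lambda>x. (f x - f z) + (g x - g z)) \<in> p" by (intro fun_ideal_add[OF p])
    then show ?case by (simp add: algebra_simps)
  next
    case (mult f g)
    have "f \<in> R" using mult by (simp add: R_def)
    from fun_ideal_add[OF p fun_ideal_mult[OF p this mult(4)] fun_ideal_mult[OF p Rc[of "g z"] mult(3)]]
    show ?case by (simp add: algebra_simps)
  qed
  have vanish: "f z = 0" if f: "f \<in> p" "f \<in> poly_funs n" for f
  proof (rule ccontr)
    assume "f z \<noteq> 0"
    have "(\<lambda>x. (- 1) * (f x - f z)) \<in> p"
      by (rule fun_ideal_mult[OF p Rc eval[OF f(2)]])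
    then have "(\<lambda>x. f x + (- 1) * (f x - f z)) \<in> p" by (rule fun_ideal_add[OF p f(1)])
    then have "(\<lambda>x. f z) \<in> p" by simp
    then show False using one \<open>f z \<noteq> 0\<close> by blast
  qed
  have "z \<in> zero_locus n P"
    unfolding zero_locus_def
  proof (intro CollectI conjI ballI)
    show "z \<in> {..<n} \<rightarrow>\<^sub>E UNIV" by (simp add: z_def)
    fix f assume "f \<in> P"
    then have "f \<in> I0" "f \<in> poly_funs n" using P by (auto simp: I0_def R_def zero_locus_def)
    then show "f z = 0" using vanish I0p by blast
  qed
  moreover have "s z \<noteq> 0" if s: "s \<in> S" for s
  proof
    assume "s z = 0"
    then have "s \<in> p" using eval[of s] S(2) s by auto
    then show False using pS s by blast
  qed
  ultimately show ?thesis by blast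
qed

section \<open>Spaces with functions and their powers\<close>

locale fun_space =
  fixes X :: "('a, 'k::field) fspace"
  assumes swf: "space_with_functions X"
begin

abbreviation zar :: "'a topology" where "zar \<equiv> zariski X"
abbreviation opn :: "'a set \<Rightarrow> bool" where "opn \<equiv> openin zar"
abbreviation pts :: "'a set" where "pts \<equiv> topspace zar"
abbreviation reg :: "'a set \<Rightarrow> ('a \<Rightarrow> 'k) set" where "reg \<equiv> regular X"
abbreviation ptop :: "'i set \<Rightarrow> ('i \<Rightarrow> 'a) topology" where "ptop M \<equiv> power_topology M X"
abbreviation preg :: "'i set \<Rightarrow> ('i \<Rightarrow> 'a) set \<Rightarrow> (('i \<Rightarrow> 'a) \<Rightarrow> 'k) set" where
  "preg M \<equiv> regular (power_fspace M X)"

lemmas swf_clauses = swf[unfolded space_with_functions_def]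

lemma reg_cong: "opn U \<Longrightarrow> f \<in> reg U \<Longrightarrow> (\<And>x. x \<in> U \<Longrightarrow> g x = f x) \<Longrightarrow> g \<in> reg U"
  by (rule swf_clauses[THEN conjunct1, rule_format])

lemma reg_restrict: "opn U \<Longrightarrow> opn V \<Longrightarrow> V \<subseteq> U \<Longrightarrow> f \<in> reg U \<Longrightarrow> f \<in> reg V"
  by (rule swf_clauses[THEN conjunct2, THEN conjunct1, rule_format])

lemma reg_glue: "(\<And>U. U \<in> \<U> \<Longrightarrow> opn U \<and> f \<in> reg U) \<Longrightarrow> f \<in> reg (\<Union>\<U>)"
  by (rule swf_clauses[THEN conjunct2, THEN conjunct2, THEN conjunct1, rule_format])

lemma reg_const: "opn U \<Longrightarrow> (\<lambda>x. c) \<in> reg U"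
  by (rule swf_clauses[THEN conjunct2, THEN conjunct2, THEN conjunct2, THEN conjunct1, rule_format])

lemma reg_add: "opn U \<Longrightarrow> f \<in> reg U \<Longrightarrow> g \<in> reg U \<Longrightarrow> (\<lambda>x. f x + g x) \<in> reg U"
  by (rule swf_clauses[THEN conjunct2, THEN conjunct2, THEN conjunct2, THEN conjunct2, THEN conjunct1, rule_format, THEN conjunct1])

lemma reg_mult: "opn U \<Longrightarrow> f \<in> reg U \<Longrightarrow> g \<in> reg U \<Longrightarrow> (\<lambda>x. f x * g x) \<in> reg U"
  by (rule swf_clauses[THEN conjunct2, THEN conjunct2, THEN conjunct2, THEN conjunct2, THEN conjunct1, rule_format, THEN conjunct2])

lemma opn_nonzero: "opn U \<Longrightarrow> f \<in> reg U \<Longrightarrow> opn {x \<in> U. f x \<noteq> 0}"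
  by (rule swf_clauses[THEN conjunct2, THEN conjunct2, THEN conjunct2, THEN conjunct2, THEN conjunct2, rule_format, THEN conjunct1])

lemma reg_inverse: "opn U \<Longrightarrow> f \<in> reg U \<Longrightarrow> (\<lambda>x. inverse (f x)) \<in> reg {x \<in> U. f x \<noteq> 0}"
  by (rule swf_clauses[THEN conjunct2, THEN conjunct2, THEN conjunct2, THEN conjunct2, THEN conjunct2, rule_format, THEN conjunct2])

lemma reg_sum: "opn U \<Longrightarrow> (\<And>i. i \<in> I \<Longrightarrow> f i \<in> reg U) \<Longrightarrow> (\<lambda>x. \<Sum>i\<in>I. f i x) \<in> reg U"
  by (induction I rule: infinite_finite_induct) (auto intro: reg_const reg_add)

lemma reg_prod: "opn U \<Longrightarrow> (\<And>i. i \<in> I \<Longrightarrow> f i \<in> reg U) \<Longrightarrow> (\<lambda>x. \<Prod>i\<in>I. f i x) \<in> reg U"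
  by (induction I rule: infinite_finite_induct) (auto intro: reg_const reg_mult)

lemma reg_power: "opn U \<Longrightarrow> f \<in> reg U \<Longrightarrow> (\<lambda>x. f x ^ n) \<in> reg U"
  by (induction n) (auto intro: reg_const reg_mult)

lemma reg_divide:
  assumes "opn U" "f \<in> reg U" "g \<in> reg U" "\<And>x. x \<in> U \<Longrightarrow> g x \<noteq> 0"
  shows "(\<lambda>x. f x / g x) \<in> reg U"
proof -
  have "{x \<in> U. g x \<noteq> 0} = U" using assms(4) by auto
  then have "(\<lambda>x. inverse (g x)) \<in> reg U" using reg_inverse[OF assms(1,3)] by simp
  then show ?thesis unfolding divide_inverse by (rule reg_mult[OF assms(1,2)])
qed

lemma reg_local:
  assumes "opn U" "\<And>x. x \<in> U \<Longrightarrow> \<exists>W. opn W \<and> x \<in> W \<and> W \<subseteq> U \<and> f \<in> reg W"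
  shows "f \<in> reg U"
proof -
  define \<U> where "\<U> = {W. opn W \<and> W \<subseteq> U \<and> f \<in> reg W}"
  have "\<Union>\<U> = U" using assms(2) unfolding \<U>_def by blast
  moreover have "f \<in> reg (\<Union>\<U>)" by (rule reg_glue) (simp add: \<U>_def)
  ultimately show ?thesis by simp
qed

text \<open>Frees the index set of the terms: sums and products of tensors are naturally indexed by
  disjoint unions and products.\<close>

lemma tensor_funsI:
  fixes f :: "'j \<Rightarrow> 'i \<Rightarrow> 'a \<Rightarrow> 'k"
  assumes "finite I" "\<And>i m. i \<in> I \<Longrightarrow> m \<in> M \<Longrightarrow> f i m \<in> reg (U m)"
    and "h = (\<lambda>x. \<Sum>i\<in>I. \<Prod>m\<in>M. f i m (x m))"
  shows "h \<in> tensor_funs M X U"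
proof -
  obtain b where b: "bij_betw b {..<card I} I"
    using ex_bij_betw_nat_finite[OF assms(1)] by (auto simp: lessThan_atLeast0)
  have "h = (\<lambda>x. \<Sum>j<card I. \<Prod>m\<in>M. f (b j) m (x m))"
    unfolding assms(3) by (intro ext sum.reindex_bij_betw[OF b, symmetric])
  moreover have "\<forall>j<card I. \<forall>m\<in>M. f (b j) m \<in> reg (U m)"
    using assms(2) bij_betwE[OF b] by auto
  ultimately show ?thesis unfolding tensor_funs_def by (intro CollectI exI[of _ "card I"] exI[of _ "\<lambda>j. f (b j)"]) simp
qed

lemma tensor_funsD:
  "h \<in> tensor_funs M X U \<Longrightarrow>
    \<exists>N f. h = (\<lambda>x. \<Sum>j<N::nat. \<Prod>m\<in>M. f j m (x m)) \<and> (\<forall>j m. j < N \<longrightarrow> m \<in> M \<longrightarrow> f j m \<in> reg (U m))"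
  unfolding tensor_funs_def by blast

lemma tensor_one: "\<forall>m\<in>M. opn (U m) \<Longrightarrow> (\<lambda>x. 1) \<in> tensor_funs M X U"
  by (rule tensor_funsI[of "{()}" _ "\<lambda>_ _ _. 1"]) (auto intro: reg_const)

lemma tensor_coord:
  assumes "finite M" "m \<in> M" "\<forall>m\<in>M. opn (U m)" "f \<in> reg (U m)"
  shows "(\<lambda>x. f (x m)) \<in> tensor_funs M X U"
proof (rule tensor_funsI[of "{()}" _ "\<lambda>_ m' a. if m' = m then f a else 1"])
  show "(\<lambda>a. if m' = m then f a else 1) \<in> reg (U m')" if "m' \<in> M" for m'
    using assms that by (cases "m' = m") (auto intro: reg_const)
qed (use assms in auto)

lemma tensor_add:
  assumes "g \<in> tensor_funs M X U" "h \<in> tensor_funs M X U"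
  shows "(\<lambda>x. g x + h x) \<in> tensor_funs M X U"
proof -
  obtain N a where g: "g = (\<lambda>x. \<Sum>j<N::nat. \<Prod>m\<in>M. a j m (x m))"
    "\<forall>j m. j < N \<longrightarrow> m \<in> M \<longrightarrow> a j m \<in> reg (U m)" using tensor_funsD[OF assms(1)] by (elim exE conjE)
  obtain K b where h: "h = (\<lambda>x. \<Sum>j<K::nat. \<Prod>m\<in>M. b j m (x m))"
    "\<forall>j m. j < K \<longrightarrow> m \<in> M \<longrightarrow> b j m \<in> reg (U m)" using tensor_funsD[OF assms(2)] by (elim exE conjE)
  show ?thesis
    by (rule tensor_funsI[of "{..<N} <+> {..<K}" _ "case_sum a b"])
      (use g h in \<open>auto simp: sum.Plus\<close>)
qed

lemma tensor_mult:
  assumes "\<forall>m\<in>M. opn (U m)" "g \<in> tensor_funs M X U" "h \<in> tensor_funs M X U"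
  shows "(\<lambda>x. g x * h x) \<in> tensor_funs M X U"
proof -
  obtain N a where g: "g = (\<lambda>x. \<Sum>j<N::nat. \<Prod>m\<in>M. a j m (x m))"
    "\<forall>j m. j < N \<longrightarrow> m \<in> M \<longrightarrow> a j m \<in> reg (U m)" using tensor_funsD[OF assms(2)] by (elim exE conjE)
  obtain K b where h: "h = (\<lambda>x. \<Sum>j<K::nat. \<Prod>m\<in>M. b j m (x m))"
    "\<forall>j m. j < K \<longrightarrow> m \<in> M \<longrightarrow> b j m \<in> reg (U m)" using tensor_funsD[OF assms(3)] by (elim exE conjE)
  show ?thesis
  proof (rule tensor_funsI[of "{..<N} \<times> {..<K}" _ "\<lambda>(i, j) m x. a i m x * b j m x"])
    show "(\<lambda>x. g x * h x) = (\<lambda>x. \<Sum>i\<in>{..<N} \<times> {..<K}. \<Prod>m\<in>M. (case i of (i, j) \<Rightarrow> \<lambda>m x. a i m x * b j m x) m (x m))"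
      unfolding g h by (simp add: sum_product sum.cartesian_product prod.distrib case_prod_unfold)
  qed (use g h assms in \<open>auto intro: reg_mult\<close>)
qed

lemma tensor_mono:
  assumes "h \<in> tensor_funs M X U" "\<forall>m\<in>M. opn (U m) \<and> opn (V m) \<and> V m \<subseteq> U m"
  shows "h \<in> tensor_funs M X V"
proof -
  obtain N a where h: "h = (\<lambda>x. \<Sum>j<N::nat. \<Prod>m\<in>M. a j m (x m))"
    "\<forall>j m. j < N \<longrightarrow> m \<in> M \<longrightarrow> a j m \<in> reg (U m)" using tensor_funsD[OF assms(1)] by (elim exE conjE)
  show ?thesis
  proof (rule tensor_funsI[of "{..<N}" _ a])
    show "a j m \<in> reg (V m)" if "j \<in> {..<N}" "m \<in> M" for j m
      by (rule reg_restrict[of "U m"]) (use that h assms(2) in auto)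
  qed (use h in auto)
qed

text \<open>The generating sets form a base and not only a subbase: to intersect two of them,
  intersect the boxes, restrict both tensors and multiply.\<close>

lemma openin_power_iff:
  "openin (ptop M) O' \<longleftrightarrow> (\<forall>x\<in>O'. \<exists>U h. (\<forall>m\<in>M. opn (U m)) \<and> h \<in> tensor_funs M X U \<and>
     x \<in> (\<Pi>\<^sub>E m\<in>M. U m) \<and> h x \<noteq> 0 \<and> {x \<in> (\<Pi>\<^sub>E m\<in>M. U m). h x \<noteq> 0} \<subseteq> O')" (is "?L \<longleftrightarrow> (\<forall>x\<in>O'. ?P x O')")
proof
  let ?B = "{{x \<in> (\<Pi>\<^sub>E m\<in>M. U m). h x \<noteq> 0} | U h. (\<forall>m\<in>M. opn (U m)) \<and> h \<in> tensor_funs M X U}"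
  have gen: "openin (ptop M) V = generate_topology_on ?B V" for V
    unfolding power_topology_def by (rule openin_topology_generated_by_iff)
  {
    assume ?L
    then have "generate_topology_on ?B O'" by (simp add: gen)
    then show "\<forall>x\<in>O'. ?P x O'"
    proof induction
      case Empty show ?case by simp
    next
      case (Int a b)
      show ?case
      proof
        fix x assume x: "x \<in> a \<inter> b"
        obtain U g where U: "\<forall>m\<in>M. opn (U m)" "g \<in> tensor_funs M X U" "x \<in> (\<Pi>\<^sub>E m\<in>M. U m)" "g x \<noteq> 0"
          "{x \<in> (\<Pi>\<^sub>E m\<in>M. U m). g x \<noteq> 0} \<subseteq> a" using bspec[OF Int.IH(1), of x] x by auto
        obtain V h where V: "\<forall>m\<in>M. opn (V m)" "h \<in> tensor_funs M X V" "x \<in> (\<Pi>\<^sub>E m\<in>M. V m)" "h x \<noteq> 0"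
          "{x \<in> (\<Pi>\<^sub>E m\<in>M. V m). h x \<noteq> 0} \<subseteq> b" using bspec[OF Int.IH(2), of x] x by auto
        let ?W = "\<lambda>m. U m \<inter> V m"
        have W: "\<forall>m\<in>M. opn (?W m)" using U V by auto
        have "g \<in> tensor_funs M X ?W" by (rule tensor_mono[OF U(2)]) (use U(1) W in auto)
        moreover have "h \<in> tensor_funs M X ?W" by (rule tensor_mono[OF V(2)]) (use V(1) W in auto)
        ultimately have "(\<lambda>x. g x * h x) \<in> tensor_funs M X ?W" by (rule tensor_mult[OF W])
        moreover have "x \<in> (\<Pi>\<^sub>E m\<in>M. ?W m)" using U V by auto
        moreover have "{x \<in> (\<Pi>\<^sub>E m\<in>M. ?W m). g x * h x \<noteq> 0} \<subseteq> a \<inter> b"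
        proof
          fix y assume "y \<in> {x \<in> (\<Pi>\<^sub>E m\<in>M. ?W m). g x * h x \<noteq> 0}"
          then have "y \<in> {x \<in> (\<Pi>\<^sub>E m\<in>M. U m). g x \<noteq> 0}" "y \<in> {x \<in> (\<Pi>\<^sub>E m\<in>M. V m). h x \<noteq> 0}" by auto
          then show "y \<in> a \<inter> b" using U(5) V(5) by blast
        qed
        ultimately show "?P x (a \<inter> b)" using W U(4) V(4)
          by (intro exI[of _ ?W] exI[of _ "\<lambda>x. g x * h x"]) simp
      qed
    next
      case (UN K)
      show ?case
      proof
        fix x assume "x \<in> \<Union>K"
        then obtain k where k: "k \<in> K" "x \<in> k" by blast
        from bspec[OF UN.IH[OF k(1)] k(2)] k(1) show "?P x (\<Union>K)"
          by (elim exE conjE, intro exI conjI) (assumption | blast)+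
      qed
    next
      case (Basis s)
      then obtain U h where s: "s = {x \<in> (\<Pi>\<^sub>E m\<in>M. U m). h x \<noteq> 0}" "\<forall>m\<in>M. opn (U m)"
        "h \<in> tensor_funs M X U" by blast
      show ?case unfolding s(1)
        by (intro ballI exI[of _ U] exI[of _ h]) (use s(2,3) in simp)
    qed
  }
  {
    assume *: "\<forall>x\<in>O'. ?P x O'"
    define \<K> where "\<K> = {V \<in> ?B. V \<subseteq> O'}"
    have "\<Union>\<K> = O'"
    proof (intro equalityI subsetI)
      fix x assume "x \<in> O'"
      from bspec[OF * this] obtain U h where "\<forall>m\<in>M. opn (U m)" "h \<in> tensor_funs M X U"
        "x \<in> (\<Pi>\<^sub>E m\<in>M. U m)" "h x \<noteq> 0" "{x \<in> (\<Pi>\<^sub>E m\<in>M. U m). h x \<noteq> 0} \<subseteq> O'"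
        by (elim exE conjE)
      then have "{x \<in> (\<Pi>\<^sub>E m\<in>M. U m). h x \<noteq> 0} \<in> \<K>" "x \<in> {x \<in> (\<Pi>\<^sub>E m\<in>M. U m). h x \<noteq> 0}"
        unfolding \<K>_def by blast+
      then show "x \<in> \<Union>\<K>" by blast
    qed (auto simp: \<K>_def)
    moreover have "generate_topology_on ?B (\<Union>\<K>)"
      by (rule generate_topology_on.UN) (auto simp: \<K>_def intro: generate_topology_on.Basis)
    ultimately show ?L by (simp add: gen)
  }
qed

lemma openin_power_basic:
  "\<forall>m\<in>M. opn (U m) \<Longrightarrow> h \<in> tensor_funs M X U \<Longrightarrow> openin (ptop M) {x \<in> (\<Pi>\<^sub>E m\<in>M. U m). h x \<noteq> 0}"
  unfolding openin_power_iff by (intro ballI exI[of _ U] exI[of _ h]) simp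

lemma openin_power_box: "\<forall>m\<in>M. opn (U m) \<Longrightarrow> openin (ptop M) (\<Pi>\<^sub>E m\<in>M. U m)"
  using openin_power_basic[of M U "\<lambda>_. 1"] tensor_one[of M U] by simp

lemma topspace_power: "topspace (ptop M) = (\<Pi>\<^sub>E m\<in>M. pts)"
proof (rule equalityI)
  show "topspace (ptop M) \<subseteq> (\<Pi>\<^sub>E m\<in>M. pts)"
  proof
    fix x assume x: "x \<in> topspace (ptop M)"
    from bspec[OF openin_topspace[of "ptop M", unfolded openin_power_iff] x]
    obtain U where "\<forall>m\<in>M. opn (U m)" "x \<in> (\<Pi>\<^sub>E m\<in>M. U m)" by blast
    then show "x \<in> (\<Pi>\<^sub>E m\<in>M. pts)" using openin_subset[of "zar"] PiE_mono[of M U "\<lambda>_. pts"] by blast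
  qed
  show "(\<Pi>\<^sub>E m\<in>M. pts) \<subseteq> topspace (ptop M)"
    by (intro openin_subset openin_power_box) simp
qed

abbreviation power_quot :: "'i set \<Rightarrow> ('i \<Rightarrow> 'a) set \<Rightarrow> (('i \<Rightarrow> 'a) \<Rightarrow> 'k) \<Rightarrow> ('i \<Rightarrow> 'a) \<Rightarrow> bool" where
  "power_quot M V f x \<equiv> \<exists>W U p q. openin (ptop M) W \<and> x \<in> W \<and> W \<subseteq> V \<and>
     (\<forall>m\<in>M. opn (U m)) \<and> W \<subseteq> (\<Pi>\<^sub>E m\<in>M. U m) \<and> p \<in> tensor_funs M X U \<and> q \<in> tensor_funs M X U \<and>
     (\<forall>y\<in>W. q y \<noteq> 0 \<and> f y = p y / q y)"

lemma reg_powerI: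
  assumes "\<And>x. x \<in> V \<Longrightarrow> power_quot M V f x"
  shows "f \<in> preg M V"
proof -
  have "\<forall>x\<in>V. \<exists>W U. openin (ptop M) W \<and> x \<in> W \<and> W \<subseteq> V \<and>
     (\<forall>m\<in>M. opn (U m)) \<and> W \<subseteq> (\<Pi>\<^sub>E m\<in>M. U m) \<and>
     (\<exists>p\<in>tensor_funs M X U. \<exists>q\<in>tensor_funs M X U. \<forall>y\<in>W. q y \<noteq> 0 \<and> f y = p y / q y)"
  proof
    fix x assume "x \<in> V"
    from assms[OF this] show "\<exists>W U. openin (ptop M) W \<and> x \<in> W \<and> W \<subseteq> V \<and>
     (\<forall>m\<in>M. opn (U m)) \<and> W \<subseteq> (\<Pi>\<^sub>E m\<in>M. U m) \<and>
     (\<exists>p\<in>tensor_funs M X U. \<exists>q\<in>tensor_funs M X U. \<forall>y\<in>W. q y \<noteq> 0 \<and> f y = p y / q y)"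
      by (elim exE conjE) (intro exI conjI bexI; assumption)
  qed
  then show ?thesis unfolding power_fspace_def by simp
qed

lemma reg_powerD:
  assumes "f \<in> preg M V" "x \<in> V"
  shows "power_quot M V f x"
proof -
  from assms have "\<exists>W U. openin (ptop M) W \<and> x \<in> W \<and> W \<subseteq> V \<and>
     (\<forall>m\<in>M. opn (U m)) \<and> W \<subseteq> (\<Pi>\<^sub>E m\<in>M. U m) \<and>
     (\<exists>p\<in>tensor_funs M X U. \<exists>q\<in>tensor_funs M X U. \<forall>y\<in>W. q y \<noteq> 0 \<and> f y = p y / q y)"
    unfolding power_fspace_def by simp
  then show ?thesis by (elim exE conjE bexE) (intro exI conjI; assumption)
qed

lemma zariski_power [simp]: "zariski (power_fspace M X) = ptop M"
  by (simp add: power_fspace_def)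

text \<open>\<open>M\<close> is nonempty because an empty product is 1: for \<open>M = {}\<close>
  the tensor functions are just the images of the natural numbers, and their quotients do not give
  every constant.\<close>

lemma swf_power:
  assumes M: "finite M" "M \<noteq> {}"
  shows "space_with_functions (power_fspace M X)"
  unfolding space_with_functions_def zariski_power
proof (intro conjI allI impI)
  fix U f g assume f: "openin (ptop M) U" "f \<in> preg M U" "\<forall>x\<in>U. g x = f x"
  show "g \<in> preg M U"
  proof (rule reg_powerI)
    fix x assume "x \<in> U"
    from reg_powerD[OF f(2) this] obtain W Ub p q where "openin (ptop M) W" "x \<in> W" "W \<subseteq> U"
      "\<forall>m\<in>M. opn (Ub m)" "W \<subseteq> (\<Pi>\<^sub>E m\<in>M. Ub m)" "p \<in> tensor_funs M X Ub" "q \<in> tensor_funs M X Ub"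
      "\<forall>y\<in>W. q y \<noteq> 0 \<and> f y = p y / q y" by (elim exE conjE)
    then show "power_quot M U g x"
      using f(3) by (intro exI[of _ W] exI[of _ Ub] exI[of _ p] exI[of _ q]) auto
  qed
next
  fix U V f assume f: "openin (ptop M) U" "openin (ptop M) V" "V \<subseteq> U"
    "f \<in> preg M U"
  show "f \<in> preg M V"
  proof (rule reg_powerI)
    fix x assume x: "x \<in> V"
    then have "x \<in> U" using f(3) by blast
    from reg_powerD[OF f(4) this] obtain W Ub p q where "openin (ptop M) W" "x \<in> W" "W \<subseteq> U"
      "\<forall>m\<in>M. opn (Ub m)" "W \<subseteq> (\<Pi>\<^sub>E m\<in>M. Ub m)" "p \<in> tensor_funs M X Ub" "q \<in> tensor_funs M X Ub"
      "\<forall>y\<in>W. q y \<noteq> 0 \<and> f y = p y / q y" by (elim exE conjE)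
    then show "power_quot M V f x"
      using f(2) x by (intro exI[of _ "W \<inter> V"] exI[of _ Ub] exI[of _ p] exI[of _ q]) auto
  qed
next
  fix \<U> f assume f: "\<forall>U\<in>\<U>. openin (ptop M) U \<and> f \<in> preg M U"
  show "f \<in> preg M (\<Union>\<U>)"
  proof (rule reg_powerI)
    fix x assume "x \<in> \<Union>\<U>"
    then obtain U where U: "U \<in> \<U>" "x \<in> U" by blast
    then have "f \<in> preg M U" using f by blast
    from reg_powerD[OF this U(2)] obtain W Ub p q where "openin (ptop M) W" "x \<in> W" "W \<subseteq> U"
      "\<forall>m\<in>M. opn (Ub m)" "W \<subseteq> (\<Pi>\<^sub>E m\<in>M. Ub m)" "p \<in> tensor_funs M X Ub" "q \<in> tensor_funs M X Ub"
      "\<forall>y\<in>W. q y \<noteq> 0 \<and> f y = p y / q y" by (elim exE conjE)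
    then show "power_quot M (\<Union>\<U>) f x"
      using U by (intro exI[of _ W] exI[of _ Ub] exI[of _ p] exI[of _ q]) auto
  qed
next
  fix U and c :: 'k assume U: "openin (ptop M) U"
  obtain m where m: "m \<in> M" using M by blast
  show "(\<lambda>x. c) \<in> preg M U"
  proof (rule reg_powerI)
    fix x assume x: "x \<in> U"
    have "(\<lambda>x. c) \<in> tensor_funs M X (\<lambda>_. pts)"
      using tensor_coord[OF M(1) m, of "\<lambda>_. pts" "\<lambda>_. c"] by (simp add: reg_const)
    then show "power_quot M U (\<lambda>y. c) x"
      using U x openin_subset[OF U] tensor_one[of M "\<lambda>_. pts"]
      by (intro exI[of _ U] exI[of _ "\<lambda>_. pts"] exI[of _ "\<lambda>_. c"] exI[of _ "\<lambda>_. 1"]) (auto simp: topspace_power)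
  qed
next
  fix V f g assume V: "openin (ptop M) V" and f: "f \<in> preg M V"
    and g: "g \<in> preg M V"
  have both: "\<exists>W U p1 p2 q1 q2. openin (ptop M) W \<and> x \<in> W \<and> W \<subseteq> V \<and>
      (\<forall>m\<in>M. opn (U m)) \<and> W \<subseteq> (\<Pi>\<^sub>E m\<in>M. U m) \<and> p1 \<in> tensor_funs M X U \<and> q1 \<in> tensor_funs M X U \<and>
      p2 \<in> tensor_funs M X U \<and> q2 \<in> tensor_funs M X U \<and>
      (\<forall>y\<in>W. q1 y \<noteq> 0 \<and> q2 y \<noteq> 0 \<and> f y = p1 y / q1 y \<and> g y = p2 y / q2 y)" if x: "x \<in> V" for x
  proof -
    from reg_powerD[OF f x] obtain W U p q where 1: "openin (ptop M) W" "x \<in> W" "W \<subseteq> V"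
      "\<forall>m\<in>M. opn (U m)" "W \<subseteq> (\<Pi>\<^sub>E m\<in>M. U m)" "p \<in> tensor_funs M X U" "q \<in> tensor_funs M X U"
      "\<forall>y\<in>W. q y \<noteq> 0 \<and> f y = p y / q y" by (elim exE conjE)
    from reg_powerD[OF g x] obtain W' U' p' q' where 2: "openin (ptop M) W'" "x \<in> W'" "W' \<subseteq> V"
      "\<forall>m\<in>M. opn (U' m)" "W' \<subseteq> (\<Pi>\<^sub>E m\<in>M. U' m)" "p' \<in> tensor_funs M X U'" "q' \<in> tensor_funs M X U'"
      "\<forall>y\<in>W'. q' y \<noteq> 0 \<and> g y = p' y / q' y" by (elim exE conjE)
    let ?U = "\<lambda>m. U m \<inter> U' m"
    have s: "\<forall>m\<in>M. opn (U m) \<and> opn (?U m) \<and> ?U m \<subseteq> U m" "\<forall>m\<in>M. opn (U' m) \<and> opn (?U m) \<and> ?U m \<subseteq> U' m"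
      using 1(4) 2(4) by auto
    have "W \<inter> W' \<subseteq> (\<Pi>\<^sub>E m\<in>M. ?U m)"
      using 1(5) 2(5) by (auto simp: PiE_def Pi_def)
    moreover have "openin (ptop M) (W \<inter> W')" "x \<in> W \<inter> W'" "W \<inter> W' \<subseteq> V" "\<forall>m\<in>M. opn (?U m)"
      using 1 2 s by auto
    moreover note tensor_mono[OF 1(6) s(1)] tensor_mono[OF 1(7) s(1)] tensor_mono[OF 2(6) s(2)] tensor_mono[OF 2(7) s(2)]
    moreover have "\<forall>y\<in>W \<inter> W'. q y \<noteq> 0 \<and> q' y \<noteq> 0 \<and> f y = p y / q y \<and> g y = p' y / q' y"
      using 1(8) 2(8) by simp
    ultimately show ?thesis
      by (intro exI[of _ "W \<inter> W'"] exI[of _ ?U] exI[of _ p] exI[of _ p'] exI[of _ q] exI[of _ q'] conjI)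
  qed
  show "(\<lambda>x. f x + g x) \<in> preg M V"
  proof (rule reg_powerI)
    fix x assume "x \<in> V"
    from both[OF this] obtain W U p1 p2 q1 q2 where *: "openin (ptop M) W" "x \<in> W" "W \<subseteq> V"
      "\<forall>m\<in>M. opn (U m)" "W \<subseteq> (\<Pi>\<^sub>E m\<in>M. U m)" "p1 \<in> tensor_funs M X U" "q1 \<in> tensor_funs M X U"
      "p2 \<in> tensor_funs M X U" "q2 \<in> tensor_funs M X U"
      "\<forall>y\<in>W. q1 y \<noteq> 0 \<and> q2 y \<noteq> 0 \<and> f y = p1 y / q1 y \<and> g y = p2 y / q2 y" by (elim exE conjE)
    show "power_quot M V (\<lambda>y. f y + g y) x"
      by (intro exI[of _ W] exI[of _ U] exI[of _ "\<lambda>y. p1 y * q2 y + p2 y * q1 y"] exI[of _ "\<lambda>y. q1 y * q2 y"]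
         conjI * tensor_add tensor_mult) (use *(10) in \<open>auto simp: add_frac_eq\<close>)
  qed
  show "(\<lambda>x. f x * g x) \<in> preg M V"
  proof (rule reg_powerI)
    fix x assume "x \<in> V"
    from both[OF this] obtain W U p1 p2 q1 q2 where *: "openin (ptop M) W" "x \<in> W" "W \<subseteq> V"
      "\<forall>m\<in>M. opn (U m)" "W \<subseteq> (\<Pi>\<^sub>E m\<in>M. U m)" "p1 \<in> tensor_funs M X U" "q1 \<in> tensor_funs M X U"
      "p2 \<in> tensor_funs M X U" "q2 \<in> tensor_funs M X U"
      "\<forall>y\<in>W. q1 y \<noteq> 0 \<and> q2 y \<noteq> 0 \<and> f y = p1 y / q1 y \<and> g y = p2 y / q2 y" by (elim exE conjE)
    show "power_quot M V (\<lambda>y. f y * g y) x"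
      by (intro exI[of _ W] exI[of _ U] exI[of _ "\<lambda>y. p1 y * p2 y"] exI[of _ "\<lambda>y. q1 y * q2 y"]
         conjI * tensor_mult) (use *(10) in auto)
  qed
next
  fix V f assume V: "openin (ptop M) V" and f: "f \<in> preg M V"
  have loc: "power_quot M {x \<in> V. f x \<noteq> 0} (\<lambda>y. inverse (f y)) x" if x: "x \<in> V" "f x \<noteq> 0" for x
  proof -
    from reg_powerD[OF f x(1)] obtain W U p q where *: "openin (ptop M) W" "x \<in> W" "W \<subseteq> V"
      "\<forall>m\<in>M. opn (U m)" "W \<subseteq> (\<Pi>\<^sub>E m\<in>M. U m)" "p \<in> tensor_funs M X U" "q \<in> tensor_funs M X U"
      "\<forall>y\<in>W. q y \<noteq> 0 \<and> f y = p y / q y" by (elim exE conjE)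
    have "openin (ptop M) (W \<inter> {x \<in> (\<Pi>\<^sub>E m\<in>M. U m). p x \<noteq> 0})"
      by (intro openin_Int *(1) openin_power_basic *)
    then show ?thesis using * x
      by (intro exI[of _ "W \<inter> {x \<in> (\<Pi>\<^sub>E m\<in>M. U m). p x \<noteq> 0}"] exI[of _ U] exI[of _ q] exI[of _ p]) auto
  qed
  show "openin (ptop M) {x \<in> V. f x \<noteq> 0}"
  proof (subst openin_subopen, rule ballI)
    fix x assume "x \<in> {x \<in> V. f x \<noteq> 0}"
    then have "x \<in> V" "f x \<noteq> 0" by auto
    from loc[OF this] show "\<exists>T. openin (ptop M) T \<and> x \<in> T \<and> T \<subseteq> {x \<in> V. f x \<noteq> 0}"
      by (elim exE conjE) (intro exI conjI; assumption)
  qed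
  show "(\<lambda>x. inverse (f x)) \<in> preg M {x \<in> V. f x \<noteq> 0}"
  proof (rule reg_powerI)
    fix x assume "x \<in> {x \<in> V. f x \<noteq> 0}"
    then have "x \<in> V" "f x \<noteq> 0" by auto
    then show "power_quot M {x \<in> V. f x \<noteq> 0} (\<lambda>y. inverse (f y)) x" by (rule loc)
  qed
qed

lemma reg_power_coord:
  assumes "finite M" "m \<in> M" "opn U" "f \<in> reg U"
  shows "openin (ptop M) {x \<in> (\<Pi>\<^sub>E m\<in>M. pts). x m \<in> U}"
    and "(\<lambda>x. f (x m)) \<in> preg M {x \<in> (\<Pi>\<^sub>E m\<in>M. pts). x m \<in> U}"
proof -
  let ?U = "\<lambda>m'. if m' = m then U else pts"
  have U: "\<forall>m\<in>M. opn (?U m)" using assms by auto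
  have eq: "{x \<in> (\<Pi>\<^sub>E m\<in>M. pts). x m \<in> U} = (\<Pi>\<^sub>E m\<in>M. ?U m)"
    using assms(2) openin_subset[OF assms(3)] by (auto simp: PiE_def Pi_def split: if_splits)
  show 1: "openin (ptop M) {x \<in> (\<Pi>\<^sub>E m\<in>M. pts). x m \<in> U}"
    unfolding eq by (rule openin_power_box[OF U])
  have t: "(\<lambda>x. f (x m)) \<in> tensor_funs M X ?U"
    by (rule tensor_coord[OF assms(1,2) U]) (use assms in simp)
  show "(\<lambda>x. f (x m)) \<in> preg M {x \<in> (\<Pi>\<^sub>E m\<in>M. pts). x m \<in> U}"
    unfolding eq
  proof (rule reg_powerI)
    fix x assume "x \<in> (\<Pi>\<^sub>E m\<in>M. ?U m)"
    then show "power_quot M (\<Pi>\<^sub>E m\<in>M. ?U m) (\<lambda>y. f (y m)) x"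
      using openin_power_box[OF U] U t tensor_one[OF U]
      by (intro exI[of _ "\<Pi>\<^sub>E m\<in>M. ?U m"] exI[of _ ?U] exI[of _ "\<lambda>x. f (x m)"] exI[of _ "\<lambda>_. 1"]) auto
  qed
qed

lemma morphism_coord: "finite M \<Longrightarrow> m \<in> M \<Longrightarrow> morphism (power_fspace M X) X (\<lambda>x. x m)"
  unfolding morphism_def zariski_power topspace_power continuous_map_def
  using reg_power_coord reg_const by (fastforce simp: Pi_def)

end

section \<open>Morphisms and the universal property of powers\<close>

lemma morphism_open: "morphism Y X \<phi> \<Longrightarrow> openin (zariski X) U \<Longrightarrow>
    openin (zariski Y) {y \<in> topspace (zariski Y). \<phi> y \<in> U}"
  by (simp add: morphism_def continuous_map_def)

lemma morphism_reg: "morphism Y X \<phi> \<Longrightarrow> openin (zariski X) U \<Longrightarrow> f \<in> regular X U \<Longrightarrow>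
    (\<lambda>y. f (\<phi> y)) \<in> regular Y {y \<in> topspace (zariski Y). \<phi> y \<in> U}"
  by (simp add: morphism_def)

lemma morphism_pts: "morphism Y X \<phi> \<Longrightarrow> y \<in> topspace (zariski Y) \<Longrightarrow> \<phi> y \<in> topspace (zariski X)"
  unfolding morphism_def continuous_map_def by blast

lemma morphism_comp:
  assumes "morphism Y X \<phi>" "morphism Z Y \<psi>"
  shows "morphism Z X (\<lambda>z. \<phi> (\<psi> z))"
proof -
  have "{z \<in> topspace (zariski Z). \<phi> (\<psi> z) \<in> V} =
      {z \<in> topspace (zariski Z). \<psi> z \<in> {y \<in> topspace (zariski Y). \<phi> y \<in> V}}" for V
    using morphism_pts[OF assms(2)] by auto
  then show ?thesis
    using morphism_open[OF assms(2) morphism_open[OF assms(1)]]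
      morphism_reg[OF assms(2) morphism_open[OF assms(1)] morphism_reg[OF assms(1)]]
      morphism_pts[OF assms(1)] morphism_pts[OF assms(2)]
    unfolding morphism_def[of Z] continuous_map_def by auto
qed

lemma morphism_id: "morphism X X (\<lambda>x. x)"
proof -
  have "{x \<in> topspace (zariski X). x \<in> V} = V" if "openin (zariski X) V" for V
    using openin_subset[OF that] by auto
  then show ?thesis unfolding morphism_def continuous_map_def by auto
qed

lemma morphism_const:
  assumes Y: "space_with_functions Y" and x: "x \<in> topspace (zariski X)"
  shows "morphism Y X (\<lambda>_. x)"
proof -
  interpret Y: fun_space Y by standard (rule Y)
  have "openin (zariski Y) {y \<in> topspace (zariski Y). x \<in> V}" for V by (cases "x \<in> V") auto
  then show ?thesis using x unfolding morphism_def continuous_map_def by (auto intro: Y.reg_const)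
qed

text \<open>Along a tuple of morphisms a tensor function becomes a sum of products of regular
  functions on \<open>B U\<close>, the preimage of the box. Continuity and regularity follow, since
  open sets are locally nonvanishing loci of tensors and regular functions locally quotients of
  them.\<close>

lemma (in fun_space) morphism_tuple:
  assumes Y: "space_with_functions Y" and M: "finite M"
    and \<phi>: "\<And>m. m \<in> M \<Longrightarrow> morphism Y X (\<phi> m)"
  shows "morphism Y (power_fspace M X) (\<lambda>y. \<lambda>m\<in>M. \<phi> m y)"
proof -
  interpret Y: fun_space Y by standard (rule Y)
  let ?\<phi> = "\<lambda>y. \<lambda>m\<in>M. \<phi> m y"
  define B where "B U = {y \<in> Y.pts. \<forall>m\<in>M. \<phi> m y \<in> U m}" for U
  have B: "Y.opn (B U)" if "\<forall>m\<in>M. opn (U m)" for U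
  proof (cases "M = {}")
    case True then show ?thesis by (simp add: B_def)
  next
    case False
    then have "B U = (\<Inter>m\<in>M. {y \<in> Y.pts. \<phi> m y \<in> U m})" by (auto simp: B_def)
    moreover have "Y.opn (\<Inter>m\<in>M. {y \<in> Y.pts. \<phi> m y \<in> U m})"
      using False M that by (intro openin_Inter) (auto intro: morphism_open[OF \<phi>])
    ultimately show ?thesis by simp
  qed
  have t: "(\<lambda>y. h (?\<phi> y)) \<in> Y.reg (B U)" if U: "\<forall>m\<in>M. opn (U m)" and h: "h \<in> tensor_funs M X U" for U h
  proof -
    obtain N f where N: "h = (\<lambda>x. \<Sum>j<N::nat. \<Prod>m\<in>M. f j m (x m))"
      "\<forall>j m. j < N \<longrightarrow> m \<in> M \<longrightarrow> f j m \<in> reg (U m)" using tensor_funsD[OF h] by (elim exE conjE)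
    have "(\<lambda>y. f j m (?\<phi> y m)) \<in> Y.reg (B U)" if "j < N" "m \<in> M" for j m
    proof -
      have "(\<lambda>y. f j m (\<phi> m y)) \<in> Y.reg {y \<in> Y.pts. \<phi> m y \<in> U m}"
        using morphism_reg[OF \<phi>[OF that(2)] _ N(2)[rule_format, OF that]] U that by auto
      then have "(\<lambda>y. f j m (\<phi> m y)) \<in> Y.reg (B U)"
        by (rule Y.reg_restrict[rotated -1])
          (use that U in \<open>auto simp: B_def intro: morphism_open[OF \<phi>] B[unfolded B_def]\<close>)
      then show ?thesis using that by simp
    qed
    then show ?thesis unfolding N(1) by (intro Y.reg_sum Y.reg_prod B U) auto
  qed
  have mem: "?\<phi> y \<in> (\<Pi>\<^sub>E m\<in>M. U m) \<longleftrightarrow> y \<in> B U" if "y \<in> Y.pts" for y U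
    using that by (auto simp: B_def)
  have pts: "?\<phi> y \<in> (\<Pi>\<^sub>E m\<in>M. pts)" if "y \<in> Y.pts" for y
    using that morphism_pts[OF \<phi>] by auto
  have cont: "Y.opn {y \<in> Y.pts. ?\<phi> y \<in> V}" if V: "openin (ptop M) V" for V
  proof (subst openin_subopen, rule ballI)
    fix y assume y: "y \<in> {y \<in> Y.pts. ?\<phi> y \<in> V}"
    then have "?\<phi> y \<in> V" by simp
    from bspec[OF V[unfolded openin_power_iff] this] obtain U h where U: "\<forall>m\<in>M. opn (U m)" "h \<in> tensor_funs M X U"
      "?\<phi> y \<in> (\<Pi>\<^sub>E m\<in>M. U m)" "h (?\<phi> y) \<noteq> 0" "{x \<in> (\<Pi>\<^sub>E m\<in>M. U m). h x \<noteq> 0} \<subseteq> V" by (elim exE conjE)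
    have o: "Y.opn {y \<in> B U. h (?\<phi> y) \<noteq> 0}" by (rule Y.opn_nonzero[OF B[OF U(1)] t[OF U(1,2)]])
    have "{y \<in> B U. h (?\<phi> y) \<noteq> 0} \<subseteq> {y \<in> Y.pts. ?\<phi> y \<in> V}"
    proof
      fix y' assume y': "y' \<in> {y \<in> B U. h (?\<phi> y) \<noteq> 0}"
      then have "y' \<in> Y.pts" by (simp add: B_def)
      then show "y' \<in> {y \<in> Y.pts. ?\<phi> y \<in> V}" using y' mem[of y' U] U(5) by blast
    qed
    moreover have "y \<in> B U" using mem[of y U] y U(3) by simp
    ultimately show "\<exists>T. Y.opn T \<and> y \<in> T \<and> T \<subseteq> {y \<in> Y.pts. ?\<phi> y \<in> V}" using o U(4) by blast
  qed
  show ?thesis unfolding morphism_def zariski_power topspace_power continuous_map_def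
  proof (intro conjI allI impI)
    show "?\<phi> \<in> Y.pts \<rightarrow> (\<Pi>\<^sub>E m\<in>M. pts)" using pts by blast
  next
    fix V assume "openin (ptop M) V"
    then show "Y.opn {y \<in> Y.pts. ?\<phi> y \<in> V}" by (rule cont)
  next
    fix V f assume V: "openin (ptop M) V" and f: "f \<in> preg M V"
    show "(\<lambda>y. f (?\<phi> y)) \<in> Y.reg {y \<in> Y.pts. ?\<phi> y \<in> V}"
    proof (rule Y.reg_local[OF cont[OF V]])
      fix y assume y: "y \<in> {y \<in> Y.pts. ?\<phi> y \<in> V}"
      then have "?\<phi> y \<in> V" by simp
      from reg_powerD[OF f this] obtain W U p q where *: "openin (ptop M) W" "?\<phi> y \<in> W" "W \<subseteq> V"
        "\<forall>m\<in>M. opn (U m)" "W \<subseteq> (\<Pi>\<^sub>E m\<in>M. U m)" "p \<in> tensor_funs M X U" "q \<in> tensor_funs M X U"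
        "\<forall>y\<in>W. q y \<noteq> 0 \<and> f y = p y / q y" by (elim exE conjE)
      let ?T = "{y \<in> Y.pts. ?\<phi> y \<in> W}"
      have oT: "Y.opn ?T" by (rule cont[OF *(1)])
      have TB: "?T \<subseteq> B U"
      proof
        fix y' assume y': "y' \<in> ?T"
        then have "?\<phi> y' \<in> (\<Pi>\<^sub>E m\<in>M. U m)" using *(5) by blast
        then show "y' \<in> B U" using mem[of y' U] y' by simp
      qed
      have "(\<lambda>y. p (?\<phi> y)) \<in> Y.reg ?T" "(\<lambda>y. q (?\<phi> y)) \<in> Y.reg ?T"
        using Y.reg_restrict[OF B[OF *(4)] oT TB] t[OF *(4)] *(6,7) by blast+
      then have "(\<lambda>y. p (?\<phi> y) / q (?\<phi> y)) \<in> Y.reg ?T"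
        by (rule Y.reg_divide[OF oT]) (use *(8) in blast)
      then have "(\<lambda>y. f (?\<phi> y)) \<in> Y.reg ?T"
        by (rule Y.reg_cong[OF oT]) (use *(8) in blast)
      moreover have "y \<in> ?T" "?T \<subseteq> {y \<in> Y.pts. ?\<phi> y \<in> V}" using y *(2,3) by auto
      ultimately show "\<exists>W. Y.opn W \<and> y \<in> W \<and> W \<subseteq> {y \<in> Y.pts. ?\<phi> y \<in> V} \<and> (\<lambda>y. f (?\<phi> y)) \<in> Y.reg W"
        using oT by blast
    qed
  qed
qed

section \<open>Irreducible sets\<close>

text \<open>Irreducibility in the subspace topology, stated with open sets of the ambient space so
  that they can be intersected directly.\<close>

definition irr_in :: "'x topology \<Rightarrow> 'x set \<Rightarrow> bool" where
  "irr_in T C \<longleftrightarrow> C \<noteq> {} \<and> C \<subseteq> topspace T \<and>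
     (\<forall>U V. openin T U \<longrightarrow> openin T V \<longrightarrow> U \<inter> C \<noteq> {} \<longrightarrow> V \<inter> C \<noteq> {} \<longrightarrow> U \<inter> V \<inter> C \<noteq> {})"

lemma irr_in_Int:
  "irr_in T C \<Longrightarrow> openin T U \<Longrightarrow> openin T V \<Longrightarrow> U \<inter> C \<noteq> {} \<Longrightarrow> V \<inter> C \<noteq> {} \<Longrightarrow> U \<inter> V \<inter> C \<noteq> {}"
  by (simp add: irr_in_def)

lemma irr_in_finite_INT:
  assumes C: "irr_in T C" and I: "finite I" and U: "\<And>i. i \<in> I \<Longrightarrow> openin T (U i) \<and> U i \<inter> C \<noteq> {}"
  shows "\<exists>x\<in>C. \<forall>i\<in>I. x \<in> U i"
proof -
  have "\<exists>V. openin T V \<and> V \<inter> C \<noteq> {} \<and> (\<forall>i\<in>I. V \<subseteq> U i)"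
    using I U
  proof (induction I rule: finite_induct)
    case empty
    then show ?case using C by (intro exI[of _ "topspace T"]) (auto simp: irr_in_def)
  next
    case (insert i I)
    then obtain V where "openin T V" "V \<inter> C \<noteq> {}" "\<forall>i\<in>I. V \<subseteq> U i" by auto
    then show ?case using irr_in_Int[OF C, of V "U i"] insert.prems
      by (intro exI[of _ "V \<inter> U i"]) auto
  qed
  then show ?thesis by blast
qed

lemma irr_in_image:
  assumes f: "continuous_map T T' f" and C: "irr_in T C"
  shows "irr_in T' (f ` C)"
  unfolding irr_in_def
proof (intro conjI allI impI)
  show "f ` C \<noteq> {}" using C by (simp add: irr_in_def)
  show "f ` C \<subseteq> topspace T'" using C continuous_map_funspace[OF f] by (auto simp: irr_in_def)
next
  fix U V assume UV: "openin T' U" "openin T' V" "U \<inter> f ` C \<noteq> {}" "V \<inter> f ` C \<noteq> {}"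
  have sub: "C \<subseteq> topspace T" using C by (simp add: irr_in_def)
  let ?U = "{x \<in> topspace T. f x \<in> U}" and ?V = "{x \<in> topspace T. f x \<in> V}"
  have "?U \<inter> C \<noteq> {}" "?V \<inter> C \<noteq> {}" using UV sub by auto
  then have "?U \<inter> ?V \<inter> C \<noteq> {}"
    using UV f by (intro irr_in_Int[OF C]) (auto simp: continuous_map_def)
  then show "U \<inter> V \<inter> f ` C \<noteq> {}" by auto
qed

lemma irr_in_closure: "irr_in T C \<Longrightarrow> irr_in T (T closure_of C)"
  unfolding irr_in_def
proof (elim conjE, intro conjI allI impI)
  assume C: "C \<noteq> {}" "C \<subseteq> topspace T"
    "\<forall>U V. openin T U \<longrightarrow> openin T V \<longrightarrow> U \<inter> C \<noteq> {} \<longrightarrow> V \<inter> C \<noteq> {} \<longrightarrow> U \<inter> V \<inter> C \<noteq> {}"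
  show "T closure_of C \<noteq> {}" using C closure_of_subset[of C T] by auto
  show "T closure_of C \<subseteq> topspace T" by (rule closure_of_subset_topspace)
  fix U V assume UV: "openin T U" "openin T V" "U \<inter> T closure_of C \<noteq> {}" "V \<inter> T closure_of C \<noteq> {}"
  then have "U \<inter> C \<noteq> {}" "V \<inter> C \<noteq> {}" by (simp_all add: openin_Int_closure_of_eq_empty)
  then have "U \<inter> V \<inter> C \<noteq> {}" using C(3) UV(1,2) by blast
  then show "U \<inter> V \<inter> T closure_of C \<noteq> {}" using closure_of_subset[OF C(2)] by blast
qed

text \<open>Noetherian induction: a nonempty closed set that is not irreducible is the union of the
  strictly smaller closed sets \<open>F - U\<close> and \<open>F - V\<close>.\<close>

lemma finite_irreducible_decomposition:
  assumes dcc: "\<And>C::nat \<Rightarrow> 'x set. (\<And>k. closedin T (C k)) \<Longrightarrow> (\<And>k. C (Suc k) \<subseteq> C k) \<Longrightarrow> \<exists>k. C (Suc k) = C k"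
    and "closedin T F"
  shows "\<exists>\<Z>. finite \<Z> \<and> F = \<Union>\<Z> \<and> (\<forall>Z\<in>\<Z>. irr_in T Z)"
proof -
  have "wf {(A, B). closedin T A \<and> closedin T B \<and> A \<subset> B}"
    unfolding wf_iff_no_infinite_down_chain
  proof
    assume "\<exists>f. \<forall>i. (f (Suc i), f i) \<in> {(A, B). closedin T A \<and> closedin T B \<and> A \<subset> B}"
    then obtain f where "\<forall>i. closedin T (f (Suc i)) \<and> closedin T (f i) \<and> f (Suc i) \<subset> f i" by auto
    then have "closedin T (f i)" "f (Suc i) \<subset> f i" for i by blast+
    then show False using dcc[of f] by blast
  qed
  then show ?thesis using assms(2)
  proof (induction F rule: wf_induct_rule)
    case (less F)
    show ?case
    proof (cases "F = {} \<or> irr_in T F")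
      case True
      then show ?thesis
      proof
        assume "F = {}" then show ?thesis by (intro exI[of _ "{}"]) simp
      next
        assume "irr_in T F" then show ?thesis by (intro exI[of _ "{F}"]) simp
      qed
    next
      case False
      then obtain U V where UV: "openin T U" "openin T V" "U \<inter> F \<noteq> {}" "V \<inter> F \<noteq> {}" "U \<inter> V \<inter> F = {}"
        using closedin_subset[OF less.prems] by (auto simp: irr_in_def)
      have "closedin T (F - U)" "closedin T (F - V)" using less.prems UV by (auto intro: closedin_diff)
      moreover have "F - U \<subset> F" "F - V \<subset> F" using UV by auto
      ultimately have "\<exists>\<Z>. finite \<Z> \<and> F - U = \<Union>\<Z> \<and> (\<forall>Z\<in>\<Z>. irr_in T Z)"
        "\<exists>\<Z>. finite \<Z> \<and> F - V = \<Union>\<Z> \<and> (\<forall>Z\<in>\<Z>. irr_in T Z)"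
        using less by simp_all
      then obtain Y Z where "finite Y" "F - U = \<Union>Y" "\<forall>Z\<in>Y. irr_in T Z"
        "finite Z" "F - V = \<Union>Z" "\<forall>Z\<in>Z. irr_in T Z" by blast
      moreover have "F = (F - U) \<union> (F - V)" using UV(5) by blast
      ultimately show ?thesis by (intro exI[of _ "Y \<union> Z"]) auto
    qed
  qed
qed

section \<open>Affine charts\<close>

lemma topspace_zariski_topology: "topspace (zariski_topology n) = {..<n} \<rightarrow>\<^sub>E (UNIV :: 'k::field set)"
proof (rule equalityI)
  show "topspace (zariski_topology n) \<subseteq> {..<n} \<rightarrow>\<^sub>E (UNIV :: 'k set)"
    using openin_topspace[of "zariski_topology n"] unfolding openin_zariski_topology by blast
  have "openin (zariski_topology n) ({..<n} \<rightarrow>\<^sub>E (UNIV :: 'k set))"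
    unfolding openin_zariski_topology
    by (rule exI[of _ "{\<lambda>x. 1}"]) (auto simp: zero_locus_def intro: poly_funs.const)
  then show "{..<n} \<rightarrow>\<^sub>E (UNIV :: 'k set) \<subseteq> topspace (zariski_topology n)" by (rule openin_subset)
qed

lemma closedin_zariski_topology:
  assumes "closedin (zariski_topology n) Z"
  shows "\<exists>P\<subseteq>poly_funs n. Z = zero_locus n P"
proof -
  have "openin (zariski_topology n) (topspace (zariski_topology n) - Z)" using assms by blast
  then obtain P where P: "P \<subseteq> poly_funs n" "topspace (zariski_topology n) - Z = ({..<n} \<rightarrow>\<^sub>E UNIV) - zero_locus n P"
    unfolding openin_zariski_topology by blast
  have "Z \<subseteq> {..<n} \<rightarrow>\<^sub>E UNIV" "zero_locus n P \<subseteq> {..<n} \<rightarrow>\<^sub>E UNIV"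
    using closedin_subset[OF assms] by (auto simp: topspace_zariski_topology zero_locus_def)
  then have "Z = zero_locus n P" using P(2) unfolding topspace_zariski_topology by blast
  then show ?thesis using P(1) by blast
qed

context fun_space
begin

text \<open>An affine coordinate system without its inverse map. In the last clause the nonvanishing
  of the denominator itself forces the point into \<open>V\<close>, so the clause encodes the
  topology as well: applied to a constant function it says that principal open sets form a base of
  \<open>U\<close>.\<close>

definition chart :: "nat \<Rightarrow> 'a set \<Rightarrow> ('a \<Rightarrow> nat \<Rightarrow> 'k) \<Rightarrow> bool" where
  "chart n U \<phi> \<longleftrightarrow> opn U \<and> inj_on \<phi> U \<and> (\<exists>P\<subseteq>poly_funs n. \<phi> ` U = zero_locus n P) \<and>
     (\<forall>i<n. (\<lambda>x. \<phi> x i) \<in> reg U) \<and>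
     (\<forall>V f x. opn V \<longrightarrow> f \<in> reg V \<longrightarrow> x \<in> U \<longrightarrow> x \<in> V \<longrightarrow>
        (\<exists>p\<in>poly_funs n. \<exists>q\<in>poly_funs n. q (\<phi> x) \<noteq> 0 \<and>
           (\<forall>u\<in>U. q (\<phi> u) \<noteq> 0 \<longrightarrow> u \<in> V \<and> f u = p (\<phi> u) / q (\<phi> u))))"

lemma chart_opn: "chart n U \<phi> \<Longrightarrow> opn U"
  and chart_inj: "chart n U \<phi> \<Longrightarrow> inj_on \<phi> U"
  and chart_image: "chart n U \<phi> \<Longrightarrow> \<exists>P\<subseteq>poly_funs n. \<phi> ` U = zero_locus n P"
  and chart_coord: "chart n U \<phi> \<Longrightarrow> i < n \<Longrightarrow> (\<lambda>x. \<phi> x i) \<in> reg U"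
  and chart_local: "chart n U \<phi> \<Longrightarrow> opn V \<Longrightarrow> f \<in> reg V \<Longrightarrow> x \<in> U \<Longrightarrow> x \<in> V \<Longrightarrow>
     \<exists>p\<in>poly_funs n. \<exists>q\<in>poly_funs n. q (\<phi> x) \<noteq> 0 \<and>
           (\<forall>u\<in>U. q (\<phi> u) \<noteq> 0 \<longrightarrow> u \<in> V \<and> f u = p (\<phi> u) / q (\<phi> u))"
  by (simp_all add: chart_def)

lemma affine_imp_chart:
  assumes U: "opn U" and aff: "affine_variety (open_subspace X U)"
  shows "\<exists>n \<phi>. chart n U \<phi>"
proof -
  obtain n Z where Z: "closedin (zariski_topology n) Z"
    and iso: "isomorphic_fspaces (open_subspace X U) (affine_subspace n Z)"
    using aff unfolding affine_variety_def by (elim exE conjE)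
  then obtain \<phi> \<psi> where \<phi>: "morphism (open_subspace X U) (affine_subspace n Z) \<phi>"
    and \<psi>: "morphism (affine_subspace n Z) (open_subspace X U) \<psi>"
    and inv: "\<forall>x \<in> topspace (zariski (open_subspace X U)). \<psi> (\<phi> x) = x"
       "\<forall>y \<in> topspace (zariski (affine_subspace n Z)). \<phi> (\<psi> y) = y"
    unfolding isomorphic_fspaces_def by (elim exE conjE)
  have tU: "topspace (zariski (open_subspace X U)) = U"
    using openin_subset[OF U] by (auto simp: open_subspace_def)
  have zA: "zariski (affine_subspace n Z) = subtopology (zariski_topology n) Z" by (simp add: affine_subspace_def)
  have tZ: "topspace (zariski (affine_subspace n Z)) = Z"
    using closedin_subset[OF Z] by (auto simp: zA)
  have \<phi>Z: "\<phi> x \<in> Z" if "x \<in> U" for x using morphism_pts[OF \<phi>] that unfolding tU tZ .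
  have \<psi>U: "\<psi> y \<in> U" if "y \<in> Z" for y using morphism_pts[OF \<psi>] that unfolding tU tZ .
  have img: "\<phi> ` U = Z" using \<phi>Z \<psi>U inv unfolding tU tZ by force
  show ?thesis
  proof (intro exI, unfold chart_def, intro conjI allI impI)
    show "opn U" by fact
    show "inj_on \<phi> U" using inv(1) unfolding tU by (metis inj_onI)
    show "\<exists>P\<subseteq>poly_funs n. \<phi> ` U = zero_locus n P" unfolding img by (rule closedin_zariski_topology[OF Z])
  next
    fix i assume i: "i < n"
    have "(\<lambda>x. x i) \<in> regular (affine_subspace n Z) Z"
    proof -
      have "openin (subtopology (zariski_topology n) Z) Z"
        using closedin_subset[OF Z] by (simp add: openin_subtopology_refl)
      moreover have "\<exists>p\<in>poly_funs n. \<exists>q\<in>poly_funs n. \<forall>y\<in>Z. q y \<noteq> 0 \<and> y i = p y / q y"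
        by (rule bexI[OF bexI[OF _ poly_funs.const[of 1]] poly_funs.coord[OF i]]) simp
      ultimately show ?thesis unfolding affine_subspace_def by auto
    qed
    moreover have "openin (zariski (affine_subspace n Z)) Z" using openin_topspace[of "zariski (affine_subspace n Z)"] unfolding tZ .
    ultimately have "(\<lambda>x. \<phi> x i) \<in> regular (open_subspace X U) {x \<in> U. \<phi> x \<in> Z}"
      using morphism_reg[OF \<phi>, of Z "\<lambda>x. x i"] unfolding tU by blast
    moreover have "{x \<in> U. \<phi> x \<in> Z} = U" using \<phi>Z by blast
    ultimately show "(\<lambda>x. \<phi> x i) \<in> reg U" by (simp add: open_subspace_def)
  next
    fix V f x assume V: "opn V" "f \<in> reg V" "x \<in> U" "x \<in> V"
    have UV: "opn (U \<inter> V)" by (rule openin_Int[OF U V(1)])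
    have "f \<in> regular (open_subspace X U) (U \<inter> V)"
      using reg_restrict[OF V(1) UV _ V(2)] by (simp add: open_subspace_def)
    moreover have "openin (zariski (open_subspace X U)) (U \<inter> V)"
      using UV by (auto simp: open_subspace_def openin_subtopology)
    ultimately have "(\<lambda>z. f (\<psi> z)) \<in> regular (affine_subspace n Z) {z \<in> Z. \<psi> z \<in> U \<inter> V}"
      using morphism_reg[OF \<psi>, of "U \<inter> V" f] unfolding tZ by blast
    moreover have "\<phi> x \<in> {z \<in> Z. \<psi> z \<in> U \<inter> V}" using \<phi>Z V inv(1) unfolding tU by auto
    ultimately have "\<exists>W. openin (subtopology (zariski_topology n) Z) W \<and> \<phi> x \<in> W \<and> W \<subseteq> {z \<in> Z. \<psi> z \<in> U \<inter> V} \<and>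
        (\<exists>p\<in>poly_funs n. \<exists>q\<in>poly_funs n. \<forall>y\<in>W. q y \<noteq> 0 \<and> f (\<psi> y) = p y / q y)"
      unfolding affine_subspace_def by simp
    then obtain W p q where W: "openin (subtopology (zariski_topology n) Z) W" "\<phi> x \<in> W" "W \<subseteq> {z \<in> Z. \<psi> z \<in> U \<inter> V}"
      and pq: "p \<in> poly_funs n" "q \<in> poly_funs n" "\<forall>y\<in>W. q y \<noteq> 0 \<and> f (\<psi> y) = p y / q y" by (elim exE conjE bexE)
    obtain W' where W': "openin (zariski_topology n) W'" "W = W' \<inter> Z" using W(1) unfolding openin_subtopology by blast
    obtain P where P: "P \<subseteq> poly_funs n" "W' = ({..<n} \<rightarrow>\<^sub>E UNIV) - zero_locus n P"
      using W'(1) unfolding openin_zariski_topology by blast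
    \<comment> \<open>\<open>W\<close> is the part of \<open>Z\<close> where some polynomial in
      \<open>P\<close> does not vanish; \<open>r\<close> is one that is nonzero at the given point.
      Expanding the fraction by \<open>r\<close> confines the set where the denominator is nonzero
      to \<open>W\<close>.\<close>
    obtain r where r: "r \<in> P" "r (\<phi> x) \<noteq> 0" using W(2) unfolding W'(2) P(2) zero_locus_def by blast
    have rW: "z \<in> W" if "z \<in> Z" "r z \<noteq> 0" for z
      using that r(1) closedin_subset[OF Z] unfolding W'(2) P(2) zero_locus_def topspace_zariski_topology by blast
    show "\<exists>p\<in>poly_funs n. \<exists>q\<in>poly_funs n. q (\<phi> x) \<noteq> 0 \<and>
           (\<forall>u\<in>U. q (\<phi> u) \<noteq> 0 \<longrightarrow> u \<in> V \<and> f u = p (\<phi> u) / q (\<phi> u))"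
    proof (rule bexI[of _ "\<lambda>y. p y * r y"], rule bexI[of _ "\<lambda>y. q y * r y"], intro conjI ballI impI)
      show "(\<lambda>y. p y * r y) \<in> poly_funs n" "(\<lambda>y. q y * r y) \<in> poly_funs n"
        using pq P(1) r(1) by (auto intro: poly_funs.mult)
      show "q (\<phi> x) * r (\<phi> x) \<noteq> 0" using pq(3) W(2) r(2) by simp
      fix u assume u: "u \<in> U" "q (\<phi> u) * r (\<phi> u) \<noteq> 0"
      then have "\<phi> u \<in> W" using rW \<phi>Z by simp
      then have *: "\<phi> u \<in> {z \<in> Z. \<psi> z \<in> U \<inter> V}" "f (\<psi> (\<phi> u)) = p (\<phi> u) / q (\<phi> u)" using W(3) pq(3) by auto
      moreover have "\<psi> (\<phi> u) = u" using inv(1) u unfolding tU by blast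
      ultimately show "u \<in> V" "f u = p (\<phi> u) * r (\<phi> u) / (q (\<phi> u) * r (\<phi> u))" using u(2) by simp_all
    qed
  qed
qed

lemma chart_basic_open:
  assumes "chart n U \<phi>" "opn V" "x \<in> U" "x \<in> V"
  shows "\<exists>q\<in>poly_funs n. q (\<phi> x) \<noteq> 0 \<and> (\<forall>u\<in>U. q (\<phi> u) \<noteq> 0 \<longrightarrow> u \<in> V)"
  using chart_local[OF assms(1,2) reg_const[OF assms(2), of 0] assms(3,4)] by blast

text \<open>To the equations of the chart one adds all polynomials vanishing on the image of
  \<open>U \<inter> C\<close>. A point of \<open>U\<close> outside \<open>C\<close> violates one of
  them: the denominator of a principal open set inside the complement of \<open>C\<close>.\<close>

lemma chart_closed_image:
  assumes ch: "chart n U \<phi>" and C: "closedin (zar) C"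
  shows "\<exists>Q\<subseteq>poly_funs n. \<phi> ` (U \<inter> C) = zero_locus n Q"
proof -
  obtain P where P: "P \<subseteq> poly_funs n" "\<phi> ` U = zero_locus n P" using chart_image[OF ch] by blast
  define Q where "Q = P \<union> {q \<in> poly_funs n. \<forall>u\<in>U \<inter> C. q (\<phi> u) = 0}"
  have "\<phi> ` (U \<inter> C) = zero_locus n Q"
  proof (intro equalityI subsetI)
    fix z assume "z \<in> \<phi> ` (U \<inter> C)"
    then obtain u where u: "u \<in> U \<inter> C" "z = \<phi> u" by blast
    then have "z \<in> zero_locus n P" using P(2) by blast
    then show "z \<in> zero_locus n Q" using u by (auto simp: Q_def zero_locus_def)
  next
    fix z assume z: "z \<in> zero_locus n Q"
    then have "z \<in> zero_locus n P" by (auto simp: Q_def zero_locus_def)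
    then obtain u where u: "u \<in> U" "z = \<phi> u" using P(2) by blast
    have "u \<in> C"
    proof (rule ccontr)
      assume "u \<notin> C"
      have "opn (pts - C)" using C by blast
      moreover have "u \<in> pts - C" using u(1) \<open>u \<notin> C\<close> openin_subset[OF chart_opn[OF ch]] by blast
      ultimately obtain q where q: "q \<in> poly_funs n" "q (\<phi> u) \<noteq> 0" "\<forall>u\<in>U. q (\<phi> u) \<noteq> 0 \<longrightarrow> u \<in> pts - C"
        using chart_basic_open[OF ch _ u(1)] by blast
      then have "q \<in> Q" by (auto simp: Q_def)
      then show False using z q(2) u(2) by (auto simp: zero_locus_def)
    qed
    then show "z \<in> \<phi> ` (U \<inter> C)" using u by blast
  qed
  moreover have "Q \<subseteq> poly_funs n" using P by (auto simp: Q_def)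
  ultimately show ?thesis by blast
qed

text \<open>In each chart the chain becomes a descending chain of zero loci and is stationary from
  some index on; finitely many charts have a common such index.\<close>

lemma noetherian_chart_cover:
  assumes fin: "finite \<U>" and cover: "\<Union>\<U> = pts" and ch: "\<And>U. U \<in> \<U> \<Longrightarrow> \<exists>n \<phi>. chart n U \<phi>"
    and C: "\<And>k. closedin (zar) (C k)" and dec: "\<And>k. C (Suc k) \<subseteq> C k"
  shows "\<exists>k. C (Suc k) = C k"
proof -
  have dec': "C k \<subseteq> C j" if "j \<le> k" for j k using lift_Suc_antimono_le[of C, OF dec that] .
  have "\<exists>k0. \<forall>k\<ge>k0. U \<inter> C k = U \<inter> C k0" if U: "U \<in> \<U>" for U
  proof -
    obtain n \<phi> where c: "chart n U \<phi>" using ch[OF U] by blast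
    have "\<forall>k. \<exists>Q. Q \<subseteq> poly_funs n \<and> \<phi> ` (U \<inter> C k) = zero_locus n Q"
      using chart_closed_image[OF c C] by blast
    from choice[OF this] obtain Q where Q: "\<And>k. Q k \<subseteq> poly_funs n" "\<And>k. \<phi> ` (U \<inter> C k) = zero_locus n (Q k)"
      by blast
    have "\<exists>k0. \<forall>k\<ge>k0. zero_locus n (Q k) = zero_locus n (Q k0)"
      by (rule zero_loci_stabilize[OF Q(1)]) (use dec' in \<open>auto simp flip: Q(2)\<close>)
    then obtain k0 where k0: "\<And>k. k \<ge> k0 \<Longrightarrow> \<phi> ` (U \<inter> C k) = \<phi> ` (U \<inter> C k0)" unfolding Q(2) by blast
    have "U \<inter> C k = U \<inter> C k0" if "k \<ge> k0" for k
      using k0[OF that] inj_on_image_eq_iff[OF chart_inj[OF c], of "U \<inter> C k" "U \<inter> C k0"] by blast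
    then show ?thesis by blast
  qed
  then have "\<forall>U\<in>\<U>. \<exists>k0. \<forall>k\<ge>k0. U \<inter> C k = U \<inter> C k0" by blast
  from bchoice[OF this] obtain K where K': "\<forall>U\<in>\<U>. \<forall>k\<ge>K U. U \<inter> C k = U \<inter> C (K U)" ..
  have K: "U \<inter> C k = U \<inter> C (K U)" if "U \<in> \<U>" "k \<ge> K U" for U k using K' that by blast
  define k where "k = Max (insert 0 (K ` \<U>))"
  have "K U \<le> k" if "U \<in> \<U>" for U using that fin by (auto simp: k_def)
  then have eq: "U \<inter> C (Suc k) = U \<inter> C k" if "U \<in> \<U>" for U
    using K[OF that, of k] K[OF that, of "Suc k"] that by (simp add: le_SucI)
  have "C j = (\<Union>U\<in>\<U>. U \<inter> C j)" for j using closedin_subset[OF C[of j]] cover by blast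
  then have "C (Suc k) = C k" using eq by (metis (no_types, lifting) SUP_cong)
  then show ?thesis by blast
qed

text \<open>All coordinates of all factors. Their number, at most \<open>n * card M\<close>,
  ultimately bounds the number of independent functions on the power.\<close>

definition chart_coords :: "nat \<Rightarrow> ('a \<Rightarrow> nat \<Rightarrow> 'k) \<Rightarrow> 'i set \<Rightarrow> (('i \<Rightarrow> 'a) \<Rightarrow> 'k) set" where
  "chart_coords n \<phi> M = (\<lambda>(m, i) x. \<phi> (x m) i) ` (M \<times> {..<n})"

lemma finite_chart_coords: "finite M \<Longrightarrow> finite (chart_coords n \<phi> M)"
  by (simp add: chart_coords_def)

lemma card_chart_coords: "finite M \<Longrightarrow> card (chart_coords n \<phi> M) \<le> n * card M"
  unfolding chart_coords_def
  by (rule order_trans[OF card_image_le]) (simp_all add: card_cartesian_product mult.commute)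

lemma chart_coords_comp:
  assumes "p \<in> poly_funs n" "m \<in> M"
  shows "(\<lambda>x. p (\<phi> (x m))) \<in> fun_alg (chart_coords n \<phi> M)"
proof (rule fun_alg_comp[where p = p and h = "\<lambda>x. \<phi> (x m)" and F = "(\<lambda>i x. x i) ` {..<n}"])
  show "p \<in> fun_alg ((\<lambda>i x. x i) ` {..<n})" using assms by (simp add: poly_funs_eq_fun_alg)
  show "(\<lambda>x. f (\<phi> (x m))) \<in> fun_alg (chart_coords n \<phi> M)" if "f \<in> (\<lambda>i x. x i) ` {..<n}" for f
    using that assms(2) by (intro fun_alg.gen) (auto simp: chart_coords_def)
qed

text \<open>The fraction is required to be valid on the whole principal open set of its denominator
  within the box of charts, so no neighbourhood of \<open>x\<close> has to be carried along and
  fractions combine algebraically.\<close>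

definition rational_at :: "nat \<Rightarrow> 'a set \<Rightarrow> ('a \<Rightarrow> nat \<Rightarrow> 'k) \<Rightarrow> 'i set \<Rightarrow> ('i \<Rightarrow> 'a) \<Rightarrow> (('i \<Rightarrow> 'a) \<Rightarrow> 'k) \<Rightarrow> bool" where
  "rational_at n U \<phi> M x f \<longleftrightarrow> (\<exists>p\<in>fun_alg (chart_coords n \<phi> M). \<exists>q\<in>fun_alg (chart_coords n \<phi> M).
     q x \<noteq> 0 \<and> (\<forall>u\<in>M \<rightarrow>\<^sub>E U. q u \<noteq> 0 \<longrightarrow> f u = p u / q u))"

lemma rational_at_add:
  assumes "rational_at n U \<phi> M x f" "rational_at n U \<phi> M x g"
  shows "rational_at n U \<phi> M x (\<lambda>x. f x + g x)"
proof -
  obtain p q where 1: "p \<in> fun_alg (chart_coords n \<phi> M)" "q \<in> fun_alg (chart_coords n \<phi> M)"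
    "q x \<noteq> 0" "\<forall>u\<in>M \<rightarrow>\<^sub>E U. q u \<noteq> 0 \<longrightarrow> f u = p u / q u"
    using assms(1) unfolding rational_at_def by (elim bexE conjE)
  obtain p' q' where 2: "p' \<in> fun_alg (chart_coords n \<phi> M)" "q' \<in> fun_alg (chart_coords n \<phi> M)"
    "q' x \<noteq> 0" "\<forall>u\<in>M \<rightarrow>\<^sub>E U. q' u \<noteq> 0 \<longrightarrow> g u = p' u / q' u"
    using assms(2) unfolding rational_at_def by (elim bexE conjE)
  show ?thesis unfolding rational_at_def
    by (rule bexI[of _ "\<lambda>u. p u * q' u + p' u * q u"], rule bexI[of _ "\<lambda>u. q u * q' u"])
      (use 1 2 in \<open>auto intro: fun_alg.intros simp: add_frac_eq\<close>)
qed

lemma rational_at_mult: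
  assumes "rational_at n U \<phi> M x f" "rational_at n U \<phi> M x g"
  shows "rational_at n U \<phi> M x (\<lambda>x. f x * g x)"
proof -
  obtain p q where 1: "p \<in> fun_alg (chart_coords n \<phi> M)" "q \<in> fun_alg (chart_coords n \<phi> M)"
    "q x \<noteq> 0" "\<forall>u\<in>M \<rightarrow>\<^sub>E U. q u \<noteq> 0 \<longrightarrow> f u = p u / q u"
    using assms(1) unfolding rational_at_def by (elim bexE conjE)
  obtain p' q' where 2: "p' \<in> fun_alg (chart_coords n \<phi> M)" "q' \<in> fun_alg (chart_coords n \<phi> M)"
    "q' x \<noteq> 0" "\<forall>u\<in>M \<rightarrow>\<^sub>E U. q' u \<noteq> 0 \<longrightarrow> g u = p' u / q' u"
    using assms(2) unfolding rational_at_def by (elim bexE conjE)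
  show ?thesis unfolding rational_at_def
    by (rule bexI[of _ "\<lambda>u. p u * p' u"], rule bexI[of _ "\<lambda>u. q u * q' u"])
      (use 1 2 in \<open>auto intro: fun_alg.intros\<close>)
qed

lemma rational_at_const: "rational_at n U \<phi> M x (\<lambda>_. c)"
  unfolding rational_at_def
  by (rule bexI[of _ "\<lambda>u. c"], rule bexI[of _ "\<lambda>u. 1"]) (auto intro: fun_alg.intros)

lemma rational_at_sum:
  "(\<And>i. i \<in> I \<Longrightarrow> rational_at n U \<phi> M x (f i)) \<Longrightarrow> rational_at n U \<phi> M x (\<lambda>x. \<Sum>i\<in>I. f i x)"
  by (induction I rule: infinite_finite_induct) (auto intro: rational_at_const rational_at_add)

lemma rational_at_prod:
  "(\<And>i. i \<in> I \<Longrightarrow> rational_at n U \<phi> M x (f i)) \<Longrightarrow> rational_at n U \<phi> M x (\<lambda>x. \<Prod>i\<in>I. f i x)"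
  by (induction I rule: infinite_finite_induct) (auto intro: rational_at_const rational_at_mult)

lemma rational_at_coord:
  assumes ch: "chart n U \<phi>" and V: "opn V" "f \<in> reg V" and m: "m \<in> M" and x: "x m \<in> U" "x m \<in> V"
  shows "rational_at n U \<phi> M x (\<lambda>x. f (x m))"
proof -
  obtain p q where pq: "p \<in> poly_funs n" "q \<in> poly_funs n" "q (\<phi> (x m)) \<noteq> 0"
    "\<forall>u\<in>U. q (\<phi> u) \<noteq> 0 \<longrightarrow> u \<in> V \<and> f u = p (\<phi> u) / q (\<phi> u)"
    using chart_local[OF ch V x] by (elim bexE conjE)
  show ?thesis unfolding rational_at_def
    by (rule bexI[OF bexI[OF _ chart_coords_comp[OF pq(2) m]] chart_coords_comp[OF pq(1) m]])
      (use pq(3,4) m in \<open>auto simp: PiE_mem\<close>)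
qed

lemma rational_at_tensor:
  assumes ch: "chart n U \<phi>" and V: "\<forall>m\<in>M. opn (V m)" "h \<in> tensor_funs M X V"
    and x: "x \<in> M \<rightarrow>\<^sub>E U" "x \<in> (\<Pi>\<^sub>E m\<in>M. V m)"
  shows "rational_at n U \<phi> M x h"
proof -
  obtain N f where h: "h = (\<lambda>x. \<Sum>j<N::nat. \<Prod>m\<in>M. f j m (x m))"
    "\<forall>j m. j < N \<longrightarrow> m \<in> M \<longrightarrow> f j m \<in> reg (V m)" using tensor_funsD[OF V(2)] by (elim exE conjE)
  have "rational_at n U \<phi> M x (\<lambda>x. f j m (x m))" if "j < N" "m \<in> M" for j m
    by (rule rational_at_coord[OF ch, of "V m"]) (use that h(2) V x in \<open>auto simp: PiE_mem\<close>)
  then show ?thesis unfolding h(1) by (intro rational_at_sum rational_at_prod) auto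
qed

lemma chart_power_basic_open:
  assumes ch: "chart n U \<phi>" and M: "finite M" and V: "openin (ptop M) V"
    and x: "x \<in> M \<rightarrow>\<^sub>E U" "x \<in> V"
  shows "\<exists>q\<in>fun_alg (chart_coords n \<phi> M). q x \<noteq> 0 \<and> (\<forall>u\<in>M \<rightarrow>\<^sub>E U. q u \<noteq> 0 \<longrightarrow> u \<in> V)"
proof -
  from bspec[OF V[unfolded openin_power_iff] x(2)] obtain B h where B: "\<forall>m\<in>M. opn (B m)" "h \<in> tensor_funs M X B"
    "x \<in> (\<Pi>\<^sub>E m\<in>M. B m)" "h x \<noteq> 0" "{x \<in> (\<Pi>\<^sub>E m\<in>M. B m). h x \<noteq> 0} \<subseteq> V" by (elim exE conjE)
  have "\<forall>m\<in>M. \<exists>q\<in>poly_funs n. q (\<phi> (x m)) \<noteq> 0 \<and> (\<forall>u\<in>U. q (\<phi> u) \<noteq> 0 \<longrightarrow> u \<in> B m)"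
  proof
    fix m assume m: "m \<in> M"
    show "\<exists>q\<in>poly_funs n. q (\<phi> (x m)) \<noteq> 0 \<and> (\<forall>u\<in>U. q (\<phi> u) \<noteq> 0 \<longrightarrow> u \<in> B m)"
      by (rule chart_basic_open[OF ch]) (use m B(1,3) x(1) in \<open>auto simp: PiE_mem\<close>)
  qed
  from bchoice[OF this[unfolded Bex_def]] obtain r where
    r: "\<forall>m\<in>M. r m \<in> poly_funs n \<and> r m (\<phi> (x m)) \<noteq> 0 \<and> (\<forall>u\<in>U. r m (\<phi> u) \<noteq> 0 \<longrightarrow> u \<in> B m)" ..
  obtain p q where pq: "p \<in> fun_alg (chart_coords n \<phi> M)" "q \<in> fun_alg (chart_coords n \<phi> M)"
    "q x \<noteq> 0" "\<forall>u\<in>M \<rightarrow>\<^sub>E U. q u \<noteq> 0 \<longrightarrow> h u = p u / q u"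
    using rational_at_tensor[OF ch B(1,2) x(1) B(3)] unfolding rational_at_def by (elim bexE conjE)
  \<comment> \<open>The three factors serve three purposes: \<open>q\<close> makes the fraction for
    \<open>h\<close> valid, \<open>p\<close> makes \<open>h\<close> nonzero, and the
    \<open>r m\<close> keep the coordinates inside the box \<open>B\<close>.\<close>
  define R where "R u = p u * q u * (\<Prod>m\<in>M. r m (\<phi> (u m)))" for u
  have "R \<in> fun_alg (chart_coords n \<phi> M)"
    unfolding R_def using r by (intro fun_alg.mult pq fun_alg_prod chart_coords_comp) auto
  moreover have "R x \<noteq> 0" using pq(3,4) B(4) x(1) r M by (auto simp: R_def)
  moreover have "u \<in> V" if u: "u \<in> M \<rightarrow>\<^sub>E U" "R u \<noteq> 0" for u
  proof -
    have nz: "p u \<noteq> 0" "q u \<noteq> 0" "\<And>m. m \<in> M \<Longrightarrow> r m (\<phi> (u m)) \<noteq> 0" using u(2) M by (auto simp: R_def)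
    have "u \<in> (\<Pi>\<^sub>E m\<in>M. B m)" using u(1) nz(3) r by (auto simp: PiE_iff)
    moreover have "h u \<noteq> 0" using pq(4) u(1) nz by simp
    ultimately show ?thesis using B(5) by blast
  qed
  ultimately show ?thesis by blast
qed

lemma rational_at_regular:
  assumes ch: "chart n U \<phi>" and M: "finite M" and V: "openin (ptop M) V"
    and f: "f \<in> preg M V" and x: "x \<in> M \<rightarrow>\<^sub>E U" "x \<in> V"
  shows "rational_at n U \<phi> M x f"
proof -
  from reg_powerD[OF f x(2)] obtain W B a b where W: "openin (ptop M) W" "x \<in> W" "W \<subseteq> V"
    "\<forall>m\<in>M. opn (B m)" "W \<subseteq> (\<Pi>\<^sub>E m\<in>M. B m)" "a \<in> tensor_funs M X B" "b \<in> tensor_funs M X B"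
    "\<forall>y\<in>W. b y \<noteq> 0 \<and> f y = a y / b y" by (elim exE conjE)
  have xB: "x \<in> (\<Pi>\<^sub>E m\<in>M. B m)" using W by blast
  let ?A = "fun_alg (chart_coords n \<phi> M)"
  obtain q where q: "q \<in> ?A" "q x \<noteq> 0" "\<forall>u\<in>M \<rightarrow>\<^sub>E U. q u \<noteq> 0 \<longrightarrow> u \<in> W"
    using chart_power_basic_open[OF ch M W(1) x(1) W(2)] by (elim bexE conjE)
  obtain p1 q1 where 1: "p1 \<in> ?A" "q1 \<in> ?A" "q1 x \<noteq> 0" "\<forall>u\<in>M \<rightarrow>\<^sub>E U. q1 u \<noteq> 0 \<longrightarrow> a u = p1 u / q1 u"
    using rational_at_tensor[OF ch W(4,6) x(1) xB] unfolding rational_at_def by (elim bexE conjE)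
  obtain p2 q2 where 2: "p2 \<in> ?A" "q2 \<in> ?A" "q2 x \<noteq> 0" "\<forall>u\<in>M \<rightarrow>\<^sub>E U. q2 u \<noteq> 0 \<longrightarrow> b u = p2 u / q2 u"
    using rational_at_tensor[OF ch W(4,7) x(1) xB] unfolding rational_at_def by (elim bexE conjE)
  \<comment> \<open>The double fraction \<open>(p1 / q1) / (p2 / q2)\<close>, expanded by
    \<open>q * q2\<close>: where \<open>Q\<close> is nonzero, \<open>q\<close> places the point in
    \<open>W\<close> and \<open>q2\<close> makes the fraction for \<open>b\<close> valid.\<close>
  define P Q where "P u = p1 u * q2 u * q u * q2 u" and "Q u = q1 u * p2 u * q u * q2 u" for u
  have "P \<in> ?A" "Q \<in> ?A" unfolding P_def Q_def by (intro fun_alg.mult 1 2 q)+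
  moreover have "Q x \<noteq> 0" using 1(3) 2(3,4) q(2) x(1) W(2,8) by (auto simp: Q_def)
  moreover have "f u = P u / Q u" if u: "u \<in> M \<rightarrow>\<^sub>E U" "Q u \<noteq> 0" for u
  proof -
    have nz: "q1 u \<noteq> 0" "p2 u \<noteq> 0" "q u \<noteq> 0" "q2 u \<noteq> 0" using u(2) by (auto simp: Q_def)
    then have "u \<in> W" using q(3) u(1) by blast
    then have "f u = a u / b u" using W(8) by blast
    also have "\<dots> = (p1 u / q1 u) / (p2 u / q2 u)" using 1(4) 2(4) u(1) nz by simp
    finally show ?thesis using nz by (simp add: P_def Q_def)
  qed
  ultimately show ?thesis unfolding rational_at_def by blast
qed

end

section \<open>Slices of open sets, irreducibility and density in powers\<close>

context fun_space
begin

lemma slice_morphism: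
  assumes "finite M" "y \<in> (\<Pi>\<^sub>E m\<in>M. pts)" "j \<in> M"
  shows "morphism X (power_fspace M X) (\<lambda>a. y(j := a))"
proof -
  have "morphism X (power_fspace M X) (\<lambda>a. \<lambda>m\<in>M. if m = j then a else y m)"
  proof (rule morphism_tuple[OF swf assms(1)])
    fix m assume "m \<in> M"
    then have "y m \<in> pts" using assms(2) by auto
    then show "morphism X X (\<lambda>a. if m = j then a else y m)"
      using morphism_const[OF swf, of "y m" X] morphism_id[of X] by (cases "m = j") simp_all
  qed
  moreover have "(\<lambda>a. \<lambda>m\<in>M. if m = j then a else y m) = (\<lambda>a. y(j := a))"
    using assms by (auto simp: fun_eq_iff PiE_def extensional_def)
  ultimately show ?thesis by simp
qed

lemma slice_open:
  assumes "finite M" "openin (ptop M) V" "y \<in> (\<Pi>\<^sub>E m\<in>M. pts)" "j \<in> M"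
  shows "opn {a \<in> pts. y(j := a) \<in> V}"
  using morphism_open[OF slice_morphism[OF assms(1,3,4)]] assms(2) by simp

text \<open>The topology is finer than the product topology, so boxes do not suffice. Instead, one
  point in each of the two open sets is adjusted coordinate by coordinate: the slices through them
  in direction \<open>j\<close> are open in \<open>X\<close> and meet \<open>C\<close>, so
  irreducibility provides a common value.\<close>

lemma irr_in_power:
  assumes M: "finite M" and C: "irr_in (zar) C"
  shows "irr_in (ptop M) (\<Pi>\<^sub>E m\<in>M. C)"
  unfolding irr_in_def
proof (intro conjI allI impI)
  have Cp: "C \<subseteq> pts" "C \<noteq> {}" using C by (auto simp: irr_in_def)
  show "(\<Pi>\<^sub>E m\<in>M. C) \<noteq> {}" using Cp by (simp add: PiE_eq_empty_iff)
  show "(\<Pi>\<^sub>E m\<in>M. C) \<subseteq> topspace (ptop M)"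
    unfolding topspace_power by (rule PiE_mono) (rule Cp)
  fix U V assume UV: "openin (ptop M) U" "openin (ptop M) V"
    "U \<inter> (\<Pi>\<^sub>E m\<in>M. C) \<noteq> {}" "V \<inter> (\<Pi>\<^sub>E m\<in>M. C) \<noteq> {}"
  have sub: "(\<Pi>\<^sub>E m\<in>M. C) \<subseteq> (\<Pi>\<^sub>E m\<in>M. pts)" by (rule PiE_mono) (rule Cp)
  have "\<exists>y z. y \<in> U \<inter> (\<Pi>\<^sub>E m\<in>M. C) \<and> z \<in> V \<inter> (\<Pi>\<^sub>E m\<in>M. C) \<and> (\<forall>j\<in>J. y j = z j)"
    if "finite J" "J \<subseteq> M" for J
    using that
  proof (induction J rule: finite_induct)
    case empty then show ?case using UV by blast
  next
    case (insert j J)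
    then obtain y z where yz: "y \<in> U \<inter> (\<Pi>\<^sub>E m\<in>M. C)" "z \<in> V \<inter> (\<Pi>\<^sub>E m\<in>M. C)" "\<forall>j\<in>J. y j = z j" by auto
    have j: "j \<in> M" using insert.prems by blast
    let ?U = "{a \<in> pts. y(j := a) \<in> U}" and ?V = "{a \<in> pts. z(j := a) \<in> V}"
    have "y j \<in> ?U \<inter> C" "z j \<in> ?V \<inter> C" using yz j Cp by (auto simp: PiE_mem)
    then have "?U \<inter> ?V \<inter> C \<noteq> {}"
      using yz sub j M UV by (intro irr_in_Int[OF C] slice_open) auto
    then obtain a where a: "a \<in> C" "y(j := a) \<in> U" "z(j := a) \<in> V" by blast
    have "y(j := a) \<in> (\<Pi>\<^sub>E m\<in>M. C)" "z(j := a) \<in> (\<Pi>\<^sub>E m\<in>M. C)"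
      using a(1) yz j by (auto simp: PiE_iff extensional_def)
    moreover have "\<forall>i\<in>insert j J. (y(j := a)) i = (z(j := a)) i" using yz(3) by simp
    ultimately show ?case using a(2,3) by blast
  qed
  from this[OF M] obtain y z where yz: "y \<in> U \<inter> (\<Pi>\<^sub>E m\<in>M. C)" "z \<in> V \<inter> (\<Pi>\<^sub>E m\<in>M. C)" "\<forall>j\<in>M. y j = z j" by auto
  then have "y = z" by (intro PiE_ext[of y M "\<lambda>_. C" z]) auto
  then show "U \<inter> V \<inter> (\<Pi>\<^sub>E m\<in>M. C) \<noteq> {}" using yz by blast
qed

text \<open>For the same reason density does not pass to powers through boxes; the coordinates of a
  point of \<open>U\<close> are moved into \<open>L\<close> one at a time along open slices.\<close>

lemma dense_power:
  assumes M: "finite M" and C: "C \<subseteq> pts" and L: "L \<subseteq> C"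
    and dense: "\<And>V. opn V \<Longrightarrow> V \<inter> C \<noteq> {} \<Longrightarrow> V \<inter> L \<noteq> {}"
    and U: "openin (ptop M) U" "U \<inter> (\<Pi>\<^sub>E m\<in>M. C) \<noteq> {}"
  shows "U \<inter> (\<Pi>\<^sub>E m\<in>M. L) \<noteq> {}"
proof -
  have sub: "(\<Pi>\<^sub>E m\<in>M. C) \<subseteq> (\<Pi>\<^sub>E m\<in>M. pts)" by (rule PiE_mono) (rule C)
  have "\<exists>y. y \<in> U \<inter> (\<Pi>\<^sub>E m\<in>M. C) \<and> (\<forall>j\<in>J. y j \<in> L)" if "finite J" "J \<subseteq> M" for J
    using that
  proof (induction J rule: finite_induct)
    case empty then show ?case using U by blast
  next
    case (insert j J)
    then obtain y where y: "y \<in> U \<inter> (\<Pi>\<^sub>E m\<in>M. C)" "\<forall>j\<in>J. y j \<in> L" by auto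
    have j: "j \<in> M" using insert.prems by blast
    let ?U = "{a \<in> pts. y(j := a) \<in> U}"
    have "y j \<in> ?U \<inter> C" using y j C by (auto simp: PiE_mem)
    then have "?U \<inter> L \<noteq> {}" using y sub j M U by (intro dense slice_open) auto
    then obtain a where a: "a \<in> L" "y(j := a) \<in> U" by blast
    have "y(j := a) \<in> (\<Pi>\<^sub>E m\<in>M. C)" using a(1) y j L by (auto simp: PiE_iff extensional_def)
    moreover have "\<forall>i\<in>insert j J. (y(j := a)) i \<in> L" using a(1) y(2) by simp
    ultimately show ?case using a(2) by blast
  qed
  from this[OF M] obtain y where "y \<in> U \<inter> (\<Pi>\<^sub>E m\<in>M. C)" "\<forall>j\<in>M. y j \<in> L" by auto
  then have "y \<in> U \<inter> (\<Pi>\<^sub>E m\<in>M. L)" by (auto simp: PiE_iff)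
  then show ?thesis by blast
qed

lemma chart_poly_reg:
  assumes ch: "chart n U \<phi>" and "p \<in> poly_funs n"
  shows "(\<lambda>x. p (\<phi> x)) \<in> reg U"
  using assms(2)
  by induction (auto intro: reg_const reg_add reg_mult chart_coord[OF ch] chart_opn[OF ch])

end

section \<open>The identity component of an algebraic group\<close>

locale alg_grp =
  fixes X :: "('a, 'k::alg_closed_field) alg_group" (structure)
  assumes ag: "algebraic_group X"

sublocale alg_grp \<subseteq> group X
  using ag by (simp add: algebraic_group_def)

sublocale alg_grp \<subseteq> fun_space "variety X"
  using ag by unfold_locales (simp add: algebraic_group_def algebraic_variety_def)

context alg_grp
begin

lemma pts_eq: "topspace (zar) = carrier X"
  using ag by (simp add: algebraic_group_def)

lemma chart_cover: "\<exists>\<U>. finite \<U> \<and> \<Union>\<U> = carrier X \<and> (\<forall>U\<in>\<U>. \<exists>n \<phi>. chart n U \<phi>)"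
proof -
  obtain \<U> where \<U>: "finite \<U>" "\<Union>\<U> = topspace (zar)"
    "\<forall>U\<in>\<U>. openin (zar) U \<and> affine_variety (open_subspace (variety X) U)"
    using ag unfolding algebraic_group_def algebraic_variety_def by (elim exE conjE)
  then have "\<forall>U\<in>\<U>. \<exists>n \<phi>. chart n U \<phi>" using affine_imp_chart by blast
  then show ?thesis using \<U> pts_eq by auto
qed

lemma morphism_mult:
  assumes Y: "space_with_functions Y" and "morphism Y (variety X) \<phi>" "morphism Y (variety X) \<psi>"
  shows "morphism Y (variety X) (\<lambda>y. \<phi> y \<otimes> \<psi> y)"
proof -
  have "morphism Y (power_fspace (UNIV :: bool set) (variety X)) (\<lambda>y. \<lambda>m\<in>UNIV. (if m then \<psi> else \<phi>) y)"
    by (rule morphism_tuple[OF Y]) (use assms in auto)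
  moreover have "morphism (power_fspace (UNIV :: bool set) (variety X)) (variety X) (\<lambda>p. p False \<otimes> p True)"
    using ag by (simp add: algebraic_group_def)
  ultimately show ?thesis using morphism_comp by fastforce
qed

lemma morphism_translations:
  assumes "b \<in> carrier X"
  shows "morphism (variety X) (variety X) (\<lambda>a. a \<otimes> b)" "morphism (variety X) (variety X) (\<lambda>a. b \<otimes> a)"
  using assms by (auto intro!: morphism_mult[OF swf] morphism_id morphism_const[OF swf] simp: pts_eq)

lemma translations_open:
  assumes "b \<in> carrier X" "opn V"
  shows "opn {a \<in> carrier X. a \<otimes> b \<in> V}" "opn {a \<in> carrier X. b \<otimes> a \<in> V}"
  using morphism_open[OF morphism_translations(1)[OF assms(1)] assms(2)]
    morphism_open[OF morphism_translations(2)[OF assms(1)] assms(2)] by (simp_all add: pts_eq)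

lemma irr_in_carrier: "irr_in (zar) C \<Longrightarrow> C \<subseteq> carrier X"
  by (simp add: irr_in_def pts_eq)

text \<open>Separate continuity of the multiplication suffices here.\<close>

lemma irr_in_mult:
  assumes C: "irr_in (zar) C" and D: "irr_in (zar) D"
  shows "irr_in (zar) {c \<otimes> d | c d. c \<in> C \<and> d \<in> D}"
  unfolding irr_in_def
proof (intro conjI allI impI)
  note sub = irr_in_carrier[OF C] irr_in_carrier[OF D]
  show "{c \<otimes> d | c d. c \<in> C \<and> d \<in> D} \<noteq> {}" using C D by (auto simp: irr_in_def)
  show "{c \<otimes> d | c d. c \<in> C \<and> d \<in> D} \<subseteq> pts" using sub by (auto simp: pts_eq)
  fix U V assume UV: "opn U" "opn V" "U \<inter> {c \<otimes> d | c d. c \<in> C \<and> d \<in> D} \<noteq> {}"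
    "V \<inter> {c \<otimes> d | c d. c \<in> C \<and> d \<in> D} \<noteq> {}"
  then obtain c1 d1 c2 d2 where 1: "c1 \<in> C" "d1 \<in> D" "c1 \<otimes> d1 \<in> U" and 2: "c2 \<in> C" "d2 \<in> D" "c2 \<otimes> d2 \<in> V"
    by blast
  \<comment> \<open>The left factor is adjusted with both right factors fixed; afterwards the right
    factor is adjusted with the common left factor \<open>c\<close>.\<close>
  have "{a \<in> carrier X. a \<otimes> d1 \<in> U} \<inter> {a \<in> carrier X. a \<otimes> d2 \<in> V} \<inter> C \<noteq> {}"
  proof (rule irr_in_Int[OF C])
    show "opn {a \<in> carrier X. a \<otimes> d1 \<in> U}" "opn {a \<in> carrier X. a \<otimes> d2 \<in> V}"
      using 1 2 sub UV by (auto intro!: translations_open)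
  qed (use 1 2 sub in blast)+
  then obtain c where c: "c \<in> C" "c \<otimes> d1 \<in> U" "c \<otimes> d2 \<in> V" by blast
  have "{a \<in> carrier X. c \<otimes> a \<in> U} \<inter> {a \<in> carrier X. c \<otimes> a \<in> V} \<inter> D \<noteq> {}"
  proof (rule irr_in_Int[OF D])
    show "opn {a \<in> carrier X. c \<otimes> a \<in> U}" "opn {a \<in> carrier X. c \<otimes> a \<in> V}"
      using c sub UV by (auto intro!: translations_open)
  qed (use c 1 2 sub in blast)+
  then show "U \<inter> V \<inter> {c \<otimes> d | c d. c \<in> C \<and> d \<in> D} \<noteq> {}" using c(1) by blast
qed

text \<open>In an algebraic group this is the connected component of the identity. It is described
  by irreducible sets because irreducibility is what the density arguments consume.\<close>

definition id_comp :: "'a set" where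
  "id_comp = \<Union>{C. irr_in (zar) C \<and> \<one> \<in> C}"

lemma id_compI: "irr_in (zar) C \<Longrightarrow> \<one> \<in> C \<Longrightarrow> C \<subseteq> id_comp"
  by (auto simp: id_comp_def)

text \<open>The product set of two irreducible sets through the identity contains both of them and
  is again irreducible. The family defining \<open>id_comp\<close> is therefore directed, whence its
  union is irreducible and closed under multiplication.\<close>

lemma id_comp_mult: "a \<in> id_comp \<Longrightarrow> b \<in> id_comp \<Longrightarrow>
  \<exists>C. irr_in (zar) C \<and> \<one> \<in> C \<and> a \<in> C \<and> b \<in> C \<and> a \<otimes> b \<in> C"
proof -
  assume "a \<in> id_comp" "b \<in> id_comp"
  then obtain C D where CD: "irr_in (zar) C" "\<one> \<in> C" "a \<in> C"
    "irr_in (zar) D" "\<one> \<in> D" "b \<in> D" by (auto simp: id_comp_def)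
  note sub = irr_in_carrier[OF CD(1)] irr_in_carrier[OF CD(4)]
  let ?E = "{c \<otimes> d | c d. c \<in> C \<and> d \<in> D}"
  have "\<one> \<otimes> \<one> \<in> ?E" "a \<otimes> \<one> \<in> ?E" "\<one> \<otimes> b \<in> ?E" "a \<otimes> b \<in> ?E" using CD by blast+
  moreover have "\<one> \<otimes> \<one> = \<one>" "a \<otimes> \<one> = a" "\<one> \<otimes> b = b" using CD sub by auto
  ultimately show ?thesis using irr_in_mult[OF CD(1,4)] by (intro exI[of _ ?E]) auto
qed

lemma id_comp_carrier: "id_comp \<subseteq> carrier X"
  using irr_in_carrier by (auto simp: id_comp_def)

lemma one_id_comp: "\<one> \<in> id_comp"
proof -
  have "irr_in (zar) {\<one>}" by (auto simp: irr_in_def pts_eq)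
  then show ?thesis using id_compI by blast
qed

lemma irr_in_id_comp: "irr_in (zar) id_comp"
  unfolding irr_in_def
proof (intro conjI allI impI)
  show "id_comp \<noteq> {}" using one_id_comp by blast
  show "id_comp \<subseteq> pts" using id_comp_carrier pts_eq by simp
  fix U V assume UV: "opn U" "opn V" "U \<inter> id_comp \<noteq> {}" "V \<inter> id_comp \<noteq> {}"
  then obtain a b where ab: "a \<in> U" "a \<in> id_comp" "b \<in> V" "b \<in> id_comp" by blast
  obtain C where C: "irr_in (zar) C" "\<one> \<in> C" "a \<in> C" "b \<in> C"
    using id_comp_mult[OF ab(2,4)] by blast
  have "U \<inter> V \<inter> C \<noteq> {}" by (rule irr_in_Int[OF C(1) UV(1,2)]) (use ab C in blast)+
  then show "U \<inter> V \<inter> id_comp \<noteq> {}" using id_compI[OF C(1,2)] by blast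
qed

lemma subgroup_id_comp: "subgroup id_comp X"
proof (rule subgroupI)
  show "id_comp \<subseteq> carrier X" by (rule id_comp_carrier)
  show "id_comp \<noteq> {}" using one_id_comp by blast
  fix a assume a: "a \<in> id_comp"
  have "continuous_map (zar) (zar) (\<lambda>x. inv x)"
    using ag by (simp add: algebraic_group_def morphism_def)
  then have "irr_in (zar) ((\<lambda>x. inv x) ` id_comp)" by (rule irr_in_image[OF _ irr_in_id_comp])
  moreover have "\<one> \<in> (\<lambda>x. inv x) ` id_comp" using one_id_comp by (intro image_eqI[of _ _ \<one>]) simp_all
  ultimately have "(\<lambda>x. inv x) ` id_comp \<subseteq> id_comp" by (rule id_compI)
  then show "inv a \<in> id_comp" using a by blast
next
  fix a b assume "a \<in> id_comp" "b \<in> id_comp"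
  then obtain C where "irr_in (zar) C" "\<one> \<in> C" "a \<otimes> b \<in> C" using id_comp_mult by blast
  then show "a \<otimes> b \<in> id_comp" using id_compI by blast
qed

lemma id_comp_m_closed: "a \<in> id_comp \<Longrightarrow> b \<in> id_comp \<Longrightarrow> a \<otimes> b \<in> id_comp"
  and id_comp_inv: "a \<in> id_comp \<Longrightarrow> inv a \<in> id_comp"
  using subgroup_id_comp by (auto intro: subgroup.m_closed subgroup.m_inv_closed)

lemma closedin_id_comp: "closedin (zar) id_comp"
proof -
  let ?T = "zar"
  have sub: "id_comp \<subseteq> topspace ?T" using id_comp_carrier pts_eq by simp
  have "?T closure_of id_comp \<subseteq> id_comp"
    by (rule id_compI[OF irr_in_closure[OF irr_in_id_comp]]) (use closure_of_subset[OF sub] one_id_comp in blast)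
  then show ?thesis using closure_of_subset[OF sub] closure_of_eq[of ?T id_comp] by blast
qed

text \<open>Dividing an irreducible piece of the group by one of its own points gives an irreducible
  set through the identity, which lies in \<open>id_comp\<close>. One representative per piece
  suffices.\<close>

lemma finite_index_id_comp:
  "\<exists>R. finite R \<and> R \<subseteq> carrier X \<and> (\<forall>a\<in>carrier X. \<exists>r\<in>R. inv r \<otimes> a \<in> id_comp)"
proof -
  obtain \<U> where \<U>: "finite \<U>" "\<Union>\<U> = pts" "\<forall>U\<in>\<U>. \<exists>n \<phi>. chart n U \<phi>"
    using chart_cover pts_eq by auto
  have "\<exists>\<Z>. finite \<Z> \<and> pts = \<Union>\<Z> \<and> (\<forall>Z\<in>\<Z>. irr_in (zar) Z)"
  proof (rule finite_irreducible_decomposition[OF _ closedin_topspace])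
    show "\<exists>k. C (Suc k) = C k"
      if "\<And>k. closedin (zar) (C k)" "\<And>k. C (Suc k) \<subseteq> C k" for C :: "nat \<Rightarrow> 'a set"
      by (rule noetherian_chart_cover[OF \<U>(1,2)]) (use \<U>(3) that in blast)+
  qed
  then obtain \<Z> where \<Z>: "finite \<Z>" "carrier X = \<Union>\<Z>" "\<forall>Z\<in>\<Z>. irr_in (zar) Z"
    unfolding pts_eq by blast
  define z where "z Z = (SOME x. x \<in> Z)" for Z :: "'a set"
  have z: "z Z \<in> Z" if "Z \<in> \<Z>" for Z using \<Z>(3) that unfolding z_def irr_in_def by (metis some_in_eq)
  show ?thesis
  proof (intro exI[of _ "z ` \<Z>"] conjI ballI)
    show "finite (z ` \<Z>)" using \<Z> by simp
    show "z ` \<Z> \<subseteq> carrier X" using z \<Z>(2) by blast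
    fix a assume "a \<in> carrier X"
    then obtain Z where Z: "Z \<in> \<Z>" "a \<in> Z" using \<Z>(2) by blast
    have zc: "z Z \<in> carrier X" using z[OF Z(1)] Z(1) \<Z>(2) by blast
    have "continuous_map (zar) (zar) (\<lambda>x. inv (z Z) \<otimes> x)"
      using morphism_translations(2)[of "inv (z Z)"] zc by (simp add: morphism_def)
    then have "irr_in (zar) ((\<lambda>x. inv (z Z) \<otimes> x) ` Z)"
      by (rule irr_in_image) (use \<Z>(3) Z in blast)
    moreover have "inv (z Z) \<otimes> z Z \<in> (\<lambda>x. inv (z Z) \<otimes> x) ` Z" using z[OF Z(1)] by blast
    ultimately have "(\<lambda>x. inv (z Z) \<otimes> x) ` Z \<subseteq> id_comp" using zc by (intro id_compI) simp_all
    then show "\<exists>r\<in>z ` \<Z>. inv r \<otimes> a \<in> id_comp" using Z by blast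
  qed
qed

text \<open>The complement is the union of the translates \<open>F r\<close> with representatives
  outside \<open>id_comp\<close>: finitely many closed sets.\<close>

lemma opn_id_comp: "opn id_comp"
proof -
  obtain R where R: "finite R" "R \<subseteq> carrier X" "\<forall>a\<in>carrier X. \<exists>r\<in>R. inv r \<otimes> a \<in> id_comp"
    using finite_index_id_comp by blast
  define F where "F r = {a \<in> carrier X. inv r \<otimes> a \<in> id_comp}" for r
  have "closedin (zar) (F r)" if "r \<in> R" for r
  proof -
    have "opn {a \<in> carrier X. inv r \<otimes> a \<in> pts - id_comp}"
      using R(2) that closedin_id_comp by (intro translations_open) auto
    moreover have "{a \<in> carrier X. inv r \<otimes> a \<in> pts - id_comp} = pts - F r"
      using R(2) that by (auto simp: F_def pts_eq)
    ultimately show ?thesis by (simp add: closedin_def F_def pts_eq subsetI)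
  qed
  then have "closedin (zar) (\<Union>r\<in>R - id_comp. F r)" using R(1) by (intro closedin_Union) auto
  moreover have "(\<Union>r\<in>R - id_comp. F r) = pts - id_comp"
  proof (intro equalityI subsetI)
    fix a assume "a \<in> (\<Union>r\<in>R - id_comp. F r)"
    then obtain r where r: "r \<in> R" "r \<notin> id_comp" "a \<in> carrier X" "inv r \<otimes> a \<in> id_comp" by (auto simp: F_def)
    have rc: "r \<in> carrier X" using r R by blast
    have "a \<notin> id_comp"
    proof
      assume a: "a \<in> id_comp"
      have "a \<otimes> inv (inv r \<otimes> a) \<in> id_comp" by (rule id_comp_m_closed[OF a id_comp_inv[OF r(4)]])
      moreover have "a \<otimes> inv (inv r \<otimes> a) = r" using r rc by (simp add: inv_mult_group m_assoc[symmetric])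
      ultimately show False using r by simp
    qed
    then show "a \<in> pts - id_comp" using r pts_eq by simp
  next
    fix a assume "a \<in> pts - id_comp"
    then have a: "a \<in> carrier X" "a \<notin> id_comp" using pts_eq by auto
    then obtain r where r: "r \<in> R" "inv r \<otimes> a \<in> id_comp" using R by blast
    have rc: "r \<in> carrier X" using r R by blast
    have "r \<notin> id_comp"
    proof
      assume "r \<in> id_comp"
      then have "r \<otimes> (inv r \<otimes> a) \<in> id_comp" by (rule id_comp_m_closed[OF _ r(2)])
      then show False using a rc by (simp add: m_assoc[symmetric])
    qed
    then show "a \<in> (\<Union>r\<in>R - id_comp. F r)" using r a by (auto simp: F_def)
  qed
  ultimately have "opn (pts - (pts - id_comp))" by (simp add: closedin_def)
  moreover have "pts - (pts - id_comp) = id_comp" using id_comp_carrier pts_eq by auto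
  ultimately show ?thesis by simp
qed

lemma irr_in_id_comp_power:
  "finite M \<Longrightarrow> irr_in (ptop M) (\<Pi>\<^sub>E m\<in>M. id_comp)"
  by (rule irr_in_power[OF _ irr_in_id_comp])

lemma opn_id_comp_power: "openin (ptop M) (\<Pi>\<^sub>E m\<in>M. id_comp)"
  by (rule openin_power_box) (simp add: opn_id_comp)

text \<open>The image of an irreducible set through the identity is irreducible and again contains
  the identity.\<close>

lemma morphism_id_comp:
  assumes "finite M" "morphism (power_fspace M (variety X)) (variety X) \<mu>" "\<mu> (\<lambda>m\<in>M. \<one>) = \<one>"
    and x: "x \<in> (\<Pi>\<^sub>E m\<in>M. id_comp)"
  shows "\<mu> x \<in> id_comp"
proof -
  have "continuous_map (ptop M) (zar) \<mu>"
    using assms(2) by (simp add: morphism_def)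
  then have "irr_in (zar) (\<mu> ` (\<Pi>\<^sub>E m\<in>M. id_comp))"
    by (rule irr_in_image[OF _ irr_in_id_comp_power[OF assms(1)]])
  moreover have "(\<lambda>m\<in>M. \<one>) \<in> (\<Pi>\<^sub>E m\<in>M. id_comp)" using one_id_comp by simp
  then have "\<one> \<in> \<mu> ` (\<Pi>\<^sub>E m\<in>M. id_comp)" using assms(3) by (metis imageI)
  ultimately show ?thesis using id_compI x by blast
qed

text \<open>A Baire-type property. If no member were dense, each \<open>S\<close> would miss a
  nonempty principal open part of \<open>id_comp\<close>, cut out by a polynomial \<open>q S\<close>
  in a chart. A generic point, at which none of these countably many polynomials vanishes, would lie
  in no member of the cover.\<close>

lemma countable_cover_dense:
  assumes unc: "uncountable (UNIV :: 'k set)" and \<S>: "countable \<S>" "id_comp \<subseteq> \<Union>\<S>"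
  shows "\<exists>S\<in>\<S>. \<forall>V. opn V \<longrightarrow> V \<inter> id_comp \<noteq> {} \<longrightarrow> V \<inter> (id_comp \<inter> S) \<noteq> {}"
proof (rule ccontr)
  assume "\<not> ?thesis"
  then have no: "\<forall>S\<in>\<S>. \<exists>V. opn V \<and> V \<inter> id_comp \<noteq> {} \<and> V \<inter> (id_comp \<inter> S) = {}"
    unfolding bex_simps not_all not_imp not_not by simp
  obtain \<U> where "\<Union>\<U> = carrier X" "\<forall>U\<in>\<U>. \<exists>n \<phi>. chart n U \<phi>" using chart_cover by (elim exE conjE)
  moreover from this(1) obtain U where "U \<in> \<U>" "\<one> \<in> U" using one_closed by blast
  ultimately obtain n \<phi> where U: "\<one> \<in> U" and ch: "chart n U \<phi>" by blast
  have qe: "\<exists>q. q \<in> poly_funs n \<and> (\<exists>u\<in>U \<inter> id_comp. q (\<phi> u) \<noteq> 0) \<and> (\<forall>u\<in>U \<inter> id_comp. q (\<phi> u) \<noteq> 0 \<longrightarrow> u \<notin> S)"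
    if S: "S \<in> \<S>" for S
  proof -
    obtain V where V: "opn V" "V \<inter> id_comp \<noteq> {}" "V \<inter> (id_comp \<inter> S) = {}"
      using bspec[OF no S] by (elim exE conjE)
    have "V \<inter> U \<inter> id_comp \<noteq> {}"
      by (rule irr_in_Int[OF irr_in_id_comp V(1) chart_opn[OF ch] V(2)]) (use U one_id_comp in blast)
    then obtain x where x: "x \<in> V" "x \<in> U" "x \<in> id_comp" by blast
    obtain q where q: "q \<in> poly_funs n" "q (\<phi> x) \<noteq> 0" "\<forall>u\<in>U. q (\<phi> u) \<noteq> 0 \<longrightarrow> u \<in> V"
      using chart_basic_open[OF ch V(1) x(2,1)] by (elim bexE conjE)
    have "\<exists>u\<in>U \<inter> id_comp. q (\<phi> u) \<noteq> 0" using x q(2) by blast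
    moreover have "\<forall>u\<in>U \<inter> id_comp. q (\<phi> u) \<noteq> 0 \<longrightarrow> u \<notin> S" using q(3) V(3) by blast
    ultimately show ?thesis using q(1) by (intro exI[of _ q] conjI)
  qed
  have "\<forall>S\<in>\<S>. \<exists>q. q \<in> poly_funs n \<and> (\<exists>u\<in>U \<inter> id_comp. q (\<phi> u) \<noteq> 0) \<and>
     (\<forall>u\<in>U \<inter> id_comp. q (\<phi> u) \<noteq> 0 \<longrightarrow> u \<notin> S)" by (intro ballI qe)
  from bchoice[OF this] obtain q where q: "\<forall>S\<in>\<S>. q S \<in> poly_funs n \<and> (\<exists>u\<in>U \<inter> id_comp. q S (\<phi> u) \<noteq> 0) \<and>
     (\<forall>u\<in>U \<inter> id_comp. q S (\<phi> u) \<noteq> 0 \<longrightarrow> u \<notin> S)" ..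
  \<comment> \<open>Products over lists form a countable multiplicatively closed set containing 1,
    as \<open>generic_point\<close> demands.\<close>
  define m where "m l z = (\<Prod>S\<leftarrow>l. q S z)" for l z
  obtain Q where Q: "Q \<subseteq> poly_funs n" "\<phi> ` (U \<inter> id_comp) = zero_locus n Q"
    using chart_closed_image[OF ch closedin_id_comp] by (elim exE conjE)
  have "\<exists>z\<in>zero_locus n Q. \<forall>s\<in>m ` lists \<S>. s z \<noteq> 0"
  proof (rule generic_point[OF unc Q(1)])
    show "countable (m ` lists \<S>)" using \<S>(1) by simp
    have "m l \<in> poly_funs n" if "l \<in> lists \<S>" for l
      using that unfolding m_def by (induction l) (auto intro: poly_funs.intros simp: q)
    then show "m ` lists \<S> \<subseteq> poly_funs n" by blast
    show "(\<lambda>x. 1) \<in> m ` lists \<S>" by (rule image_eqI[of _ _ "[]"]) (auto simp: m_def)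
  next
    fix s t assume "s \<in> m ` lists \<S>" "t \<in> m ` lists \<S>"
    then obtain l k where "l \<in> lists \<S>" "s = m l" "k \<in> lists \<S>" "t = m k" by blast
    then show "(\<lambda>x. s x * t x) \<in> m ` lists \<S>"
      by (intro image_eqI[of _ _ "l @ k"]) (auto simp: m_def)
  next
    fix s assume "s \<in> m ` lists \<S>"
    then obtain l where l: "l \<in> lists \<S>" "s = m l" by blast
    \<comment> \<open>The extra index \<open>undefined\<close> keeps the family nonempty, so that
      the common point lies in \<open>U\<close> even for the empty list; both branches of the
      conditional are subsets of \<open>U\<close>.\<close>
    have "\<exists>x\<in>id_comp. \<forall>S\<in>insert undefined (set l). x \<in> (if S \<in> set l then {u \<in> U. q S (\<phi> u) \<noteq> 0} else U)"
    proof (rule irr_in_finite_INT[OF irr_in_id_comp])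
      fix S assume "S \<in> insert undefined (set l)"
      show "opn (if S \<in> set l then {u \<in> U. q S (\<phi> u) \<noteq> 0} else U) \<and>
          (if S \<in> set l then {u \<in> U. q S (\<phi> u) \<noteq> 0} else U) \<inter> id_comp \<noteq> {}"
      proof (cases "S \<in> set l")
        case True
        then have S: "S \<in> \<S>" using l by auto
        then have "opn {u \<in> U. q S (\<phi> u) \<noteq> 0}"
          using opn_nonzero[OF chart_opn[OF ch] chart_poly_reg[OF ch, of "q S"]] q by blast
        moreover have "\<exists>u\<in>U \<inter> id_comp. q S (\<phi> u) \<noteq> 0" using q S by blast
        ultimately show ?thesis using True by auto
      next
        case False
        then show ?thesis using chart_opn[OF ch] U one_id_comp by auto
      qed
    qed simp
    then obtain u where u: "u \<in> id_comp"
      "\<forall>S\<in>insert undefined (set l). u \<in> (if S \<in> set l then {u \<in> U. q S (\<phi> u) \<noteq> 0} else U)" ..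
    then have "u \<in> U" "\<forall>S\<in>set l. q S (\<phi> u) \<noteq> 0" by (auto split: if_splits)
    moreover from this(2) have "s (\<phi> u) \<noteq> 0" unfolding l(2) m_def by (induction l) auto
    ultimately show "\<exists>z\<in>zero_locus n Q. s z \<noteq> 0" using u(1) Q(2) by blast
  qed
  then obtain u where u: "u \<in> U \<inter> id_comp" "\<forall>s\<in>m ` lists \<S>. s (\<phi> u) \<noteq> 0" unfolding Q(2)[symmetric] by blast
  then obtain S where S: "S \<in> \<S>" "u \<in> S" using \<S>(2) by blast
  have "m [S] \<in> m ` lists \<S>" using S by simp
  then have "m [S] (\<phi> u) \<noteq> 0" by (rule bspec[OF u(2)])
  then have "q S (\<phi> u) \<noteq> 0" by (simp add: m_def)
  moreover have "\<forall>u\<in>U \<inter> id_comp. q S (\<phi> u) \<noteq> 0 \<longrightarrow> u \<notin> S" using bspec[OF q S(1)] by (elim conjE)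
  ultimately show False using u(1) S(2) by simp
qed

section \<open>Algebraically independent functions on powers\<close>

text \<open>Stands for: the corresponding power of the identity component has dimension at least
  \<open>d\<close>. The functions may live on any nonempty open part, which irreducibility makes
  harmless.\<close>

definition has_indep :: "'i set \<Rightarrow> nat \<Rightarrow> bool" where
  "has_indep I d \<longleftrightarrow> (\<exists>W f. openin (ptop I) W \<and> W \<noteq> {} \<and> W \<subseteq> (\<Pi>\<^sub>E i\<in>I. id_comp) \<and>
     (\<forall>i<d. f i \<in> preg I W) \<and> alg_indep W f d)"

lemma has_indepE:
  assumes "has_indep I d"
  obtains W f where "openin (ptop I) W" "W \<noteq> {}" "W \<subseteq> (\<Pi>\<^sub>E i\<in>I. id_comp)"
    "\<forall>i<d. f i \<in> preg I W" "alg_indep W f d"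
  using assms unfolding has_indep_def by (elim exE conjE)

lemma has_indepI:
  "openin (ptop I) W \<Longrightarrow> W \<noteq> {} \<Longrightarrow> W \<subseteq> (\<Pi>\<^sub>E i\<in>I. id_comp) \<Longrightarrow>
    (\<And>i. i < d \<Longrightarrow> f i \<in> preg I W) \<Longrightarrow> alg_indep W f d \<Longrightarrow> has_indep I d"
  unfolding has_indep_def by (intro exI conjI allI impI)

lemma monomial_sum_regular:
  assumes I: "finite I" "I \<noteq> {}" and W: "openin (ptop I) W"
    and f: "\<forall>i<d. f i \<in> preg I W"
  shows "(\<lambda>x. \<Sum>\<alpha>\<in>B. c \<alpha> * (\<Prod>i<d. f i x ^ \<alpha> i)) \<in> preg I W"
    and "openin (ptop I) {x \<in> W. (\<Sum>\<alpha>\<in>B. c \<alpha> * (\<Prod>i<d. f i x ^ \<alpha> i)) \<noteq> 0}"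
proof -
  interpret P: fun_space "power_fspace I (variety X)" by standard (rule swf_power[OF I])
  note W' = W[folded zariski_power]
  show 1: "(\<lambda>x. \<Sum>\<alpha>\<in>B. c \<alpha> * (\<Prod>i<d. f i x ^ \<alpha> i)) \<in> preg I W"
    using f by (intro P.reg_sum P.reg_mult P.reg_prod P.reg_power P.reg_const W') auto
  show "openin (ptop I) {x \<in> W. (\<Sum>\<alpha>\<in>B. c \<alpha> * (\<Prod>i<d. f i x ^ \<alpha> i)) \<noteq> 0}"
    using P.opn_nonzero[OF W' 1] by simp
qed

text \<open>The set where a relation fails is open in the irreducible power, so if it were nonempty
  it would meet \<open>Y\<close>.\<close>

lemma alg_indep_open_subset:
  assumes I: "finite I" "I \<noteq> {}" and W: "openin (ptop I) W" "W \<subseteq> (\<Pi>\<^sub>E i\<in>I. id_comp)"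
    and f: "\<forall>i<d. f i \<in> preg I W" and ind: "alg_indep W f d"
    and Y: "openin (ptop I) Y" "Y \<inter> (\<Pi>\<^sub>E i\<in>I. id_comp) \<noteq> {}"
  shows "alg_indep (Y \<inter> W) f d"
  unfolding alg_indep_def
proof (intro allI impI)
  fix s :: nat and c
  let ?B = "{..<d} \<rightarrow>\<^sub>E {..s}"
  assume zero: "\<forall>y\<in>Y \<inter> W. (\<Sum>\<alpha>\<in>?B. c \<alpha> * (\<Prod>i<d. f i y ^ \<alpha> i)) = 0"
  let ?V = "{x \<in> W. (\<Sum>\<alpha>\<in>?B. c \<alpha> * (\<Prod>i<d. f i x ^ \<alpha> i)) \<noteq> 0}"
  have "?V = {}"
  proof (rule ccontr)
    assume ne: "?V \<noteq> {}"
    then have "?V \<inter> (\<Pi>\<^sub>E i\<in>I. id_comp) \<noteq> {}" using W(2) by blast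
    then have "Y \<inter> ?V \<inter> (\<Pi>\<^sub>E i\<in>I. id_comp) \<noteq> {}"
      by (intro irr_in_Int[OF irr_in_id_comp_power[OF I(1)] Y(1) _ Y(2)] monomial_sum_regular(2)[OF I W(1) f])
    then show False using zero by blast
  qed
  then have "\<And>x. x \<in> W \<Longrightarrow> (\<Sum>\<alpha>\<in>?B. c \<alpha> * (\<Prod>i<d. f i x ^ \<alpha> i)) = 0" by blast
  then show "\<forall>\<alpha>\<in>?B. c \<alpha> = 0" using alg_indepD[OF ind] by blast
qed

lemma chart_coords_regular:
  assumes ch: "chart n U \<phi>" and I: "finite I" "I \<noteq> {}" and p: "p \<in> fun_alg (chart_coords n \<phi> I)"
  shows "p \<in> preg I (I \<rightarrow>\<^sub>E U)"
proof -
  interpret P: fun_space "power_fspace I (variety X)" by standard (rule swf_power[OF I])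
  have U: "opn U" by (rule chart_opn[OF ch])
  have op: "P.opn (I \<rightarrow>\<^sub>E U)" using openin_power_box[of I "\<lambda>_. U"] U by simp
  from p show ?thesis
  proof induction
    case (gen f)
    then obtain m i where mi: "m \<in> I" "i < n" "f = (\<lambda>x. \<phi> (x m) i)" by (auto simp: chart_coords_def)
    show ?case unfolding mi(3)
    proof (rule P.reg_restrict)
      show "P.opn {x \<in> (\<Pi>\<^sub>E m\<in>I. pts). x m \<in> U}"
        using reg_power_coord(1)[OF I(1) mi(1) U chart_coord[OF ch mi(2)]] by simp
      show "(\<lambda>x. \<phi> (x m) i) \<in> preg I {x \<in> (\<Pi>\<^sub>E m\<in>I. pts). x m \<in> U}"
        by (rule reg_power_coord(2)[OF I(1) mi(1) U chart_coord[OF ch mi(2)]])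
      show "I \<rightarrow>\<^sub>E U \<subseteq> {x \<in> (\<Pi>\<^sub>E m\<in>I. pts). x m \<in> U}"
        using openin_subset[OF U] mi(1) by (auto simp: PiE_iff)
    qed (rule op)
  qed (auto intro: P.reg_const P.reg_add P.reg_mult op)
qed

text \<open>Near a point in the box of charts all the functions become fractions in the coordinates;
  \<open>Q\<close> is their common denominator, and \<open>alg_indep_le_card\<close> counts the
  coordinates. The chart contains the identity so that its box meets the power of
  \<open>id_comp\<close>. The linear bound keeps the growth rate finite.\<close>

lemma has_indep_le:
  assumes ch: "chart n U \<phi>" "\<one> \<in> U" and I: "finite I" "I \<noteq> {}" and ind: "has_indep I d"
  shows "d \<le> n * card I"
proof -
  let ?T = "ptop I" and ?A0 = "\<Pi>\<^sub>E i\<in>I. id_comp" and ?F = "chart_coords n \<phi> I"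
  obtain W f where W: "openin ?T W" "W \<noteq> {}" "W \<subseteq> ?A0"
    and f: "\<forall>i<d. f i \<in> preg I W" "alg_indep W f d"
    using ind by (rule has_indepE)
  have op: "openin ?T (I \<rightarrow>\<^sub>E U)" using openin_power_box[of I "\<lambda>_. U"] chart_opn[OF ch(1)] by simp
  have "(\<lambda>i\<in>I. \<one>) \<in> (I \<rightarrow>\<^sub>E U) \<inter> ?A0" using ch(2) one_id_comp by auto
  then have "(I \<rightarrow>\<^sub>E U) \<inter> ?A0 \<noteq> {}" by blast
  moreover have "W \<inter> ?A0 \<noteq> {}" using W by blast
  ultimately have "(I \<rightarrow>\<^sub>E U) \<inter> W \<inter> ?A0 \<noteq> {}"
    by (rule irr_in_Int[OF irr_in_id_comp_power[OF I(1)] op W(1)])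
  then obtain x where x: "x \<in> I \<rightarrow>\<^sub>E U" "x \<in> W" "x \<in> ?A0" by blast
  have "\<forall>i<d. \<exists>pq. fst pq \<in> fun_alg ?F \<and> snd pq \<in> fun_alg ?F \<and> snd pq x \<noteq> 0 \<and>
      (\<forall>u\<in>I \<rightarrow>\<^sub>E U. snd pq u \<noteq> 0 \<longrightarrow> f i u = fst pq u / snd pq u)"
  proof (intro allI impI)
    fix i assume "i < d"
    then have "f i \<in> preg I W" using f(1) by blast
    from rational_at_regular[OF ch(1) I(1) W(1) this x(1,2)]
    obtain p q where "p \<in> fun_alg ?F" "q \<in> fun_alg ?F" "q x \<noteq> 0" "\<forall>u\<in>I \<rightarrow>\<^sub>E U. q u \<noteq> 0 \<longrightarrow> f i u = p u / q u"
      unfolding rational_at_def by (elim bexE conjE)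
    then show "\<exists>pq. fst pq \<in> fun_alg ?F \<and> snd pq \<in> fun_alg ?F \<and> snd pq x \<noteq> 0 \<and>
      (\<forall>u\<in>I \<rightarrow>\<^sub>E U. snd pq u \<noteq> 0 \<longrightarrow> f i u = fst pq u / snd pq u)" by (intro exI[of _ "(p, q)"]) simp
  qed
  then have "\<forall>i. \<exists>pq. i < d \<longrightarrow> fst pq \<in> fun_alg ?F \<and> snd pq \<in> fun_alg ?F \<and> snd pq x \<noteq> 0 \<and>
      (\<forall>u\<in>I \<rightarrow>\<^sub>E U. snd pq u \<noteq> 0 \<longrightarrow> f i u = fst pq u / snd pq u)" by simp
  from choice[OF this] obtain pq where pq: "\<forall>i<d. fst (pq i) \<in> fun_alg ?F \<and> snd (pq i) \<in> fun_alg ?F \<and> snd (pq i) x \<noteq> 0 \<and>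
      (\<forall>u\<in>I \<rightarrow>\<^sub>E U. snd (pq i) u \<noteq> 0 \<longrightarrow> f i u = fst (pq i) u / snd (pq i) u)" by blast
  define p q where "p i = fst (pq i)" and "q i = snd (pq i)" for i
  have p: "p i \<in> fun_alg ?F" "q i \<in> fun_alg ?F" "q i x \<noteq> 0" "u \<in> I \<rightarrow>\<^sub>E U \<Longrightarrow> q i u \<noteq> 0 \<Longrightarrow> f i u = p i u / q i u"
    if "i < d" for i u using pq that unfolding p_def q_def by simp_all
  obtain r where r: "r \<in> fun_alg ?F" "r x \<noteq> 0" "\<forall>u\<in>I \<rightarrow>\<^sub>E U. r u \<noteq> 0 \<longrightarrow> u \<in> W"
    using chart_power_basic_open[OF ch(1) I(1) W(1) x(1,2)] by (elim bexE conjE)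
  define Q where "Q u = r u * (\<Prod>i<d. q i u)" for u
  define P where "P i u = p i u * (r u * (\<Prod>j\<in>{..<d} - {i}. q j u))" for i u
  have Q: "Q \<in> fun_alg ?F" unfolding Q_def using p by (intro fun_alg.mult r fun_alg_prod) auto
  have P: "P i \<in> fun_alg ?F" if "i < d" for i
    unfolding P_def using p that by (intro fun_alg.mult r fun_alg_prod) auto
  interpret PP: fun_space "power_fspace I (variety X)" by standard (rule swf_power[OF I])
  let ?Y = "{u \<in> I \<rightarrow>\<^sub>E U. Q u \<noteq> 0}"
  have Yop: "openin ?T ?Y" using PP.opn_nonzero[OF _ chart_coords_regular[OF ch(1) I Q]] op by simp
  have "x \<in> ?Y" using x(1) r(2) p(3) by (simp add: Q_def)
  then have "alg_indep (?Y \<inter> W) f d"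
    by (intro alg_indep_open_subset[OF I W(1,3) f Yop]) (use x(3) in blast)
  then have "d \<le> card ?F"
  proof (rule alg_indep_le_card[OF finite_chart_coords[OF I(1)] _ P Q])
    fix i u assume i: "i < d" and u: "u \<in> ?Y \<inter> W"
    have nz: "Q u \<noteq> 0" "u \<in> I \<rightarrow>\<^sub>E U" using u by auto
    then have "r u \<noteq> 0" "\<And>j. j < d \<Longrightarrow> q j u \<noteq> 0" by (auto simp: Q_def)
    moreover have "Q u = q i u * (r u * (\<Prod>j\<in>{..<d} - {i}. q j u))"
      using i by (simp add: Q_def prod.remove[of "{..<d}" i])
    ultimately show "Q u \<noteq> 0 \<and> f i u = P i u / Q u" using nz p(4)[OF i nz(2)] i by (simp add: P_def)
  qed
  also have "\<dots> \<le> n * card I" by (rule card_chart_coords[OF I(1)])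
  finally show ?thesis .
qed

text \<open>The product criterion with a one-point second factor carrying no functions.\<close>

lemma alg_indep_pullback:
  assumes "alg_indep Y f d" "\<And>y. y \<in> Y \<Longrightarrow> \<exists>w\<in>W. \<forall>i<d. g i w = f i y"
  shows "alg_indep W g d"
  using alg_indep_Times[OF assms(1) alg_indep_0[of "{()}" "\<lambda>_ _. 0"], of W g] assms(2) by simp

lemma has_indep_reindex:
  assumes I: "finite I" "I \<noteq> {}" "finite J" and \<sigma>: "bij_betw \<sigma> I J" and ind: "has_indep I d"
  shows "has_indep J d"
proof -
  obtain W f where W: "openin (ptop I) W" "W \<noteq> {}" "W \<subseteq> (\<Pi>\<^sub>E i\<in>I. id_comp)"
    and f: "\<forall>i<d. f i \<in> preg I W" "alg_indep W f d"
    using ind by (rule has_indepE)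
  have J: "J \<noteq> {}" using I(2) \<sigma> by (auto simp: bij_betw_def)
  have \<sigma>J: "\<sigma> i \<in> J" if "i \<in> I" for i using that \<sigma> by (auto simp: bij_betw_def)
  define \<rho> where "\<rho> x = (\<lambda>i\<in>I. x (\<sigma> i))" for x :: "'c \<Rightarrow> 'a"
  have \<rho>: "morphism (power_fspace J (variety X)) (power_fspace I (variety X)) \<rho>"
    unfolding \<rho>_def by (rule morphism_tuple[OF swf_power[OF I(3) J] I(1)]) (intro morphism_coord I(3) \<sigma>J)
  let ?W = "{x \<in> topspace (zariski (power_fspace J (variety X))). \<rho> x \<in> W}"
  have lift: "\<exists>x\<in>?W. \<rho> x = y" if y: "y \<in> W" for y
  proof -
    let ?x = "\<lambda>j\<in>J. y (inv_into I \<sigma> j)"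
    have yA: "y \<in> (\<Pi>\<^sub>E i\<in>I. id_comp)" using y W(3) by blast
    have "\<rho> ?x = y"
      using yA \<sigma>J \<sigma> by (auto simp: \<rho>_def fun_eq_iff bij_betw_def inv_into_f_f PiE_iff extensional_def)
    moreover have "y (inv_into I \<sigma> j) \<in> carrier X" if "j \<in> J" for j
    proof -
      have "inv_into I \<sigma> j \<in> I" using that \<sigma> by (metis bij_betw_def inv_into_into)
      then show ?thesis using yA id_comp_carrier by (auto simp: PiE_iff)
    qed
    then have "?x \<in> topspace (zariski (power_fspace J (variety X)))" by (simp add: topspace_power pts_eq)
    ultimately show ?thesis using y by (intro bexI[of _ ?x]) simp_all
  qed
  show ?thesis
  proof (rule has_indepI)
    show "openin (ptop J) ?W"
      using morphism_open[OF \<rho>] W(1) by simp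
    show "?W \<noteq> {}" using lift W(2) by blast
    show "?W \<subseteq> (\<Pi>\<^sub>E j\<in>J. id_comp)"
    proof
      fix x assume x: "x \<in> ?W"
      have "x j \<in> id_comp" if j: "j \<in> J" for j
      proof -
        obtain i where "i \<in> I" "\<sigma> i = j" using \<sigma> j by (auto simp: bij_betw_def)
        moreover have "\<rho> x \<in> (\<Pi>\<^sub>E i\<in>I. id_comp)" using x W(3) by blast
        ultimately show ?thesis by (auto simp: \<rho>_def PiE_iff)
      qed
      then show "x \<in> (\<Pi>\<^sub>E j\<in>J. id_comp)" using x by (auto simp: topspace_power PiE_iff)
    qed
    show "(\<lambda>x. f i (\<rho> x)) \<in> preg J ?W" if "i < d" for i
      using morphism_reg[OF \<rho>, of W "f i"] W(1) f(1) that by simp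
    show "alg_indep ?W (\<lambda>i x. f i (\<rho> x)) d"
      by (rule alg_indep_pullback[OF f(2)]) (use lift in metis)
  qed
qed

text \<open>Functions of the two blocks of coordinates are independent of each other, because any
  two points of \<open>W\<close> and \<open>V\<close> can be glued. This is the superadditivity
  behind the growth rate.\<close>

lemma has_indep_Un:
  assumes I: "finite I" "I \<noteq> {}" and J: "finite J" "J \<noteq> {}" and disj: "I \<inter> J = {}"
    and indI: "has_indep I d" and indJ: "has_indep J e"
  shows "has_indep (I \<union> J) (d + e)"
proof -
  obtain W f where W: "openin (ptop I) W" "W \<noteq> {}" "W \<subseteq> (\<Pi>\<^sub>E i\<in>I. id_comp)"
    and f: "\<forall>i<d. f i \<in> preg I W" "alg_indep W f d"
    using indI by (rule has_indepE)
  obtain V g where V: "openin (ptop J) V" "V \<noteq> {}" "V \<subseteq> (\<Pi>\<^sub>E i\<in>J. id_comp)"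
    and g: "\<forall>i<e. g i \<in> preg J V" "alg_indep V g e"
    using indJ by (rule has_indepE)
  let ?P = "power_fspace (I \<union> J) (variety X)"
  have fin: "finite (I \<union> J)" "I \<union> J \<noteq> {}" using I J by auto
  interpret P: fun_space ?P by standard (rule swf_power[OF fin])
  have rI: "morphism ?P (power_fspace I (variety X)) (\<lambda>x. restrict x I)"
    using morphism_tuple[OF P.swf I(1), of "\<lambda>i x. x i"] morphism_coord[OF fin(1)] by simp
  have rJ: "morphism ?P (power_fspace J (variety X)) (\<lambda>x. restrict x J)"
    using morphism_tuple[OF P.swf J(1), of "\<lambda>i x. x i"] morphism_coord[OF fin(1)] by simp
  let ?A = "{x \<in> P.pts. restrict x I \<in> W}" and ?B = "{x \<in> P.pts. restrict x J \<in> V}"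
  have A: "P.opn ?A" and B: "P.opn ?B" using morphism_open[OF rI] morphism_open[OF rJ] W(1) V(1) by simp_all
  have AB: "P.opn (?A \<inter> ?B)" by (rule openin_Int[OF A B])
  have glue: "\<exists>x\<in>?A \<inter> ?B. restrict x I = y \<and> restrict x J = z" if y: "y \<in> W" and z: "z \<in> V" for y z
  proof -
    let ?x = "\<lambda>i\<in>I \<union> J. if i \<in> I then y i else z i"
    have yz: "y \<in> (\<Pi>\<^sub>E i\<in>I. id_comp)" "z \<in> (\<Pi>\<^sub>E i\<in>J. id_comp)" using y z W(3) V(3) by blast+
    have "restrict ?x I = y" using yz(1) by (auto simp: fun_eq_iff PiE_iff extensional_def)
    moreover have "restrict ?x J = z" using yz(2) disj by (auto simp: fun_eq_iff PiE_iff extensional_def)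
    moreover have "?x \<in> P.pts" using yz id_comp_carrier by (auto simp: topspace_power pts_eq PiE_iff)
    ultimately show ?thesis using y z by (intro bexI[of _ ?x]) simp_all
  qed
  define h where "h i x = (if i < d then f i (restrict x I) else g (i - d) (restrict x J))" for i x
  show ?thesis
  proof (rule has_indepI)
    show "openin (ptop (I \<union> J)) (?A \<inter> ?B)" using AB by simp
    show "?A \<inter> ?B \<noteq> {}" using glue W(2) V(2) by blast
    show "?A \<inter> ?B \<subseteq> (\<Pi>\<^sub>E i\<in>I \<union> J. id_comp)"
    proof
      fix x assume x: "x \<in> ?A \<inter> ?B"
      then have "restrict x I \<in> (\<Pi>\<^sub>E i\<in>I. id_comp)" "restrict x J \<in> (\<Pi>\<^sub>E i\<in>J. id_comp)" using W(3) V(3) by blast+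
      then show "x \<in> (\<Pi>\<^sub>E i\<in>I \<union> J. id_comp)" using x by (auto simp: topspace_power PiE_iff)
    qed
    show "h i \<in> P.reg (?A \<inter> ?B)" if i: "i < d + e" for i
    proof (cases "i < d")
      case True
      then have "(\<lambda>x. f i (restrict x I)) \<in> P.reg ?A" using morphism_reg[OF rI, of W "f i"] W(1) f(1) by simp
      then have "(\<lambda>x. f i (restrict x I)) \<in> P.reg (?A \<inter> ?B)" by (rule P.reg_restrict[OF A AB Int_lower1])
      then show ?thesis using True by (simp add: h_def[abs_def])
    next
      case False
      then have "i - d < e" using i by simp
      then have "(\<lambda>x. g (i - d) (restrict x J)) \<in> P.reg ?B"
        using morphism_reg[OF rJ, of V "g (i - d)"] V(1) g(1) by simp
      then have "(\<lambda>x. g (i - d) (restrict x J)) \<in> P.reg (?A \<inter> ?B)" by (rule P.reg_restrict[OF B AB Int_lower2])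
      then show ?thesis using False by (simp add: h_def[abs_def])
    qed
    show "alg_indep (?A \<inter> ?B) h (d + e)"
    proof (rule alg_indep_Times[OF f(2) g(2)])
      fix y z assume "y \<in> W" "z \<in> V"
      then obtain x where "x \<in> ?A \<inter> ?B" "restrict x I = y" "restrict x J = z" using glue by blast
      then show "\<exists>w\<in>?A \<inter> ?B. (\<forall>i<d. h i w = f i y) \<and> (\<forall>i<e. h (d + i) w = g i z)"
        by (intro bexI[of _ x]) (simp_all add: h_def)
    qed
  qed
qed

lemma has_indep_0: "has_indep I 0"
  by (rule has_indepI[OF opn_id_comp_power]) (use one_id_comp in \<open>auto simp: PiE_eq_empty_iff intro!: alg_indep_0\<close>)

end

section \<open>Finite approximations of sofic groups\<close>

text \<open>\<open>\<psi> j\<close> transplants a neighbourhood of the identity of \<open>G\<close>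
  to the vertex \<open>j\<close>. The second clause says that transplants that meet differ by a
  translation of \<open>G\<close>. Translating a window in this way leads out of \<open>F\<close>
  into products \<open>a b^-1 c\<close>, so injectivity is required on these.\<close>

definition local_approx ::
    "('g, 'm) monoid_scheme \<Rightarrow> 'g set \<Rightarrow> 'v set \<Rightarrow> 'v set \<Rightarrow> ('v \<Rightarrow> 'g \<Rightarrow> 'v) \<Rightarrow> bool" where
  "local_approx G F I J \<psi> \<longleftrightarrow>
     (\<forall>j\<in>J. \<psi> j ` F \<subseteq> I \<and> \<psi> j \<one>\<^bsub>G\<^esub> = j \<and>
        inj_on (\<psi> j) {a \<otimes>\<^bsub>G\<^esub> inv\<^bsub>G\<^esub> b \<otimes>\<^bsub>G\<^esub> c | a b c. a \<in> F \<and> b \<in> F \<and> c \<in> F}) \<and>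
     (\<forall>i\<in>J. \<forall>j\<in>J. \<forall>g\<in>F. \<forall>m\<in>F. \<psi> i m = \<psi> j g \<longrightarrow>
        (\<forall>k\<in>F. \<psi> i k = \<psi> j (g \<otimes>\<^bsub>G\<^esub> inv\<^bsub>G\<^esub> m \<otimes>\<^bsub>G\<^esub> k)))"

text \<open>Disjoint copies of one approximation, later indexed by a block on which the growth rate
  is nearly attained.\<close>

lemma local_approx_copies:
  assumes "local_approx G F I J \<psi>"
  shows "local_approx G F (I \<times> L) (J \<times> L) (\<lambda>(j, l) g. (\<psi> j g, l))"
proof -
  have inj: "inj_on (\<lambda>g. (\<psi> j g, l)) D \<longleftrightarrow> inj_on (\<psi> j) D" for j D and l :: 'd by (auto simp: inj_on_def)
  note a = assms[unfolded local_approx_def, THEN conjunct1, rule_format]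
    and b = assms[unfolded local_approx_def, THEN conjunct2, rule_format]
  show ?thesis unfolding local_approx_def
  proof (intro conjI ballI impI)
    fix p assume "p \<in> J \<times> L"
    then obtain j l where p: "p = (j, l)" "j \<in> J" "l \<in> L" by blast
    show "(case p of (j, l) \<Rightarrow> \<lambda>g. (\<psi> j g, l)) ` F \<subseteq> I \<times> L" using a[OF p(2)] p by auto
    show "(case p of (j, l) \<Rightarrow> \<lambda>g. (\<psi> j g, l)) \<one>\<^bsub>G\<^esub> = p" using a[OF p(2)] p by simp
    show "inj_on (case p of (j, l) \<Rightarrow> \<lambda>g. (\<psi> j g, l))
        {a \<otimes>\<^bsub>G\<^esub> inv\<^bsub>G\<^esub> b \<otimes>\<^bsub>G\<^esub> c | a b c. a \<in> F \<and> b \<in> F \<and> c \<in> F}"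
      unfolding p(1) prod.case inj using a[OF p(2)] by blast
  next
    fix p q g m k assume pq: "p \<in> J \<times> L" "q \<in> J \<times> L" and F: "g \<in> F" "m \<in> F" "k \<in> F"
      and eq: "(case p of (j, l) \<Rightarrow> \<lambda>g. (\<psi> j g, l)) m = (case q of (j, l) \<Rightarrow> \<lambda>g. (\<psi> j g, l)) g"
    obtain i l j l' where p: "p = (i, l)" "q = (j, l')" "i \<in> J" "j \<in> J" using pq by blast
    have "\<psi> i m = \<psi> j g" "l = l'" using eq p by simp_all
    then show "(case p of (j, l) \<Rightarrow> \<lambda>g. (\<psi> j g, l)) k =
        (case q of (j, l) \<Rightarrow> \<lambda>g. (\<psi> j g, l)) (g \<otimes>\<^bsub>G\<^esub> inv\<^bsub>G\<^esub> m \<otimes>\<^bsub>G\<^esub> k)"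
      using b[OF p(3,4) F(1,2) _ F(3)] p(1,2) by simp
  qed
qed

section \<open>Balls in labeled graphs\<close>

lemma relpow_sym: "sym R \<Longrightarrow> (a, b) \<in> R ^^ n \<Longrightarrow> (b, a) \<in> R ^^ n"
proof (induction n arbitrary: b)
  case (Suc n)
  then obtain c where "(a, c) \<in> R ^^ n" "(c, b) \<in> R" by (auto elim: relpow_Suc_E)
  then show ?case using Suc by (intro relpow_Suc_I2[of b c]) (auto dest: symD)
qed simp

lemma sym_adjacency: "sym (adjacency \<Gamma>)"
  by (auto simp: sym_def adjacency_def)

lemma ball_vertices_mono: "m \<le> n \<Longrightarrow> ball_vertices \<Gamma> v m \<subseteq> ball_vertices \<Gamma> v n"
  by (auto simp: ball_vertices_def intro: order_trans)

lemma ball_vertices_self: "v \<in> fst \<Gamma> \<Longrightarrow> v \<in> ball_vertices \<Gamma> v n"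
  by (auto simp: ball_vertices_def intro!: exI[of _ 0])

lemma ball_vertices_triangle:
  assumes "w \<in> ball_vertices \<Gamma> v m" "x \<in> ball_vertices \<Gamma> w n"
  shows "x \<in> ball_vertices \<Gamma> v (m + n)"
proof -
  obtain i j where "i \<le> m" "(v, w) \<in> adjacency \<Gamma> ^^ i" "j \<le> n" "(w, x) \<in> adjacency \<Gamma> ^^ j" "x \<in> fst \<Gamma>"
    using assms unfolding ball_vertices_def by blast
  then show ?thesis unfolding ball_vertices_def relpow_add
    by (intro CollectI conjI exI[of _ "i + j"]) (auto simp: relpow_add)
qed

lemma ball_vertices_sym: "w \<in> ball_vertices \<Gamma> v n \<Longrightarrow> v \<in> fst \<Gamma> \<Longrightarrow> v \<in> ball_vertices \<Gamma> w n"
  unfolding ball_vertices_def by (auto intro: relpow_sym[OF sym_adjacency])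

lemma ball_vertices_0: "w \<in> ball_vertices \<Gamma> v 0 \<Longrightarrow> w = v"
  by (auto simp: ball_vertices_def)

lemma ball_vertices_Suc_cases:
  assumes "w \<in> ball_vertices \<Gamma> v (Suc n)" "is_labeled_graph S \<Gamma>" "v \<in> fst \<Gamma>"
  shows "w \<in> ball_vertices \<Gamma> v n \<or> (\<exists>u\<in>ball_vertices \<Gamma> v n. (u, w) \<in> adjacency \<Gamma>)"
proof -
  obtain i where i: "i \<le> Suc n" "(v, w) \<in> adjacency \<Gamma> ^^ i" "w \<in> fst \<Gamma>"
    using assms(1) unfolding ball_vertices_def by blast
  show ?thesis
  proof (cases i)
    case 0
    then have "w = v" using i by simp
    then show ?thesis using ball_vertices_self[OF assms(3)] by blast
  next
    case (Suc k)
    then obtain u where u: "(v, u) \<in> adjacency \<Gamma> ^^ k" "(u, w) \<in> adjacency \<Gamma>"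
      using i(2) by (auto elim: relpow_Suc_E)
    have "u \<in> fst \<Gamma>" using u(2) assms(2) by (auto simp: adjacency_def is_labeled_graph_def)
    then have "u \<in> ball_vertices \<Gamma> v n" using u(1) i(1) Suc by (auto simp: ball_vertices_def)
    then show ?thesis using u(2) by blast
  qed
qed

lemma ball_vertices_step:
  assumes "u \<in> ball_vertices \<Gamma> v n" "(u, w) \<in> adjacency \<Gamma>" "w \<in> fst \<Gamma>"
  shows "w \<in> ball_vertices \<Gamma> v (Suc n)"
proof -
  obtain i where "i \<le> n" "(v, u) \<in> adjacency \<Gamma> ^^ i" using assms(1) unfolding ball_vertices_def by blast
  then show ?thesis using assms(2,3) unfolding ball_vertices_def
    by (intro CollectI conjI exI[of _ "Suc i"]) (auto intro: relpow_Suc_I)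
qed

section \<open>Balls in the Cayley graph\<close>

locale cayley = group G for G :: "('g, 'm) monoid_scheme" (structure) +
  fixes S :: "'g set"
  assumes fsgs: "finite_symmetric_generating_set G S"
begin

abbreviation cay :: "('g, 'g) labeled_graph" where "cay \<equiv> cayley_graph G S"

definition B :: "nat \<Rightarrow> 'g set" where "B n = ball_vertices cay \<one> n"

lemma S: "finite S" "S \<subseteq> carrier G" "s \<in> S \<Longrightarrow> inv s \<in> S" "generate G S = carrier G"
  using fsgs by (auto simp: finite_symmetric_generating_set_def)

lemma edge_cay: "(g, s, h) \<in> snd cay \<longleftrightarrow> g \<in> carrier G \<and> s \<in> S \<and> h = g \<otimes> s"
  by (auto simp: cayley_graph_def)

lemma labeled_cay: "is_labeled_graph S cay"
  using S by (auto simp: is_labeled_graph_def cayley_graph_def)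

lemma fst_cay [simp]: "fst cay = carrier G" by (simp add: cayley_graph_def)

text \<open>An edge labelled \<open>s\<close>, traversed backwards, is right multiplication by
  \<open>inv s\<close>, and \<open>S\<close> is symmetric; orientation can thus be
  forgotten.\<close>

lemma adj_cay: "(g, h) \<in> adjacency cay \<longleftrightarrow> g \<in> carrier G \<and> (\<exists>s\<in>S. h = g \<otimes> s)"
proof
  assume "(g, h) \<in> adjacency cay"
  then obtain s where "(g, s, h) \<in> snd cay \<or> (h, s, g) \<in> snd cay" by (auto simp: adjacency_def)
  then consider "g \<in> carrier G" "s \<in> S" "h = g \<otimes> s" | "h \<in> carrier G" "s \<in> S" "g = h \<otimes> s"
    by (auto simp: edge_cay)
  then show "g \<in> carrier G \<and> (\<exists>s\<in>S. h = g \<otimes> s)"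
  proof cases
    case 2
    then have "s \<in> carrier G" using S by blast
    then have "h = g \<otimes> inv s" "g \<in> carrier G" using 2 by (simp_all add: m_assoc)
    then show ?thesis using S(3)[OF 2(2)] by blast
  qed blast
qed (auto simp: adjacency_def edge_cay)

lemma B_carrier: "B n \<subseteq> carrier G" by (auto simp: B_def ball_vertices_def)

lemma one_B: "\<one> \<in> B n" unfolding B_def by (rule ball_vertices_self) simp

lemma B_0: "g \<in> B 0 \<Longrightarrow> g = \<one>" unfolding B_def by (rule ball_vertices_0)

lemma B_mono: "m \<le> n \<Longrightarrow> B m \<subseteq> B n" unfolding B_def by (rule ball_vertices_mono)

lemma B_Suc: "g \<in> B n \<Longrightarrow> s \<in> S \<Longrightarrow> g \<otimes> s \<in> B (Suc n)"
proof -
  assume g: "g \<in> B n" and s: "s \<in> S"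
  have "g \<in> carrier G" "s \<in> carrier G" using g s B_carrier S by blast+
  then show ?thesis using g s unfolding B_def by (intro ball_vertices_step[of g]) (auto simp: adj_cay)
qed

lemma B_Suc_cases: "h \<in> B (Suc n) \<Longrightarrow> h \<in> B n \<or> (\<exists>g\<in>B n. \<exists>s\<in>S. h = g \<otimes> s)"
  unfolding B_def using ball_vertices_Suc_cases[OF _ labeled_cay, of h \<one> n] by (auto simp: adj_cay)

lemma B_mult: "g \<in> B m \<Longrightarrow> h \<in> B n \<Longrightarrow> g \<otimes> h \<in> B (m + n)"
proof (induction n arbitrary: h)
  case 0
  then show ?case using B_0 B_carrier[of m] by force
next
  case (Suc n)
  from B_Suc_cases[OF Suc.prems(2)] show ?case
  proof
    assume "h \<in> B n"
    then show ?thesis using Suc.IH Suc.prems B_mono[of "m + n" "m + Suc n"] by auto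
  next
    assume "\<exists>g\<in>B n. \<exists>s\<in>S. h = g \<otimes> s"
    then obtain k s where k: "k \<in> B n" "s \<in> S" "h = k \<otimes> s" by blast
    have "g \<in> carrier G" "k \<in> carrier G" "s \<in> carrier G" using Suc.prems k B_carrier S by blast+
    then have "g \<otimes> h = (g \<otimes> k) \<otimes> s" using k by (simp add: m_assoc)
    then show ?thesis using B_Suc[OF Suc.IH[OF Suc.prems(1) k(1)] k(2)] by simp
  qed
qed

lemma finite_B: "finite (B n)"
proof (induction n)
  case 0 have "B 0 \<subseteq> {\<one>}" using B_0 by blast
  then show ?case by (rule finite_subset) simp
next
  case (Suc n)
  have "B (Suc n) \<subseteq> B n \<union> (\<lambda>(g, s). g \<otimes> s) ` (B n \<times> S)" using B_Suc_cases by force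
  then show ?case by (rule finite_subset) (use Suc S in simp)
qed

lemma B_cover: "g \<in> carrier G \<Longrightarrow> \<exists>n. g \<in> B n"
proof -
  assume "g \<in> carrier G"
  then have "g \<in> generate G S" using S by simp
  then show ?thesis
  proof induction
    case one show ?case using one_B by blast
  next
    case (incl s)
    then have "\<one> \<otimes> s \<in> B (Suc 0)" by (intro B_Suc one_B)
    moreover have "s \<in> carrier G" using incl S(2) by blast
    ultimately show ?case by (intro exI[of _ "Suc 0"]) simp
  next
    case (inv s)
    have "\<one> \<otimes> inv s \<in> B (Suc 0)" by (intro B_Suc one_B S(3) inv)
    moreover have "s \<in> carrier G" using inv S(2) by blast
    ultimately show ?case by (intro exI[of _ "Suc 0"]) simp
  next
    case (eng g h)
    then show ?case using B_mult by blast
  qed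
qed

lemma countable_carrier: "countable (carrier G)"
proof -
  have "carrier G \<subseteq> (\<Union>n. B n)" using B_cover by blast
  moreover have "countable (\<Union>n. B n)" using finite_B by (intro countable_UN) (auto intro: countable_finite)
  ultimately show ?thesis by (rule countable_subset)
qed

lemma finite_subset_B: "finite F \<Longrightarrow> F \<subseteq> carrier G \<Longrightarrow> \<exists>n. F \<subseteq> B n"
proof (induction F rule: finite_induct)
  case (insert g F)
  then obtain m where "F \<subseteq> B m" by auto
  moreover obtain n where "g \<in> B n" using B_cover[of g] insert.prems by auto
  ultimately have "insert g F \<subseteq> B (max m n)" using B_mono[of m "max m n"] B_mono[of n "max m n"] by auto
  then show ?case by blast
qed auto

lemma B_inv: "g \<in> B n \<Longrightarrow> inv g \<in> B n"
proof (induction n arbitrary: g)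
  case 0 then show ?case using B_0 by fastforce
next
  case (Suc n)
  from B_Suc_cases[OF Suc.prems] show ?case
  proof
    assume "g \<in> B n" then show ?thesis using Suc.IH B_mono[of n "Suc n"] by auto
  next
    assume "\<exists>h\<in>B n. \<exists>s\<in>S. g = h \<otimes> s"
    then obtain h s where h: "h \<in> B n" "s \<in> S" "g = h \<otimes> s" by blast
    have c: "h \<in> carrier G" "s \<in> carrier G" using h B_carrier S by blast+
    have "\<one> \<otimes> inv s \<in> B (Suc 0)" using S h by (intro B_Suc one_B) auto
    then have "inv s \<in> B 1" using c by simp
    then have "inv s \<otimes> inv h \<in> B (1 + n)" by (rule B_mult[OF _ Suc.IH[OF h(1)]])
    then show ?thesis using h c by (simp add: inv_mult_group)
  qed
qed

end

locale good_ball = cayley G S for G :: "('g, 'm) monoid_scheme" (structure) and S +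
  fixes \<Gamma> :: "('v, 'g) labeled_graph" and R :: nat and v :: 'v and \<phi> :: "'g \<Rightarrow> 'v"
  assumes labeled: "is_labeled_graph S \<Gamma>" and v: "v \<in> fst \<Gamma>"
    and iso: "labeled_graph_iso (graph_ball cay \<one> R) (graph_ball \<Gamma> v R) \<phi>" and \<phi>_one: "\<phi> \<one> = v"
begin

lemma bij: "bij_betw \<phi> (B R) (ball_vertices \<Gamma> v R)"
  using iso by (simp add: labeled_graph_iso_def graph_ball_def B_def)

lemma edges: "g \<in> B R \<Longrightarrow> h \<in> B R \<Longrightarrow> (\<phi> g, s, \<phi> h) \<in> snd \<Gamma> \<longleftrightarrow> s \<in> S \<and> h = g \<otimes> s"
proof -
  assume g: "g \<in> B R" and h: "h \<in> B R"
  have "\<phi> g \<in> ball_vertices \<Gamma> v R" "\<phi> h \<in> ball_vertices \<Gamma> v R" using bij g h by (auto simp: bij_betw_def)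
  moreover have "(g, s, h) \<in> snd (graph_ball cay \<one> R) \<longleftrightarrow> (\<phi> g, s, \<phi> h) \<in> snd (graph_ball \<Gamma> v R)"
    using iso g h by (simp add: labeled_graph_iso_def graph_ball_def B_def)
  ultimately show ?thesis using g h B_carrier by (auto simp: graph_ball_def edge_cay B_def[symmetric])
qed

text \<open>The isomorphism is given for radius \<open>R\<close> only. Following edges outward from
  the centre shows that it maps each smaller ball into the ball of the same radius; the converse
  inclusion is \<open>ball_\<phi>\<close>.\<close>

lemma \<phi>_ball: "n \<le> R \<Longrightarrow> g \<in> B n \<Longrightarrow> \<phi> g \<in> ball_vertices \<Gamma> v n"
proof (induction n arbitrary: g)
  case 0
  then show ?case using B_0[of g] \<phi>_one ball_vertices_self[OF v, of 0] by simp
next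
  case (Suc n)
  from B_Suc_cases[OF Suc.prems(2)] show ?case
  proof
    assume "g \<in> B n" then show ?thesis using Suc ball_vertices_mono[of n "Suc n" \<Gamma> v] by auto
  next
    assume "\<exists>h\<in>B n. \<exists>s\<in>S. g = h \<otimes> s"
    then obtain h s where h: "h \<in> B n" "s \<in> S" "g = h \<otimes> s" by blast
    have R: "h \<in> B R" "g \<in> B R" using h(1) Suc.prems B_mono[of n R] B_mono[of "Suc n" R] by auto
    then have "(\<phi> h, s, \<phi> g) \<in> snd \<Gamma>" using edges h by blast
    then have "(\<phi> h, \<phi> g) \<in> adjacency \<Gamma>" by (auto simp: adjacency_def)
    moreover have "\<phi> h \<in> ball_vertices \<Gamma> v n" using Suc h by simp
    moreover have "\<phi> g \<in> fst \<Gamma>" using bij R by (auto simp: bij_betw_def ball_vertices_def)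
    ultimately show ?thesis by (intro ball_vertices_step)
  qed
qed

lemma ball_\<phi>: "n \<le> R \<Longrightarrow> w \<in> ball_vertices \<Gamma> v n \<Longrightarrow> \<exists>g\<in>B n. \<phi> g = w"
proof (induction n arbitrary: w)
  case 0
  then have "w = v" using ball_vertices_0[of w \<Gamma> v] by simp
  then show ?case using \<phi>_one one_B[of 0] by (intro bexI[of _ \<one>]) simp_all
next
  case (Suc n)
  from ball_vertices_Suc_cases[OF Suc.prems(2) labeled v] show ?case
  proof
    assume "w \<in> ball_vertices \<Gamma> v n"
    then obtain g where "g \<in> B n" "\<phi> g = w" using Suc.IH[of w] Suc.prems(1) by auto
    then show ?thesis using B_mono[of n "Suc n"] by (intro bexI[of _ g]) auto
  next
    assume "\<exists>u\<in>ball_vertices \<Gamma> v n. (u, w) \<in> adjacency \<Gamma>"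
    then obtain u where u: "u \<in> ball_vertices \<Gamma> v n" "(u, w) \<in> adjacency \<Gamma>" by blast
    then obtain h where h: "h \<in> B n" "\<phi> h = u" using Suc.IH[of u] Suc.prems(1) by auto
    have "w \<in> ball_vertices \<Gamma> v R" using Suc.prems ball_vertices_mono[of "Suc n" R \<Gamma> v] by blast
    then have "w \<in> \<phi> ` B R" using bij by (simp add: bij_betw_def)
    then obtain k where k: "k \<in> B R" "\<phi> k = w" by blast
    have hR: "h \<in> B R" using h(1) Suc.prems B_mono[of n R] by auto
    have c: "h \<in> carrier G" "k \<in> carrier G" using hR k(1) B_carrier by blast+
    obtain s where "(\<phi> h, s, \<phi> k) \<in> snd \<Gamma> \<or> (\<phi> k, s, \<phi> h) \<in> snd \<Gamma>" using u(2) h k by (auto simp: adjacency_def)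
    then consider "s \<in> S" "k = h \<otimes> s" | "s \<in> S" "h = k \<otimes> s" using edges hR k(1) by blast
    then have "\<exists>s\<in>S. k = h \<otimes> s"
    proof cases
      case 2
      then have "s \<in> carrier G" using S by blast
      then have "k = h \<otimes> inv s" using 2 c by (simp add: m_assoc)
      then show ?thesis using S(3)[OF 2(1)] by blast
    qed blast
    then show ?thesis using B_Suc[OF h(1)] k by blast
  qed
qed

end

section \<open>Overlapping good balls\<close>

context cayley
begin

text \<open>Inside a good ball an edge leaving a given vertex with a given label has only one
  possible endpoint. Spelling \<open>k\<close> as a word and walking from \<open>w\<close> therefore
  leads to the same vertex in both charts; the bound \<open>a + b \<le> R\<close> keeps the walk
  inside the ball around \<open>v\<close>.\<close>

lemma good_balls_compatible:
  assumes gv: "good_ball G S \<Gamma> R v \<phi>" and gw: "good_ball G S \<Gamma> R w \<theta>"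
    and w: "w = \<phi> h" "h \<in> B a" and "a + b \<le> R" and "k \<in> B b"
  shows "\<theta> k = \<phi> (h \<otimes> k)"
  using assms(5,6)
proof (induction b arbitrary: k)
  case 0
  have "h \<in> carrier G" using w B_carrier by blast
  then show ?case using B_0[OF 0(2)] good_ball.\<phi>_one[OF gw] w by simp
next
  case (Suc b)
  from B_Suc_cases[OF Suc.prems(2)] show ?case
  proof
    assume "k \<in> B b" then show ?thesis using Suc by simp
  next
    assume "\<exists>g\<in>B b. \<exists>s\<in>S. k = g \<otimes> s"
    then obtain g s where g: "g \<in> B b" "s \<in> S" "k = g \<otimes> s" by blast
    have IH: "\<theta> g = \<phi> (h \<otimes> g)" using Suc.IH[OF _ g(1)] Suc.prems by simp
    have gR: "g \<in> B R" "k \<in> B R" using g(1) Suc.prems B_mono[of b R] B_mono[of "Suc b" R] by auto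
    then have e: "(\<theta> g, s, \<theta> k) \<in> snd \<Gamma>" using good_ball.edges[OF gw] g by blast
    have "\<theta> k \<in> ball_vertices \<Gamma> w (Suc b)"
      by (rule good_ball.\<phi>_ball[OF gw]) (use Suc.prems in auto)
    moreover have "w \<in> ball_vertices \<Gamma> v a"
      unfolding w(1) by (rule good_ball.\<phi>_ball[OF gv]) (use Suc.prems w in auto)
    ultimately have "\<theta> k \<in> ball_vertices \<Gamma> v (a + Suc b)" by (rule ball_vertices_triangle[rotated])
    then obtain k' where k': "k' \<in> B (a + Suc b)" "\<phi> k' = \<theta> k"
      using good_ball.ball_\<phi>[OF gv Suc.prems(1)] by blast
    have "h \<otimes> g \<in> B (a + b)" by (rule B_mult[OF w(2) g(1)])
    then have "h \<otimes> g \<in> B R" "k' \<in> B R" using k'(1) B_mono[of "a + b" R] B_mono[of "a + Suc b" R] Suc.prems by auto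
    then have "k' = (h \<otimes> g) \<otimes> s" using good_ball.edges[OF gv, of "h \<otimes> g" k' s] e IH k'(2) by simp
    moreover have "h \<in> carrier G" "g \<in> carrier G" "s \<in> carrier G" using w(2) g B_carrier S by blast+
    ultimately have "k' = h \<otimes> k" using g(3) by (simp add: m_assoc)
    then show ?thesis using k'(2) by simp
  qed
qed

text \<open>If two transplants meet, their centres are at distance at most \<open>2 * t\<close>, so
  \<open>i\<close> is \<open>\<psi> j h\<close> for some \<open>h\<close>; compatibility rewrites
  everything in the chart at \<open>j\<close>, where injectivity identifies \<open>h\<close> as
  \<open>g \<otimes> inv m\<close>. All group elements involved have length at most
  \<open>3 * t\<close> and lie in the ball of radius \<open>4 * t\<close>.\<close>

lemma good_vertices_local_approx:
  assumes \<Gamma>: "is_labeled_graph S \<Gamma>" and F: "F \<subseteq> B t"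
  shows "\<exists>\<psi>. local_approx G F (fst \<Gamma>) (good_vertices G S \<Gamma> (4 * t)) \<psi>"
proof -
  let ?J = "good_vertices G S \<Gamma> (4 * t)" and ?R = "4 * t"
  have "\<forall>v\<in>?J. \<exists>\<phi>. good_ball G S \<Gamma> ?R v \<phi>"
  proof
    fix v assume "v \<in> ?J"
    then obtain \<phi> where "v \<in> fst \<Gamma>" "labeled_graph_iso (graph_ball cay \<one> ?R) (graph_ball \<Gamma> v ?R) \<phi>" "\<phi> \<one> = v"
      unfolding good_vertices_def by blast
    then have "good_ball G S \<Gamma> ?R v \<phi>" using \<Gamma> by unfold_locales
    then show "\<exists>\<phi>. good_ball G S \<Gamma> ?R v \<phi>" by (rule exI[of _ \<phi>])
  qed
  from bchoice[OF this] obtain \<psi> where \<psi>: "\<forall>v\<in>?J. good_ball G S \<Gamma> ?R v (\<psi> v)" ..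
  have inj: "inj_on (\<psi> v) (B ?R)" if "v \<in> ?J" for v
    using good_ball.bij[OF bspec[OF \<psi> that]] by (simp add: bij_betw_def)
  have B3: "a \<otimes> inv b \<otimes> c \<in> B (3 * t)" if "a \<in> F" "b \<in> F" "c \<in> F" for a b c
  proof -
    have "a \<otimes> inv b \<otimes> c \<in> B (t + t + t)" using that F by (intro B_mult B_inv) auto
    moreover have "t + t + t = 3 * t" by simp
    ultimately show ?thesis by metis
  qed
  have "local_approx G F (fst \<Gamma>) ?J \<psi>"
    unfolding local_approx_def
  proof (intro conjI ballI impI)
    fix j assume j: "j \<in> ?J"
    note gj = bspec[OF \<psi> j]
    show "\<psi> j ` F \<subseteq> fst \<Gamma>"
      using good_ball.\<phi>_ball[OF gj, of t] F by (force simp: ball_vertices_def)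
    show "\<psi> j \<one> = j" by (rule good_ball.\<phi>_one[OF gj])
    have "{a \<otimes> inv b \<otimes> c | a b c. a \<in> F \<and> b \<in> F \<and> c \<in> F} \<subseteq> B ?R"
      using B3 B_mono[of "3 * t" ?R] by auto
    then show "inj_on (\<psi> j) {a \<otimes> inv b \<otimes> c | a b c. a \<in> F \<and> b \<in> F \<and> c \<in> F}"
      by (rule inj_on_subset[OF inj[OF j]])
  next
    fix i j g m k assume ij: "i \<in> ?J" "j \<in> ?J" and gm: "g \<in> F" "m \<in> F" "\<psi> i m = \<psi> j g" and k: "k \<in> F"
    note gi = bspec[OF \<psi> ij(1)] and gj = bspec[OF \<psi> ij(2)]
    have iV: "i \<in> fst \<Gamma>" using ij(1) by (simp add: good_vertices_def)
    have "\<psi> j g \<in> ball_vertices \<Gamma> j t" by (rule good_ball.\<phi>_ball[OF gj]) (use gm F in auto)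
    moreover have "\<psi> i m \<in> ball_vertices \<Gamma> i t" by (rule good_ball.\<phi>_ball[OF gi]) (use gm F in auto)
    then have "i \<in> ball_vertices \<Gamma> (\<psi> j g) t" unfolding gm(3) by (rule ball_vertices_sym[OF _ iV])
    ultimately have "i \<in> ball_vertices \<Gamma> j (t + t)" by (rule ball_vertices_triangle)
    then obtain h where h: "h \<in> B (t + t)" "\<psi> j h = i" using good_ball.ball_\<phi>[OF gj, of "t + t"] by auto
    have comp: "\<psi> i k' = \<psi> j (h \<otimes> k')" if "k' \<in> F" for k'
      by (rule good_balls_compatible[OF gj gi h(2)[symmetric] h(1), of t]) (use that F in auto)
    have "\<psi> j (h \<otimes> m) = \<psi> j g" using comp[OF gm(2)] gm(3) by simp
    moreover have "h \<otimes> m \<in> B (t + t + t)" using gm F by (intro B_mult h) auto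
    then have "h \<otimes> m \<in> B ?R" "g \<in> B ?R" using B_mono[of "t + t + t" ?R] B_mono[of t ?R] gm F by auto
    ultimately have hm: "h \<otimes> m = g" using inj[OF ij(2)] by (auto dest: inj_onD)
    have c: "h \<in> carrier G" "m \<in> carrier G" using h(1) gm F B_carrier by blast+
    have "g \<otimes> inv m = h" using hm c by (auto simp: m_assoc)
    then show "\<psi> i k = \<psi> j (g \<otimes> inv m \<otimes> k)" using comp[OF k] by simp
  qed
  then show ?thesis by (rule exI[of _ \<psi>])
qed

end

lemma sofic_local_approx:
  assumes G: "group G" and "sofic G" and F: "finite F" "F \<subseteq> carrier G" and \<epsilon>: "\<epsilon> > 0"
  shows "\<exists>(V :: nat set) J \<psi>. finite V \<and> V \<noteq> {} \<and> J \<subseteq> V \<and> real (card J) \<ge> (1 - \<epsilon>) * real (card V) \<and>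
     local_approx G F V J \<psi>"
proof -
  obtain S where S: "finite_symmetric_generating_set G S"
    and so: "\<forall>r::nat. \<forall>\<epsilon>::real. r > 0 \<longrightarrow> \<epsilon> > 0 \<longrightarrow>
           (\<exists>\<Gamma> :: (nat, 'a) labeled_graph.
              is_labeled_graph S \<Gamma> \<and> finite (fst \<Gamma>) \<and> fst \<Gamma> \<noteq> {} \<and>
              real (card (good_vertices G S \<Gamma> r)) \<ge> (1 - \<epsilon>) * real (card (fst \<Gamma>)))"
    using \<open>sofic G\<close> unfolding sofic_def by (elim exE conjE)
  interpret cayley G S using G S by (simp add: cayley_def cayley_axioms_def)
  obtain t0 where "F \<subseteq> B t0" using finite_subset_B[OF F] by blast
  \<comment> \<open>The successor ensures a positive radius, for which alone \<open>sofic\<close>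
    provides a graph.\<close>
  then have Ft: "F \<subseteq> B (Suc t0)" using B_mono[of t0 "Suc t0"] by auto
  have "4 * Suc t0 > 0" by simp
  from so[rule_format, OF this \<epsilon>]
  obtain \<Gamma> :: "(nat, 'a) labeled_graph" where \<Gamma>: "is_labeled_graph S \<Gamma>" "finite (fst \<Gamma>)" "fst \<Gamma> \<noteq> {}"
    "real (card (good_vertices G S \<Gamma> (4 * Suc t0))) \<ge> (1 - \<epsilon>) * real (card (fst \<Gamma>))"
    by (elim exE conjE)
  obtain \<psi> where "local_approx G F (fst \<Gamma>) (good_vertices G S \<Gamma> (4 * Suc t0)) \<psi>"
    using good_vertices_local_approx[OF \<Gamma>(1) Ft] by (elim exE)
  moreover have "good_vertices G S \<Gamma> (4 * Suc t0) \<subseteq> fst \<Gamma>" by (auto simp: good_vertices_def)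
  ultimately show ?thesis using \<Gamma> by blast
qed

lemma sofic_countable: "group G \<Longrightarrow> sofic G \<Longrightarrow> countable (carrier G)"
  unfolding sofic_def using cayley.countable_carrier by (auto simp: cayley_def cayley_axioms_def)

section \<open>Cosets of the identity component\<close>

context alg_grp
begin

definition coset :: "'a \<Rightarrow> 'a set" where
  "coset a = {b \<in> carrier X. inv a \<otimes> b \<in> id_comp}"

lemma coset_eq_iff:
  assumes "a \<in> carrier X" "b \<in> carrier X"
  shows "coset a = coset b \<longleftrightarrow> inv a \<otimes> b \<in> id_comp"
proof
  assume "coset a = coset b"
  moreover have "b \<in> coset b" using assms one_id_comp by (simp add: coset_def)
  ultimately have "b \<in> coset a" by simp
  then show "inv a \<otimes> b \<in> id_comp" by (simp add: coset_def)
next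
  assume ab: "inv a \<otimes> b \<in> id_comp"
  have "inv a \<otimes> c \<in> id_comp \<longleftrightarrow> inv b \<otimes> c \<in> id_comp" if c: "c \<in> carrier X" for c
  proof
    assume "inv b \<otimes> c \<in> id_comp"
    then have "(inv a \<otimes> b) \<otimes> (inv b \<otimes> c) \<in> id_comp" by (rule id_comp_m_closed[OF ab])
    moreover have "(inv a \<otimes> b) \<otimes> (inv b \<otimes> c) = inv a \<otimes> c"
      using assms c by (metis inv_closed inv_solve_left m_assoc m_closed)
    ultimately show "inv a \<otimes> c \<in> id_comp" by simp
  next
    assume "inv a \<otimes> c \<in> id_comp"
    then have "inv (inv a \<otimes> b) \<otimes> (inv a \<otimes> c) \<in> id_comp" by (rule id_comp_m_closed[OF id_comp_inv[OF ab]])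
    moreover have "inv (inv a \<otimes> b) \<otimes> (inv a \<otimes> c) = inv b \<otimes> c"
      using assms c by (metis inv_closed inv_inv inv_mult_group inv_solve_left m_assoc m_closed)
    ultimately show "inv b \<otimes> c \<in> id_comp" by simp
  qed
  then show "coset a = coset b" by (auto simp: coset_def)
qed

lemma coset_image:
  assumes R: "R \<subseteq> carrier X" "\<forall>a\<in>carrier X. \<exists>r\<in>R. inv r \<otimes> a \<in> id_comp"
  shows "coset ` carrier X = coset ` R"
proof (intro equalityI subsetI)
  fix q assume "q \<in> coset ` carrier X"
  then obtain a where a: "a \<in> carrier X" "q = coset a" by blast
  then obtain r where r: "r \<in> R" "inv r \<otimes> a \<in> id_comp" using R(2) by blast
  then have "coset r = coset a" using coset_eq_iff[of r a] a R(1) by blast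
  then show "q \<in> coset ` R" using r a by blast
qed (use R(1) in blast)

end

section \<open>Group cellular automata on finite approximations\<close>

locale group_ca = G: group G + X: alg_grp X
  for G :: "('g, 'm) monoid_scheme" (structure) and X :: "('a, 'k::alg_closed_field) alg_group" +
  fixes \<tau> :: "('g \<Rightarrow> 'a) \<Rightarrow> ('g \<Rightarrow> 'a)" and M :: "'g set" and \<mu> :: "('g \<Rightarrow> 'a) \<Rightarrow> 'a"
  assumes rule: "local_rule G (carrier X) \<tau> M \<mu>"
    and hom: "alg_group_hom (alg_group_power M X) X \<mu>"
    and configs: "\<tau> \<in> configs G (carrier X) \<rightarrow> configs G (carrier X)"
begin

abbreviation A :: "'a set" where "A \<equiv> carrier X"
abbreviation e :: 'a where "e \<equiv> \<one>\<^bsub>X\<^esub>"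
abbreviation xmult :: "'a \<Rightarrow> 'a \<Rightarrow> 'a" (infixl \<open>\<cdot>\<close> 70) where "a \<cdot> b \<equiv> a \<otimes>\<^bsub>X\<^esub> b"

lemma M: "finite M" "M \<subseteq> carrier G" using rule by (auto simp: local_rule_def)

lemma \<tau>_eq:
  assumes "c \<in> configs G A" "g \<in> carrier G"
  shows "\<tau> c g = \<mu> (\<lambda>m\<in>M. c (g \<otimes> m))"
proof -
  have "\<tau> c g = \<mu> (restrict (shift G (inv g) c) M)" using rule assms by (simp add: local_rule_def)
  also have "restrict (shift G (inv g) c) M = (\<lambda>m\<in>M. c (g \<otimes> m))"
    using assms M by (auto simp: shift_def fun_eq_iff)
  finally show ?thesis .
qed

lemma \<mu>_closed: "x \<in> M \<rightarrow>\<^sub>E A \<Longrightarrow> \<mu> x \<in> A"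
  using rule by (auto simp: local_rule_def)

lemma \<mu>_mult: "x \<in> M \<rightarrow>\<^sub>E A \<Longrightarrow> y \<in> M \<rightarrow>\<^sub>E A \<Longrightarrow> \<mu> (\<lambda>m\<in>M. x m \<cdot> y m) = \<mu> x \<cdot> \<mu> y"
  using hom by (auto simp: alg_group_hom_def hom_def alg_group_power_def product_group_def)

lemma \<mu>_morphism: "morphism (power_fspace M (variety X)) (variety X) \<mu>"
  using hom by (simp add: alg_group_hom_def alg_group_power_def)

lemma \<mu>_one: "\<mu> (\<lambda>m\<in>M. e) = e"
proof -
  have o: "(\<lambda>m\<in>M. e) \<in> M \<rightarrow>\<^sub>E A" by simp
  have "\<mu> (\<lambda>m\<in>M. e) \<cdot> \<mu> (\<lambda>m\<in>M. e) = \<mu> (\<lambda>m\<in>M. (\<lambda>m\<in>M. e) m \<cdot> (\<lambda>m\<in>M. e) m)"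
    by (rule \<mu>_mult[OF o o, symmetric])
  also have "(\<lambda>m\<in>M. (\<lambda>m\<in>M. e) m \<cdot> (\<lambda>m\<in>M. e) m) = (\<lambda>m\<in>M. e)" by (auto simp: fun_eq_iff)
  finally show ?thesis unfolding X.r_cancel_one[OF \<mu>_closed[OF o] \<mu>_closed[OF o]] .
qed

lemma \<mu>_id_comp: "x \<in> M \<rightarrow>\<^sub>E X.id_comp \<Longrightarrow> \<mu> x \<in> X.id_comp"
  using X.morphism_id_comp[OF M(1) \<mu>_morphism \<mu>_one] by simp

definition supported :: "'g set \<Rightarrow> 'a set \<Rightarrow> ('g \<Rightarrow> 'a) \<Rightarrow> bool" where
  "supported E C z \<longleftrightarrow> z \<in> carrier G \<rightarrow>\<^sub>E C \<and> (\<forall>g\<in>carrier G - E. z g = e)"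

definition delta :: "'a \<Rightarrow> 'g \<Rightarrow> 'a" where
  "delta a = (\<lambda>g\<in>carrier G. if g = \<one> then a else e)"

abbreviation maps_to_delta :: "('g \<Rightarrow> 'a) \<Rightarrow> 'a \<Rightarrow> bool" where
  "maps_to_delta z a \<equiv> \<forall>h\<in>carrier G. \<tau> z h = (if h = \<one> then a else e)"

text \<open>The automaton transported to the graph. Only vertices in \<open>J\<close> have a window
  on which the local rule can be read, so configurations on all vertices are mapped to
  configurations on \<open>J\<close>.\<close>

definition Phi :: "'v set \<Rightarrow> ('v \<Rightarrow> 'g \<Rightarrow> 'v) \<Rightarrow> ('v \<Rightarrow> 'a) \<Rightarrow> 'v \<Rightarrow> 'a" where
  "Phi J \<psi> x = (\<lambda>j\<in>J. \<mu> (\<lambda>m\<in>M. x (\<psi> j m)))"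

text \<open>The finitely supported \<open>z\<close> copied to the vertex \<open>v\<close>, with the
  neutral element elsewhere; \<open>\<psi> v\<close> is injective on the sets \<open>E\<close> for
  which this is used.\<close>

definition plant :: "'v set \<Rightarrow> ('v \<Rightarrow> 'g \<Rightarrow> 'v) \<Rightarrow> 'g set \<Rightarrow> 'v \<Rightarrow> ('g \<Rightarrow> 'a) \<Rightarrow> 'v \<Rightarrow> 'a" where
  "plant I \<psi> E v z = (\<lambda>i\<in>I. if i \<in> \<psi> v ` E then z (inv_into E (\<psi> v) i) else e)"

lemma supported_configs: "supported E C z \<Longrightarrow> C \<subseteq> A \<Longrightarrow> z \<in> configs G A"
  unfolding supported_def configs_def using PiE_mono[of "carrier G" "\<lambda>_. C" "\<lambda>_. A"] by blast

lemma \<tau>_mult: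
  assumes "x \<in> configs G A" "y \<in> configs G A" "g \<in> carrier G"
  shows "\<tau> (\<lambda>g\<in>carrier G. x g \<cdot> y g) g = \<tau> x g \<cdot> \<tau> y g"
proof -
  have xy: "(\<lambda>g\<in>carrier G. x g \<cdot> y g) \<in> configs G A" using assms by (auto simp: configs_def PiE_iff)
  have gm: "g \<otimes> m \<in> carrier G" if "m \<in> M" for m using that M assms by auto
  have "(\<lambda>m\<in>M. x (g \<otimes> m)) \<in> M \<rightarrow>\<^sub>E A" "(\<lambda>m\<in>M. y (g \<otimes> m)) \<in> M \<rightarrow>\<^sub>E A"
    using assms gm by (auto simp: configs_def PiE_iff)
  from \<mu>_mult[OF this] have "\<mu> (\<lambda>m\<in>M. (\<lambda>m\<in>M. x (g \<otimes> m)) m \<cdot> (\<lambda>m\<in>M. y (g \<otimes> m)) m) = \<tau> x g \<cdot> \<tau> y g"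
    using assms by (simp add: \<tau>_eq)
  moreover have "(\<lambda>m\<in>M. (\<lambda>m\<in>M. x (g \<otimes> m)) m \<cdot> (\<lambda>m\<in>M. y (g \<otimes> m)) m) =
      (\<lambda>m\<in>M. (\<lambda>g\<in>carrier G. x g \<cdot> y g) (g \<otimes> m))" using gm by (auto simp: fun_eq_iff)
  ultimately show ?thesis using \<tau>_eq[OF xy assms(3)] by simp
qed

end

section \<open>The homomorphism on a finite approximation\<close>

locale approx_ca = group_ca G X \<tau> M \<mu>
  for G :: "('g, 'm) monoid_scheme" (structure) and X :: "('a, 'k::alg_closed_field) alg_group"
    and \<tau> M \<mu> +
  fixes F :: "'g set" and I J :: "'v set" and \<psi> :: "'v \<Rightarrow> 'g \<Rightarrow> 'v"
  assumes la: "local_approx G F I J \<psi>"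
    and MF: "M \<subseteq> F" and oneF: "\<one> \<in> F" and FG: "F \<subseteq> carrier G" and JI: "J \<subseteq> I"
    and fin: "finite I" "I \<noteq> {}"
begin

definition D :: "'g set" where "D = {a \<otimes> inv b \<otimes> c | a b c. a \<in> F \<and> b \<in> F \<and> c \<in> F}"

lemma D_I: "a \<in> F \<Longrightarrow> b \<in> F \<Longrightarrow> c \<in> F \<Longrightarrow> a \<otimes> inv b \<otimes> c \<in> D"
  by (auto simp: D_def)

lemma D_carrier: "D \<subseteq> carrier G"
  using FG by (auto simp: D_def)

lemma F_D: "F \<subseteq> D"
  using D_I[OF _ oneF oneF] FG by force

lemma \<psi>_I: "j \<in> J \<Longrightarrow> g \<in> F \<Longrightarrow> \<psi> j g \<in> I"
  and \<psi>_one: "j \<in> J \<Longrightarrow> \<psi> j \<one> = j"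
  and \<psi>_inj: "j \<in> J \<Longrightarrow> inj_on (\<psi> j) D"
  using la unfolding local_approx_def D_def by blast+

lemma \<psi>_comp: "i \<in> J \<Longrightarrow> j \<in> J \<Longrightarrow> g \<in> F \<Longrightarrow> m \<in> F \<Longrightarrow> \<psi> i m = \<psi> j g \<Longrightarrow> k \<in> F \<Longrightarrow>
    \<psi> i k = \<psi> j (g \<otimes> inv m \<otimes> k)"
  using la[unfolded local_approx_def, THEN conjunct2, rule_format] by blast

lemma finJ: "finite J" using JI fin(1) by (rule finite_subset)

lemma Phi_restr: "x \<in> I \<rightarrow>\<^sub>E C \<Longrightarrow> j \<in> J \<Longrightarrow> (\<lambda>m\<in>M. x (\<psi> j m)) \<in> M \<rightarrow>\<^sub>E C"
  using \<psi>_I MF by (auto simp: PiE_iff)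

lemma Phi_closed: "x \<in> I \<rightarrow>\<^sub>E A \<Longrightarrow> Phi J \<psi> x \<in> J \<rightarrow>\<^sub>E A"
  unfolding Phi_def by (rule restrict_PiE_iff[THEN iffD2]) (intro ballI \<mu>_closed Phi_restr)

lemma Phi_id_comp: "x \<in> I \<rightarrow>\<^sub>E X.id_comp \<Longrightarrow> Phi J \<psi> x \<in> J \<rightarrow>\<^sub>E X.id_comp"
  unfolding Phi_def by (rule restrict_PiE_iff[THEN iffD2]) (intro ballI \<mu>_id_comp Phi_restr)

lemma Phi_mult:
  assumes "x \<in> I \<rightarrow>\<^sub>E A" "y \<in> I \<rightarrow>\<^sub>E A"
  shows "Phi J \<psi> (\<lambda>i\<in>I. x i \<cdot> y i) = (\<lambda>j\<in>J. Phi J \<psi> x j \<cdot> Phi J \<psi> y j)"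
proof (rule ext)
  fix j
  show "Phi J \<psi> (\<lambda>i\<in>I. x i \<cdot> y i) j = (\<lambda>j\<in>J. Phi J \<psi> x j \<cdot> Phi J \<psi> y j) j"
  proof (cases "j \<in> J")
    case True
    have "(\<lambda>m\<in>M. (\<lambda>i\<in>I. x i \<cdot> y i) (\<psi> j m)) = (\<lambda>m\<in>M. (\<lambda>m\<in>M. x (\<psi> j m)) m \<cdot> (\<lambda>m\<in>M. y (\<psi> j m)) m)"
      using True \<psi>_I MF by (auto simp: fun_eq_iff)
    then show ?thesis
      using \<mu>_mult[OF Phi_restr[OF assms(1) True] Phi_restr[OF assms(2) True]] True by (simp add: Phi_def)
  qed (simp add: Phi_def)
qed

lemma Phi_morphism: "morphism (power_fspace I (variety X)) (power_fspace J (variety X)) (Phi J \<psi>)"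
  unfolding Phi_def
proof (rule X.morphism_tuple[OF X.swf_power[OF fin] finJ])
  fix j assume "j \<in> J"
  then have "morphism (power_fspace I (variety X)) (power_fspace M (variety X)) (\<lambda>x. \<lambda>m\<in>M. x (\<psi> j m))"
    using \<psi>_I MF by (intro X.morphism_tuple[OF X.swf_power[OF fin] M(1)] X.morphism_coord fin(1)) auto
  then show "morphism (power_fspace I (variety X)) (variety X) (\<lambda>x. \<mu> (\<lambda>m\<in>M. x (\<psi> j m)))"
    by (rule morphism_comp[OF \<mu>_morphism])
qed

text \<open>The quotient \<open>d\<close> of the two configurations has its values in
  \<open>id_comp\<close>, and so has its image under the homomorphism \<open>Phi\<close>. Hence
  \<open>Phi\<close> acts on patterns of cosets.\<close>

lemma Phi_coset:
  assumes x: "x \<in> I \<rightarrow>\<^sub>E A" and y: "y \<in> I \<rightarrow>\<^sub>E A"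
    and rel: "\<And>i. i \<in> I \<Longrightarrow> inv\<^bsub>X\<^esub> (x i) \<cdot> y i \<in> X.id_comp" and j: "j \<in> J"
  shows "X.coset (Phi J \<psi> x j) = X.coset (Phi J \<psi> y j)"
proof -
  define d where "d = (\<lambda>i\<in>I. inv\<^bsub>X\<^esub> (x i) \<cdot> y i)"
  have d: "d \<in> I \<rightarrow>\<^sub>E X.id_comp" using rel by (auto simp: d_def)
  then have dA: "d \<in> I \<rightarrow>\<^sub>E A" using X.id_comp_carrier PiE_mono[of I "\<lambda>_. X.id_comp" "\<lambda>_. A"] by blast
  have "(\<lambda>i\<in>I. x i \<cdot> d i) = y"
    using x y by (auto simp: d_def fun_eq_iff PiE_iff extensional_def X.m_assoc[symmetric])
  then have eq: "Phi J \<psi> y j = Phi J \<psi> x j \<cdot> Phi J \<psi> d j" using Phi_mult[OF x dA] j by simp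
  have c: "Phi J \<psi> x j \<in> A" "Phi J \<psi> d j \<in> A" "Phi J \<psi> d j \<in> X.id_comp"
    using Phi_closed[OF x] Phi_closed[OF dA] Phi_id_comp[OF d] j by (auto simp: PiE_iff)
  then have "inv\<^bsub>X\<^esub> (Phi J \<psi> x j) \<cdot> Phi J \<psi> y j \<in> X.id_comp" unfolding eq by (simp add: X.m_assoc[symmetric])
  then show ?thesis using X.coset_eq_iff c eq by simp
qed

lemma plant_in:
  assumes z: "supported E C z" "e \<in> C" and E: "E \<subseteq> F" and v: "v \<in> J"
  shows "plant I \<psi> E v z \<in> I \<rightarrow>\<^sub>E C"
proof -
  have "z (inv_into E (\<psi> v) i) \<in> C" if "i \<in> \<psi> v ` E" for i
  proof -
    have "inv_into E (\<psi> v) i \<in> carrier G" using inv_into_into[OF that] E FG by blast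
    then show ?thesis using z by (auto simp: supported_def PiE_iff)
  qed
  then show ?thesis using z(2) by (auto simp: plant_def)
qed

text \<open>For \<open>h\<close> outside \<open>E\<close>, injectivity of \<open>\<psi> v\<close> on
  all of \<open>D\<close> keeps the vertex off the planted copy, so both sides are neutral.\<close>

lemma plant_val:
  assumes z: "supported E C z" and E: "E \<subseteq> F" and v: "v \<in> J" and h: "h \<in> D" "\<psi> v h \<in> I"
  shows "plant I \<psi> E v z (\<psi> v h) = z h"
proof (cases "h \<in> E")
  case True
  have "inj_on (\<psi> v) E" using \<psi>_inj[OF v] E F_D by (meson inj_on_subset order_trans)
  then show ?thesis using True h by (simp add: plant_def)
next
  case False
  have "\<psi> v h \<notin> \<psi> v ` E"
  proof
    assume "\<psi> v h \<in> \<psi> v ` E"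
    then obtain g where g: "g \<in> E" "\<psi> v h = \<psi> v g" by blast
    then have "h = g" using inj_onD[OF \<psi>_inj[OF v], of h g] h E F_D by blast
    then show False using False g by simp
  qed
  moreover have "z h = e" using z False h(1) D_carrier by (auto simp: supported_def)
  ultimately show ?thesis using h(2) by (simp add: plant_def)
qed

text \<open>A window at \<open>w\<close> that meets the planted copy, say at
  \<open>\<psi> v g\<close>, sees a translate of \<open>z\<close>, so \<open>Phi\<close> computes
  \<open>\<tau> z\<close> at \<open>g \<otimes> inv m\<close>. This element is not the identity when
  \<open>w \<noteq> v\<close>, because \<open>\<psi> v\<close> maps it to \<open>w\<close>. A window
  that misses the copy sees only neutral elements.\<close>

lemma Phi_plant:
  assumes z: "supported E C z" "C \<subseteq> A" and E: "E \<subseteq> F" and v: "v \<in> J"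
    and tau: "\<And>h. h \<in> carrier G \<Longrightarrow> \<tau> z h = (if h = \<one> then a else e)"
  shows "Phi J \<psi> (plant I \<psi> E v z) = (\<lambda>j\<in>J. if j = v then a else e)"
proof (rule ext)
  fix w
  let ?p = "plant I \<psi> E v z"
  have zc: "z \<in> configs G A" by (rule supported_configs[OF z])
  have step: "Phi J \<psi> ?p w = \<tau> z h" if w: "w \<in> J" and h: "h \<in> carrier G" "\<And>k. k \<in> F \<Longrightarrow> \<psi> w k = \<psi> v (h \<otimes> k)"
      "\<And>k. k \<in> F \<Longrightarrow> h \<otimes> k \<in> D" for h
  proof -
    have "?p (\<psi> w m) = z (h \<otimes> m)" if "m \<in> M" for m
      using plant_val[OF z(1) E v h(3)[of m]] h(2)[of m] \<psi>_I[OF w, of m] MF that by auto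
    then have "(\<lambda>m\<in>M. ?p (\<psi> w m)) = (\<lambda>m\<in>M. z (h \<otimes> m))" by (auto simp: fun_eq_iff)
    then show ?thesis using w \<tau>_eq[OF zc h(1)] by (simp add: Phi_def)
  qed
  show "Phi J \<psi> ?p w = (\<lambda>j\<in>J. if j = v then a else e) w"
  proof (cases "w \<in> J")
    case w: True
    show ?thesis
    proof (cases "w = v")
      case True
      have "Phi J \<psi> ?p w = \<tau> z \<one>"
        by (rule step[OF w]) (use True FG F_D G.l_one in \<open>auto simp: subset_iff\<close>)
      then show ?thesis using tau True v by simp
    next
      case ne: False
      show ?thesis
      proof (cases "\<exists>g\<in>E. \<exists>m\<in>M. \<psi> w m = \<psi> v g")
        case True
        then obtain g m where gm: "g \<in> E" "m \<in> M" "\<psi> w m = \<psi> v g" by blast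
        then have F: "g \<in> F" "m \<in> F" using E MF by auto
        have comp: "\<psi> w k = \<psi> v (g \<otimes> inv m \<otimes> k)" if "k \<in> F" for k
          by (rule \<psi>_comp[OF w v F gm(3) that])
        have c: "g \<in> carrier G" "m \<in> carrier G" using F FG by auto
        have "Phi J \<psi> ?p w = \<tau> z (g \<otimes> inv m)"
          by (rule step[OF w]) (use c comp D_I F in auto)
        moreover have "g \<otimes> inv m \<noteq> \<one>"
          using comp[OF oneF] \<psi>_one[OF w] \<psi>_one[OF v] ne c by auto
        ultimately show ?thesis using tau c w ne by simp
      next
        case False
        have "?p (\<psi> w m) = e" if "m \<in> M" for m
        proof -
          have "\<psi> w m \<notin> \<psi> v ` E" using False that by (metis imageE)
          moreover have "\<psi> w m \<in> I" using \<psi>_I[OF w] MF that by auto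
          ultimately show ?thesis by (simp add: plant_def)
        qed
        then have "(\<lambda>m\<in>M. ?p (\<psi> w m)) = (\<lambda>m\<in>M. e)" by (auto simp: fun_eq_iff)
        then show ?thesis using \<mu>_one w ne by (simp add: Phi_def)
      qed
    qed
  qed (simp add: Phi_def)
qed

text \<open>Plant a preimage of each required value and multiply. Each planted copy affects the
  image at one vertex only, so the order of the factors in the possibly noncommutative group does
  not matter. Taking the values in a subgroup \<open>C\<close> treats \<open>A\<close> and
  \<open>id_comp\<close> together.\<close>

lemma Phi_image:
  assumes C: "subgroup C X" and L: "L \<subseteq> A" and E: "E \<subseteq> F"
    and z: "\<And>a. a \<in> L \<Longrightarrow> \<exists>z. supported E C z \<and> (maps_to_delta z a)"
    and y: "y \<in> J \<rightarrow>\<^sub>E L"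
  shows "\<exists>x\<in>I \<rightarrow>\<^sub>E C. Phi J \<psi> x = y"
proof -
  have CA: "C \<subseteq> A" using C by (rule subgroup.subset)
  have eC: "e \<in> C" using C by (rule subgroup.one_closed)
  have CA': "I \<rightarrow>\<^sub>E C \<subseteq> I \<rightarrow>\<^sub>E A" by (rule PiE_mono) (rule CA)
  have "\<exists>x\<in>I \<rightarrow>\<^sub>E C. \<forall>j\<in>J. Phi J \<psi> x j = (if j \<in> K then y j else e)" if "finite K" "K \<subseteq> J" for K
    using that
  proof (induction K rule: finite_induct)
    case empty
    have "Phi J \<psi> (\<lambda>i\<in>I. e) j = e" if "j \<in> J" for j
    proof -
      have "(\<lambda>m\<in>M. (\<lambda>i\<in>I. e) (\<psi> j m)) = (\<lambda>m\<in>M. e)" using \<psi>_I[OF that] MF by (auto simp: fun_eq_iff)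
      then show ?thesis using that \<mu>_one by (simp add: Phi_def)
    qed
    moreover have "(\<lambda>i\<in>I. e) \<in> I \<rightarrow>\<^sub>E C" using eC by simp
    ultimately show ?case by (intro bexI[of _ "\<lambda>i\<in>I. e"]) (simp_all del: restrict_apply)
  next
    case (insert v K)
    then obtain x where x: "x \<in> I \<rightarrow>\<^sub>E C" "\<forall>j\<in>J. Phi J \<psi> x j = (if j \<in> K then y j else e)" by auto
    have v: "v \<in> J" "y v \<in> L" using insert.prems y by auto
    obtain z where z: "supported E C z" "maps_to_delta z (y v)"
      using z[OF v(2)] by blast
    let ?p = "plant I \<psi> E v z"
    have p: "?p \<in> I \<rightarrow>\<^sub>E C" by (rule plant_in[OF z(1) eC E v(1)])
    have Pp: "Phi J \<psi> ?p = (\<lambda>j\<in>J. if j = v then y v else e)"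
      by (rule Phi_plant[OF z(1) CA E v(1)]) (use z(2) in blast)
    show ?case
    proof (intro bexI[of _ "\<lambda>i\<in>I. x i \<cdot> ?p i"] ballI)
      show "(\<lambda>i\<in>I. x i \<cdot> ?p i) \<in> I \<rightarrow>\<^sub>E C"
        using x(1) p subgroup.m_closed[OF C] by (auto simp: PiE_iff)
      fix j assume j: "j \<in> J"
      have yj: "y j \<in> A" using y j L by auto
      have "Phi J \<psi> (\<lambda>i\<in>I. x i \<cdot> ?p i) j = Phi J \<psi> x j \<cdot> Phi J \<psi> ?p j"
        using Phi_mult[of x ?p] x(1) p CA' j by (auto simp: subset_iff)
      also have "\<dots> = (if j \<in> K then y j else e) \<cdot> (if j = v then y v else e)"
        using x(2) j by (simp add: Pp)
      also have "\<dots> = (if j \<in> insert v K then y j else e)"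
        using insert.hyps(2) yj by auto
      finally show "Phi J \<psi> (\<lambda>i\<in>I. x i \<cdot> ?p i) j = (if j \<in> insert v K then y j else e)" .
    qed
  qed
  from this[OF finJ order_refl] obtain x where x: "x \<in> I \<rightarrow>\<^sub>E C" "\<forall>j\<in>J. Phi J \<psi> x j = y j" by auto
  have "y \<in> J \<rightarrow>\<^sub>E A" using y L PiE_mono[of J "\<lambda>_. L" "\<lambda>_. A"] by blast
  moreover have "Phi J \<psi> x \<in> J \<rightarrow>\<^sub>E A" using x(1) CA' by (intro Phi_closed) blast
  ultimately have "Phi J \<psi> x = y"
    using x(2) by (intro PiE_ext[of "Phi J \<psi> x" J "\<lambda>_. A" y]) simp_all
  then show ?thesis using x(1) by blast
qed

text \<open>For a maximal disjoint family, every vertex \<open>u\<close> of \<open>J\<close> has a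
  copy meeting that of some \<open>v\<close> in \<open>T\<close>, say in
  \<open>\<psi> u b = \<psi> v a\<close>. Then \<open>u\<close> is determined by \<open>v\<close>,
  \<open>a\<close> and \<open>b\<close>, whence the square of \<open>card \<Omega>\<close>.\<close>

lemma disjoint_copies:
  assumes \<Omega>: "finite \<Omega>" "\<Omega> \<noteq> {}" "\<Omega> \<subseteq> F"
  shows "\<exists>T\<subseteq>J. (\<forall>u\<in>T. \<forall>v\<in>T. u \<noteq> v \<longrightarrow> \<psi> u ` \<Omega> \<inter> \<psi> v ` \<Omega> = {}) \<and> card J \<le> card T * (card \<Omega>)\<^sup>2"
proof -
  have "\<exists>T\<subseteq>K. (\<forall>u\<in>T. \<forall>v\<in>T. u \<noteq> v \<longrightarrow> \<psi> u ` \<Omega> \<inter> \<psi> v ` \<Omega> = {}) \<and>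
      (\<forall>u\<in>K. \<exists>v\<in>T. \<psi> u ` \<Omega> \<inter> \<psi> v ` \<Omega> \<noteq> {})" if "finite K" for K
    using that
  proof (induction K rule: finite_induct)
    case (insert w K)
    then obtain T where T: "T \<subseteq> K" "\<forall>u\<in>T. \<forall>v\<in>T. u \<noteq> v \<longrightarrow> \<psi> u ` \<Omega> \<inter> \<psi> v ` \<Omega> = {}"
      "\<forall>u\<in>K. \<exists>v\<in>T. \<psi> u ` \<Omega> \<inter> \<psi> v ` \<Omega> \<noteq> {}" by blast
    show ?case
    proof (cases "\<exists>v\<in>T. \<psi> w ` \<Omega> \<inter> \<psi> v ` \<Omega> \<noteq> {}")
      case True
      then show ?thesis using T by (intro exI[of _ T]) auto
    next
      case False
      have "\<psi> w ` \<Omega> \<inter> \<psi> w ` \<Omega> \<noteq> {}" using \<Omega>(2) by simp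
      then show ?thesis using T False by (intro exI[of _ "insert w T"]) (auto simp: Int_commute)
    qed
  qed simp
  from this[OF finJ] obtain T where T: "T \<subseteq> J" "\<forall>u\<in>T. \<forall>v\<in>T. u \<noteq> v \<longrightarrow> \<psi> u ` \<Omega> \<inter> \<psi> v ` \<Omega> = {}"
    "\<forall>u\<in>J. \<exists>v\<in>T. \<psi> u ` \<Omega> \<inter> \<psi> v ` \<Omega> \<noteq> {}" by blast
  have finT: "finite T" using T(1) finJ by (rule finite_subset)
  have "J \<subseteq> (\<lambda>(v, a, b). \<psi> v (a \<otimes> inv b \<otimes> \<one>)) ` (T \<times> \<Omega> \<times> \<Omega>)"
  proof
    fix u assume u: "u \<in> J"
    then obtain v where v0: "v \<in> T" "\<psi> u ` \<Omega> \<inter> \<psi> v ` \<Omega> \<noteq> {}" using T(3) by blast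
    then obtain x where "x \<in> \<psi> u ` \<Omega>" "x \<in> \<psi> v ` \<Omega>" by blast
    then obtain a b where v: "v \<in> T" "b \<in> \<Omega>" "a \<in> \<Omega>" "\<psi> u b = \<psi> v a" using v0(1) by auto
    have "\<psi> u \<one> = \<psi> v (a \<otimes> inv b \<otimes> \<one>)"
      by (rule \<psi>_comp[OF u _ _ _ v(4) oneF]) (use v \<Omega> T in auto)
    then have "u = \<psi> v (a \<otimes> inv b \<otimes> \<one>)" using \<psi>_one[OF u] by simp
    then show "u \<in> (\<lambda>(v, a, b). \<psi> v (a \<otimes> inv b \<otimes> \<one>)) ` (T \<times> \<Omega> \<times> \<Omega>)"
      using v by (intro image_eqI[of _ _ "(v, a, b)"]) auto
  qed
  then have "card J \<le> card ((\<lambda>(v, a, b). \<psi> v (a \<otimes> inv b \<otimes> \<one>)) ` (T \<times> \<Omega> \<times> \<Omega>))"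
    using finT \<Omega>(1) by (intro card_mono) auto
  also have "\<dots> \<le> card (T \<times> \<Omega> \<times> \<Omega>)" using finT \<Omega>(1) by (intro card_image_le) auto
  also have "\<dots> = card T * (card \<Omega>)\<^sup>2" by (simp add: card_cartesian_product power2_eq_square)
  finally show ?thesis using T by blast
qed

text \<open>The number of cosets of the identity component plays the role of the size of the alphabet.\<close>

lemma coset_count:
  assumes R: "finite R" "R \<subseteq> A" "\<And>a. a \<in> A \<Longrightarrow> \<exists>r\<in>R. inv\<^bsub>X\<^esub> r \<cdot> a \<in> X.id_comp"
    and E: "E \<subseteq> F" "\<And>a. a \<in> R \<Longrightarrow> \<exists>z. supported E A z \<and> (maps_to_delta z a)"
    and n: "supported \<Omega> A n" "\<Omega> \<subseteq> F" "\<And>h. h \<in> carrier G \<Longrightarrow> \<tau> n h = e" "\<omega> \<in> \<Omega>" "n \<omega> \<notin> X.id_comp"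
    and T: "T \<subseteq> J" "\<And>u v. u \<in> T \<Longrightarrow> v \<in> T \<Longrightarrow> u \<noteq> v \<Longrightarrow> \<psi> u ` \<Omega> \<inter> \<psi> v ` \<Omega> = {}"
  shows "2 ^ card T * card (X.coset ` A) ^ card J \<le> card (X.coset ` A) ^ card I"
proof -
  let ?Q = "X.coset ` A"
  have finT: "finite T" using T(1) finJ by (rule finite_subset)
  have QR: "?Q = X.coset ` R" by (rule X.coset_image[OF R(2)]) (use R(3) in blast)
  have finQ: "finite ?Q" unfolding QR using R(1) by simp
  \<comment> \<open>\<open>Phi\<close> is surjective on patterns of cosets: the finitely many
    representatives in \<open>R\<close> have preimages with the common support
    \<open>E\<close>.\<close>
  have sect: "\<exists>x\<in>I \<rightarrow>\<^sub>E A. \<forall>j\<in>J. X.coset (Phi J \<psi> x j) = y j" if y: "y \<in> J \<rightarrow>\<^sub>E ?Q" for y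
  proof -
    have "\<forall>j\<in>J. \<exists>r\<in>R. X.coset r = y j" using y QR by (fastforce simp: PiE_iff)
    from bchoice[OF this[unfolded Bex_def]] obtain r where r: "\<forall>j\<in>J. r j \<in> R \<and> X.coset (r j) = y j" ..
    have "restrict r J \<in> J \<rightarrow>\<^sub>E R" using r by auto
    then obtain x where "x \<in> I \<rightarrow>\<^sub>E A" "Phi J \<psi> x = restrict r J"
      using Phi_image[OF X.subgroup_self R(2) E] by blast
    then show ?thesis using r by (intro bexI[of _ x]) auto
  qed
  then have "\<forall>y\<in>J \<rightarrow>\<^sub>E ?Q. \<exists>x. x \<in> I \<rightarrow>\<^sub>E A \<and> (\<forall>j\<in>J. X.coset (Phi J \<psi> x j) = y j)" by blast
  from bchoice[OF this] obtain x where
    x: "\<forall>y\<in>J \<rightarrow>\<^sub>E ?Q. x y \<in> I \<rightarrow>\<^sub>E A \<and> (\<forall>j\<in>J. X.coset (Phi J \<psi> (x y) j) = y j)" ..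
  \<comment> \<open>For every set \<open>K\<close> of copies, planting \<open>n\<close> exactly at
    the members of \<open>K\<close> gives a kernel element that shows at the sites
    \<open>\<psi> v \<omega>\<close> which copies were used.\<close>
  have ex_p: "\<exists>p. p \<in> I \<rightarrow>\<^sub>E A \<and> (\<forall>j\<in>J. Phi J \<psi> p j = e) \<and> (\<forall>v\<in>T. p (\<psi> v \<omega>) = (if v \<in> K then n \<omega> else e))"
    if "finite K" "K \<subseteq> T" for K
    using that
  proof (induction K rule: finite_induct)
    case empty
    have "Phi J \<psi> (\<lambda>i\<in>I. e) j = e" if "j \<in> J" for j
    proof -
      have "(\<lambda>m\<in>M. (\<lambda>i\<in>I. e) (\<psi> j m)) = (\<lambda>m\<in>M. e)" using \<psi>_I[OF that] MF by (auto simp: fun_eq_iff)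
      then show ?thesis using that \<mu>_one by (simp add: Phi_def)
    qed
    moreover have "\<forall>v\<in>T. (\<lambda>i\<in>I. e) (\<psi> v \<omega>) = e" using \<psi>_I T(1) n(2,4) by auto
    moreover have "(\<lambda>i\<in>I. e) \<in> I \<rightarrow>\<^sub>E A" by simp
    ultimately show ?case by (intro exI[of _ "\<lambda>i\<in>I. e"]) (simp del: restrict_apply)
  next
    case (insert v K)
    then obtain p where p: "p \<in> I \<rightarrow>\<^sub>E A" "\<forall>j\<in>J. Phi J \<psi> p j = e"
      "\<forall>v\<in>T. p (\<psi> v \<omega>) = (if v \<in> K then n \<omega> else e)" by auto
    have v: "v \<in> T" "v \<in> J" using insert.prems T(1) by auto
    let ?q = "plant I \<psi> \<Omega> v n"
    have q: "?q \<in> I \<rightarrow>\<^sub>E A" by (rule plant_in[OF n(1) _ n(2) v(2)]) simp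
    have Pq: "Phi J \<psi> ?q = (\<lambda>j\<in>J. if j = v then e else e)"
      by (rule Phi_plant[OF n(1) order_refl n(2) v(2)]) (simp add: n(3))
    have qv: "?q (\<psi> u \<omega>) = (if u = v then n \<omega> else e)" if u: "u \<in> T" for u
    proof -
      have uI: "\<psi> u \<omega> \<in> I" using \<psi>_I u T(1) n(2,4) by auto
      show ?thesis
      proof (cases "u = v")
        case True
        then show ?thesis using plant_val[OF n(1,2) v(2), of \<omega>] uI F_D n(2,4) by auto
      next
        case False
        then have "\<psi> u \<omega> \<notin> \<psi> v ` \<Omega>" using T(2)[OF u v(1) False] n(4) by blast
        then show ?thesis using uI False by (simp add: plant_def)
      qed
    qed
    show ?case
    proof (intro exI[of _ "\<lambda>i\<in>I. p i \<cdot> ?q i"] conjI ballI)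
      show "(\<lambda>i\<in>I. p i \<cdot> ?q i) \<in> I \<rightarrow>\<^sub>E A" using p(1) q by (auto simp: PiE_iff)
      show "Phi J \<psi> (\<lambda>i\<in>I. p i \<cdot> ?q i) j = e" if "j \<in> J" for j
        using Phi_mult[OF p(1) q] p(2) that by (simp add: Pq)
      show "(\<lambda>i\<in>I. p i \<cdot> ?q i) (\<psi> u \<omega>) = (if u \<in> insert v K then n \<omega> else e)" if u: "u \<in> T" for u
      proof -
        have uI: "\<psi> u \<omega> \<in> I" using \<psi>_I u T(1) n(2,4) by auto
        have "\<omega> \<in> carrier G" using n(2,4) FG by blast
        then have "n \<omega> \<in> A" using n(1) by (auto simp: supported_def PiE_iff)
        then show ?thesis using p(3) qv[OF u] u uI insert.hyps(2) by auto
      qed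
    qed
  qed
  have "\<forall>K\<in>Pow T. \<exists>p. p \<in> I \<rightarrow>\<^sub>E A \<and> (\<forall>j\<in>J. Phi J \<psi> p j = e) \<and>
      (\<forall>v\<in>T. p (\<psi> v \<omega>) = (if v \<in> K then n \<omega> else e))" 
    by (intro ballI ex_p) (use finite_subset[OF _ finT] in auto)
  from bchoice[OF this] obtain p where p: "\<forall>K\<in>Pow T. p K \<in> I \<rightarrow>\<^sub>E A \<and> (\<forall>j\<in>J. Phi J \<psi> (p K) j = e) \<and>
      (\<forall>v\<in>T. p K (\<psi> v \<omega>) = (if v \<in> K then n \<omega> else e))" ..
  define w where "w K y = (\<lambda>i\<in>I. x y i \<cdot> p K i)" for K y
  \<comment> \<open>The coset pattern of \<open>w K y\<close> recovers \<open>y\<close> through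
    \<open>Phi\<close>, and then \<open>K\<close>: at a site where only one of two sets plants its
    copy, the cosets differ since \<open>n \<omega>\<close> is not in \<open>id_comp\<close>. The
    injectivity of this map is the whole count.\<close>
  define \<Theta> where "\<Theta> = (\<lambda>(K, y). \<lambda>i\<in>I. X.coset (w K y i))"
  have w: "w K y \<in> I \<rightarrow>\<^sub>E A" "\<And>j. j \<in> J \<Longrightarrow> Phi J \<psi> (w K y) j = Phi J \<psi> (x y) j"
    if "K \<in> Pow T" "y \<in> J \<rightarrow>\<^sub>E ?Q" for K y
  proof -
    have xy: "x y \<in> I \<rightarrow>\<^sub>E A" using bspec[OF x that(2)] by (rule conjunct1)
    have pK: "p K \<in> I \<rightarrow>\<^sub>E A" "\<forall>j\<in>J. Phi J \<psi> (p K) j = e" using bspec[OF p that(1)] by simp_all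
    show "w K y \<in> I \<rightarrow>\<^sub>E A" using xy pK by (auto simp: w_def PiE_iff)
    show "Phi J \<psi> (w K y) j = Phi J \<psi> (x y) j" if "j \<in> J" for j
      unfolding w_def using Phi_mult[OF xy pK(1)] pK(2) that Phi_closed[OF xy] by (auto simp: PiE_iff)
  qed
  have "inj_on \<Theta> (Pow T \<times> (J \<rightarrow>\<^sub>E ?Q))"
  proof (rule inj_onI, clarify)
    fix K y L y'
    assume K: "K \<subseteq> T" and y: "y \<in> J \<rightarrow>\<^sub>E ?Q" and L: "L \<subseteq> T" and y': "y' \<in> J \<rightarrow>\<^sub>E ?Q"
      and eq: "\<Theta> (K, y) = \<Theta> (L, y')"
    have KP: "K \<in> Pow T" "L \<in> Pow T" using K L by auto
    note wK = w[OF KP(1) y] and wL = w[OF KP(2) y']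
    have rel: "inv\<^bsub>X\<^esub> (w K y i) \<cdot> w L y' i \<in> X.id_comp" if i: "i \<in> I" for i
    proof -
      have "X.coset (w K y i) = X.coset (w L y' i)" using fun_cong[OF eq, of i] i by (simp add: \<Theta>_def)
      then show ?thesis using X.coset_eq_iff wK(1) wL(1) i by (auto simp: PiE_iff)
    qed
    have "y j = y' j" if j: "j \<in> J" for j
    proof -
      have "X.coset (Phi J \<psi> (w K y) j) = X.coset (Phi J \<psi> (w L y') j)"
        by (rule Phi_coset[OF wK(1) wL(1) rel j])
      then show ?thesis using wK(2)[OF j] wL(2)[OF j] bspec[OF x y] bspec[OF x y'] j by simp
    qed
    then have yy: "y = y'" using y y' by (intro PiE_ext[of y J "\<lambda>_. ?Q" y']) auto
    have sub: "K' \<subseteq> L'" if KL: "K' \<in> Pow T" "L' \<in> Pow T" and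
      r: "\<And>i. i \<in> I \<Longrightarrow> inv\<^bsub>X\<^esub> (w K' y i) \<cdot> w L' y i \<in> X.id_comp" for K' L'
    proof (rule subsetI, rule ccontr)
      fix v assume v: "v \<in> K'" "v \<notin> L'"
      have vT: "v \<in> T" using v KL by blast
      have vI: "\<psi> v \<omega> \<in> I" using \<psi>_I vT T(1) n(2,4) by auto
      have "\<omega> \<in> carrier G" using n(2,4) FG by blast
      then have nA: "n \<omega> \<in> A" using n(1) by (auto simp: supported_def PiE_iff)
      have xA: "x y (\<psi> v \<omega>) \<in> A" using x y vI by (auto simp: PiE_iff)
      have "p K' (\<psi> v \<omega>) = n \<omega>" "p L' (\<psi> v \<omega>) = e" using bspec[OF p KL(1)] bspec[OF p KL(2)] vT v by simp_all
      then have "inv\<^bsub>X\<^esub> (x y (\<psi> v \<omega>) \<cdot> n \<omega>) \<cdot> (x y (\<psi> v \<omega>) \<cdot> e) \<in> X.id_comp"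
        using r[OF vI] vI by (simp add: w_def)
      moreover have "inv\<^bsub>X\<^esub> (x y (\<psi> v \<omega>) \<cdot> n \<omega>) \<cdot> (x y (\<psi> v \<omega>) \<cdot> e) = inv\<^bsub>X\<^esub> (n \<omega>)"
        using xA nA by (simp add: X.inv_mult_group X.m_assoc)
      ultimately have "inv\<^bsub>X\<^esub> (inv\<^bsub>X\<^esub> (n \<omega>)) \<in> X.id_comp" using X.id_comp_inv by metis
      then show False using nA n(5) by simp
    qed
    have "K \<subseteq> L" by (rule sub[OF KP]) (use rel yy in simp)
    moreover have "L \<subseteq> K"
    proof (rule sub[OF KP(2,1)])
      fix i assume i: "i \<in> I"
      have "w K y i \<in> A" "w L y i \<in> A" using wK(1) wL(1) i yy by (auto simp: PiE_iff)
      then have "inv\<^bsub>X\<^esub> (w L y i) \<cdot> w K y i = inv\<^bsub>X\<^esub> (inv\<^bsub>X\<^esub> (w K y i) \<cdot> w L y i)"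
        by (simp add: X.inv_mult_group)
      then show "inv\<^bsub>X\<^esub> (w L y i) \<cdot> w K y i \<in> X.id_comp" using rel[OF i] yy X.id_comp_inv by simp
    qed
    ultimately show "K = L \<and> y = y'" using yy by blast
  qed
  moreover have "\<Theta> ` (Pow T \<times> (J \<rightarrow>\<^sub>E ?Q)) \<subseteq> I \<rightarrow>\<^sub>E ?Q"
  proof clarify
    fix K y assume "K \<subseteq> T" "y \<in> J \<rightarrow>\<^sub>E ?Q"
    then have "w K y \<in> I \<rightarrow>\<^sub>E A" using w(1) by blast
    then show "\<Theta> (K, y) \<in> I \<rightarrow>\<^sub>E ?Q" by (auto simp: \<Theta>_def PiE_iff)
  qed
  moreover have "finite (I \<rightarrow>\<^sub>E ?Q)" using fin(1) finQ by (simp add: finite_PiE)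
  ultimately have "card (Pow T \<times> (J \<rightarrow>\<^sub>E ?Q)) \<le> card (I \<rightarrow>\<^sub>E ?Q)" by (rule card_inj_on_le)
  then show ?thesis using finT finJ fin(1) by (simp add: card_cartesian_product card_Pow card_PiE)
qed

end

section \<open>Coordinates separating many translates\<close>

context alg_grp
begin

text \<open>One coordinate separates more than \<open>s\<close> translates
  \<open>a \<otimes> b\<close>, for all \<open>a\<close> in an open set \<open>Q\<close> and with
  the same \<open>b\<close>. Openness allows this to be combined with other generic conditions on
  \<open>a\<close>.\<close>

abbreviation spreads :: "'a set \<Rightarrow> ('a \<Rightarrow> nat \<Rightarrow> 'k) \<Rightarrow> nat \<Rightarrow> 'a set \<Rightarrow> nat \<Rightarrow> bool" where
  "spreads U \<phi> i N s \<equiv> \<exists>B Q. finite B \<and> s < card B \<and> B \<subseteq> N \<and> opn Q \<and> Q \<inter> id_comp \<noteq> {} \<and>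
     (\<forall>a\<in>Q. (\<forall>b\<in>B. a \<otimes> b \<in> U) \<and> inj_on (\<lambda>b. \<phi> (a \<otimes> b) i) B)"

text \<open>Distinct points differ in some coordinate, and there are finitely many coordinates.\<close>

lemma coordinate_spread:
  assumes ch: "chart n U \<phi>" and U: "\<one> \<in> U" and N: "N \<subseteq> id_comp" "infinite N"
  shows "\<exists>i<n. \<forall>s. spreads U \<phi> i N s"
proof (rule ccontr)
  define P where "P i s \<longleftrightarrow> (spreads U \<phi> i N s)" for i and s :: nat
  assume "\<not> ?thesis"
  then have no: "\<forall>i\<in>{..<n}. \<exists>s. \<not> P i s" by (fold P_def) auto
  have down: "P i s" if "P i t" "s \<le> t" for i s t
    using that(1) unfolding P_def by (elim exE conjE, intro exI conjI) (use that(2) in \<open>assumption | simp\<close>)+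
  from bchoice[OF no] obtain s where s: "\<forall>i\<in>{..<n}. \<not> P i (s i)" ..
  \<comment> \<open>Spreading for \<open>s\<close> follows from spreading for any larger bound, so
    the failures of the single coordinates combine into failure of all of them at
    \<open>t\<close>.\<close>
  define t where "t = Max (insert 0 (s ` {..<n}))"
  have Pt: "\<not> P i t" if "i < n" for i
  proof -
    have "s i \<le> t" using that by (auto simp: t_def)
    then show ?thesis using down s that by blast
  qed
  \<comment> \<open>If each of the \<open>n\<close> coordinates took at most \<open>Suc t\<close>
    values on the translates, there would be at most \<open>Suc t ^ n\<close> of them.\<close>
  obtain B where B: "finite B" "card B = Suc (Suc t ^ n)" "B \<subseteq> N"
    using infinite_arbitrarily_large[OF N(2)] by blast
  have BC: "B \<subseteq> carrier X" using B(3) N(1) id_comp_carrier by blast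
  have "\<exists>a\<in>id_comp. \<forall>b\<in>B. a \<in> {a \<in> carrier X. a \<otimes> b \<in> U}"
  proof (rule irr_in_finite_INT[OF irr_in_id_comp B(1)])
    fix b assume b: "b \<in> B"
    have "inv b \<in> id_comp" using b B(3) N(1) id_comp_inv by blast
    moreover have "inv b \<otimes> b \<in> U" using b BC U by auto
    ultimately show "opn {a \<in> carrier X. a \<otimes> b \<in> U} \<and> {a \<in> carrier X. a \<otimes> b \<in> U} \<inter> id_comp \<noteq> {}"
      using translations_open(1)[OF _ chart_opn[OF ch], of b] b BC id_comp_carrier by blast
  qed
  then obtain a where a: "a \<in> id_comp" "\<And>b. b \<in> B \<Longrightarrow> a \<otimes> b \<in> U" by blast
  have ac: "a \<in> carrier X" using a(1) id_comp_carrier by blast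
  define V where "V i = (\<lambda>b. \<phi> (a \<otimes> b) i) ` B" for i
  have "\<exists>i<n. card (V i) > Suc t"
  proof (rule ccontr)
    assume "\<not> ?thesis"
    then have le: "card (V i) \<le> Suc t" if "i < n" for i using that by (meson not_le)
    have inj: "inj_on (\<lambda>b. \<phi> (a \<otimes> b)) B"
    proof (rule inj_onI)
      fix b c assume bc: "b \<in> B" "c \<in> B" "\<phi> (a \<otimes> b) = \<phi> (a \<otimes> c)"
      then have "a \<otimes> b = a \<otimes> c" using inj_onD[OF chart_inj[OF ch]] a(2) by blast
      moreover have "b \<in> carrier X" "c \<in> carrier X" using bc(1,2) BC by blast+
      ultimately show "b = c" using ac by simp
    qed
    obtain P where P: "\<phi> ` U = zero_locus n P" using chart_image[OF ch] by blast
    have "(\<lambda>b. \<phi> (a \<otimes> b)) ` B \<subseteq> (\<Pi>\<^sub>E i\<in>{..<n}. V i)"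
    proof clarify
      fix b assume b: "b \<in> B"
      have "\<phi> (a \<otimes> b) \<in> zero_locus n P" using a(2)[OF b] P by blast
      then have "\<phi> (a \<otimes> b) \<in> extensional {..<n}" by (auto simp: zero_locus_def PiE_iff)
      then show "\<phi> (a \<otimes> b) \<in> (\<Pi>\<^sub>E i\<in>{..<n}. V i)" using b by (auto simp: V_def PiE_iff)
    qed
    moreover have "finite (\<Pi>\<^sub>E i\<in>{..<n}. V i)" using B(1) by (intro finite_PiE) (auto simp: V_def)
    ultimately have "card B \<le> card (\<Pi>\<^sub>E i\<in>{..<n}. V i)" by (rule card_inj_on_le[OF inj])
    also have "\<dots> = (\<Prod>i<n. card (V i))" by (simp add: card_PiE)
    also have "\<dots> \<le> (\<Prod>i<n. Suc t)" by (rule prod_mono) (use le in auto)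
    finally show False using B(2) by simp
  qed
  then obtain i where i: "i < n" "card (V i) > Suc t" by blast
  obtain C where C: "C \<subseteq> B" "inj_on (\<lambda>b. \<phi> (a \<otimes> b) i) C" "V i = (\<lambda>b. \<phi> (a \<otimes> b) i) ` C"
    using subset_image_inj[of "V i" "\<lambda>b. \<phi> (a \<otimes> b) i" B] by (auto simp: V_def)
  have finC: "finite C" using C(1) B(1) by (rule finite_subset)
  have CC: "C \<subseteq> carrier X" using C(1) BC by blast
  have cardC: "card C > t" using i(2) card_image[OF C(2)] C(3) by simp
  then have Cne: "C \<noteq> {}" by auto
  define W where "W = (\<Inter>b\<in>C. {x \<in> carrier X. x \<otimes> b \<in> U})"
  have W: "opn W" unfolding W_def
    using Cne finC CC by (intro openin_Inter) (auto intro!: translations_open chart_opn[OF ch])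
  \<comment> \<open>The product of all differences: its nonvanishing is an open condition and means
    that the coordinate is injective on the translates.\<close>
  define D where "D x = (\<Prod>(b, c)\<in>C \<times> C - Id. \<phi> (x \<otimes> b) i - \<phi> (x \<otimes> c) i)" for x
  have r: "(\<lambda>x. \<phi> (x \<otimes> b) i) \<in> reg W" if b: "b \<in> C" for b
  proof (rule reg_restrict[OF _ W])
    have bc: "b \<in> carrier X" using b CC by blast
    show "opn {x \<in> pts. x \<otimes> b \<in> U}" using translations_open(1)[OF bc chart_opn[OF ch]] pts_eq by simp
    show "(\<lambda>x. \<phi> (x \<otimes> b) i) \<in> reg {x \<in> pts. x \<otimes> b \<in> U}"
      by (rule morphism_reg[OF morphism_translations(1)[OF bc] chart_opn[OF ch] chart_coord[OF ch i(1)]])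
    show "W \<subseteq> {x \<in> pts. x \<otimes> b \<in> U}" using b by (auto simp: W_def pts_eq)
  qed
  have "(\<lambda>x. \<phi> (x \<otimes> b) i - \<phi> (x \<otimes> c) i) \<in> reg W" if "b \<in> C" "c \<in> C" for b c
  proof -
    have "(\<lambda>x. \<phi> (x \<otimes> b) i + (- 1) * \<phi> (x \<otimes> c) i) \<in> reg W"
      by (intro reg_add reg_mult reg_const W r that)
    then show ?thesis by simp
  qed
  then have "D \<in> reg W" unfolding D_def by (intro reg_prod W) auto
  from opn_nonzero[OF W this] have "opn {x \<in> W. D x \<noteq> 0}" .
  moreover have finCC: "finite (C \<times> C - Id)" using finC by simp
  have "D a \<noteq> 0" unfolding D_def using finCC inj_onD[OF C(2)] by auto
  then have "a \<in> {x \<in> W. D x \<noteq> 0}" using a(2) ac C(1) by (auto simp: W_def)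
  moreover have "\<forall>x\<in>{x \<in> W. D x \<noteq> 0}. (\<forall>b\<in>C. x \<otimes> b \<in> U) \<and> inj_on (\<lambda>b. \<phi> (x \<otimes> b) i) C"
  proof (intro ballI conjI)
    fix x assume x: "x \<in> {x \<in> W. D x \<noteq> 0}"
    then show "x \<otimes> b \<in> U" if "b \<in> C" for b using that by (auto simp: W_def)
    show "inj_on (\<lambda>b. \<phi> (x \<otimes> b) i) C"
    proof (rule inj_onI, rule ccontr)
      fix b c assume "b \<in> C" "c \<in> C" "\<phi> (x \<otimes> b) i = \<phi> (x \<otimes> c) i" "b \<noteq> c"
      then have "D x = 0" unfolding D_def using finCC by (intro prod_zero bexI[of _ "(b, c)"]) auto
      then show False using x by simp
    qed
  qed
  ultimately have "P i t" unfolding P_def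
    using finC cardC C(1) B(3) a(1) by (intro exI[of _ C] exI[of _ "{x \<in> W. D x \<noteq> 0}"]) auto
  then show False using Pt[OF i(1)] by blast
qed

end

section \<open>Dominance and the gain from the kernel\<close>

context approx_ca
begin

text \<open>Dominance of \<open>Phi\<close> on the powers of the identity component. The image
  contains the dense set of configurations with values in \<open>L\<close>, so the preimage of
  \<open>U\<close> is a nonempty open part of an irreducible set and meets \<open>V\<close>.\<close>

lemma Phi_preimage_meets:
  assumes L: "L \<subseteq> X.id_comp" and E: "E \<subseteq> F"
    and z: "\<And>a. a \<in> L \<Longrightarrow> \<exists>z. supported E X.id_comp z \<and> (maps_to_delta z a)"
    and dense: "\<And>V. X.opn V \<Longrightarrow> V \<inter> X.id_comp \<noteq> {} \<Longrightarrow> V \<inter> L \<noteq> {}"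
    and U: "openin (X.ptop J) U" "U \<inter> (J \<rightarrow>\<^sub>E X.id_comp) \<noteq> {}"
    and V: "openin (X.ptop I) V" "V \<inter> (I \<rightarrow>\<^sub>E X.id_comp) \<noteq> {}"
  shows "\<exists>x\<in>I \<rightarrow>\<^sub>E X.id_comp. x \<in> V \<and> Phi J \<psi> x \<in> U"
proof -
  have sub: "X.id_comp \<subseteq> X.pts" using X.id_comp_carrier X.pts_eq by simp
  obtain y where y: "y \<in> U" "y \<in> J \<rightarrow>\<^sub>E L"
    using X.dense_power[OF finJ sub L dense U] by blast
  have LA: "L \<subseteq> A" using L X.id_comp_carrier by blast
  obtain x where x: "x \<in> I \<rightarrow>\<^sub>E X.id_comp" "Phi J \<psi> x = y"
    using Phi_image[OF X.subgroup_id_comp LA E z y(2)] by blast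
  let ?W = "{x \<in> topspace (zariski (power_fspace I (variety X))). Phi J \<psi> x \<in> U}"
  have W: "openin (X.ptop I) ?W" using morphism_open[OF Phi_morphism] U(1) by simp
  have "I \<rightarrow>\<^sub>E X.id_comp \<subseteq> topspace (X.ptop I)"
    by (rule openin_subset[OF X.opn_id_comp_power])
  then have "?W \<inter> (I \<rightarrow>\<^sub>E X.id_comp) \<noteq> {}" using x y by auto
  from irr_in_Int[OF X.irr_in_id_comp_power[OF fin(1)] W V(1) this V(2)] show ?thesis by auto
qed

text \<open>Functions pulled back along \<open>Phi\<close> are constant on the cosets of its kernel, whereas the
  coordinate \<open>i0\<close> at \<open>\<psi> v \<omega>\<close> takes many values when the \<open>v\<close>-th copy of the kernel acts.\<close>

lemma has_indep_extend:
  assumes ch: "X.chart n U \<phi>" and i0: "i0 < n" and J: "J \<noteq> {}"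
    and L: "L \<subseteq> X.id_comp" and E: "E \<subseteq> F"
    and z: "\<And>a. a \<in> L \<Longrightarrow> \<exists>z. supported E X.id_comp z \<and> (maps_to_delta z a)"
    and dense: "\<And>V. X.opn V \<Longrightarrow> V \<inter> X.id_comp \<noteq> {} \<Longrightarrow> V \<inter> L \<noteq> {}"
    and N: "\<And>k. k \<in> N \<Longrightarrow> supported \<Omega> X.id_comp k \<and> (\<forall>h\<in>carrier G. \<tau> k h = e)"
    and \<Omega>: "\<Omega> \<subseteq> F" "\<omega> \<in> \<Omega>"
    and spread: "\<And>s. X.spreads U \<phi> i0 ((\<lambda>k. k \<omega>) ` N) s"
    and U: "e \<in> U"
    and T: "T \<subseteq> J" "\<And>u v. u \<in> T \<Longrightarrow> v \<in> T \<Longrightarrow> u \<noteq> v \<Longrightarrow> \<psi> u ` \<Omega> \<inter> \<psi> v ` \<Omega> = {}"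
    and ind: "X.has_indep J d"
  shows "X.has_indep I (d + card T)"
proof -
  let ?TI = "X.ptop I" and ?RI = "X.preg I"
  interpret P: fun_space "power_fspace I (variety X)" by standard (rule X.swf_power[OF fin])
  have finT: "finite T" using T(1) finJ by (rule finite_subset)
  obtain W0 f where W0: "openin (X.ptop J) W0" "W0 \<noteq> {}" "W0 \<subseteq> (J \<rightarrow>\<^sub>E X.id_comp)"
    and f: "\<forall>i<d. f i \<in> X.preg J W0" "alg_indep W0 f d"
    using ind by (rule X.has_indepE)
  have A0A: "I \<rightarrow>\<^sub>E X.id_comp \<subseteq> I \<rightarrow>\<^sub>E A" by (rule PiE_mono) (rule X.id_comp_carrier)
  have top: "topspace ?TI = I \<rightarrow>\<^sub>E A" by (simp add: X.topspace_power X.pts_eq)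
  \<comment> \<open>The sites \<open>\<psi> v \<omega>\<close> are confined to the chart, so that
    the coordinate \<open>i0\<close> is a regular function there.\<close>
  define box where "box i = (if \<exists>v\<in>T. i = \<psi> v \<omega> then U \<inter> X.id_comp else X.id_comp)" for i
  have box: "openin ?TI (\<Pi>\<^sub>E i\<in>I. box i)"
    by (rule X.openin_power_box) (use X.chart_opn[OF ch] X.opn_id_comp in \<open>auto simp: box_def\<close>)
  have box_sub: "(\<Pi>\<^sub>E i\<in>I. box i) \<subseteq> I \<rightarrow>\<^sub>E X.id_comp" by (rule PiE_mono) (auto simp: box_def)
  have "(\<lambda>i\<in>I. e) \<in> (\<Pi>\<^sub>E i\<in>I. box i)" using U X.one_id_comp by (auto simp: box_def)
  then have box_ne: "(\<Pi>\<^sub>E i\<in>I. box i) \<inter> (I \<rightarrow>\<^sub>E X.id_comp) \<noteq> {}" using box_sub by blast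
  let ?V = "{x \<in> topspace (zariski (power_fspace I (variety X))). Phi J \<psi> x \<in> W0}"
  define W where "W = ?V \<inter> (\<Pi>\<^sub>E i\<in>I. box i)"
  have V: "openin ?TI ?V" using morphism_open[OF Phi_morphism] W0(1) by simp
  have W: "openin ?TI W" unfolding W_def by (rule openin_Int[OF V box])
  have W_sub: "W \<subseteq> I \<rightarrow>\<^sub>E X.id_comp" using box_sub by (auto simp: W_def)
  have W_mem: "x \<in> W \<longleftrightarrow> Phi J \<psi> x \<in> W0 \<and> x \<in> (\<Pi>\<^sub>E i\<in>I. box i)" for x
  proof -
    have "x \<in> topspace (zariski (power_fspace I (variety X)))" if "x \<in> (\<Pi>\<^sub>E i\<in>I. box i)"
      unfolding X.zariski_power top using that box_sub A0A by blast
    then show ?thesis unfolding W_def by blast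
  qed
  have meets: "\<exists>x\<in>W. Phi J \<psi> x \<in> O'" if O': "openin (X.ptop J) O'" "O' \<noteq> {}" "O' \<subseteq> W0" for O'
  proof -
    have "O' \<inter> (J \<rightarrow>\<^sub>E X.id_comp) \<noteq> {}" using O'(2,3) W0(3) by blast
    from Phi_preimage_meets[OF L E z dense O'(1) this box box_ne] show ?thesis
      using O'(3) W_mem by blast
  qed
  obtain t where t: "bij_betw t {..<card T} T"
    using ex_bij_betw_nat_finite[OF finT] by (auto simp: lessThan_atLeast0)
  have tT: "t k \<in> T" if "k < card T" for k using t that by (auto simp: bij_betw_def)
  define h where "h i x = (if i < d then f i (Phi J \<psi> x) else \<phi> (x (\<psi> (t (i - d)) \<omega>)) i0)" for i x
  have \<omega>I: "\<psi> v \<omega> \<in> I" if "v \<in> T" for v using \<psi>_I \<Omega> T(1) that by auto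
  have reg: "h i \<in> ?RI W" if i: "i < d + card T" for i
  proof (cases "i < d")
    case True
    then have "(\<lambda>x. f i (Phi J \<psi> x)) \<in> ?RI ?V" using morphism_reg[OF Phi_morphism, of W0 "f i"] W0(1) f(1) by simp
    then have "(\<lambda>x. f i (Phi J \<psi> x)) \<in> ?RI W"
      by (rule P.reg_restrict[rotated -1]) (use V W in \<open>auto simp: W_def\<close>)
    then show ?thesis using True by (simp add: h_def[abs_def])
  next
    case False
    let ?v = "t (i - d)"
    have v: "?v \<in> T" using tT i False by simp
    note rc = X.reg_power_coord[OF fin(1) \<omega>I[OF v] X.chart_opn[OF ch] X.chart_coord[OF ch i0]]
    have W_U: "W \<subseteq> {x \<in> (\<Pi>\<^sub>E m\<in>I. X.pts). x (\<psi> ?v \<omega>) \<in> U}"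
    proof
      fix x assume "x \<in> W"
      then have x: "x \<in> (\<Pi>\<^sub>E i\<in>I. box i)" by (simp add: W_def)
      then have "x (\<psi> ?v \<omega>) \<in> box (\<psi> ?v \<omega>)" using \<omega>I[OF v] by auto
      then have "x (\<psi> ?v \<omega>) \<in> U" using v by (auto simp: box_def split: if_splits)
      moreover have "x \<in> (\<Pi>\<^sub>E m\<in>I. X.pts)" unfolding X.pts_eq using x box_sub A0A by blast
      ultimately show "x \<in> {x \<in> (\<Pi>\<^sub>E m\<in>I. X.pts). x (\<psi> ?v \<omega>) \<in> U}" by simp
    qed
    have "(\<lambda>x. \<phi> (x (\<psi> ?v \<omega>)) i0) \<in> ?RI W"
      by (rule P.reg_restrict[OF _ _ W_U rc(2)]) (use rc(1) W in simp_all)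
    then show ?thesis using False by (simp add: h_def[abs_def])
  qed
  have indep: "alg_indep W h (d + k)" if "k \<le> card T" for k
    using that
  proof (induction k)
    case 0
    \<comment> \<open>Dominance carries independence across the pullback: the open set where a
      relation between the \<open>f i\<close> fails would contain the image of a point of
      \<open>W\<close>.\<close>
    have "alg_indep W (\<lambda>i x. f i (Phi J \<psi> x)) d"
      unfolding alg_indep_def
    proof (intro allI impI)
      fix s :: nat and c
      let ?B = "{..<d} \<rightarrow>\<^sub>E {..s}"
      assume zero: "\<forall>x\<in>W. (\<Sum>\<alpha>\<in>?B. c \<alpha> * (\<Prod>i<d. f i (Phi J \<psi> x) ^ \<alpha> i)) = 0"
      let ?O = "{y \<in> W0. (\<Sum>\<alpha>\<in>?B. c \<alpha> * (\<Prod>i<d. f i y ^ \<alpha> i)) \<noteq> 0}"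
      have "?O = {}"
      proof (rule ccontr)
        assume "?O \<noteq> {}"
        from meets[OF X.monomial_sum_regular(2)[OF finJ J W0(1) f(1)] this]
        obtain x where "x \<in> W" "Phi J \<psi> x \<in> ?O" by blast
        then show False using zero by simp
      qed
      then have "(\<Sum>\<alpha>\<in>?B. c \<alpha> * (\<Prod>i<d. f i y ^ \<alpha> i)) = 0" if "y \<in> W0" for y using that by simp
      then show "\<forall>\<alpha>\<in>?B. c \<alpha> = 0" using alg_indepD[OF f(2)] by blast
    qed
    moreover have "alg_indep W h d \<longleftrightarrow> alg_indep W (\<lambda>i x. f i (Phi J \<psi> x)) d"
      by (rule alg_indep_cong) (simp add: h_def)
    ultimately show ?case by simp
  next
    case (Suc k)
    then have IH: "alg_indep W h (d + k)" by simp
    let ?v = "t k"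
    have v: "?v \<in> T" using tT Suc.prems by simp
    have vJ: "?v \<in> J" using v T(1) by blast
    have "alg_indep W h (Suc (d + k))"
    proof (rule alg_indep_Suc)
      fix s :: nat and c :: "(nat \<Rightarrow> nat) \<Rightarrow> 'k" and \<alpha>0
      let ?B = "{..<d + k} \<rightarrow>\<^sub>E {..s}" and ?n = "d + k"
      assume \<alpha>0: "\<alpha>0 \<in> ?B" "c \<alpha>0 \<noteq> 0"
      let ?S = "\<lambda>x. \<Sum>\<alpha>\<in>?B. c \<alpha> * (\<Prod>i<?n. h i x ^ \<alpha> i)"
      have "\<exists>x\<in>W. ?S x \<noteq> 0"
      proof (rule ccontr)
        assume "\<not> ?thesis"
        then have "?S x = 0" if "x \<in> W" for x using that by blast
        then have "c \<alpha>0 = 0" by (rule alg_indepD[where c = c, OF IH _ \<alpha>0(1)])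
        then show False using \<alpha>0(2) by simp
      qed
      then have ne: "{x \<in> W. ?S x \<noteq> 0} \<inter> (I \<rightarrow>\<^sub>E X.id_comp) \<noteq> {}" using W_sub by blast
      have op: "openin ?TI {x \<in> W. ?S x \<noteq> 0}"
        by (rule X.monomial_sum_regular(2)[OF fin W]) (use reg Suc.prems in auto)
      obtain B Q where B: "finite B" "s < card B" "B \<subseteq> (\<lambda>k. k \<omega>) ` N"
        and Q: "X.opn Q" "Q \<inter> X.id_comp \<noteq> {}"
        and BQ: "\<forall>a\<in>Q. (\<forall>b\<in>B. a \<cdot> b \<in> U) \<and> inj_on (\<lambda>b. \<phi> (a \<cdot> b) i0) B"
        using spread[of s] by (elim exE conjE)
      obtain a where a: "a \<in> Q" "a \<in> X.id_comp" using Q(2) by blast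
      let ?C = "{x \<in> (\<Pi>\<^sub>E m\<in>I. X.pts). x (\<psi> ?v \<omega>) \<in> Q}"
      have opC: "openin ?TI ?C"
        by (rule X.reg_power_coord(1)[OF fin(1) \<omega>I[OF v] Q(1) X.reg_const[OF Q(1)]])
      have "(\<lambda>i\<in>I. if i = \<psi> ?v \<omega> then a else e) \<in> ?C \<inter> (I \<rightarrow>\<^sub>E X.id_comp)"
        using a X.one_id_comp \<omega>I[OF v] X.id_comp_carrier X.pts_eq by auto
      then have "?C \<inter> (I \<rightarrow>\<^sub>E X.id_comp) \<noteq> {}" by blast
      from irr_in_Int[OF X.irr_in_id_comp_power[OF fin(1)] op opC ne this]
      obtain x where x: "x \<in> W" "?S x \<noteq> 0" "x (\<psi> ?v \<omega>) \<in> Q" by blast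
      have xA0: "x \<in> I \<rightarrow>\<^sub>E X.id_comp" using x(1) W_sub by blast
      have xA: "x \<in> I \<rightarrow>\<^sub>E A" using xA0 A0A by blast
      \<comment> \<open>Multiplying \<open>x\<close> by a planted kernel element leaves its image
        under \<open>Phi\<close> and the sites of the other copies unchanged, and multiplies the
        value at the site of \<open>?v\<close> by \<open>b\<close>. Of the functions considered so
        far, only the new one moves.\<close>
      have move: "\<exists>y\<in>W. h ?n y = \<phi> (x (\<psi> ?v \<omega>) \<cdot> b) i0 \<and> (\<forall>i<?n. h i y = h i x)" if b: "b \<in> B" for b
      proof -
        obtain m where m: "m \<in> N" "b = m \<omega>" using b B(3) by blast
        have ms: "supported \<Omega> X.id_comp m" "\<And>h. h \<in> carrier G \<Longrightarrow> \<tau> m h = e" using N[OF m(1)] by auto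
        let ?p = "plant I \<psi> \<Omega> ?v m"
        have p: "?p \<in> I \<rightarrow>\<^sub>E X.id_comp" by (rule plant_in[OF ms(1) X.one_id_comp \<Omega>(1) vJ])
        have Pp: "Phi J \<psi> ?p = (\<lambda>j\<in>J. if j = ?v then e else e)"
          by (rule Phi_plant[OF ms(1) X.id_comp_carrier \<Omega>(1) vJ]) (simp add: ms(2))
        let ?y = "\<lambda>i\<in>I. x i \<cdot> ?p i"
        have pA: "?p \<in> I \<rightarrow>\<^sub>E A" using p A0A by blast
        have Py: "Phi J \<psi> ?y = Phi J \<psi> x"
          using Phi_mult[OF xA pA] Phi_closed[OF xA]
          by (auto simp: Pp fun_eq_iff PiE_iff extensional_def)
        have pv: "?p (\<psi> ?v \<omega>) = b"
          using plant_val[OF ms(1) \<Omega>(1) vJ _ \<omega>I[OF v]] F_D \<Omega> m(2) by auto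
        have pu: "?p (\<psi> u \<omega>) = e" if "u \<in> T" "u \<noteq> ?v" for u
        proof -
          have "\<psi> u \<omega> \<notin> \<psi> ?v ` \<Omega>" using T(2)[OF that(1) v that(2)] \<Omega>(2) by blast
          then show ?thesis using \<omega>I[OF that(1)] by (simp add: plant_def)
        qed
        have yu: "?y (\<psi> u \<omega>) = x (\<psi> u \<omega>)" if "u \<in> T" "u \<noteq> ?v" for u
          using pu[OF that] \<omega>I[OF that(1)] xA by (auto simp: PiE_iff)
        have yv: "?y (\<psi> ?v \<omega>) = x (\<psi> ?v \<omega>) \<cdot> b" using pv \<omega>I[OF v] by simp
        have "?y i \<in> box i" if i: "i \<in> I" for i
        proof -
          have y0: "?y i \<in> X.id_comp" using xA0 p i X.id_comp_m_closed by (auto simp: PiE_iff)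
          show ?thesis
          proof (cases "\<exists>u\<in>T. i = \<psi> u \<omega>")
            case True
            then obtain u where u: "u \<in> T" "i = \<psi> u \<omega>" by blast
            have "?y i \<in> U"
            proof (cases "u = ?v")
              case True
              then show ?thesis using yv u(2) BQ x(3) b by auto
            next
              case False
              have "x i \<in> box i" using x(1) i by (auto simp: W_def PiE_iff)
              then have "x i \<in> U" using u by (auto simp: box_def split: if_splits)
              then show ?thesis using yu[OF u(1) False] u(2) by simp
            qed
            then show ?thesis using y0 True by (simp add: box_def del: restrict_apply)
          next
            case False
            then show ?thesis using y0 by (simp add: box_def del: restrict_apply)
          qed
        qed
        then have "?y \<in> (\<Pi>\<^sub>E i\<in>I. box i)" by auto
        then have yW: "?y \<in> W" using W_mem Py x(1) by simp
        have "h i ?y = h i x" if i: "i < ?n" for i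
        proof (cases "i < d")
          case True then show ?thesis using Py by (simp add: h_def)
        next
          case False
          then have ik: "i - d < k" using i by simp
          have "inj_on t {..<card T}" using t by (simp add: bij_betw_def)
          then have "t (i - d) \<noteq> ?v"
            using inj_onD[of t "{..<card T}" "i - d" k] ik Suc.prems by auto
          moreover have "t (i - d) \<in> T" using tT ik Suc.prems by simp
          ultimately have "t (i - d) \<in> T" "t (i - d) \<noteq> ?v" by blast+
          then show ?thesis using yu False by (simp add: h_def del: restrict_apply)
        qed
        moreover have "h ?n ?y = \<phi> (x (\<psi> ?v \<omega>) \<cdot> b) i0" using yv by (simp add: h_def del: restrict_apply)
        ultimately show ?thesis using yW by blast
      qed
      have "card ((\<lambda>b. \<phi> (x (\<psi> ?v \<omega>) \<cdot> b) i0) ` B) > s"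
        using B(2) BQ x(3) by (simp add: card_image)
      then show "\<exists>y\<in>W. ?S y \<noteq> 0 \<and>
        (\<exists>B. finite B \<and> card B > s \<and> (\<forall>t\<in>B. \<exists>y'\<in>W. h ?n y' = t \<and> (\<forall>i<?n. h i y' = h i y)))"
        using x(1,2) move B(1)
        by (intro bexI[of _ x] conjI exI[of _ "(\<lambda>b. \<phi> (x (\<psi> ?v \<omega>) \<cdot> b) i0) ` B"]) blast+
    qed
    then show ?case by simp
  qed
  show ?thesis
  proof (rule X.has_indepI[OF W])
    show "W \<noteq> {}" using meets[OF W0(1,2)] by blast
    show "W \<subseteq> I \<rightarrow>\<^sub>E X.id_comp" by (rule W_sub)
    show "alg_indep W h (d + card T)" by (rule indep) simp
  qed (rule reg)
qed

end

section \<open>Kernels of post-surjective automata\<close>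

context alg_grp
begin

lemma has_indep_Times:
  assumes l: "l > 0" "has_indep {..<l::nat} d" and J: "finite J" "J \<noteq> {}"
  shows "has_indep (J \<times> {..<l}) (card J * d)"
proof -
  have one: "has_indep ({j} \<times> {..<l}) d" for j :: 'c
    by (rule has_indep_reindex[where \<sigma> = "\<lambda>i. (j, i)", OF _ _ _ _ l(2)]) (use l(1) in \<open>auto simp: bij_betw_def inj_on_def\<close>)
  show ?thesis using J
  proof (induction J rule: finite_ne_induct)
    case (singleton j) show ?case using one by simp
  next
    case (insert j J)
    have "has_indep ({j} \<times> {..<l} \<union> J \<times> {..<l}) (d + card J * d)"
      by (rule has_indep_Un[OF _ _ _ _ _ one insert.IH]) (use insert.hyps l(1) in auto)
    moreover have "{j} \<times> {..<l} \<union> J \<times> {..<l} = insert j J \<times> {..<l}" by auto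
    ultimately show ?case using insert.hyps by simp
  qed
qed

end

context group_ca
begin

lemma supported_mono:
  assumes "supported E C z" "E \<subseteq> E'" "C \<subseteq> C'" shows "supported E' C' z"
  using assms unfolding supported_def by (auto simp: PiE_iff)

text \<open>The neutral configuration is fixed by \<open>\<tau>\<close>, and \<open>delta a\<close>
  differs from it at one point only. Post-surjectivity thus gives a preimage asymptotic to the
  neutral one, whose support \<open>E\<close> depends on \<open>a\<close>.\<close>

lemma post_surjective_delta:
  assumes ps: "post_surjective G A \<tau>" and a: "a \<in> A"
  shows "\<exists>E z. finite E \<and> E \<subseteq> carrier G \<and> supported E A z \<and> (maps_to_delta z a)"
proof -
  define x where "x = (\<lambda>g\<in>carrier G. e)"
  have x: "x \<in> configs G A" by (simp add: x_def configs_def)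
  have \<tau>x: "\<tau> x g = e" if g: "g \<in> carrier G" for g
  proof -
    have "(\<lambda>m\<in>M. x (g \<otimes> m)) = (\<lambda>m\<in>M. e)" using g M by (auto simp: x_def fun_eq_iff)
    then show ?thesis using \<tau>_eq[OF x g] \<mu>_one by simp
  qed
  have y: "delta a \<in> configs G A" using a by (simp add: delta_def configs_def)
  have "asymptotic G (delta a) (\<tau> x)"
    unfolding asymptotic_def
    by (rule exI[of _ "{\<one>}"]) (use \<tau>x in \<open>auto simp: delta_def fun_eq_iff\<close>)
  then obtain z where z: "z \<in> configs G A" "asymptotic G z x" "\<tau> z = delta a"
    using ps x y unfolding post_surjective_def by blast
  obtain E where E: "finite E" "E \<subseteq> carrier G" "restrict z (carrier G - E) = restrict x (carrier G - E)"
    using z(2) unfolding asymptotic_def by blast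
  have "z g = e" if "g \<in> carrier G - E" for g
    using fun_cong[OF E(3), of g] that by (simp add: x_def)
  then have "supported E A z" using z(1) by (simp add: supported_def configs_def)
  then show ?thesis using E z(3) by (intro exI[of _ E] exI[of _ z]) (auto simp: delta_def)
qed

text \<open>With \<open>\<epsilon> \<le> 1 / 2\<close> at least half of the vertices are good, which
  turns the estimate of \<open>disjoint_copies\<close> into a fixed proportion of
  \<open>card V\<close>.\<close>

lemma sofic_approx_ca:
  assumes so: "sofic G" and F: "finite F" "F \<subseteq> carrier G" "M \<subseteq> F" "\<one> \<in> F"
    and \<Omega>: "finite \<Omega>" "\<Omega> \<noteq> {}" "\<Omega> \<subseteq> F" and \<epsilon>: "0 < \<epsilon>" "\<epsilon> \<le> 1 / 2"
  shows "\<exists>(V :: nat set) J \<psi> T. approx_ca G X \<tau> M \<mu> F V J \<psi> \<and> J \<noteq> {} \<and> T \<subseteq> J \<and>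
     (\<forall>u\<in>T. \<forall>v\<in>T. u \<noteq> v \<longrightarrow> \<psi> u ` \<Omega> \<inter> \<psi> v ` \<Omega> = {}) \<and>
     real (card V) - real (card J) \<le> \<epsilon> * real (card V) \<and> 0 < real (card V) \<and> card J \<le> card V \<and>
     real (card V) \<le> 2 * (real (card \<Omega>))\<^sup>2 * real (card T)"
proof -
  obtain V :: "nat set" and J \<psi> where V: "finite V" "V \<noteq> {}" "J \<subseteq> V"
    "real (card J) \<ge> (1 - \<epsilon>) * real (card V)" "local_approx G F V J \<psi>"
    using sofic_local_approx[OF G.is_group so F(1,2) \<epsilon>(1)] by (elim exE conjE)
  have ap: "approx_ca G X \<tau> M \<mu> F V J \<psi>"
    using V F by unfold_locales auto
  interpret approx_ca G X \<tau> M \<mu> F V J \<psi> by (rule ap)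
  obtain T where T: "T \<subseteq> J" "\<forall>u\<in>T. \<forall>v\<in>T. u \<noteq> v \<longrightarrow> \<psi> u ` \<Omega> \<inter> \<psi> v ` \<Omega> = {}"
    "card J \<le> card T * (card \<Omega>)\<^sup>2" using disjoint_copies[OF \<Omega>] by (elim exE conjE)
  have pos: "0 < real (card V)" using V by (simp add: card_gt_0_iff)
  have "(1 / 2) * real (card V) \<le> (1 - \<epsilon>) * real (card V)" using \<epsilon> by (intro mult_right_mono) auto
  then have half: "real (card V) / 2 \<le> real (card J)" using V(4) by simp
  then have "J \<noteq> {}" using pos by auto
  moreover have "real (card J) \<le> real (card T) * (real (card \<Omega>))\<^sup>2"
    using T(3) by (metis of_nat_le_iff of_nat_mult of_nat_power)
  then have "real (card V) \<le> 2 * (real (card \<Omega>))\<^sup>2 * real (card T)" using half by (simp add: mult.commute)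
  moreover have "real (card V) - real (card J) \<le> \<epsilon> * real (card V)" using V(4) by (simp add: algebra_simps)
  moreover have "card J \<le> card V" using V by (simp add: card_mono)
  ultimately show ?thesis using ap T(1,2) pos by blast
qed

text \<open>Otherwise the coset count gives \<open>2 ^ card T * q ^ card J \<le> q ^ card V\<close>
  for the number \<open>q\<close> of cosets, so \<open>card T\<close> is at most
  \<open>q * (card V - card J)\<close>. The right side can be made an arbitrarily small fraction of
  \<open>card V\<close>, the left side cannot.\<close>

lemma kernel_id_comp:
  assumes so: "sofic G" and ps: "post_surjective G A \<tau>"
    and \<Omega>: "finite \<Omega>" "\<Omega> \<subseteq> carrier G" and n: "supported \<Omega> A n" "\<And>h. h \<in> carrier G \<Longrightarrow> \<tau> n h = e"
    and \<omega>: "\<omega> \<in> \<Omega>"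
  shows "n \<omega> \<in> X.id_comp"
proof (rule ccontr)
  assume no: "n \<omega> \<notin> X.id_comp"
  obtain R where R: "finite R" "R \<subseteq> A" "\<forall>a\<in>A. \<exists>r\<in>R. inv\<^bsub>X\<^esub> r \<cdot> a \<in> X.id_comp"
    using X.finite_index_id_comp by (elim exE conjE)
  have "\<forall>a\<in>R. \<exists>E. finite E \<and> E \<subseteq> carrier G \<and> (\<exists>z. supported E A z \<and> (maps_to_delta z a))"
    using post_surjective_delta[OF ps] R(2) by (meson subsetD)
  from bchoice[OF this] obtain E where E: "\<forall>a\<in>R. finite (E a) \<and> E a \<subseteq> carrier G \<and>
    (\<exists>z. supported (E a) A z \<and> (maps_to_delta z a))" ..
  define EE where "EE = (\<Union>a\<in>R. E a)"
  define F where "F = insert \<one> (M \<union> EE \<union> \<Omega>)"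
  have F: "finite F" "F \<subseteq> carrier G" using R(1) E M \<Omega> by (auto simp: F_def EE_def)
  have EF: "EE \<subseteq> F" "\<Omega> \<subseteq> F" "M \<subseteq> F" "\<one> \<in> F" by (auto simp: F_def)
  have EE: "\<exists>z. supported EE A z \<and> (maps_to_delta z a)" if a: "a \<in> R" for a
  proof -
    obtain z where z: "supported (E a) A z" "maps_to_delta z a"
      using bspec[OF E a] by blast
    have "supported EE A z" by (rule supported_mono[OF z(1)]) (use a in \<open>auto simp: EE_def\<close>)
    then show ?thesis using z(2) by blast
  qed
  have half: "2 * (1 / (4 * t)) = 1 / (2 * t)" for t :: real by (cases "t = 0") (auto simp: field_simps)
  define q where "q = card (X.coset ` A)"
  define w where "w = real (card \<Omega>)"
  have "card \<Omega> > 0" using \<Omega>(1) \<omega> by (auto simp: card_gt_0_iff)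
  then have w: "w \<ge> 1" by (simp add: w_def)
  then have w2: "w\<^sup>2 \<ge> 1" by simp
  \<comment> \<open>Chosen so that \<open>2 * w\<^sup>2 * q * \<epsilon>\<close> is
    \<open>q / (2 * (q + 1))\<close>, which is less than 1.\<close>
  define \<epsilon> where "\<epsilon> = 1 / (4 * (real q + 1) * w\<^sup>2)"
  have "4 * (real q + 1) * w\<^sup>2 \<ge> 4 * (real q + 1) * 1" using w2 by (intro mult_left_mono) auto
  moreover have "2 \<le> 4 * (real q + 1) * 1" by simp
  ultimately have "4 * (real q + 1) * w\<^sup>2 \<ge> 2" by (rule order_trans[rotated])
  then have \<epsilon>: "0 < \<epsilon>" "\<epsilon> \<le> 1 / 2" unfolding \<epsilon>_def by (auto simp: field_simps)
  have \<Omega>ne: "\<Omega> \<noteq> {}" using \<omega> by blast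
  obtain V :: "nat set" and J \<psi> T where ap: "approx_ca G X \<tau> M \<mu> F V J \<psi>" and T: "T \<subseteq> J"
    "\<forall>u\<in>T. \<forall>v\<in>T. u \<noteq> v \<longrightarrow> \<psi> u ` \<Omega> \<inter> \<psi> v ` \<Omega> = {}"
    and num: "real (card V) - real (card J) \<le> \<epsilon> * real (card V)" "0 < real (card V)" "card J \<le> card V"
     "real (card V) \<le> 2 * (real (card \<Omega>))\<^sup>2 * real (card T)"
    using sofic_approx_ca[OF so F EF(3,4) \<Omega>(1) \<Omega>ne EF(2) \<epsilon>] by (elim exE conjE)
  interpret approx_ca G X \<tau> M \<mu> F V J \<psi> by (rule ap)
  have cnt: "2 ^ card T * q ^ card J \<le> q ^ card V"
    unfolding q_def
    by (rule coset_count[OF R(1,2) _ EF(1) EE n(1) EF(2) n(2) \<omega> no T(1)]) (use R(3) T(2) in blast)+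
  have "q \<noteq> 0"
  proof
    assume "q = 0"
    have "finite (X.coset ` A)" unfolding X.coset_image[OF R(2,3)] using R(1) by simp
    then show False using \<open>q = 0\<close> X.one_closed by (auto simp: q_def card_eq_0_iff)
  qed
  then have "q ^ card J > 0" by simp
  moreover have "q ^ card V = q ^ (card V - card J) * q ^ card J" using num(3) by (simp flip: power_add)
  ultimately have "2 ^ card T \<le> q ^ (card V - card J)" using cnt by simp
  \<comment> \<open>The crude bound of \<open>q\<close> by \<open>2 ^ q\<close> takes the place of
    its binary logarithm.\<close>
  also have "\<dots> \<le> (2 ^ q) ^ (card V - card J)" by (rule power_mono[OF less_imp_le[OF less_exp]]) simp
  finally have "(2::nat) ^ card T \<le> 2 ^ (q * (card V - card J))" by (simp flip: power_mult)
  then have "card T \<le> q * (card V - card J)" by simp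
  then have "real (card T) \<le> real q * (real (card V) - real (card J))"
    using num(3) by (metis of_nat_diff of_nat_le_iff of_nat_mult)
  also have "\<dots> \<le> real q * (\<epsilon> * real (card V))" using num(1) by (intro mult_left_mono) auto
  finally have "2 * w\<^sup>2 * real (card T) \<le> 2 * w\<^sup>2 * (real q * (\<epsilon> * real (card V)))"
    by (intro mult_left_mono) auto
  then have "real (card V) \<le> 2 * w\<^sup>2 * (real q * (\<epsilon> * real (card V)))" using num(4) by (simp add: w_def)
  also have "2 * w\<^sup>2 * (real q * (\<epsilon> * real (card V))) = 2 * (w\<^sup>2 * \<epsilon>) * (real q * real (card V))"
    by (simp add: mult_ac)
  also have "w\<^sup>2 * \<epsilon> = 1 / (4 * (real q + 1))" using w by (simp add: \<epsilon>_def)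
  also have "2 * (1 / (4 * (real q + 1))) * (real q * real (card V)) = (real q / (2 * (real q + 1))) * real (card V)"
    unfolding half by simp
  also have "\<dots> < 1 * real (card V)"
    using num(2) by (intro mult_strict_right_mono) (auto simp: field_simps)
  finally show False by simp
qed

text \<open>The values in \<open>id_comp\<close> are sorted by a support \<open>E\<close> and a
  pattern \<open>\<rho>\<close> of cosets of a preimage, which gives countably many classes; one
  class \<open>S p\<close> is dense. Dividing the preimages in this class by a fixed one,
  \<open>z0\<close>, gives values in \<open>id_comp\<close>, at the price of translating the class
  by \<open>inv a0\<close>, which preserves density.\<close>

lemma delta_dense:
  assumes unc: "uncountable (UNIV :: 'k set)" and cG: "countable (carrier G)" and ps: "post_surjective G A \<tau>"
  shows "\<exists>E L. finite E \<and> E \<subseteq> carrier G \<and> L \<subseteq> X.id_comp \<and>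
    (\<forall>a\<in>L. \<exists>z. supported E X.id_comp z \<and> (maps_to_delta z a)) \<and>
    (\<forall>V. X.opn V \<longrightarrow> V \<inter> X.id_comp \<noteq> {} \<longrightarrow> V \<inter> L \<noteq> {})"
proof -
  obtain R where R: "finite R" "R \<subseteq> A" "\<forall>a\<in>A. \<exists>r\<in>R. inv\<^bsub>X\<^esub> r \<cdot> a \<in> X.id_comp"
    using X.finite_index_id_comp by (elim exE conjE)
  define S where "S = (\<lambda>(E, \<rho>). {a \<in> X.id_comp. \<exists>z. supported E A z \<and> (\<forall>g\<in>E. inv\<^bsub>X\<^esub> (\<rho> g) \<cdot> z g \<in> X.id_comp) \<and>
     (maps_to_delta z a)})"
  define Ix where "Ix = (SIGMA E:{E. E \<subseteq> carrier G \<and> finite E}. E \<rightarrow>\<^sub>E R)"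
  have "countable Ix" unfolding Ix_def
  proof (rule countable_SIGMA)
    show "countable {E. E \<subseteq> carrier G \<and> finite E}"
      using countable_Collect_finite_subset[OF cG] by (simp add: conj_commute)
    show "countable (E \<rightarrow>\<^sub>E R)" if "E \<in> {E. E \<subseteq> carrier G \<and> finite E}" for E
      using that R(1) by (intro countable_finite finite_PiE) auto
  qed
  then have cS: "countable (S ` Ix)" by simp
  have "X.id_comp \<subseteq> \<Union>(S ` Ix)"
  proof
    fix a assume a: "a \<in> X.id_comp"
    then have aA: "a \<in> A" using X.id_comp_carrier by blast
    obtain E z where z: "finite E" "E \<subseteq> carrier G" "supported E A z"
      "maps_to_delta z a"
      using post_surjective_delta[OF ps aA] by (elim exE conjE)
    have "\<forall>g\<in>E. \<exists>r. r \<in> R \<and> inv\<^bsub>X\<^esub> r \<cdot> z g \<in> X.id_comp"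
    proof
      fix g assume "g \<in> E"
      then have "z g \<in> A" using z(2,3) by (auto simp: supported_def PiE_iff)
      then show "\<exists>r. r \<in> R \<and> inv\<^bsub>X\<^esub> r \<cdot> z g \<in> X.id_comp" using R(3) by blast
    qed
    from bchoice[OF this] obtain \<rho> where \<rho>: "\<forall>g\<in>E. \<rho> g \<in> R \<and> inv\<^bsub>X\<^esub> (\<rho> g) \<cdot> z g \<in> X.id_comp" ..
    have "(E, restrict \<rho> E) \<in> Ix" using z \<rho> by (auto simp: Ix_def)
    moreover have "a \<in> S (E, restrict \<rho> E)"
      unfolding S_def prod.case using a z(3,4) \<rho> by (intro CollectI conjI exI[of _ z]) auto
    ultimately show "a \<in> \<Union>(S ` Ix)" by blast
  qed
  from X.countable_cover_dense[OF unc cS this]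
  obtain p where p: "p \<in> Ix" "\<forall>V. X.opn V \<longrightarrow> V \<inter> X.id_comp \<noteq> {} \<longrightarrow> V \<inter> (X.id_comp \<inter> S p) \<noteq> {}"
    by (elim bexE imageE) auto
  obtain E \<rho> where Ep: "p = (E, \<rho>)" by (cases p)
  have E: "finite E" "E \<subseteq> carrier G" "\<rho> \<in> E \<rightarrow>\<^sub>E R" using p(1) by (auto simp: Ix_def Ep)
  have "X.id_comp \<inter> X.id_comp \<noteq> {}" using X.one_id_comp by blast
  then have "X.id_comp \<inter> (X.id_comp \<inter> S p) \<noteq> {}" using p(2) X.opn_id_comp by blast
  then obtain a0 where a0: "a0 \<in> S p" by blast
  have SD: "a \<in> X.id_comp" "\<exists>z. supported E A z \<and> (\<forall>g\<in>E. inv\<^bsub>X\<^esub> (\<rho> g) \<cdot> z g \<in> X.id_comp) \<and>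
     (maps_to_delta z a)" if "a \<in> S p" for a
    using that unfolding S_def Ep prod.case by blast+
  have a0A: "a0 \<in> A" "a0 \<in> X.id_comp" using SD(1)[OF a0] X.id_comp_carrier by blast+
  obtain z0 where z0: "supported E A z0" "\<forall>g\<in>E. inv\<^bsub>X\<^esub> (\<rho> g) \<cdot> z0 g \<in> X.id_comp"
    "maps_to_delta z0 a0" using SD(2)[OF a0] by (elim exE conjE)
  have z0c: "z0 \<in> configs G A" by (rule supported_configs[OF z0(1) order_refl])
  define L where "L = (\<lambda>a. inv\<^bsub>X\<^esub> a0 \<cdot> a) ` S p"
  have "L \<subseteq> X.id_comp" using SD(1) a0A(2) X.id_comp_m_closed X.id_comp_inv by (auto simp: L_def)
  moreover have "\<exists>w. supported E X.id_comp w \<and> (maps_to_delta w b)" if b: "b \<in> L" for b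
  proof -
    obtain a where a: "a \<in> S p" "b = inv\<^bsub>X\<^esub> a0 \<cdot> a" using b by (auto simp: L_def)
    have aA: "a \<in> A" using SD(1)[OF a(1)] X.id_comp_carrier by blast
    obtain z where z: "supported E A z" "\<forall>g\<in>E. inv\<^bsub>X\<^esub> (\<rho> g) \<cdot> z g \<in> X.id_comp"
      "maps_to_delta z a" using SD(2)[OF a(1)] by (elim exE conjE)
    have zc: "z \<in> configs G A" by (rule supported_configs[OF z(1) order_refl])
    have zA: "z g \<in> A" "z0 g \<in> A" if "g \<in> carrier G" for g using zc z0c that by (auto simp: configs_def PiE_iff)
    define w where "w = (\<lambda>g\<in>carrier G. inv\<^bsub>X\<^esub> (z0 g) \<cdot> z g)"
    have wc: "w \<in> configs G A" using zA by (auto simp: w_def configs_def)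
    have "w g \<in> X.id_comp" if g: "g \<in> carrier G" for g
    proof (cases "g \<in> E")
      case True
      have rA: "\<rho> g \<in> A" using E(3) R(2) True by auto
      have "inv\<^bsub>X\<^esub> (inv\<^bsub>X\<^esub> (\<rho> g) \<cdot> z0 g) \<cdot> (inv\<^bsub>X\<^esub> (\<rho> g) \<cdot> z g) \<in> X.id_comp"
        by (rule X.id_comp_m_closed[OF X.id_comp_inv[OF bspec[OF z0(2) True]] bspec[OF z(2) True]])
      moreover have "inv\<^bsub>X\<^esub> (inv\<^bsub>X\<^esub> (\<rho> g) \<cdot> z0 g) \<cdot> (inv\<^bsub>X\<^esub> (\<rho> g) \<cdot> z g) = inv\<^bsub>X\<^esub> (z0 g) \<cdot> z g"
      proof -
        have "inv\<^bsub>X\<^esub> (inv\<^bsub>X\<^esub> (\<rho> g) \<cdot> z0 g) \<cdot> (inv\<^bsub>X\<^esub> (\<rho> g) \<cdot> z g) =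
            inv\<^bsub>X\<^esub> (z0 g) \<cdot> (\<rho> g \<cdot> (inv\<^bsub>X\<^esub> (\<rho> g) \<cdot> z g))"
          using rA zA[OF g] by (simp add: X.inv_mult_group X.m_assoc)
        also have "\<rho> g \<cdot> (inv\<^bsub>X\<^esub> (\<rho> g) \<cdot> z g) = z g"
          using rA zA[OF g] by (simp add: X.m_assoc[symmetric])
        finally show ?thesis .
      qed
      ultimately show ?thesis using g by (simp add: w_def)
    next
      case False
      then have "z g = e" "z0 g = e" using z(1) z0(1) g by (auto simp: supported_def)
      then show ?thesis using g X.one_id_comp by (simp add: w_def)
    qed
    moreover have "w g = e" if "g \<in> carrier G - E" for g
      using z(1) z0(1) that by (simp add: supported_def w_def)
    ultimately have "supported E X.id_comp w" by (auto simp: supported_def w_def)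
    moreover have "\<tau> w h = (if h = \<one> then b else e)" if h: "h \<in> carrier G" for h
    proof -
      have "(\<lambda>g\<in>carrier G. z0 g \<cdot> w g) = z"
      proof
        fix g show "(\<lambda>g\<in>carrier G. z0 g \<cdot> w g) g = z g"
          using zA[of g] zc by (cases "g \<in> carrier G") (auto simp: w_def configs_def PiE_iff extensional_def X.m_assoc[symmetric])
      qed
      then have "\<tau> z h = \<tau> z0 h \<cdot> \<tau> w h" using \<tau>_mult[OF z0c wc h] by simp
      moreover have "\<tau> w h \<in> A" using configs wc h by (auto simp: configs_def Pi_iff PiE_iff)
      ultimately have "\<tau> w h = inv\<^bsub>X\<^esub> (\<tau> z0 h) \<cdot> \<tau> z h"
        using z0(3) h a0A(1) by (simp add: X.m_assoc[symmetric])
      then show ?thesis using z0(3) z(3) h a(2) by simp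
    qed
    ultimately show ?thesis by blast
  qed
  moreover have "V \<inter> L \<noteq> {}" if V: "X.opn V" "V \<inter> X.id_comp \<noteq> {}" for V
  proof -
    have "inv\<^bsub>X\<^esub> a0 \<in> A" using a0A by simp
    from X.translations_open(2)[OF this V(1)] have op: "X.opn {a \<in> A. inv\<^bsub>X\<^esub> a0 \<cdot> a \<in> V}" .
    obtain v where v: "v \<in> V" "v \<in> X.id_comp" using V(2) by blast
    have vA: "v \<in> A" using v(2) X.id_comp_carrier by blast
    have "a0 \<cdot> v \<in> X.id_comp" by (rule X.id_comp_m_closed[OF a0A(2) v(2)])
    moreover have "inv\<^bsub>X\<^esub> a0 \<cdot> (a0 \<cdot> v) = v" using a0A(1) vA by (simp add: X.m_assoc[symmetric])
    then have "a0 \<cdot> v \<in> {a \<in> A. inv\<^bsub>X\<^esub> a0 \<cdot> a \<in> V}" using v(1) a0A(1) vA by simp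
    ultimately have "{a \<in> A. inv\<^bsub>X\<^esub> a0 \<cdot> a \<in> V} \<inter> X.id_comp \<noteq> {}" by blast
    then obtain a where "a \<in> S p" "inv\<^bsub>X\<^esub> a0 \<cdot> a \<in> V" using p(2) op by blast
    then show ?thesis by (auto simp: L_def)
  qed
  ultimately show ?thesis using E(1,2) by blast
qed

text \<open>An infinite \<open>N\<close> takes infinitely many values at some
  \<open>\<omega>\<close>, separated by some coordinate. Put a block of length \<open>l\<close>,
  with rate above \<open>\<delta> - \<eta>\<close>, at every good vertex: \<open>card J * d\<close>
  pulled-back functions and \<open>card T * l\<close> from the kernel, on \<open>card V * l\<close>
  sites in all, would have a rate above \<open>\<delta>\<close>.\<close>

lemma finite_kernel:
  assumes unc: "uncountable (UNIV :: 'k set)" and so: "sofic G" and ps: "post_surjective G A \<tau>"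
    and \<Omega>: "finite \<Omega>" "\<Omega> \<subseteq> carrier G"
    and N: "\<And>k. k \<in> N \<Longrightarrow> supported \<Omega> X.id_comp k \<and> (\<forall>h\<in>carrier G. \<tau> k h = e)"
  shows "finite N"
proof (rule ccontr)
  assume inf: "infinite N"
  have "\<exists>\<omega>\<in>\<Omega>. infinite ((\<lambda>k. k \<omega>) ` N)"
  proof (rule ccontr)
    assume "\<not> ?thesis"
    then have "finite (\<Pi>\<^sub>E \<omega>\<in>\<Omega>. (\<lambda>k. k \<omega>) ` N)" using \<Omega>(1) by (intro finite_PiE) auto
    moreover have "(\<lambda>k. restrict k \<Omega>) ` N \<subseteq> (\<Pi>\<^sub>E \<omega>\<in>\<Omega>. (\<lambda>k. k \<omega>) ` N)" by auto
    moreover have "inj_on (\<lambda>k. restrict k \<Omega>) N"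
    proof (rule inj_onI)
      fix k l assume kl: "k \<in> N" "l \<in> N" "restrict k \<Omega> = restrict l \<Omega>"
      show "k = l"
      proof
        fix g
        show "k g = l g"
          using N[OF kl(1)] N[OF kl(2)] fun_cong[OF kl(3), of g]
          by (cases "g \<in> \<Omega>"; cases "g \<in> carrier G") (auto simp: supported_def PiE_iff extensional_def)
      qed
    qed
    ultimately show False using inf inj_on_finite by blast
  qed
  then obtain \<omega> where \<omega>: "\<omega> \<in> \<Omega>" "infinite ((\<lambda>k. k \<omega>) ` N)" by blast
  have N\<omega>: "(\<lambda>k. k \<omega>) ` N \<subseteq> X.id_comp" using N \<omega>(1) \<Omega>(2) by (fastforce simp: supported_def PiE_iff)
  obtain \<U> where \<U>: "\<Union>\<U> = A" "\<forall>U\<in>\<U>. \<exists>n \<phi>. X.chart n U \<phi>" using X.chart_cover by (elim exE conjE)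
  obtain U where "U \<in> \<U>" "e \<in> U" using \<U>(1) X.one_closed by blast
  then obtain n \<phi> where U: "e \<in> U" and ch: "X.chart n U \<phi>" using \<U>(2) by blast
  obtain i0 where i0: "i0 < n" and spread: "\<forall>s. X.spreads U \<phi> i0 ((\<lambda>k. k \<omega>) ` N) s"
    using X.coordinate_spread[OF ch U N\<omega> \<omega>(2)] by (elim exE conjE)
  obtain E L where E: "finite E" "E \<subseteq> carrier G" and L: "L \<subseteq> X.id_comp"
    "\<forall>a\<in>L. \<exists>z. supported E X.id_comp z \<and> (maps_to_delta z a)"
    "\<forall>V. X.opn V \<longrightarrow> V \<inter> X.id_comp \<noteq> {} \<longrightarrow> V \<inter> L \<noteq> {}"
    using delta_dense[OF unc sofic_countable[OF G.is_group so] ps] by (elim exE conjE)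
  define F where "F = insert \<one> (M \<union> E \<union> \<Omega>)"
  have F: "finite F" "F \<subseteq> carrier G" using E M \<Omega> by (auto simp: F_def)
  have EF: "E \<subseteq> F" "\<Omega> \<subseteq> F" "M \<subseteq> F" "\<one> \<in> F" by (auto simp: F_def)
  define w where "w = real (card \<Omega>)"
  have "card \<Omega> > 0" using \<Omega>(1) \<omega>(1) by (auto simp: card_gt_0_iff)
  then have w: "w \<ge> 1" by (simp add: w_def)
  then have w2: "w\<^sup>2 \<ge> 1" by simp
  define \<epsilon> where "\<epsilon> = 1 / (4 * (real n + 1) * w\<^sup>2)"
  have half: "2 * (1 / (4 * t)) = 1 / (2 * t)" for t :: real by (cases "t = 0") (auto simp: field_simps)
  \<comment> \<open>Together with \<open>\<epsilon>\<close> this makes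
    \<open>2 * w\<^sup>2 * (n * \<epsilon> + \<eta>)\<close> equal to
    \<open>n / (2 * (n + 1)) + 1 / 2\<close>, again less than 1; \<open>\<eta>\<close> absorbs the
    distance of the chosen block from the supremum.\<close>
  define \<eta> where "\<eta> = 1 / (4 * w\<^sup>2)"
  have "4 * (real n + 1) * w\<^sup>2 \<ge> 4 * (real n + 1) * 1" using w2 by (intro mult_left_mono) auto
  moreover have "2 \<le> 4 * (real n + 1) * 1" by simp
  ultimately have "4 * (real n + 1) * w\<^sup>2 \<ge> 2" by (rule order_trans[rotated])
  then have \<epsilon>: "0 < \<epsilon>" "\<epsilon> \<le> 1 / 2" unfolding \<epsilon>_def by (auto simp: field_simps)
  have \<eta>: "\<eta> > 0" using w by (simp add: \<eta>_def)
  \<comment> \<open>The exact value of the dimension of a power is not needed, only its growth rate \<open>\<delta>\<close>,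
    which exists by superadditivity and the linear bound.\<close>
  define Rat where "Rat = {real d / real l | d l. l > 0 \<and> X.has_indep {..<l::nat} d}"
  have Rat_le: "x \<le> real n" if x: "x \<in> Rat" for x
  proof -
    obtain d l where d: "x = real d / real l" "l > 0" "X.has_indep {..<l::nat} d" using x by (auto simp: Rat_def)
    have "{..<l} \<noteq> {}" using d(2) by auto
    from X.has_indep_le[OF ch U _ this d(3)] have "d \<le> n * l" by simp
    then have "real d \<le> real n * real l" by (metis of_nat_le_iff of_nat_mult)
    then show ?thesis unfolding d(1) using d(2) by (simp add: pos_divide_le_eq)
  qed
  have "real 0 / real (1::nat) \<in> Rat" unfolding Rat_def
    using X.has_indep_0[of "{..<1::nat}"] by (intro CollectI exI[of _ 0] exI[of _ 1]) simp
  then have Rat0: "0 \<in> Rat" by simp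
  define \<delta> where "\<delta> = Sup Rat"
  have bdd: "bdd_above Rat" using Rat_le by (auto simp: bdd_above_def)
  have \<delta>n: "\<delta> \<le> real n" unfolding \<delta>_def using Rat0 Rat_le by (intro cSup_least) auto
  have "\<delta> - \<eta> < Sup Rat" using \<eta> by (simp add: \<delta>_def)
  then obtain x where x: "x \<in> Rat" "\<delta> - \<eta> < x" using less_cSup_iff[of Rat] Rat0 bdd by blast
  then obtain d l where d: "x = real d / real l" "l > 0" "X.has_indep {..<l::nat} d" by (auto simp: Rat_def)
  have \<Omega>ne: "\<Omega> \<noteq> {}" using \<omega> by blast
  obtain V :: "nat set" and J \<psi> T where ap: "approx_ca G X \<tau> M \<mu> F V J \<psi>" and J: "J \<noteq> {}" and T: "T \<subseteq> J"
    "\<forall>u\<in>T. \<forall>v\<in>T. u \<noteq> v \<longrightarrow> \<psi> u ` \<Omega> \<inter> \<psi> v ` \<Omega> = {}"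
    and num: "real (card V) - real (card J) \<le> \<epsilon> * real (card V)" "0 < real (card V)" "card J \<le> card V"
     "real (card V) \<le> 2 * (real (card \<Omega>))\<^sup>2 * real (card T)"
    using sofic_approx_ca[OF so F EF(3,4) \<Omega>(1) \<Omega>ne EF(2) \<epsilon>] by (elim exE conjE)
  have V: "finite V" "V \<noteq> {}" "finite J" "local_approx G F V J \<psi>" "J \<subseteq> V"
    using approx_ca.fin[OF ap] approx_ca.finJ[OF ap] approx_ca.la[OF ap] approx_ca.JI[OF ap] by blast+
  let ?L = "{..<l}" and ?\<psi> = "\<lambda>(j, l) g. (\<psi> j g, l)"
  \<comment> \<open>One copy of the approximation for each element of the block; both the good
    vertices and the disjoint copies of the kernel are multiplied by \<open>l\<close>.\<close>
  interpret C: approx_ca G X \<tau> M \<mu> F "V \<times> ?L" "J \<times> ?L" ?\<psi>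
    using local_approx_copies[OF V(4), of ?L] F EF V d(2) by unfold_locales auto
  have "X.has_indep (V \<times> ?L) (card J * d + card (T \<times> ?L))"
  proof (rule C.has_indep_extend[OF ch i0 _ L(1) EF(1) _ _ N EF(2) \<omega>(1) _ U])
    show "J \<times> ?L \<noteq> {}" using J d(2) by auto
    show "T \<times> ?L \<subseteq> J \<times> ?L" using T(1) by auto
    show "X.has_indep (J \<times> ?L) (card J * d)" by (rule X.has_indep_Times[OF d(2,3) V(3) J])
  next
    fix p q assume p: "p \<in> T \<times> ?L" "q \<in> T \<times> ?L" "p \<noteq> q"
    obtain u a v b where uv: "p = (u, a)" "q = (v, b)" "u \<in> T" "v \<in> T" using p(1,2) by blast
    show "?\<psi> p ` \<Omega> \<inter> ?\<psi> q ` \<Omega> = {}"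
    proof (cases "u = v")
      case True
      then show ?thesis using p(3) uv by auto
    next
      case False
      then have "\<psi> u ` \<Omega> \<inter> \<psi> v ` \<Omega> = {}" using T(2) uv by blast
      then show ?thesis using uv by auto
    qed
  next
    show "\<exists>z. supported E X.id_comp z \<and> (maps_to_delta z a)" if "a \<in> L" for a
      by (rule bspec[OF L(2) that])
    show "V \<inter> L \<noteq> {}" if "X.opn V" "V \<inter> X.id_comp \<noteq> {}" for V
      by (rule L(3)[rule_format, OF that])
    show "X.spreads U \<phi> i0 ((\<lambda>k. k \<omega>) ` N) s" for s
      by (rule spread[rule_format])
  qed
  moreover obtain \<sigma> where "bij_betw \<sigma> (V \<times> ?L) {..<card V * l}"
    using ex_bij_betw_finite_nat[of "V \<times> ?L"] V(1) by (auto simp: lessThan_atLeast0 card_cartesian_product)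
  ultimately have "X.has_indep {..<card V * l} (card J * d + card (T \<times> ?L))"
    using V d(2) by (intro X.has_indep_reindex[of "V \<times> ?L" "{..<card V * l}" \<sigma>]) auto
  then have "real (card J * d + card T * l) / real (card V * l) \<in> Rat"
    unfolding Rat_def using num(2) d(2)
    by (intro CollectI exI[of _ "card J * d + card T * l"] exI[of _ "card V * l"]) (simp add: card_cartesian_product)
  then have "real (card J * d + card T * l) / real (card V * l) \<le> \<delta>" unfolding \<delta>_def by (rule cSup_upper[OF _ bdd])
  then have "real (card J) * real d + real (card T) * real l \<le> \<delta> * real (card V) * real l"
    using num(2) d(2) by (simp add: field_simps)
  moreover have "real (card J) * ((\<delta> - \<eta>) * real l) \<le> real (card J) * real d"
    using x(2) d(1,2) by (intro mult_left_mono) (auto simp: field_simps)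
  ultimately have "(real (card J) * (\<delta> - \<eta>) + real (card T)) * real l \<le> (\<delta> * real (card V)) * real l"
    by (simp add: algebra_simps)
  then have "real (card J) * (\<delta> - \<eta>) + real (card T) \<le> \<delta> * real (card V)" using d(2) by simp
  then have "real (card T) \<le> \<delta> * (real (card V) - real (card J)) + \<eta> * real (card J)" by (simp add: algebra_simps)
  also have "\<dots> \<le> real n * (\<epsilon> * real (card V)) + \<eta> * real (card V)"
    using \<delta>n num(1,3) \<eta> by (intro add_mono mult_mono mult_left_mono) auto
  finally have "2 * w\<^sup>2 * real (card T) \<le> 2 * w\<^sup>2 * (real n * (\<epsilon> * real (card V)) + \<eta> * real (card V))"
    by (intro mult_left_mono) auto
  then have "real (card V) \<le> 2 * w\<^sup>2 * (real n * (\<epsilon> * real (card V)) + \<eta> * real (card V))"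
    using num(4) by (simp add: w_def)
  also have "\<dots> = 2 * (w\<^sup>2 * \<epsilon>) * (real n * real (card V)) + 2 * (w\<^sup>2 * \<eta>) * real (card V)"
    by (simp add: distrib_left mult_ac)
  also have "w\<^sup>2 * \<epsilon> = 1 / (4 * (real n + 1))" using w by (simp add: \<epsilon>_def)
  also have "w\<^sup>2 * \<eta> = 1 / 4" using w by (simp add: \<eta>_def)
  also have "2 * (1 / (4 * (real n + 1))) * (real n * real (card V)) + 2 * (1 / 4) * real (card V) =
      (real n / (2 * (real n + 1)) + 1 / 2) * real (card V)"
    unfolding half by (simp add: distrib_right)
  also have "\<dots> < 1 * real (card V)"
    using num(2) by (intro mult_strict_right_mono) (auto simp: field_simps)
  finally show False by simp
qed

text \<open>Fix \<open>x\<close> outside \<open>H\<close>. For each \<open>a\<close>, the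
  configuration \<open>x a\<close> has the same image as some \<open>h\<close> in \<open>H\<close>,
  so \<open>k\<close>, the quotient of the two, is in the kernel and \<open>m k a\<close> is in
  \<open>H\<close>. Were every open set \<open>U k\<close> to meet the irreducible power of
  \<open>id_comp\<close>, a common point of these finitely many sets would contradict this. So one
  \<open>k\<close> moves the entire power into \<open>H\<close>.\<close>

lemma bullet_pre_injectiveI:
  assumes unc: "uncountable (UNIV :: 'k set)" and so: "sofic G" and ps: "post_surjective G A \<tau>"
  shows "bullet_pre_injective G X \<tau>"
  unfolding bullet_pre_injective_def
proof (rule notI, elim exE conjE)
  fix \<Omega> H
  assume \<Omega>: "finite \<Omega>" "\<Omega> \<subseteq> carrier G" and H: "closedin (zariski (variety (alg_group_power \<Omega> X))) H"
    "H \<subset> (\<Omega> \<rightarrow>\<^sub>E A)" and eq: "\<tau> ` extend_by G e \<Omega> (\<Omega> \<rightarrow>\<^sub>E A) = \<tau> ` extend_by G e \<Omega> H"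
  let ?T = "power_topology \<Omega> (variety X)"
  have H': "closedin ?T H" using H(1) by (simp add: alg_group_power_def)
  define ext where "ext a = (\<lambda>g\<in>carrier G. if g \<in> \<Omega> then a g else e)" for a
  have ext_r: "restrict (ext a) \<Omega> = a" if "a \<in> \<Omega> \<rightarrow>\<^sub>E A" for a
    using that \<Omega>(2) by (auto simp: ext_def fun_eq_iff PiE_iff extensional_def)
  have ext_in: "ext a \<in> extend_by G e \<Omega> (\<Omega> \<rightarrow>\<^sub>E A)" if a: "a \<in> \<Omega> \<rightarrow>\<^sub>E A" for a
    unfolding extend_by_def mem_Collect_eq ext_r[OF a] using a by (auto simp: ext_def)
  have sup: "supported \<Omega> A c" if c: "c \<in> extend_by G e \<Omega> (\<Omega> \<rightarrow>\<^sub>E A)" for c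
  proof -
    have "c g \<in> A" if "g \<in> carrier G" for g
    proof (cases "g \<in> \<Omega>")
      case True
      have "restrict c \<Omega> \<in> \<Omega> \<rightarrow>\<^sub>E A" using c by (simp add: extend_by_def)
      then show ?thesis using True by (auto simp: PiE_iff)
    next
      case False
      then show ?thesis using c that by (simp add: extend_by_def)
    qed
    then show ?thesis using c by (auto simp: extend_by_def supported_def PiE_iff)
  qed
  obtain x where x: "x \<in> \<Omega> \<rightarrow>\<^sub>E A" "x \<notin> H" using H(2) by blast
  define K where "K = {k. supported \<Omega> A k \<and> (\<forall>h\<in>carrier G. \<tau> k h = e)}"
  have Kid: "k \<omega> \<in> X.id_comp" if "k \<in> K" "\<omega> \<in> \<Omega>" for k \<omega>
    using kernel_id_comp[OF so ps \<Omega> _ _ that(2)] that(1) by (auto simp: K_def)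
  have KS: "supported \<Omega> X.id_comp k \<and> (\<forall>h\<in>carrier G. \<tau> k h = e)" if k: "k \<in> K" for k
  proof -
    have "k g \<in> X.id_comp" if "g \<in> carrier G" for g
      using Kid[OF k, of g] k that X.one_id_comp by (cases "g \<in> \<Omega>") (auto simp: K_def supported_def)
    then show ?thesis using k by (auto simp: K_def supported_def PiE_iff)
  qed
  have finK: "finite K" by (rule finite_kernel[OF unc so ps \<Omega> KS])
  have KA: "k \<omega> \<in> A" if "k \<in> K" "\<omega> \<in> \<Omega>" for k \<omega> using Kid[OF that] X.id_comp_carrier by blast
  define m where "m k a = (\<lambda>\<omega>\<in>\<Omega>. x \<omega> \<cdot> a \<omega> \<cdot> inv\<^bsub>X\<^esub> (k \<omega>))" for k a
  have id_sub: "\<Omega> \<rightarrow>\<^sub>E X.id_comp \<subseteq> \<Omega> \<rightarrow>\<^sub>E A" by (rule PiE_mono) (rule X.id_comp_carrier)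
  have hit: "\<exists>k\<in>K. m k a \<in> H" if a: "a \<in> \<Omega> \<rightarrow>\<^sub>E A" for a
  proof -
    define b where "b = (\<lambda>\<omega>\<in>\<Omega>. x \<omega> \<cdot> a \<omega>)"
    have b: "b \<in> \<Omega> \<rightarrow>\<^sub>E A" using x(1) a by (auto simp: b_def PiE_iff)
    have "\<tau> (ext b) \<in> \<tau> ` extend_by G e \<Omega> H" using ext_in[OF b] eq by blast
    then obtain h where h: "h \<in> extend_by G e \<Omega> H" "\<tau> (ext b) = \<tau> h" by blast
    have h': "h \<in> extend_by G e \<Omega> (\<Omega> \<rightarrow>\<^sub>E A)" using h(1) H(2) unfolding extend_by_def by blast
    have hc: "h \<in> configs G A" "ext b \<in> configs G A"
      using supported_configs[OF sup order_refl] h' ext_in[OF b] by blast+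
    define k where "k = (\<lambda>g\<in>carrier G. inv\<^bsub>X\<^esub> (h g) \<cdot> ext b g)"
    have hA: "h g \<in> A" "ext b g \<in> A" if "g \<in> carrier G" for g using hc that by (auto simp: configs_def PiE_iff)
    have kc: "k \<in> configs G A" using hA by (auto simp: k_def configs_def)
    have "k g = e" if "g \<in> carrier G - \<Omega>" for g
      using that h(1) by (auto simp: k_def ext_def extend_by_def)
    then have "supported \<Omega> A k" using kc by (simp add: supported_def configs_def)
    moreover have "\<tau> k g = e" if g: "g \<in> carrier G" for g
    proof -
      have "(\<lambda>g\<in>carrier G. h g \<cdot> k g) = ext b"
      proof
        fix g show "(\<lambda>g\<in>carrier G. h g \<cdot> k g) g = ext b g"
          using hA[of g] by (cases "g \<in> carrier G") (auto simp: k_def X.m_assoc[symmetric] ext_def)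
      qed
      then have "\<tau> h g = \<tau> h g \<cdot> \<tau> k g" using \<tau>_mult[OF hc(1) kc g] h(2) by simp
      moreover have "\<tau> h g \<in> A" "\<tau> k g \<in> A" using configs hc kc g by (auto simp: configs_def Pi_iff PiE_iff)
      ultimately show ?thesis using X.l_cancel_one'[of "\<tau> h g" "\<tau> k g"] by simp
    qed
    ultimately have "k \<in> K" by (simp add: K_def)
    moreover have "m k a = restrict h \<Omega>"
    proof
      fix \<omega>
      show "m k a \<omega> = restrict h \<Omega> \<omega>"
      proof (cases "\<omega> \<in> \<Omega>")
        case True
        then have \<omega>: "\<omega> \<in> carrier G" using \<Omega>(2) by blast
        have bA: "b \<omega> \<in> A" "h \<omega> \<in> A" using b True hA[OF \<omega>] by auto
        have "m k a \<omega> = b \<omega> \<cdot> inv\<^bsub>X\<^esub> (inv\<^bsub>X\<^esub> (h \<omega>) \<cdot> b \<omega>)"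
          using True \<omega> by (simp add: m_def b_def k_def ext_def)
        also have "\<dots> = h \<omega>" using bA by (simp add: X.inv_mult_group X.m_assoc[symmetric])
        finally show ?thesis using True by simp
      qed (simp add: m_def)
    qed
    moreover have "restrict h \<Omega> \<in> H" using h(1) by (simp add: extend_by_def)
    ultimately show ?thesis by (intro bexI[of _ k]) simp_all
  qed
  \<comment> \<open>The empty index set is excluded separately, as its power is not covered by
    \<open>swf_power\<close>; there \<open>H\<close> would be empty.\<close>
  have \<Omega>ne: "\<Omega> \<noteq> {}"
  proof
    assume "\<Omega> = {}"
    then have "H = {}" using H(2) by auto
    then show False using hit[OF x(1)] by blast
  qed
  define U where "U k = {a \<in> topspace (zariski (power_fspace \<Omega> (variety X))). m k a \<in> topspace ?T - H}" for k
  have opU: "openin ?T (U k)" if k: "k \<in> K" for k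
  proof -
    have "morphism (power_fspace \<Omega> (variety X)) (power_fspace \<Omega> (variety X)) (\<lambda>a. m k a)"
      unfolding m_def
    proof (rule X.morphism_tuple[OF X.swf_power[OF \<Omega>(1) \<Omega>ne] \<Omega>(1)])
      fix \<omega> assume \<omega>: "\<omega> \<in> \<Omega>"
      then have "x \<omega> \<in> X.pts" "inv\<^bsub>X\<^esub> (k \<omega>) \<in> X.pts" using x(1) KA[OF k \<omega>] X.pts_eq by auto
      then show "morphism (power_fspace \<Omega> (variety X)) (variety X) (\<lambda>a. x \<omega> \<cdot> a \<omega> \<cdot> inv\<^bsub>X\<^esub> (k \<omega>))"
        by (intro X.morphism_mult X.swf_power \<Omega>(1) \<Omega>ne morphism_const X.morphism_coord \<omega>)
    qed
    from morphism_open[OF this, of "topspace ?T - H"] H' show ?thesis by (simp add: U_def closedin_def)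
  qed
  have "\<exists>k\<in>K. U k \<inter> (\<Omega> \<rightarrow>\<^sub>E X.id_comp) = {}"
  proof (rule ccontr)
    assume "\<not> ?thesis"
    then have "openin ?T (U k) \<and> U k \<inter> (\<Omega> \<rightarrow>\<^sub>E X.id_comp) \<noteq> {}" if "k \<in> K" for k using opU that by blast
    then have "\<exists>a\<in>\<Omega> \<rightarrow>\<^sub>E X.id_comp. \<forall>k\<in>K. a \<in> U k"
      by (rule irr_in_finite_INT[OF X.irr_in_id_comp_power[OF \<Omega>(1)] finK])
    then obtain a where "a \<in> \<Omega> \<rightarrow>\<^sub>E X.id_comp" "\<forall>k\<in>K. a \<in> U k" by blast
    then show False using hit[of a] id_sub by (auto simp: U_def)
  qed
  then obtain k where k: "k \<in> K" "U k \<inter> (\<Omega> \<rightarrow>\<^sub>E X.id_comp) = {}" by blast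
  \<comment> \<open>The kernel element itself is a point of the power of \<open>id_comp\<close>,
    which is what \<open>kernel_id_comp\<close> provides, and \<open>m k\<close> maps it back to
    \<open>x\<close>. Thus \<open>x\<close> would lie in \<open>H\<close>.\<close>
  let ?a = "restrict k \<Omega>"
  have a: "?a \<in> \<Omega> \<rightarrow>\<^sub>E X.id_comp" using Kid[OF k(1)] by auto
  have "m k ?a = x"
  proof
    fix \<omega>
    show "m k ?a \<omega> = x \<omega>"
    proof (cases "\<omega> \<in> \<Omega>")
      case True
      then have "x \<omega> \<in> A" "k \<omega> \<in> A" using x(1) KA[OF k(1)] by auto
      then show ?thesis using True by (simp add: m_def X.m_assoc)
    next
      case False
      then show ?thesis using x(1) by (simp add: m_def PiE_iff extensional_def)
    qed
  qed
  moreover have "?a \<in> \<Omega> \<rightarrow>\<^sub>E A" using a id_sub by blast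
  ultimately have "?a \<in> U k" using x by (simp add: U_def X.topspace_power X.pts_eq)
  then show False using k(2) a by blast
qed

end

theorem theoremA:
  fixes G :: "('g, 'm) monoid_scheme"
    and X :: "('a, 'k::alg_closed_field) alg_group"
    and \<tau> :: "('g \<Rightarrow> 'a) \<Rightarrow> ('g \<Rightarrow> 'a)"
  assumes "group G" and "finitely_generated G" and "sofic G"
    and "uncountable (UNIV :: 'k set)"
    and "algebraic_group X"
    and "\<tau> \<in> CA_algr G X"
    and "post_surjective G (carrier X) \<tau>"
  shows "bullet_pre_injective G X \<tau>"
proof -
  obtain M \<mu> where "local_rule G (carrier X) \<tau> M \<mu>" "alg_group_hom (alg_group_power M X) X \<mu>"
    and "\<tau> \<in> configs G (carrier X) \<rightarrow> configs G (carrier X)"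
    using assms(6) unfolding CA_algr_def cellular_automaton_def by blast
  then interpret group_ca G X \<tau> M \<mu>
    using assms(1,5) by (simp add: group_ca_def alg_grp_def group_ca_axioms_def)
  show ?thesis by (rule bullet_pre_injectiveI[OF assms(4,3,7)])
qed

end
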